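(* Let $(M^0,M^1)\in\mathcal M(\theta_0,\theta_1,\theta_\infty)$ and let $y(x,M^0,M^1)$ be the solution of $(\mathrm{P_V})$ labelled with $(M^0,M^1)$. For every $p\in\mathbb{Z}$, $$y(e^{2\pi ip}x,M^0,M^1)=y(x,M^0_{(p)},M^1_{(p)}),$$ where $M^0_{(p)}:=(M^1M^0)^pM^0(M^1M^0)^{-p}$ and $M^1_{(p)}:=(M^1M^0)^pM^1(M^1M^0)^{-p}$.
   Context: Painlevé V. For $\theta_0,\theta_1,\theta_\infty\in\mathbb{C}$, $(\mathrm{P_V})$ is $$y''=\Bigl(\frac1{2y}+\frac1{y-1}\Bigr)(y')^2-\frac{y'}x+\frac{(y-1)^2}{x^2}\Bigl(a_\theta y-\frac{b_\theta}y\Bigr)+c_\theta\frac yx-\frac{y(y+1)}{2(y-1)},$$ $a_\theta=\frac18(\theta_0-\theta_1+\theta_\infty)^2$, $b_\theta=\frac18(\theta_0-\theta_1-\theta_\infty)^2$, $c_\theta=1-\theta_0-\theta_1$. It is equivalent to the system for $(y,\mathfrak z,u)$ $$xy'=xy-2\mathfrak z(y-1)^2-(y-1)\bigl(\tfrac12(\theta_0-\theta_1+\theta_\infty)y-\tfrac12(3\theta_0+\theta_1+\theta_\infty)\bigr),$$ $$x\mathfrak z'=y\mathfrak z(\mathfrak z+\tfrac12(\theta_0-\theta_1+\theta_\infty))-y^{-1}(\mathfrak z+\theta_0)(\mathfrak z+\tfrac12(\theta_0+\theta_1+\theta_\infty)),$$ $$x(\ln u)'=-2\mathfrak z-\theta_0+y(\mathfrak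 z+\tfrac12(\theta_0-\theta_1+\theta_\infty))+y^{-1}(\mathfrak z+\tfrac12(\theta_0+\theta_1+\theta_\infty)),$$ which governs the isomonodromy deformation of $$\frac{d\Xi}{d\xi}=\Bigl(\frac x2\sigma_3+\frac{\mathcal A_0}\xi+\frac{\mathcal A_1}{\xi-1}\Bigr)\Xi,\quad \mathcal A_0=\begin{pmatrix}\mathfrak z+\frac12\theta_0&-u(\mathfrak z+\theta_0)\\ u^{-1}\mathfrak z&-\mathfrak z-\frac12\theta_0\end{pmatrix},$$ $$\mathcal A_1=\begin{pmatrix}-\mathfrak z-\frac12(\theta_0+\theta_\infty)&uy(\mathfrak z+\frac12(\theta_0-\theta_1+\theta_\infty))\\ -(uy)^{-1}(\mathfrak z+\frac12(\theta_0+\theta_1+\theta_\infty))&\mathfrak z+\frac12(\theta_0+\theta_\infty)\end{pmatrix},$$ $\sigma_3=\mathrm{diag}(1,-1)$. Monodromy data. For $x=e^{i\phi}t$, $t>0$, $|\phi|<\pi/2$, put $\xi=\frac12(e^{-i\phi}\lambda+1)$, $Y=\exp(-\varpi\sigma_3)\Xi$, $\varpi=\frac14e^{i\phi}t+\frac12\theta_\infty(i\phi+\ln2)$. The resulting linear system in $\lambda$ (singular at $\mp e^{i\phi},\infty$) has, for $k\in\mathbb{Z}$, the solution $Y_k=(I+O(\lambda^{-1}))\exp(\frac14(t\lambda-2\theta_\infty\ln\lambda)\sigma_3)$ as $\lambda\to\infty$ in $|\arg\lambda-\pi/2-(k-2)\pi|<\pi$. Let $\hat l_0,\hat l_1$ start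 at $\hat p_{\rm st}$ ($\arg\hat p_{\rm st}=\pi/2$, $|\hat p_{\rm st}|>100$), go straight to near $-e^{i\phi}$, respectively $e^{i\phi}$, circle it once anticlockwise, and return. $M^0=(m^0_{ij})$, $M^1=(m^1_{ij})\in SL_2(\mathbb{C})$ are defined by $Y_2|_{\hat l_0}=Y_2M^0$, $Y_2|_{\hat l_1}=Y_2M^1$ (analytic continuation). The monodromy manifold $\mathcal M(\theta_0,\theta_1,\theta_\infty)$ is the set of $(M^0,M^1)\in SL_2(\mathbb{C})^2$ with $m^0_{11}m^1_{11}+m^0_{21}m^1_{12}=e^{-\pi i\theta_\infty}$, $\mathrm{tr}M^0=2\cos\pi\theta_0$, $\mathrm{tr}M^1=2\cos\pi\theta_1$, modulo $(M^0,M^1)\sim c^{\sigma_3}(M^0,M^1)c^{-\sigma_3}$, $c\ne0$. For each class $(M^0,M^1)$, $y(x,M^0,M^1)$ denotes a solution of $(\mathrm{P_V})$ whose linear system (for $|\arg x|<\pi/2$) has this class of monodromy data; it is unique if $M^0,M^1\ne\pm I$. The same symbol denotes its analytic continuation to the universal covering of $\mathbb{C}\setminus\{0\}$. *)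

theory Defs
  imports
    "HOL-Complex_Analysis.Complex_Analysis"
    "HOL-Library.Landau_Symbols"
begin

section \<open>Two-by-two complex matrices\<close>

definition mat2 :: "complex \<Rightarrow> complex \<Rightarrow> complex \<Rightarrow> complex \<Rightarrow> complex^2^2" where
  "mat2 a b c d = vector [vector [a, b], vector [c, d]]"

definition sigma3 :: "complex^2^2" where
  "sigma3 = mat2 1 0 0 (-1)"

text \<open>The matrix exponential \<open>exp (w \<sigma>\<^sub>3)\<close> and the matrix power \<open>c\<close> to the \<open>\<sigma>\<^sub>3\<close>.\<close>

definition exp_sigma3 :: "complex \<Rightarrow> complex^2^2" where
  "exp_sigma3 w = mat2 (exp w) 0 0 (exp (- w))"

definition pow_sigma3 :: "complex \<Rightarrow> complex^2^2" where
  "pow_sigma3 c = mat2 c 0 0 (inverse c)"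

definition scale_mat :: "complex \<Rightarrow> complex^2^2 \<Rightarrow> complex^2^2" where
  "scale_mat c A = (\<chi> i j. c * A $ i $ j)"

text \<open>Integer powers for the matrix product; the library's \<open>^\<close> on this type is componentwise.\<close>

definition mat_powi :: "complex^2^2 \<Rightarrow> int \<Rightarrow> complex^2^2" where
  "mat_powi A k =
     (if 0 \<le> k then (((**) A) ^^ nat k) (mat 1)
      else (((**) (matrix_inv A)) ^^ nat (- k)) (mat 1))"


section \<open>The fifth Painleve equation on the universal covering\<close>

text \<open>
  The universal covering of the punctured plane is the complex plane with coordinate \<open>s\<close>
  and projection \<open>x = exp s\<close>, so that \<open>arg x = Im s\<close> and \<open>\<bar>x\<bar> = exp (Re s)\<close>.  Functions of
  \<open>x\<close> on the covering are functions of \<open>s\<close>; \<open>d/dx\<close> becomes \<open>exp (-s) d/ds\<close>, and the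
  passage from \<open>x\<close> to \<open>exp (2 \<pi> \<i> p) x\<close> becomes \<open>s \<mapsto> s + 2 \<pi> \<i> p\<close>.
\<close>

definition ddx :: "(complex \<Rightarrow> complex) \<Rightarrow> complex \<Rightarrow> complex" where
  "ddx f s = deriv f s / exp s"

definition PV_at ::
  "complex \<Rightarrow> complex \<Rightarrow> complex \<Rightarrow> (complex \<Rightarrow> complex) \<Rightarrow> complex \<Rightarrow> bool" where
  "PV_at \<theta>0 \<theta>1 \<theta>inf y s \<longleftrightarrow>
     (let x = exp s;
          a = (\<theta>0 - \<theta>1 + \<theta>inf)^2 / 8;
          b = (\<theta>0 - \<theta>1 - \<theta>inf)^2 / 8;
          c = 1 - \<theta>0 - \<theta>1
      in ddx (ddx y) s =
           (1 / (2 * y s) + 1 / (y s - 1)) * (ddx y s)^2 - ddx y s / x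
           + (y s - 1)^2 / x^2 * (a * y s - b / y s)
           + c * y s / x - y s * (y s + 1) / (2 * (y s - 1)))"

text \<open>
  Solutions of the equation are meromorphic on the covering (Painleve property).  Being
  \<open>nicely\<close> meromorphic only fixes the value at poles, so that equality of two solutions is
  equality of functions.  The equation is required off a discrete set; in particular the
  constants \<open>0\<close> and \<open>1\<close>, for which it is meaningless, are excluded.
\<close>

definition PV_solution ::
  "complex \<Rightarrow> complex \<Rightarrow> complex \<Rightarrow> (complex \<Rightarrow> complex) \<Rightarrow> bool" where
  "PV_solution \<theta>0 \<theta>1 \<theta>inf y \<longleftrightarrow>
     y nicely_meromorphic_on UNIV \<and>
     (\<forall>\<^sub>\<approx>s. y s \<noteq> 0 \<and> y s \<noteq> 1 \<and> PV_at \<theta>0 \<theta>1 \<theta>inf y s)"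

text \<open>The equivalent system for \<open>(y, z, u)\<close>; \<open>(ln u)'\<close> is written as \<open>u' / u\<close>.\<close>

definition PV_system_at ::
  "complex \<Rightarrow> complex \<Rightarrow> complex \<Rightarrow> (complex \<Rightarrow> complex) \<Rightarrow> (complex \<Rightarrow> complex) \<Rightarrow>
   (complex \<Rightarrow> complex) \<Rightarrow> complex \<Rightarrow> bool" where
  "PV_system_at \<theta>0 \<theta>1 \<theta>inf y z u s \<longleftrightarrow>
     (let x = exp s in
        x * ddx y s =
          x * y s - 2 * z s * (y s - 1)^2
          - (y s - 1) * ((\<theta>0 - \<theta>1 + \<theta>inf) / 2 * y s - (3 * \<theta>0 + \<theta>1 + \<theta>inf) / 2) \<and>
        x * ddx z s =
          y s * z s * (z s + (\<theta>0 - \<theta>1 + \<theta>inf) / 2)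
          - inverse (y s) * (z s + \<theta>0) * (z s + (\<theta>0 + \<theta>1 + \<theta>inf) / 2) \<and>
        x * (ddx u s / u s) =
          - 2 * z s - \<theta>0 + y s * (z s + (\<theta>0 - \<theta>1 + \<theta>inf) / 2)
          + inverse (y s) * (z s + (\<theta>0 + \<theta>1 + \<theta>inf) / 2))"

definition PV_system ::
  "complex \<Rightarrow> complex \<Rightarrow> complex \<Rightarrow> (complex \<Rightarrow> complex) \<Rightarrow> (complex \<Rightarrow> complex) \<Rightarrow>
   (complex \<Rightarrow> complex) \<Rightarrow> bool" where
  "PV_system \<theta>0 \<theta>1 \<theta>inf y z u \<longleftrightarrow>
     y nicely_meromorphic_on UNIV \<and> z nicely_meromorphic_on UNIV \<and>
     u nicely_meromorphic_on UNIV \<and>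
     (\<forall>\<^sub>\<approx>s. y s \<noteq> 0 \<and> u s \<noteq> 0 \<and> PV_system_at \<theta>0 \<theta>1 \<theta>inf y z u s)"


section \<open>The linear system\<close>

definition A0_mat :: "complex \<Rightarrow> complex \<Rightarrow> complex \<Rightarrow> complex^2^2" where
  "A0_mat \<theta>0 z u =
     mat2 (z + \<theta>0 / 2)   (- u * (z + \<theta>0))
          (inverse u * z) (- z - \<theta>0 / 2)"

definition A1_mat ::
  "complex \<Rightarrow> complex \<Rightarrow> complex \<Rightarrow> complex \<Rightarrow> complex \<Rightarrow> complex \<Rightarrow> complex^2^2" where
  "A1_mat \<theta>0 \<theta>1 \<theta>inf y z u =
     mat2 (- z - (\<theta>0 + \<theta>inf) / 2)
          (u * y * (z + (\<theta>0 - \<theta>1 + \<theta>inf) / 2))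
          (- inverse (u * y) * (z + (\<theta>0 + \<theta>1 + \<theta>inf) / 2))
          (z + (\<theta>0 + \<theta>inf) / 2)"

definition Xi_coeff ::
  "complex \<Rightarrow> complex \<Rightarrow> complex \<Rightarrow> complex \<Rightarrow> complex \<Rightarrow> complex \<Rightarrow> complex \<Rightarrow>
   complex \<Rightarrow> complex^2^2" where
  "Xi_coeff \<theta>0 \<theta>1 \<theta>inf x y z u \<xi> =
     scale_mat (x / 2) sigma3 + scale_mat (1 / \<xi>) (A0_mat \<theta>0 z u)
     + scale_mat (1 / (\<xi> - 1)) (A1_mat \<theta>0 \<theta>1 \<theta>inf y z u)"

text \<open>
  The coefficient of the system in \<open>\<lambda>\<close> obtained from \<open>\<xi> = (exp (-\<i>\<phi>) \<lambda> + 1) / 2\<close> and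
  \<open>Y = exp (-\<varpi> \<sigma>\<^sub>3) \<Xi>\<close> at \<open>x = exp (\<i>\<phi>) t\<close>; the leading factor is \<open>d\<xi>/d\<lambda>\<close>.
\<close>

definition Y_coeff ::
  "complex \<Rightarrow> complex \<Rightarrow> complex \<Rightarrow> real \<Rightarrow> real \<Rightarrow> complex \<Rightarrow> complex \<Rightarrow> complex \<Rightarrow>
   complex \<Rightarrow> complex^2^2" where
  "Y_coeff \<theta>0 \<theta>1 \<theta>inf \<phi> t y z u l =
     (let x = exp (\<i> * of_real \<phi>) * of_real t;
          \<xi> = (exp (- \<i> * of_real \<phi>) * l + 1) / 2;
          w = exp (\<i> * of_real \<phi>) * of_real t / 4 + \<theta>inf / 2 * (\<i> * of_real \<phi> + of_real (ln 2))
      in scale_mat (exp (- \<i> * of_real \<phi>) / 2)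
           (exp_sigma3 (- w) ** Xi_coeff \<theta>0 \<theta>1 \<theta>inf x y z u \<xi> ** exp_sigma3 w))"

text \<open>
  The canonical solution with index \<open>k = 2\<close>.  Its sector \<open>\<bar>arg \<lambda> - \<pi>/2\<bar> < \<pi>\<close> is the plane
  cut along the negative imaginary axis.  There \<open>arg \<lambda> - \<pi>/2\<close> is the principal argument
  of \<open>-\<i> \<lambda>\<close>, whence the branch of \<open>ln \<lambda>\<close> below.  The singular points lie on the unit
  circle.  As usual, the asymptotic relation is uniform on closed subsectors only.
\<close>

definition arg2 :: "complex \<Rightarrow> real" where
  "arg2 l = Arg (- \<i> * l) + pi / 2"

definition ln2 :: "complex \<Rightarrow> complex" where
  "ln2 l = Ln (- \<i> * l) + \<i> * of_real (pi / 2)"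

definition sector2 :: "complex set" where
  "sector2 = {l. 1 < cmod l \<and> \<bar>arg2 l - pi / 2\<bar> < pi}"

definition canonical_solution2 ::
  "(complex \<Rightarrow> complex^2^2) \<Rightarrow> complex \<Rightarrow> real \<Rightarrow> (complex \<Rightarrow> complex^2^2) \<Rightarrow> bool" where
  "canonical_solution2 B \<theta>inf t Y \<longleftrightarrow>
     (\<forall>l\<in>sector2. \<forall>i j. ((\<lambda>l. Y l $ i $ j) has_field_derivative (B l ** Y l) $ i $ j) (at l)) \<and>
     (\<exists>G. (\<forall>l\<in>sector2. Y l = (mat 1 + G l) ** exp_sigma3 ((of_real t * l - 2 * \<theta>inf * ln2 l) / 4)) \<and>
          (\<forall>\<delta>>0. \<forall>i j. (\<lambda>l. G l $ i $ j) \<in>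
             O[inf at_infinity (principal {l. \<bar>arg2 l - pi / 2\<bar> \<le> pi - \<delta>})](\<lambda>l. 1 / l)))"


section \<open>Monodromy data\<close>

text \<open>Analytic continuation along a path as a locally constant family of germs.\<close>

definition analytic_continuation_along ::
  "(real \<Rightarrow> complex) \<Rightarrow> (complex \<Rightarrow> complex^2^2) \<Rightarrow> (complex \<Rightarrow> complex^2^2) \<Rightarrow> bool" where
  "analytic_continuation_along \<gamma> f g \<longleftrightarrow>
     (\<exists>F :: real \<Rightarrow> complex \<Rightarrow> complex^2^2.
        (\<forall>\<tau>\<in>{0..1}. \<exists>U \<epsilon>. open U \<and> \<epsilon> > 0 \<and>
           (\<forall>i j. (\<lambda>l. F \<tau> l $ i $ j) holomorphic_on U) \<and>
           (\<forall>\<tau>'\<in>{0..1}. \<bar>\<tau>' - \<tau>\<bar> < \<epsilon> \<longrightarrow>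
              \<gamma> \<tau>' \<in> U \<and> (\<forall>\<^sub>F l in nhds (\<gamma> \<tau>'). F \<tau>' l = F \<tau> l))) \<and>
        (\<forall>\<^sub>F l in nhds (\<gamma> 0). F 0 l = f l) \<and>
        (\<forall>\<^sub>F l in nhds (\<gamma> 1). F 1 l = g l))"

text \<open>
  From the base point \<open>\<i> R\<close> straight towards \<open>a\<close> up to distance \<open>r\<close>, once anticlockwise
  around the circle of radius \<open>r\<close> about \<open>a\<close>, and straight back.
\<close>

definition lasso :: "real \<Rightarrow> real \<Rightarrow> complex \<Rightarrow> real \<Rightarrow> complex" where
  "lasso R r a =
     (let p = \<i> * of_real R;
          \<alpha> = Arg (p - a);
          q = a + of_real r * exp (\<i> * of_real \<alpha>)
      in linepath p q +++ (part_circlepath a r \<alpha> (\<alpha> + 2 * pi) +++ linepath q p))"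

text \<open>
  The two singular points have distance \<open>2\<close>.  All admissible base points (\<open>R > 100\<close>) and
  radii give the same matrices.
\<close>

definition monodromy_data ::
  "complex \<Rightarrow> complex \<Rightarrow> complex \<Rightarrow> real \<Rightarrow> real \<Rightarrow> complex \<Rightarrow> complex \<Rightarrow> complex \<Rightarrow>
   (complex^2^2) \<times> (complex^2^2) \<Rightarrow> bool" where
  "monodromy_data \<theta>0 \<theta>1 \<theta>inf \<phi> t y z u N \<longleftrightarrow>
     (\<exists>Y2. canonical_solution2 (Y_coeff \<theta>0 \<theta>1 \<theta>inf \<phi> t y z u) \<theta>inf t Y2 \<and>
        (\<forall>R r. R > 100 \<and> 0 < r \<and> r < 1 \<longrightarrow>
           analytic_continuation_along (lasso R r (- exp (\<i> * of_real \<phi>))) Y2 (\<lambda>l. Y2 l ** fst N) \<and>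
           analytic_continuation_along (lasso R r (exp (\<i> * of_real \<phi>))) Y2 (\<lambda>l. Y2 l ** snd N)))"

definition monodromy_pairs ::
  "complex \<Rightarrow> complex \<Rightarrow> complex \<Rightarrow> ((complex^2^2) \<times> (complex^2^2)) set" where
  "monodromy_pairs \<theta>0 \<theta>1 \<theta>inf =
     {(M0, M1). det M0 = 1 \<and> det M1 = 1 \<and>
        M0 $ 1 $ 1 * M1 $ 1 $ 1 + M0 $ 2 $ 1 * M1 $ 1 $ 2 = exp (- of_real pi * \<i> * \<theta>inf) \<and>
        trace M0 = 2 * cos (of_real pi * \<theta>0) \<and>
        trace M1 = 2 * cos (of_real pi * \<theta>1)}"

definition gauge_rel ::
  "(((complex^2^2) \<times> (complex^2^2)) \<times> ((complex^2^2) \<times> (complex^2^2))) set" where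
  "gauge_rel =
     {((M0, M1), (N0, N1)). \<exists>c. c \<noteq> 0 \<and>
        N0 = pow_sigma3 c ** M0 ** pow_sigma3 (inverse c) \<and>
        N1 = pow_sigma3 c ** M1 ** pow_sigma3 (inverse c)}"

definition gauge_class ::
  "(complex^2^2) \<times> (complex^2^2) \<Rightarrow> ((complex^2^2) \<times> (complex^2^2)) set" where
  "gauge_class N = gauge_rel `` {N}"

definition monodromy_manifold ::
  "complex \<Rightarrow> complex \<Rightarrow> complex \<Rightarrow> ((complex^2^2) \<times> (complex^2^2)) set set" where
  "monodromy_manifold \<theta>0 \<theta>1 \<theta>inf = monodromy_pairs \<theta>0 \<theta>1 \<theta>inf // gauge_rel"

text \<open>
  \<open>PV_labelled \<theta>0 \<theta>1 \<theta>inf K y\<close>: \<open>y\<close> is a solution labelled with the class \<open>K\<close>, that is, one of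
  the functions denoted by \<open>y(x, M\<^sup>0, M\<^sup>1)\<close> when \<open>K\<close> is the class of \<open>(M\<^sup>0, M\<^sup>1)\<close>.  This is a relation,
  since the solution with a given class need not be unique if \<open>M\<^sup>0\<close> or \<open>M\<^sup>1\<close> is \<open>I\<close> or \<open>-I\<close>.
  The linear system is considered wherever its coefficients are defined and \<open>\<bar>arg x\<bar> < \<pi>/2\<close>.
\<close>

definition PV_labelled ::
  "complex \<Rightarrow> complex \<Rightarrow> complex \<Rightarrow> ((complex^2^2) \<times> (complex^2^2)) set \<Rightarrow>
   (complex \<Rightarrow> complex) \<Rightarrow> bool" where
  "PV_labelled \<theta>0 \<theta>1 \<theta>inf K y \<longleftrightarrow>
     PV_solution \<theta>0 \<theta>1 \<theta>inf y \<and>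
     (\<exists>z u. PV_system \<theta>0 \<theta>1 \<theta>inf y z u \<and>
        (\<forall>s. \<bar>Im s\<bar> < pi / 2 \<and> y analytic_on {s} \<and> z analytic_on {s} \<and> u analytic_on {s} \<and>
             y s \<noteq> 0 \<and> u s \<noteq> 0 \<longrightarrow>
           (\<exists>N. monodromy_data \<theta>0 \<theta>1 \<theta>inf (Im s) (exp (Re s)) (y s) (z s) (u s) N \<and>
                gauge_class N = K)))"

definition shifted_pair ::
  "int \<Rightarrow> (complex^2^2) \<times> (complex^2^2) \<Rightarrow> (complex^2^2) \<times> (complex^2^2)" where
  "shifted_pair p N =
     (let M0 = fst N; M1 = snd N
      in (mat_powi (M1 ** M0) p ** M0 ** mat_powi (M1 ** M0) (- p),
          mat_powi (M1 ** M0) p ** M1 ** mat_powi (M1 ** M0) (- p)))"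

end

theory Submission
 imports Defs
begin

text \<open>In the coordinate \<open>s = ln x\<close>, the flow from \<open>s\<close> to \<open>s + 2 \<pi> i p\<close> is given by a gauge transformation of the linear
 system that is entire in the spectral variable and therefore keeps the monodromy of the transported solution, but turns the
 sector that defines the canonical solution by \<open>-2 \<pi> p\<close>.  Returning to the original sector costs \<open>-p\<close> turns around both
 finite singular points, hence a conjugation by \<open>(M\<^sup>1 M\<^sup>0)\<^sup>p\<close>.

 Two solutions with the same label are equal: the quotient of the canonical solutions of their linear systems is
 single-valued, bounded at the finite singular points because the local exponents agree, and bounded at infinity
 by the Phragmen-Lindelof principle.  By Liouville's theorem it is constant, so it conjugates the coefficients.
 For integral differences of exponents, boundedness at the singular points needs the local monodromy not to be scalar.\<close>

text \<open>At fixed \<open>v\<close> the flow in \<open>s\<close> may grow like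
  \<open>exp (a |v| |s - s'|)\<close>, so it does not visibly respect the asymptotics
  \<open>I + O(1/v)\<close> of a canonical solution. What it does respect, for steps small against
  the decay rate, is exponential decay of a recessive column along a ray. Canonicity is therefore
  replaced by decay of each column in its own sector. This fixes a solution only up to a diagonal
  right factor, which is harmless since labels are classes modulo diagonal conjugation. Small steps
  are chained along the connected set of regular points. The poles are rotated to \<open>1\<close>
  and \<open>- 1\<close>, independently of \<open>arg x\<close>, and the outside of the unit disc is
  unwrapped by \<open>h = ln\<close>. The canonical sector then has centre
  \<open>pi / 2 - Im s\<close>: its turning becomes a translation in \<open>h\<close>, and no branch
  cut interferes. All systems are trace-free, so solutions have constant determinant and are
  normalised to 1. Monodromy is read off three continuations of one solution, across the real
  intervals left of, between and right of the poles: a lasso crosses two neighbouring ones, a large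
  circle the two outer ones.\<close>

no_notation fps_nth (infixl "$" 75)

abbreviation (input) period :: complex where "period \<equiv> 2 * of_real pi * \<i>"

section \<open>Matrix-valued holomorphic functions and linear systems\<close>

lemma mat_mult_entry:
 fixes A B :: "complex^2^2"
 shows "(A ** B) $ i $ j = A $ i $ 1 * B $ 1 $ j + A $ i $ 2 * B $ 2 $ j"
 by (simp add: matrix_matrix_mult_def sum_2)

lemma mat2_entry [simp]:
 "mat2 a b c d $ 1 $ 1 = a" "mat2 a b c d $ 1 $ 2 = b"
 "mat2 a b c d $ 2 $ 1 = c" "mat2 a b c d $ 2 $ 2 = d"
 by (simp_all add: mat2_def)

lemma mat_1_entry [simp]:
 "(mat 1 :: complex^2^2) $ 1 $ 1 = 1" "(mat 1 :: complex^2^2) $ 1 $ 2 = 0"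
 "(mat 1 :: complex^2^2) $ 2 $ 1 = 0" "(mat 1 :: complex^2^2) $ 2 $ 2 = 1"
 by (simp_all add: mat_def)

lemma scale_mat_entry [simp]: "scale_mat c A $ i $ j = c * A $ i $ j"
 by (simp add: scale_mat_def)

lemma mat_eq_iff:
 fixes A B :: "complex^2^2"
 shows "A = B \<longleftrightarrow> A $ 1 $ 1 = B $ 1 $ 1 \<and> A $ 1 $ 2 = B $ 1 $ 2 \<and> A $ 2 $ 1 = B $ 2 $ 1 \<and> A $ 2 $ 2 = B $ 2 $ 2"
 by (auto simp: vec_eq_iff forall_2)

text \<open>The inverse of a matrix of determinant 1. Being polynomial in the entries it keeps
  holomorphy, and it replaces every inverse of a unimodular solution without a division.\<close>

definition adj2 :: "complex^2^2 \<Rightarrow> complex^2^2" where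
 "adj2 A = mat2 (A $ 2 $ 2) (- A $ 1 $ 2) (- A $ 2 $ 1) (A $ 1 $ 1)"

lemma adj2_entry [simp]:
 "adj2 A $ 1 $ 1 = A $ 2 $ 2" "adj2 A $ 1 $ 2 = - A $ 1 $ 2"
 "adj2 A $ 2 $ 1 = - A $ 2 $ 1" "adj2 A $ 2 $ 2 = A $ 1 $ 1"
 by (simp_all add: adj2_def)

lemma adj2_inverse:
 assumes "det A = 1"
 shows "A ** adj2 A = mat 1" "adj2 A ** A = mat 1"
 using assms by (simp_all add: mat_eq_iff mat_mult_entry det_2 algebra_simps)

lemma adj2_adj2 [simp]: "adj2 (adj2 A) = A"
 by (simp add: mat_eq_iff)

lemma det_adj2 [simp]: "det (adj2 A) = det A"
 by (simp add: det_2 algebra_simps)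

lemma adj2_mult: "adj2 (A ** B) = adj2 B ** adj2 A"
 by (simp add: mat_eq_iff mat_mult_entry algebra_simps)

lemma adj2_mat_1 [simp]: "adj2 (mat 1) = mat 1"
 by (simp add: mat_eq_iff)

lemma adj2_cancel:
 assumes "det A = 1"
 shows "A ** (adj2 A ** B) = B" "adj2 A ** (A ** B) = B"
  "(B ** A) ** adj2 A = B" "(B ** adj2 A) ** A = B"
 using adj2_inverse[OF assms] by (metis matrix_mul_assoc matrix_mul_lid matrix_mul_rid)+

lemma scaleC_mat_mult: "scale_mat c A ** B = scale_mat c (A ** B)" "A ** scale_mat c B = scale_mat c (A ** B)"
 by (simp_all add: mat_eq_iff mat_mult_entry algebra_simps)

lemma norm_entry_le: "cmod ((A :: complex^2^2) $ i $ j) \<le> norm A"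
 using Finite_Cartesian_Product.norm_nth_le[where x = "A $ i" and i = j]
  Finite_Cartesian_Product.norm_nth_le[where x = A and i = i] by linarith

lemma norm_mat_le_sum:
 "norm (A :: complex^2^2) \<le> cmod (A $ 1 $ 1) + cmod (A $ 1 $ 2) + cmod (A $ 2 $ 1) + cmod (A $ 2 $ 2)"
proof -
 have v: "norm (v :: 'a::real_normed_vector^2) \<le> norm (v $ 1) + norm (v $ 2)" for v
  unfolding norm_vec_def by (rule order.trans[OF L2_set_le_sum]) (simp_all add: sum_2)
 show ?thesis using v[of A] v[of "A $ 1"] v[of "A $ 2"] by linarith
qed

lemma norm_mat_leI:
 fixes A :: "complex^2^2"
 assumes "\<And>i j. cmod (A $ i $ j) \<le> c"
 shows "norm A \<le> 4 * c"
 using norm_mat_le_sum[of A] assms[of 1 1] assms[of 1 2] assms[of 2 1] assms[of 2 2] by linarith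

lemma norm_mat_mult_le:
 fixes A B :: "complex^2^2"
 shows "norm (A ** B) \<le> 8 * norm A * norm B"
proof -
 have "cmod ((A ** B) $ i $ j) \<le> 2 * (norm A * norm B)" for i j
 proof -
  have "cmod ((A ** B) $ i $ j) \<le> cmod (A $ i $ 1) * cmod (B $ 1 $ j) + cmod (A $ i $ 2) * cmod (B $ 2 $ j)"
   unfolding mat_mult_entry by (rule order.trans[OF norm_triangle_ineq]) (simp add: norm_mult)
  also have "\<dots> \<le> norm A * norm B + norm A * norm B"
   by (intro add_mono mult_mono norm_entry_le) auto
  finally show ?thesis by simp
 qed
 from norm_mat_leI[OF this] show ?thesis by simp
qed

definition has_mderiv :: "(complex \<Rightarrow> complex^2^2) \<Rightarrow> complex^2^2 \<Rightarrow> complex \<Rightarrow> bool" where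
 "has_mderiv X D z \<longleftrightarrow> (\<forall>i j. ((\<lambda>w. X w $ i $ j) has_field_derivative D $ i $ j) (at z))"

definition mat_holo :: "(complex \<Rightarrow> complex^2^2) \<Rightarrow> complex set \<Rightarrow> bool" where
 "mat_holo X S \<longleftrightarrow> (\<forall>i j. (\<lambda>w. X w $ i $ j) holomorphic_on S)"

lemma has_mderivD: "has_mderiv X D z \<Longrightarrow> ((\<lambda>w. X w $ i $ j) has_field_derivative D $ i $ j) (at z)"
 by (simp add: has_mderiv_def)

lemma has_mderiv_iff: "has_mderiv X D z \<longleftrightarrow>
  ((\<lambda>w. X w $ 1 $ 1) has_field_derivative D $ 1 $ 1) (at z) \<and>
  ((\<lambda>w. X w $ 1 $ 2) has_field_derivative D $ 1 $ 2) (at z) \<and>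
  ((\<lambda>w. X w $ 2 $ 1) has_field_derivative D $ 2 $ 1) (at z) \<and>
  ((\<lambda>w. X w $ 2 $ 2) has_field_derivative D $ 2 $ 2) (at z)"
 by (auto simp: has_mderiv_def forall_2)

lemma has_mderiv_mult:
 assumes "has_mderiv X X' z" "has_mderiv Y Y' z"
 shows "has_mderiv (\<lambda>w. X w ** Y w) (X' ** Y z + X z ** Y') z"
 unfolding has_mderiv_def mat_mult_entry
proof (intro allI)
 fix i j
 show "((\<lambda>w. X w $ i $ 1 * Y w $ 1 $ j + X w $ i $ 2 * Y w $ 2 $ j) has_field_derivative
     (X' ** Y z + X z ** Y') $ i $ j) (at z)"
  by (rule derivative_eq_intros has_mderivD[OF assms(1)] has_mderivD[OF assms(2)] refl)+
    (simp add: mat_mult_entry algebra_simps)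
qed

lemma has_mderiv_const: "has_mderiv (\<lambda>_. C) 0 z"
 by (simp add: has_mderiv_def)

lemma has_mderiv_mult_const:
 assumes "has_mderiv X X' z"
 shows "has_mderiv (\<lambda>w. X w ** C) (X' ** C) z" "has_mderiv (\<lambda>w. C ** X w) (C ** X') z"
 using has_mderiv_mult[OF assms has_mderiv_const[of C]] has_mderiv_mult[OF has_mderiv_const[of C] assms]
 by simp_all

lemma has_mderiv_add:
 "has_mderiv X X' z \<Longrightarrow> has_mderiv Y Y' z \<Longrightarrow> has_mderiv (\<lambda>w. X w + Y w) (X' + Y') z"
 unfolding has_mderiv_def by (auto intro: derivative_intros)

lemma has_mderiv_diff:
 "has_mderiv X X' z \<Longrightarrow> has_mderiv Y Y' z \<Longrightarrow> has_mderiv (\<lambda>w. X w - Y w) (X' - Y') z"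
 unfolding has_mderiv_def by (auto intro: derivative_intros)

lemma has_mderiv_scale:
 assumes "(f has_field_derivative f') (at z)" "has_mderiv X X' z"
 shows "has_mderiv (\<lambda>w. scale_mat (f w) (X w)) (scale_mat f' (X z) + scale_mat (f z) X') z"
 unfolding has_mderiv_def scale_mat_entry
proof (intro allI)
 fix i j
 show "((\<lambda>w. f w * X w $ i $ j) has_field_derivative (scale_mat f' (X z) + scale_mat (f z) X') $ i $ j) (at z)"
  by (rule derivative_eq_intros assms(1) has_mderivD[OF assms(2)] refl)+ simp
qed

lemma has_mderiv_adj2:
 assumes "has_mderiv X X' z"
 shows "has_mderiv (\<lambda>w. adj2 (X w)) (adj2 X') z"
 using assms unfolding has_mderiv_iff adj2_entry by (auto intro: derivative_intros)

lemma has_mderiv_chain: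
 assumes "has_mderiv X X' (f z)" "(f has_field_derivative f') (at z)"
 shows "has_mderiv (\<lambda>w. X (f w)) (scale_mat f' X') z"
proof -
 have "((\<lambda>w. X (f w) $ i $ j) has_field_derivative X' $ i $ j * f') (at z)" for i j
  using DERIV_chain2[OF has_mderivD[OF assms(1)] assms(2)] .
 then show ?thesis by (simp add: has_mderiv_def mult.commute)
qed

lemma has_mderiv_transform:
 assumes "has_mderiv X D z" "open S" "z \<in> S" "\<And>w. w \<in> S \<Longrightarrow> X w = Y w"
 shows "has_mderiv Y D z"
 unfolding has_mderiv_def
 using has_field_derivative_transform_within_open[OF has_mderivD[OF assms(1)] assms(2,3)] assms(4) by simp

lemma has_mderiv_unique: "has_mderiv X D z \<Longrightarrow> has_mderiv X E z \<Longrightarrow> D = E"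
 unfolding has_mderiv_def by (metis DERIV_unique vec_eq_iff)

lemma mat_holo_if_mderiv:
 assumes "\<And>z. z \<in> S \<Longrightarrow> has_mderiv X (D z) z" "open S"
 shows "mat_holo X S"
 unfolding mat_holo_def holomorphic_on_open[OF assms(2)] using has_mderivD[OF assms(1)] by blast

lemma mat_holo_imp_mderiv:
 assumes "mat_holo X S" "open S" "z \<in> S"
 obtains D where "has_mderiv X D z"
proof -
 have "\<exists>d. ((\<lambda>w. X w $ i $ j) has_field_derivative d) (at z)" for i j
  using assms unfolding mat_holo_def holomorphic_on_open[OF assms(2)] by blast
 then obtain d where d: "\<And>i j. ((\<lambda>w. X w $ i $ j) has_field_derivative d i j) (at z)" by metis
 have "has_mderiv X (\<chi> i j. d i j) z" using d by (simp add: has_mderiv_def)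
 then show ?thesis using that by blast
qed

lemma mat_holo_continuous_on:
 assumes "mat_holo X S"
 shows "continuous_on S X"
 unfolding continuous_on_def
proof (intro ballI vec_tendstoI)
 fix z i j assume "z \<in> S"
 have "continuous_on S (\<lambda>w. X w $ i $ j)"
  using assms holomorphic_on_imp_continuous_on unfolding mat_holo_def by blast
 then show "((\<lambda>w. X w $ i $ j) \<longlongrightarrow> X z $ i $ j) (at z within S)"
  using \<open>z \<in> S\<close> by (simp add: continuous_on_def)
qed

lemma mat_holo_subset: "mat_holo X S \<Longrightarrow> T \<subseteq> S \<Longrightarrow> mat_holo X T"
 unfolding mat_holo_def using holomorphic_on_subset by blast

lemma mat_holo_mult: "mat_holo X S \<Longrightarrow> mat_holo Y S \<Longrightarrow> mat_holo (\<lambda>w. X w ** Y w) S"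
 unfolding mat_holo_def mat_mult_entry by (auto intro!: holomorphic_intros)

lemma mat_holo_const [simp]: "mat_holo (\<lambda>_. C) S"
 unfolding mat_holo_def by (auto intro!: holomorphic_intros)

lemma mat_holo_adj2: "mat_holo X S \<Longrightarrow> mat_holo (\<lambda>w. adj2 (X w)) S"
 unfolding mat_holo_def adj2_def
 by (auto simp: forall_2 adj2_def intro!: holomorphic_intros)

lemma mat_holo_compose:
 assumes "mat_holo X T" "f holomorphic_on S" "\<And>z. z \<in> S \<Longrightarrow> f z \<in> T"
 shows "mat_holo (\<lambda>z. X (f z)) S"
 unfolding mat_holo_def
proof (intro allI)
 fix i j
 have "((\<lambda>w. X w $ i $ j) \<circ> f) holomorphic_on S"
  using assms by (intro holomorphic_on_compose_gen[where t = T]) (auto simp: mat_holo_def)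
 then show "(\<lambda>z. X (f z) $ i $ j) holomorphic_on S" by (simp add: o_def)
qed

lemma mat_holo_bounded:
 assumes "mat_holo X S" "compact K" "K \<subseteq> S"
 obtains c where "c > 0" "\<And>z. z \<in> K \<Longrightarrow> norm (X z) \<le> c"
proof -
 have "continuous_on K X" using mat_holo_continuous_on[OF assms(1)] assms(3) continuous_on_subset by blast
 then have "bounded (X ` K)" using assms(2) compact_continuous_image compact_imp_bounded by blast
 then obtain c where "c > 0" "\<forall>x\<in>X ` K. norm x \<le> c" using bounded_pos by blast
 then show ?thesis using that by blast
qed

section \<open>Growth of matrix functions along curves and segments\<close>

lemma vector_derivative_of_mderiv:
 assumes "has_mderiv X D (g r)" "(g has_vector_derivative g') (at r within T)"
 shows "((\<lambda>r. X (g r)) has_vector_derivative scale_mat g' D) (at r within T)"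
proof -
 \<comment> \<open>The coordinate embeddings \<open>E i j\<close> reassemble a matrix from its
   entries, so that the derivative along a real curve passes from the entries to the whole
   matrix.\<close>
 define E where "E i j c = (axis i (axis j c) :: complex^2^2)" for i j :: 2 and c :: complex
 have E: "bounded_linear (E i j)" for i j
 proof -
  have "linear (E i j)"
   by (rule linearI) (auto simp: E_def vec_eq_iff axis_def)
  then show ?thesis by (simp add: linear_conv_bounded_linear)
 qed
 have dec: "M = E 1 1 (M $ 1 $ 1) + E 1 2 (M $ 1 $ 2) + E 2 1 (M $ 2 $ 1) + E 2 2 (M $ 2 $ 2)" for M
  by (simp add: mat_eq_iff E_def axis_def)
 have ent: "((\<lambda>r. X (g r) $ i $ j) has_vector_derivative g' * D $ i $ j) (at r within T)" for i j
  using field_vector_diff_chain_within[OF assms(2), of "\<lambda>w. X w $ i $ j" "D $ i $ j"]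
   has_field_derivative_at_within[OF has_mderivD[OF assms(1)]] by (simp add: o_def)
 have "((\<lambda>r. E 1 1 (X (g r) $ 1 $ 1) + E 1 2 (X (g r) $ 1 $ 2) + E 2 1 (X (g r) $ 2 $ 1) + E 2 2 (X (g r) $ 2 $ 2))
   has_vector_derivative E 1 1 (g' * D $ 1 $ 1) + E 1 2 (g' * D $ 1 $ 2) + E 2 1 (g' * D $ 2 $ 1) + E 2 2 (g' * D $ 2 $ 2))
   (at r within T)"
  by (intro has_vector_derivative_add bounded_linear.has_vector_derivative[OF E] ent)
 then show ?thesis
  unfolding dec[symmetric] using dec[of "scale_mat g' D"] by simp
qed

lemma norm_scale_mat: "norm (scale_mat c A) = cmod c * norm A"
proof -
 have "norm (scale_mat c A $ i) = cmod c * norm (A $ i)" for i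
  unfolding norm_vec_def[of "scale_mat c A $ i"] norm_vec_def[of "A $ i"] scale_mat_entry norm_mult
  by (rule L2_set_right_distrib[symmetric]) simp
 then show ?thesis
  unfolding norm_vec_def[of "scale_mat c A"] norm_vec_def[of A] by (simp add: L2_set_right_distrib)
qed

text \<open>A barrier argument: a curve that starts strictly below the barrier and whose speed is at most the
 speed of the barrier as long as it stays below cannot cross it.\<close>

lemma gronwall:
 fixes f :: "real \<Rightarrow> 'a::real_normed_vector"
 assumes "0 \<le> L" "0 \<le> k" "0 \<le> e"
  and der: "\<And>r. 0 \<le> r \<Longrightarrow> r \<le> L \<Longrightarrow> (f has_vector_derivative f' r) (at r within {0..L})"
  and bd: "\<And>r. 0 \<le> r \<Longrightarrow> r \<le> L \<Longrightarrow> norm (f' r) \<le> k * norm (f r) + e"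
 shows "norm (f L) \<le> (norm (f 0) + e * L) * exp (k * L)"
proof (rule ccontr)
 assume "\<not> ?thesis"
 then have big: "norm (f L) > (norm (f 0) + e * L) * exp (k * L)" by simp
 \<comment> \<open>Half of the gap by which the claimed bound fails. The barrier raised by
   \<open>h\<close> starts strictly above the curve and still ends strictly below
   \<open>norm (f L)\<close>.\<close>
 define h where "h = (norm (f L) * exp (- (k * L)) - (norm (f 0) + e * L)) / 2"
 have "norm (f L) * exp (- (k * L)) > (norm (f 0) + e * L)"
  using big by (simp add: exp_minus field_simps)
 then have eta: "h > 0" by (simp add: h_def)
 define u where "u r = (norm (f 0) + e * r + h) * exp (k * r)" for r
 have uL: "u L < norm (f L)"
 proof -
  have "norm (f 0) + e * L + h < norm (f L) * exp (- (k * L))" using eta unfolding h_def by (simp add: field_simps)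
  then have "(norm (f 0) + e * L + h) * exp (k * L) < norm (f L) * exp (- (k * L)) * exp (k * L)"
   by (simp only: mult_strict_right_mono exp_gt_zero)
  then show ?thesis by (simp add: u_def mult.assoc flip: exp_add)
 qed
 have contf: "continuous_on {0..L} f"
  unfolding continuous_on_eq_continuous_within
  using has_vector_derivative_continuous[OF der] by auto
 have contu: "continuous_on A u" for A unfolding u_def by (intro continuous_intros)
 define Z where "Z = {r \<in> {0..L}. u r \<le> norm (f r)}"
 have Zne: "L \<in> Z" using uL \<open>0 \<le> L\<close> by (simp add: Z_def)
 have "closed Z"
  unfolding Z_def by (intro continuous_on_closed_Collect_le contu continuous_on_norm contf closed_atLeastAtMost)
 moreover have bz: "bdd_below Z" unfolding Z_def by (rule bdd_belowI[of _ 0]) auto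
 ultimately have InfZ: "Inf Z \<in> Z" using Zne closed_contains_Inf by blast
 define r1 where "r1 = Inf Z"
 have t1: "0 \<le> r1" "r1 \<le> L" "u r1 \<le> norm (f r1)" using InfZ by (auto simp: r1_def Z_def)
 have below: "norm (f r) < u r" if "0 \<le> r" "r < r1" for r
 proof (rule ccontr)
  assume "\<not> norm (f r) < u r"
  then have "r \<in> Z" using that t1 by (auto simp: Z_def)
  then have "r1 \<le> r" unfolding r1_def using bz by (rule cInf_lower)
  then show False using that by simp
 qed
 have "r1 \<noteq> 0"
 proof
  assume "r1 = 0"
  then have "u 0 \<le> norm (f 0)" using t1 by simp
  then show False using eta by (simp add: u_def)
 qed
 then have pos: "0 < r1" using t1 by simp
 have "norm (f r1 - f 0) \<le> u r1 - u 0"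
 proof (rule differentiable_bound_general[OF pos])
  show "continuous_on {0..r1} f" using contf t1 continuous_on_subset by (metis atLeastatMost_subset_iff order_refl)
  show "continuous_on {0..r1} u" by (rule contu)
  fix r assume t: "0 < r" "r < r1"
  show "(f has_vector_derivative f' r) (at r)"
   using der[of r] t t1 by (simp add: at_within_Icc_at)
  show "(u has_vector_derivative (e * exp (k * r) + (norm (f 0) + e * r + h) * (exp (k * r) * k))) (at r)"
   unfolding u_def has_real_derivative_iff_has_vector_derivative[symmetric]
   by (rule derivative_eq_intros refl | simp)+
  have "norm (f' r) \<le> k * norm (f r) + e" using bd t t1 by simp
  also have "\<dots> \<le> k * u r + e * exp (k * r)"
  proof (intro add_mono mult_left_mono)
   show "norm (f r) \<le> u r" using below t by (simp add: less_imp_le)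
   show "e \<le> e * exp (k * r)" using \<open>0 \<le> e\<close> \<open>0 \<le> k\<close> t by (simp add: mult_le_cancel_left1)
  qed (use assms in auto)
  finally show "norm (f' r) \<le> e * exp (k * r) + (norm (f 0) + e * r + h) * (exp (k * r) * k)"
   by (simp add: u_def algebra_simps)
 qed
 then have "norm (f r1) \<le> norm (f 0) + (u r1 - u 0)"
  using norm_triangle_ineq2[of "f r1" "f 0"] by linarith
 then show False using t1(3) eta by (simp add: u_def)
qed

lemma mat_gronwall:
 assumes "\<And>w. w \<in> closed_segment a b \<Longrightarrow> has_mderiv X (D w) w"
  and "\<And>w. w \<in> closed_segment a b \<Longrightarrow> norm (D w) \<le> k * norm (X w) + e" "0 \<le> k" "0 \<le> e"
 shows "norm (X b) \<le> (norm (X a) + e * dist a b) * exp (k * dist a b)"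
proof -
 define g where "g r = a + of_real r * (b - a)" for r :: real
 have seg: "g r \<in> closed_segment a b" if "0 \<le> r" "r \<le> 1" for r
  using that by (auto simp: closed_segment_def g_def scaleR_conv_of_real algebra_simps intro!: exI[of _ r])
 have gd: "(g has_vector_derivative (b - a)) (at r within T)" for r T
  unfolding g_def by (rule derivative_eq_intros refl | simp)+
 have "norm (X (g 1)) \<le> (norm (X (g 0)) + (e * dist a b) * 1) * exp ((k * dist a b) * 1)"
 proof (rule gronwall)
  fix r :: real assume t: "0 \<le> r" "r \<le> 1"
  show "((\<lambda>r. X (g r)) has_vector_derivative scale_mat (b - a) (D (g r))) (at r within {0..1})"
   by (rule vector_derivative_of_mderiv[OF assms(1)[OF seg[OF t]] gd])
  have "norm (scale_mat (b - a) (D (g r))) \<le> dist a b * (k * norm (X (g r)) + e)"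
   unfolding norm_scale_mat using assms(2)[OF seg[OF t]]
   by (metis dist_norm dist_commute mult_left_mono zero_le_dist)
  then show "norm (scale_mat (b - a) (D (g r))) \<le> k * dist a b * norm (X (g r)) + e * dist a b"
   by (simp add: algebra_simps)
 qed (use assms in auto)
 then show ?thesis by (simp add: g_def)
qed

section \<open>Linear matrix differential equations: existence, determinant, uniqueness\<close>

definition mat_ode :: "(complex \<Rightarrow> complex^2^2) \<Rightarrow> (complex \<Rightarrow> complex^2^2) \<Rightarrow> complex set \<Rightarrow> bool" where
 "mat_ode A X S \<longleftrightarrow> (\<forall>z\<in>S. has_mderiv X (A z ** X z) z)"

lemma mat_odeD: "mat_ode A X S \<Longrightarrow> z \<in> S \<Longrightarrow> has_mderiv X (A z ** X z) z"
 by (simp add: mat_ode_def)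

lemma mat_ode_subset: "mat_ode A X S \<Longrightarrow> T \<subseteq> S \<Longrightarrow> mat_ode A X T"
 by (auto simp: mat_ode_def)

lemma mat_ode_mult_const: "mat_ode A X S \<Longrightarrow> mat_ode A (\<lambda>z. X z ** C) S"
 unfolding mat_ode_def using has_mderiv_mult_const(1) by (metis matrix_mul_assoc)

lemma mat_ode_translate:
 assumes "mat_ode A X S" "\<And>z. z \<in> S \<Longrightarrow> z + a \<in> S \<and> A (z + a) = A z"
 shows "mat_ode A (\<lambda>z. X (z + a)) S"
 unfolding mat_ode_def
proof
 fix z assume z: "z \<in> S"
 have d: "((\<lambda>z. z + a) has_field_derivative 1) (at z)" by (auto intro!: derivative_eq_intros)
 have "has_mderiv X (A (z + a) ** X (z + a)) (z + a)" using assms(2)[OF z] by (intro mat_odeD[OF assms(1)]) simp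
 from has_mderiv_chain[where f = "\<lambda>z. z + a", OF this d]
 show "has_mderiv (\<lambda>z. X (z + a)) (A z ** X (z + a)) z"
  using assms(2)[OF z] by (simp add: scale_mat_def vec_lambda_eta)
qed

lemma mat_ode_holo: "mat_ode A X S \<Longrightarrow> open S \<Longrightarrow> mat_holo X S"
 using mat_holo_if_mderiv[of S X "\<lambda>z. A z ** X z"] by (simp add: mat_ode_def)

lemma closed_segment_iff_affine:
 "v \<in> closed_segment p w \<longleftrightarrow> (\<exists>r::real. 0 \<le> r \<and> r \<le> 1 \<and> v = p + of_real r * (w - p :: complex))"
proof -
 have "(1 - r) *\<^sub>R p + r *\<^sub>R w = p + of_real r * (w - p)" for r :: real
  by (simp add: scaleR_conv_of_real algebra_simps)
 then show ?thesis by (auto simp: closed_segment_def)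
qed

lemma mat_primitive:
 assumes "open S" "\<And>z. z \<in> S \<Longrightarrow> closed_segment p z \<subseteq> S" "p \<in> S" "mat_holo F S"
 obtains P where "P p = 0" "\<And>z. z \<in> S \<Longrightarrow> has_mderiv P (F z) z"
proof -
 have "starlike S" unfolding starlike_def using assms by blast
 have "\<exists>g. \<forall>z\<in>S. (g has_field_derivative F z $ i $ j) (at z)" for i j
 proof (rule holomorphic_starlike_primitive[where k = "{}"])
  have h: "(\<lambda>z. F z $ i $ j) holomorphic_on S" using assms(4) by (simp add: mat_holo_def)
  show "continuous_on S (\<lambda>z. F z $ i $ j)" using h by (rule holomorphic_on_imp_continuous_on)
  show "(\<lambda>z. F z $ i $ j) field_differentiable at x" if "x \<in> S - {}" for x
   using h that assms(1) holomorphic_on_imp_differentiable_at by auto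
 qed (use \<open>starlike S\<close> assms in auto)
 then obtain g where g: "\<And>i j z. z \<in> S \<Longrightarrow> (g i j has_field_derivative F z $ i $ j) (at z)" by metis
 define P where "P z = (\<chi> i j. g i j z - g i j p)" for z
 have "P p = 0" by (simp add: P_def vec_eq_iff)
 moreover have "has_mderiv P (F z) z" if "z \<in> S" for z
  unfolding has_mderiv_def P_def using g[OF that] by (auto intro!: derivative_eq_intros)
 ultimately show ?thesis using that by blast
qed

text \<open>Picard iteration: the solution is the sum of iterated integrals, each
  \<open>Q (Suc n)\<close> being the primitive of \<open>A ** Q n\<close> that vanishes at
  \<open>p\<close>. Along segments from \<open>p\<close> the n-th term is at most
  \<open>N1 * (8 * M * L) ^ n / fact n\<close>, the 8 coming from \<open>norm_mat_mult_le\<close>.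
  The constants can be chosen uniformly on small balls, so the series may be differentiated term by
  term.\<close>

lemma mat_ode_exists:
 assumes S: "open S" "\<And>z. z \<in> S \<Longrightarrow> closed_segment p z \<subseteq> S" "p \<in> S" and A: "mat_holo A S"
 obtains X where "X p = mat 1" "mat_ode A X S"
proof -
 define nxt where "nxt P Q \<longleftrightarrow> Q p = 0 \<and> (\<forall>z\<in>S. has_mderiv Q (A z ** P z) z)" for P Q
 have ex: "\<exists>Q. nxt P Q" if "mat_holo P S" for P
  using mat_primitive[OF S mat_holo_mult[OF A that]] unfolding nxt_def by metis
 have "\<exists>Q. \<forall>n. (mat_holo (Q n) S \<and> (n = 0 \<longrightarrow> Q n = (\<lambda>_. mat 1))) \<and> nxt (Q n) (Q (Suc n))"
 proof (rule dependent_nat_choice)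
  show "\<exists>x. mat_holo x S \<and> (0 = (0::nat) \<longrightarrow> x = (\<lambda>_. mat 1))" by auto
  fix P :: "complex \<Rightarrow> complex^2^2" and n :: nat
  assume "mat_holo P S \<and> (n = 0 \<longrightarrow> P = (\<lambda>_. mat 1))"
  then obtain Q where Q: "nxt P Q" using ex by blast
  then have "mat_holo Q S" using mat_holo_if_mderiv[of S Q "\<lambda>z. A z ** P z"] S(1) by (simp add: nxt_def)
  then show "\<exists>y. (mat_holo y S \<and> (Suc n = 0 \<longrightarrow> y = (\<lambda>_. mat 1))) \<and> nxt P y" using Q by auto
 qed
 then obtain Q where Qh: "\<And>n. mat_holo (Q n) S" and Q0: "Q 0 = (\<lambda>_. mat 1)" and Qs: "\<And>n. nxt (Q n) (Q (Suc n))"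
  by auto
 have Qder: "has_mderiv (Q (Suc n)) (A z ** Q n z) z" if "z \<in> S" for n z using Qs that by (simp add: nxt_def)
 have Qp: "Q (Suc n) p = 0" for n using Qs by (simp add: nxt_def)
 define N1 where "N1 = norm (mat 1 :: complex^2^2)"
 have bnd: "norm (Q n w) \<le> N1 * (8 * M * L) ^ n / fact n"
  if w: "w \<in> S" and M: "\<And>v. v \<in> closed_segment p w \<Longrightarrow> norm (A v) \<le> M" "0 \<le> M" and L: "dist p w \<le> L" for w M L n
 proof -
  define g where "g r = p + of_real r * (w - p)" for r :: real
  have seg: "g r \<in> closed_segment p w" if "0 \<le> r" "r \<le> 1" for r
   using that unfolding closed_segment_iff_affine g_def by blast
  have gS: "g r \<in> S" if "0 \<le> r" "r \<le> 1" for r using seg[OF that] S(2)[OF w] by blast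
  have gd: "(g has_vector_derivative (w - p)) (at r within T)" for r T
   unfolding g_def by (rule derivative_eq_intros refl | simp)+
  have N1: "0 \<le> N1" by (simp add: N1_def)
  have L0: "0 \<le> L" using L zero_le_dist[of p w] by linarith
  have "norm (Q n (g r)) \<le> N1 * (8 * M * L * r) ^ n / fact n" if "0 \<le> r" "r \<le> 1" for r
   using that
  proof (induction n arbitrary: r)
   case 0
   then show ?case by (simp add: Q0 N1_def)
  next
   case (Suc n)
   show ?case
   proof (cases "r = 0")
    case True
    then show ?thesis by (simp add: Qp g_def)
   next
    case False
    then have t: "0 < r" using Suc by simp
    define f where "f r = N1 * (8 * M * L * r) ^ Suc n / fact (Suc n)" for r :: real
    have dv: "((\<lambda>r. Q (Suc n) (g r)) has_vector_derivative scale_mat (w - p) (A (g u) ** Q n (g u))) (at u within T)"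
     if "0 \<le> u" "u \<le> 1" for u T
     by (rule vector_derivative_of_mderiv[OF Qder[OF gS[OF that]] gd])
    have "norm (Q (Suc n) (g r) - Q (Suc n) (g 0)) \<le> f r - f 0"
    proof (rule differentiable_bound_general[OF t])
     show "continuous_on {0..r} (\<lambda>r. Q (Suc n) (g r))"
      unfolding continuous_on_eq_continuous_within
      using has_vector_derivative_continuous[OF dv] Suc.prems by auto
     show "continuous_on {0..r} f" unfolding f_def by (intro continuous_intros) auto
     fix u assume s: "0 < u" "u < r"
     show "((\<lambda>r. Q (Suc n) (g r)) has_vector_derivative scale_mat (w - p) (A (g u) ** Q n (g u))) (at u)"
      using dv s Suc.prems by simp
     show "(f has_vector_derivative (8 * M * L) * (N1 * (8 * M * L * u) ^ n / fact n)) (at u)"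
      unfolding f_def has_real_derivative_iff_has_vector_derivative[symmetric]
      by (rule derivative_eq_intros refl | simp add: divide_simps del: power_Suc)+
     have "norm (scale_mat (w - p) (A (g u) ** Q n (g u))) \<le> L * (8 * M * norm (Q n (g u)))"
      unfolding norm_scale_mat
     proof (intro mult_mono L0)
      show "cmod (w - p) \<le> L" using L by (simp add: dist_norm norm_minus_commute)
      show "norm (A (g u) ** Q n (g u)) \<le> 8 * M * norm (Q n (g u))"
       by (rule order.trans[OF norm_mat_mult_le]) (use M(1)[OF seg] s Suc.prems in \<open>auto intro!: mult_mono M(2)\<close>)
     qed auto
     also have "\<dots> \<le> L * (8 * M * (N1 * (8 * M * L * u) ^ n / fact n))"
      using Suc.IH[of u] s Suc.prems L0 M(2) by (intro mult_left_mono) auto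
     finally show "norm (scale_mat (w - p) (A (g u) ** Q n (g u))) \<le> (8 * M * L) * (N1 * (8 * M * L * u) ^ n / fact n)"
      by (simp add: algebra_simps)
    qed
    then show ?thesis by (simp add: f_def g_def Qp)
   qed
  qed
  from this[of 1] show ?thesis by (simp add: g_def)
 qed
 have loc: "\<exists>d h. 0 < d \<and> summable h \<and> range h \<subseteq> \<real>\<^sub>\<ge>\<^sub>0 \<and>
   (\<forall>\<^sub>F n in sequentially. \<forall>y\<in>ball z d \<inter> S. cmod (Q n y $ i $ j) \<le> cmod (h n))" if z: "z \<in> S" for z i j
 proof -
  obtain d where d: "d > 0" "cball z d \<subseteq> S" using S(1) z open_contains_cball by blast
  \<comment> \<open>The union of all segments from \<open>p\<close> to the ball: a compact subset of
    \<open>S\<close>, hence one bound on \<open>A\<close> for all of them.\<close>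
  define K where "K = (\<lambda>(r::real, w). p + of_real r * (w - p)) ` ({0..1} \<times> cball z d)"
  have "compact K" unfolding K_def
   by (intro compact_continuous_image compact_Times continuous_intros) (auto intro!: continuous_intros simp: case_prod_unfold)
  have segK: "closed_segment p w \<subseteq> K" if "w \<in> cball z d" for w
  proof
   fix x assume "x \<in> closed_segment p w"
   then obtain r :: real where "0 \<le> r" "r \<le> 1" "x = p + of_real r * (w - p)"
    unfolding closed_segment_iff_affine by blast
   then show "x \<in> K" unfolding K_def using that by (intro image_eqI[of _ _ "(r, w)"]) auto
  qed
  have "K \<subseteq> S"
  proof
   fix x assume "x \<in> K"
   then obtain r w where tw: "0 \<le> r" "r \<le> 1" "w \<in> cball z d" "x = p + of_real r * (w - p)"
    unfolding K_def by auto
   then have "x \<in> closed_segment p w"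
    unfolding closed_segment_iff_affine by blast
   then show "x \<in> S" using S(2) d(2) tw by blast
  qed
  then obtain M where M: "M > 0" "\<And>v. v \<in> K \<Longrightarrow> norm (A v) \<le> M"
   using mat_holo_bounded[OF A \<open>compact K\<close>] by blast
  define L where "L = dist p z + d"
  define h where "h n = complex_of_real (N1 * (8 * M * L) ^ n / fact n)" for n
  have L0: "0 \<le> L" using d by (simp add: L_def)
  have Hn: "cmod (h n) = N1 * (8 * M * L) ^ n / fact n" for n
   using L0 M(1) by (simp add: h_def norm_mult norm_divide norm_power N1_def)
  have "summable (\<lambda>n. N1 * ((8 * M * L) ^ n /\<^sub>R fact n))"
   by (intro summable_mult summable_exp_generic)
  then have "summable h"
   unfolding h_def summable_of_real_iff by (simp add: divide_inverse mult_ac)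
  moreover have "range h \<subseteq> \<real>\<^sub>\<ge>\<^sub>0"
  proof -
   have "0 \<le> N1 * (8 * M * L) ^ n / fact n" for n
    using L0 M(1) unfolding N1_def by (intro divide_nonneg_nonneg mult_nonneg_nonneg zero_le_power) auto
   then show ?thesis unfolding h_def nonneg_Reals_of_real_iff image_subset_iff by blast
  qed
  moreover have "cmod (Q n y $ i $ j) \<le> cmod (h n)" if y: "y \<in> ball z d" for n y
  proof -
   have yc: "y \<in> cball z d" using y by auto
   have "dist p y \<le> L" using dist_triangle[of p y z] y by (simp add: L_def)
   then have "norm (Q n y) \<le> N1 * (8 * M * L) ^ n / fact n"
    using bnd[of y M L n] M segK[OF yc] d(2) yc by (meson less_imp_le subsetD)
   then show ?thesis unfolding Hn using norm_entry_le[of "Q n y" i j] by linarith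
  qed
  ultimately show ?thesis using d(1) by (intro exI[of _ d] exI[of _ h]) auto
 qed
 define Q' where "Q' n z = (case n of 0 \<Rightarrow> 0 | Suc m \<Rightarrow> A z ** Q m z)" for n z
 have Q'd: "has_mderiv (Q n) (Q' n z) z" if "z \<in> S" for n z
  using Qder[OF that] by (cases n) (auto simp: Q'_def Q0 has_mderiv_const)
 define R where "R i j g g' \<longleftrightarrow> (\<forall>z\<in>S. (\<lambda>n. Q n z $ i $ j) sums g z \<and> (\<lambda>n. Q' n z $ i $ j) sums g' z \<and>
  (g has_field_derivative g' z) (at z))" for i j g g'
 have "\<exists>g g'. R i j g g'" for i j
  unfolding R_def by (rule series_and_derivative_comparison_complex[OF S(1) has_mderivD[OF Q'd] loc])
 then obtain g g' where R: "\<And>i j. R i j (g i j) (g' i j)" by metis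
 have g: "(\<lambda>n. Q n z $ i $ j) sums g i j z" "(\<lambda>n. Q' n z $ i $ j) sums g' i j z"
  "(g i j has_field_derivative g' i j z) (at z)" if "z \<in> S" for i j z
  using R[of i j] that by (auto simp: R_def)
 define X where "X z = (\<chi> i j. g i j z)" for z
 have "g' i j z = (A z ** X z) $ i $ j" if z: "z \<in> S" for i j z
 proof -
  have "(\<lambda>n. Q' (Suc n) z $ i $ j) sums (A z ** X z) $ i $ j"
   unfolding mat_mult_entry Q'_def nat.case X_def using g(1)[OF z]
   by (auto intro!: sums_add sums_mult)
  then have "(\<lambda>n. Q' n z $ i $ j) sums ((A z ** X z) $ i $ j + Q' 0 z $ i $ j)" by (rule sums_Suc)
  from sums_unique2[OF g(2)[OF z] this] show ?thesis by (simp add: Q'_def)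
 qed
 then have "mat_ode A X S" using g(3) by (simp add: mat_ode_def has_mderiv_def X_def)
 moreover have "X p = mat 1"
 proof -
  have "(\<lambda>n. Q n p $ i $ j) sums (mat 1 $ i $ j)" for i j
  proof -
   have "(\<lambda>n. Q (Suc n) p $ i $ j) sums 0" unfolding Qp by simp
   from sums_Suc[OF this] show ?thesis by (simp add: Q0)
  qed
  from sums_unique2[OF g(1)[OF S(3)] this] have "g i j p = mat 1 $ i $ j" for i j .
  then show ?thesis by (simp add: X_def vec_eq_iff)
 qed
 ultimately show ?thesis using that by blast
qed

definition trace_free :: "(complex \<Rightarrow> complex^2^2) \<Rightarrow> complex set \<Rightarrow> bool" where
 "trace_free A S \<longleftrightarrow> (\<forall>z\<in>S. A z $ 2 $ 2 = - A z $ 1 $ 1)"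

text \<open>Liouville's formula: the derivative of the determinant is the trace of \<open>A\<close>
  times the determinant, and here the trace is zero.\<close>

lemma det_mat_ode_const:
 assumes "mat_ode A X S" "trace_free A S" "open S" "connected S" "p \<in> S" "z \<in> S"
 shows "det (X z) = det (X p)"
proof -
 have "((\<lambda>z. det (X z)) has_field_derivative 0) (at z)" if "z \<in> S" for z
 proof -
  note d = has_mderivD[OF mat_odeD[OF assms(1) that]]
  have tr: "A z $ 2 $ 2 = - A z $ 1 $ 1" using assms(2) that by (simp add: trace_free_def)
  show ?thesis unfolding det_2
   by (rule derivative_eq_intros d refl)+ (simp add: mat_mult_entry tr algebra_simps)
 qed
 then have "(\<lambda>z. det (X z)) constant_on S"
  using assms(4,3) by (rule has_field_derivative_0_imp_constant_on)
 then show ?thesis using assms(5,6) by (metis constant_on_def)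
qed

lemma adj2_trace_free: "A $ 2 $ 2 = - A $ 1 $ 1 \<Longrightarrow> adj2 (A ** X) = scale_mat (-1) (adj2 X ** A)"
 by (simp add: mat_eq_iff mat_mult_entry algebra_simps)

lemma mat_ode_adj2:
 assumes "mat_ode A X S" "trace_free A S" "z \<in> S"
 shows "has_mderiv (\<lambda>z. adj2 (X z)) (scale_mat (-1) (adj2 (X z) ** A z)) z"
 using has_mderiv_adj2[OF mat_odeD[OF assms(1,3)]] adj2_trace_free[of "A z" "X z"] assms(2,3)
 by (simp add: trace_free_def)

text \<open>The derivative of \<open>adj2 (X z) ** Z z\<close> vanishes, so a second solution is a
  constant right multiple of a unimodular one. All connection and monodromy matrices below arise as
  such constants.\<close>

lemma mat_ode_unique:
 assumes "mat_ode A X S" "mat_ode A Z S" "trace_free A S" "open S" "connected S" "p \<in> S" "det (X p) = 1" "z \<in> S"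
 shows "Z z = X z ** (adj2 (X p) ** Z p)"
proof -
 have D: "has_mderiv (\<lambda>z. adj2 (X z) ** Z z) 0 z" if "z \<in> S" for z
 proof -
  have e: "scale_mat (-1) (adj2 (X z) ** A z) ** Z z + adj2 (X z) ** (A z ** Z z) = 0"
   by (simp add: mat_eq_iff mat_mult_entry algebra_simps)
  show ?thesis
   using has_mderiv_mult[OF mat_ode_adj2[OF assms(1,3) that] mat_odeD[OF assms(2) that]] unfolding e .
 qed
 have "(adj2 (X z) ** Z z) $ i $ j = (adj2 (X p) ** Z p) $ i $ j" for i j
 proof -
  have "(\<lambda>z. (adj2 (X z) ** Z z) $ i $ j) constant_on S"
  proof (rule has_field_derivative_0_imp_constant_on[OF _ assms(5,4)])
   show "((\<lambda>z. (adj2 (X z) ** Z z) $ i $ j) has_field_derivative 0) (at z)" if "z \<in> S" for z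
    using has_mderivD[OF D[OF that], of i j] by simp
  qed
  then obtain c where "\<And>z. z \<in> S \<Longrightarrow> (adj2 (X z) ** Z z) $ i $ j = c" by (auto simp: constant_on_def)
  then show ?thesis using assms(6,8) by simp
 qed
 then have "adj2 (X z) ** Z z = adj2 (X p) ** Z p" by (simp add: vec_eq_iff)
 moreover have "det (X z) = 1" using det_mat_ode_const[OF assms(1,3,4,5,6,8)] assms(7) by simp
 ultimately show ?thesis by (metis adj2_cancel(1))
qed

lemma mat_ode_unique_eq:
 assumes "mat_ode A X S" "mat_ode A Z S" "trace_free A S" "open S" "connected S" "p \<in> S" "det (X p) = 1" "z \<in> S"
  "X p = Z p"
 shows "X z = Z z"
 using mat_ode_unique[OF assms(1-8)] assms(7,9) by (metis adj2_inverse(2) matrix_mul_rid)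

lemma mat_ode_fundamental:
 assumes "open S" "starlike S" "mat_holo A S" "trace_free A S"
 obtains X where "mat_ode A X S" "\<And>z. z \<in> S \<Longrightarrow> det (X z) = 1"
proof -
 obtain p where p: "p \<in> S" "\<And>z. z \<in> S \<Longrightarrow> closed_segment p z \<subseteq> S"
  using assms(2) by (auto simp: starlike_def)
 obtain X where X: "X p = mat 1" "mat_ode A X S" using mat_ode_exists[OF assms(1) p(2,1) assms(3)] by blast
 have "det (X z) = 1" if "z \<in> S" for z
  using det_mat_ode_const[OF X(2) assms(4,1) _ p(1) that] X(1) assms(2) starlike_imp_connected by auto
 then show ?thesis using that X by blast
qed

section \<open>Recessive solutions near infinity\<close>

text \<open>The complement of a closed cone around the negative real axis, with vertex moved to \<open>\<rho>\<close>.
 It is invariant under translation to the right.\<close>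

definition cone_compl :: "real \<Rightarrow> real \<Rightarrow> complex set" where
 "cone_compl k \<rho> = {z. k * cmod (z - of_real \<rho>) + Re (z - of_real \<rho>) > 0}"

lemma open_cone_compl: "open (cone_compl k \<rho>)"
 unfolding cone_compl_def by (intro open_Collect_less continuous_intros)

context
 fixes \<kappa> \<rho> :: real
 assumes \<kappa>: "0 \<le> \<kappa>" "\<kappa> < 1" and \<rho>: "\<rho> > 0"
begin

lemma cone_compl_right:
 assumes "z \<in> cone_compl \<kappa> \<rho>" "0 \<le> r"
 shows "z + of_real r \<in> cone_compl \<kappa> \<rho>"
proof -
 have "cmod (z - of_real \<rho>) \<le> cmod (z + of_real r - of_real \<rho>) + r"
  using norm_triangle_ineq4[of "z + of_real r - of_real \<rho>" "of_real r"] assms by simp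
 then have "\<kappa> * cmod (z - of_real \<rho>) \<le> \<kappa> * (cmod (z + of_real r - of_real \<rho>) + r)"
  using \<kappa> by (intro mult_left_mono) auto
 moreover have "\<kappa> * r \<le> 1 * r" using \<kappa> assms by (intro mult_right_mono) auto
 ultimately show ?thesis using assms by (simp add: cone_compl_def algebra_simps)
qed

lemma cone_compl_starlike:
 assumes "x \<in> cone_compl \<kappa> \<rho>"
 shows "closed_segment (of_real (\<rho> + 1)) x \<subseteq> cone_compl \<kappa> \<rho>"
proof
 fix z assume "z \<in> closed_segment (of_real (\<rho> + 1)) x"
 then obtain t :: real where t: "0 \<le> t" "t \<le> 1" and z: "z = of_real (\<rho> + 1) + of_real t * (x - of_real (\<rho> + 1))"
  unfolding closed_segment_iff_affine by blast
 define w where "w = x - of_real \<rho>"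
 have w: "\<kappa> * cmod w + Re w > 0" using assms by (simp add: cone_compl_def w_def)
 have zw: "z - of_real \<rho> = of_real t * w + of_real (1 - t)" by (simp add: z w_def algebra_simps)
 show "z \<in> cone_compl \<kappa> \<rho>"
 proof (cases "t = 1")
  case True
  then show ?thesis using assms by (simp add: z)
 next
  case False
  have "t * cmod w \<le> cmod (z - of_real \<rho>) + (1 - t)"
   using norm_triangle_ineq4[of "z - of_real \<rho>" "of_real (1 - t)"] t unfolding zw by (simp add: norm_mult del: of_real_diff)
  then have "\<kappa> * (t * cmod w) \<le> \<kappa> * (cmod (z - of_real \<rho>) + (1 - t))"
   using \<kappa> by (intro mult_left_mono) auto
  moreover have "\<kappa> * (1 - t) < 1 * (1 - t)" using \<kappa> t False by (intro mult_strict_right_mono) auto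
  moreover have "0 \<le> t * (\<kappa> * cmod w + Re w)" using w t by simp
  moreover have "Re (z - of_real \<rho>) = t * Re w + (1 - t)" unfolding zw by simp
  ultimately show ?thesis unfolding cone_compl_def mem_Collect_eq by (simp add: algebra_simps)
 qed
qed

lemma cone_compl_base: "of_real (\<rho> + 1) \<in> cone_compl \<kappa> \<rho>"
 using \<kappa> by (simp add: cone_compl_def)

lemma starlike_cone_compl: "starlike (cone_compl \<kappa> \<rho>)"
 unfolding starlike_def using cone_compl_base cone_compl_starlike by blast

lemma connected_cone_compl: "connected (cone_compl \<kappa> \<rho>)"
 by (rule starlike_imp_connected[OF starlike_cone_compl])

text \<open>Seen from the vertex, points of the region keep an angle from the negative axis, so a
  shift to the right cannot cancel much. With \<open>w\<close> measured from the vertex, \<open>|w +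
  r|^2 \<ge> |w|^2 + r^2 - 2 \<kappa> r |w| \<ge> (1 - \<kappa>) (|w|^2 + r^2)\<close>, and this is
  at least \<open>(1 - \<kappa>) / 2\<close> times \<open>(|w| + r)^2\<close>. The second bound uses
  that the vertex lies at distance \<rho> from the origin.\<close>

lemma cone_compl_norm:
 assumes "z \<in> cone_compl \<kappa> \<rho>" "0 \<le> v"
 shows "sqrt ((1 - \<kappa>) / 2) * (cmod z + v) \<le> cmod (z + of_real v)"
  and "sqrt ((1 - \<kappa>) / 2) * \<rho> \<le> cmod z"
proof -
 define w where "w = z - of_real \<rho>"
 have w: "\<kappa> * cmod w + Re w > 0" using assms by (simp add: cone_compl_def w_def)
 have key: "sqrt ((1 - \<kappa>) / 2) * (cmod w + r) \<le> cmod (w + of_real r)" if "0 \<le> r" for r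
 proof -
  have "(sqrt ((1 - \<kappa>) / 2) * (cmod w + r))\<^sup>2 = (1 - \<kappa>) / 2 * (cmod w + r)\<^sup>2"
   using \<kappa> by (simp add: power_mult_distrib)
  also have "\<dots> \<le> (1 - \<kappa>) * ((cmod w)\<^sup>2 + r\<^sup>2)"
  proof -
   have "(cmod w + r)\<^sup>2 \<le> 2 * ((cmod w)\<^sup>2 + r\<^sup>2)"
    using sum_squares_bound[of "cmod w" r] by (simp add: power2_sum)
   then show ?thesis using \<kappa> mult_left_mono[of "(cmod w + r)\<^sup>2" "2 * ((cmod w)\<^sup>2 + r\<^sup>2)" "(1 - \<kappa>)/2"] by simp
  qed
  also have "\<dots> \<le> (cmod w)\<^sup>2 + r\<^sup>2 - 2 * r * (\<kappa> * cmod w)"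
  proof -
   have "\<kappa> * (2 * cmod w * r) \<le> \<kappa> * ((cmod w)\<^sup>2 + r\<^sup>2)"
    using \<kappa> sum_squares_bound[of "cmod w" r] by (intro mult_left_mono) auto
   then show ?thesis by (simp add: algebra_simps)
  qed
  also have "\<dots> \<le> (cmod w)\<^sup>2 + r\<^sup>2 + 2 * r * Re w"
   using mult_left_mono[of "- (\<kappa> * cmod w)" "Re w" "2 * r"] w that by simp
  also have "\<dots> = (cmod (w + of_real r))\<^sup>2"
   unfolding cmod_power2 by (simp add: power2_sum algebra_simps)
  finally show ?thesis by (rule power2_le_imp_le) simp
 qed
 have *: "cmod z \<le> cmod w + \<rho>"
  using norm_triangle_ineq[of w "of_real \<rho>"] \<rho> by (simp add: w_def)
 have c: "0 \<le> sqrt ((1 - \<kappa>) / 2)" using \<kappa> by simp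
 have "sqrt ((1 - \<kappa>) / 2) * (cmod z + v) \<le> sqrt ((1 - \<kappa>) / 2) * (cmod w + (\<rho> + v))"
  using * c by (intro mult_left_mono) auto
 also have "\<dots> \<le> cmod (w + of_real (\<rho> + v))" using \<rho> assms(2) by (intro key) auto
 finally show "sqrt ((1 - \<kappa>) / 2) * (cmod z + v) \<le> cmod (z + of_real v)" by (simp add: w_def)
 have "sqrt ((1 - \<kappa>) / 2) * \<rho> \<le> sqrt ((1 - \<kappa>) / 2) * (cmod w + \<rho>)" using c by (intro mult_left_mono) auto
 also have "\<dots> \<le> cmod (w + of_real \<rho>)" using \<rho> by (intro key) auto
 finally show "sqrt ((1 - \<kappa>) / 2) * \<rho> \<le> cmod z" by (simp add: w_def)
qed

text \<open>The primitive is minus the integral of \<open>f\<close> over the horizontal ray to the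
  right. The function \<open>H x r\<close> majorises the tail of that integral from \<open>r\<close>
  on, since its derivative is \<open>- b x r\<close> and it tends to zero; the last assumption makes
  the limit at the right end the same on all rays.\<close>

lemma primitive_vanishing_at_right:
 assumes f: "f holomorphic_on cone_compl \<kappa> \<rho>"
  and b: "\<And>x r. x \<in> cone_compl \<kappa> \<rho> \<Longrightarrow> 0 \<le> r \<Longrightarrow> cmod (f (x + of_real r)) \<le> b x r"
  and H: "\<And>x r. x \<in> cone_compl \<kappa> \<rho> \<Longrightarrow> 0 \<le> r \<Longrightarrow> (H x has_real_derivative - b x r) (at r)"
  and H0: "\<And>x. x \<in> cone_compl \<kappa> \<rho> \<Longrightarrow> (H x \<longlongrightarrow> 0) at_top"
  and unif: "\<And>R e. e > 0 \<Longrightarrow> \<exists>N0. \<forall>N\<ge>N0. \<forall>w. cmod w \<le> R \<and> w + of_real N \<in> cone_compl \<kappa> \<rho> \<longrightarrow> cmod (f (w + of_real N)) \<le> e"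
 obtains h where "\<And>x. x \<in> cone_compl \<kappa> \<rho> \<Longrightarrow> (h has_field_derivative f x) (at x)"
  "\<And>x. x \<in> cone_compl \<kappa> \<rho> \<Longrightarrow> cmod (h x) \<le> H x 0"
proof -
 let ?S = "cone_compl \<kappa> \<rho>"
 have "\<exists>g. \<forall>x\<in>?S. (g has_field_derivative f x) (at x)"
  by (rule holomorphic_starlike_primitive[where k = "{}"])
    (use f open_cone_compl starlike_cone_compl holomorphic_on_imp_continuous_on holomorphic_on_imp_differentiable_at in auto)
 then obtain g where g: "\<And>x. x \<in> ?S \<Longrightarrow> (g has_field_derivative f x) (at x)" by blast
 have diff: "cmod (g (x + of_real N') - g (x + of_real N)) \<le> H x N - H x N'"
  if z: "x \<in> ?S" and N: "0 \<le> N" "N < N'" for x N N'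
 proof -
  have gd: "((\<lambda>r. g (x + of_real r)) has_vector_derivative f (x + of_real r)) (at r)" if "0 \<le> r" for r :: real
  proof -
   have "((\<lambda>r::real. x + of_real r) has_vector_derivative 1) (at r)"
    by (rule derivative_eq_intros refl | simp)+
   then show ?thesis
    using field_vector_diff_chain_at[of "\<lambda>r. x + of_real r" 1 r g, OF _ g[OF cone_compl_right[OF z that]]]
    by (simp add: o_def)
  qed
  have Pd: "((\<lambda>r. - H x r) has_vector_derivative b x r) (at r)" if "0 \<le> r" for r
   unfolding has_real_derivative_iff_has_vector_derivative[symmetric]
   using DERIV_minus[OF H[OF z that]] by simp
  have "cmod (g (x + of_real N') - g (x + of_real N)) \<le> - H x N' - (- H x N)"
  proof (rule differentiable_bound_general[OF N(2)])
   show "continuous_on {N..N'} (\<lambda>r. g (x + of_real r))"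
    using N by (intro continuous_at_imp_continuous_on ballI has_vector_derivative_continuous[OF gd]) auto
   show "continuous_on {N..N'} (\<lambda>r. - H x r)"
    using N by (intro continuous_at_imp_continuous_on ballI has_vector_derivative_continuous[OF Pd]) auto
   fix r assume s: "N < r" "r < N'"
   then have s0: "0 \<le> r" using N by simp
   show "((\<lambda>r. g (x + of_real r)) has_vector_derivative f (x + of_real r)) (at r)" by (rule gd[OF s0])
   show "((\<lambda>r. - H x r) has_vector_derivative b x r) (at r)" by (rule Pd[OF s0])
   show "cmod (f (x + of_real r)) \<le> b x r" by (rule b[OF z s0])
  qed
  then show ?thesis by simp
 qed
 let ?p = "of_real (\<rho> + 1) :: complex"
 define X where "X n = g (?p + of_real (real n))" for n
 have "Cauchy X"
 proof (rule metric_CauchyI)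
  fix e :: real assume e: "e > 0"
  have "\<forall>\<^sub>F r in at_top. \<bar>H ?p r\<bar> < e / 2"
   using tendstoD[OF H0[OF cone_compl_base], of "e / 2"] e by simp
  then obtain N0 where N0: "\<And>r. r \<ge> N0 \<Longrightarrow> \<bar>H ?p r\<bar> < e / 2" by (auto simp: eventually_at_top_linorder)
  obtain M :: nat where M: "real M \<ge> N0" using real_arch_simple by blast
  have *: "dist (X m) (X n) < e" if "M \<le> m" "m < n" for m n
  proof -
   have "dist (X m) (X n) \<le> H ?p m - H ?p n"
    unfolding X_def dist_norm using diff[OF cone_compl_base, of "real m" "real n"] that by (simp add: norm_minus_commute)
   then show ?thesis using N0[of m] N0[of n] M that by auto
  qed
  show "\<exists>M. \<forall>m\<ge>M. \<forall>n\<ge>M. dist (X m) (X n) < e"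
  proof (intro exI[of _ M] allI impI)
   fix m n assume "M \<le> m" "M \<le> n"
   then show "dist (X m) (X n) < e" using *[of m n] *[of n m] e by (cases m n rule: linorder_cases) (auto simp: dist_commute)
  qed
 qed
 then obtain L where L: "X \<longlonglongrightarrow> L" using Cauchy_convergent_iff convergent_def by blast
 \<comment> \<open>The segment from the base point to \<open>x\<close>, translated far to the right,
   stays in the region and \<open>f\<close> is uniformly small on it. So \<open>g\<close> has the
   same limit \<open>L\<close> on every ray.\<close>
 have lim: "(\<lambda>n. g (x + of_real (real n))) \<longlonglongrightarrow> L" if z: "x \<in> ?S" for x
 proof -
  define R where "R = max (cmod x) (cmod ?p)"
  have "(\<lambda>n. g (x + of_real (real n)) - X n) \<longlonglongrightarrow> 0"
  proof (rule LIMSEQ_I)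
   fix e :: real assume e: "e > 0"
   define e' where "e' = e / (2 * (dist x ?p + 1))"
   have d1: "dist x ?p + 1 > 0" by (rule add_nonneg_pos) auto
   have e': "e' > 0" using e d1 unfolding e'_def by simp
   obtain N0 where N0: "\<And>N w. N \<ge> N0 \<Longrightarrow> cmod w \<le> R \<Longrightarrow> w + of_real N \<in> ?S \<Longrightarrow> cmod (f (w + of_real N)) \<le> e'"
    using unif[OF e', of R] by blast
   obtain M :: nat where M: "real M \<ge> max N0 (R + \<rho> + 1)" using real_arch_simple by blast
   show "\<exists>no. \<forall>n\<ge>no. norm (g (x + of_real (real n)) - X n - 0) < e"
   proof (intro exI[of _ M] allI impI)
    fix n assume n: "n \<ge> M"
    let ?T = "closed_segment ?p x"
    have Tb: "cmod w \<le> R" if "w \<in> ?T" for w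
    proof -
     have "?T \<subseteq> cball 0 R" by (rule closed_segment_subset) (auto simp: R_def)
     then show ?thesis using that by auto
    qed
    have TS: "w + of_real (real n) \<in> ?S" if "w \<in> ?T" for w
    proof -
     have "Re (w + of_real (real n) - of_real \<rho>) \<ge> 1"
      using Tb[OF that] abs_Re_le_cmod[of w] M n by auto
     moreover have "0 \<le> \<kappa> * cmod (w + of_real (real n) - of_real \<rho>)" using \<kappa> by simp
     ultimately show ?thesis unfolding cone_compl_def mem_Collect_eq by linarith
    qed
    have "cmod (g (x + of_real (real n)) - g (?p + of_real (real n))) \<le> e' * cmod (x - ?p)"
    proof (rule field_differentiable_bound[of ?T "\<lambda>w. g (w + of_real (real n))" "\<lambda>w. f (w + of_real (real n))"])
     fix w assume w: "w \<in> ?T"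
     have "((\<lambda>w. g (w + of_real (real n))) has_field_derivative f (w + of_real (real n))) (at w)"
      using g[OF TS[OF w]] by (simp add: DERIV_shift)
     then show "((\<lambda>w. g (w + of_real (real n))) has_field_derivative f (w + of_real (real n))) (at w within ?T)"
      by (rule has_field_derivative_at_within)
     show "cmod (f (w + of_real (real n))) \<le> e'"
      by (rule N0[OF _ Tb[OF w] TS[OF w]]) (use M n in linarith)
    qed auto
    also have "\<dots> \<le> e' * (dist x ?p + 1)" using e' by (simp add: dist_norm)
    also have "\<dots> = e / 2" unfolding e'_def using d1 by (simp add: field_simps)
    also have "\<dots> < e" using e by simp
    finally show "norm (g (x + of_real (real n)) - X n - 0) < e" by (simp add: X_def)
   qed
  qed
  from tendsto_add[OF this L] show ?thesis by simp
 qed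
 show ?thesis
 proof (rule that[of "\<lambda>x. g x - L"])
  fix x assume z: "x \<in> ?S"
  show "((\<lambda>x. g x - L) has_field_derivative f x) (at x)"
   using g[OF z] by (auto intro!: derivative_eq_intros)
  have l1: "(\<lambda>n. cmod (g (x + of_real (real n)) - g x)) \<longlonglongrightarrow> cmod (L - g x)"
   by (intro tendsto_intros lim z)
  have l2: "(\<lambda>n. H x 0 - H x (real n)) \<longlonglongrightarrow> H x 0 - 0"
   by (intro tendsto_intros filterlim_compose[OF H0[OF z]] filterlim_real_sequentially)
  have "cmod (g (x + of_real (real n)) - g x) \<le> H x 0 - H x (real n)" if "1 \<le> n" for n
   using diff[OF z, of 0 "real n"] that by simp
  then have "\<forall>\<^sub>F n in sequentially. cmod (g (x + of_real (real n)) - g x) \<le> H x 0 - H x (real n)"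
   using eventually_ge_at_top eventually_mono by (metis (mono_tags, lifting))
  from tendsto_le[OF _ l2 l1 this] show "cmod (g x - L) \<le> H x 0" by (simp add: norm_minus_commute)
 qed
qed

text \<open>Adding a multiple of \<open>exp (t * x)\<close> to a solution destroys boundedness to
  the right. The bounded one is \<open>exp (t * x)\<close> times the primitive of
  \<open>exp (- t * x) * g x\<close> that vanishes at the right end, and integrating the majorant
  gives \<open>M / Re t\<close>.\<close>

lemma bounded_solution_cone:
 assumes g: "g holomorphic_on cone_compl \<kappa> \<rho>" "\<And>x. x \<in> cone_compl \<kappa> \<rho> \<Longrightarrow> cmod (g x) \<le> M" and t: "Re t > 0"
 obtains v where "\<And>x. x \<in> cone_compl \<kappa> \<rho> \<Longrightarrow> (v has_field_derivative t * v x + g x) (at x)"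
  "\<And>x. x \<in> cone_compl \<kappa> \<rho> \<Longrightarrow> cmod (v x) \<le> M / Re t"
proof -
 let ?S = "cone_compl \<kappa> \<rho>"
 define f where "f x = exp (- t * x) * g x" for x
 define b where "b x r = M * cmod (exp (- t * x)) * exp (- Re t * r)" for x :: complex and r :: real
 define H where "H x r = b x r / Re t" for x r
 have M: "0 \<le> M" using g(2)[OF cone_compl_base] norm_ge_zero order.trans by blast
 have ex: "cmod (exp (- t * (w + of_real N))) = cmod (exp (- t * w)) * exp (- Re t * N)" for w N
  unfolding norm_exp_eq_Re exp_add[symmetric] by (simp add: algebra_simps)
 obtain h where h: "\<And>x. x \<in> ?S \<Longrightarrow> (h has_field_derivative f x) (at x)"
  "\<And>x. x \<in> ?S \<Longrightarrow> cmod (h x) \<le> H x 0"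
 proof (rule primitive_vanishing_at_right[of f b H])
  show "f holomorphic_on ?S" unfolding f_def by (intro holomorphic_intros g)
  show "cmod (f (x + of_real r)) \<le> b x r" if "x \<in> ?S" "0 \<le> r" for x r
   unfolding f_def b_def norm_mult ex using g(2)[OF cone_compl_right[OF that]]
    mult_left_mono[of "cmod (g (x + of_real r))" M "cmod (exp (- t * x)) * exp (- Re t * r)"]
   by (simp add: mult_ac)
  show "(H x has_real_derivative - b x r) (at r)" for x r
   unfolding H_def b_def using t by (auto intro!: derivative_eq_intros)
  show "(H x \<longlongrightarrow> 0) at_top" for x :: complex
  proof -
   have "((\<lambda>r. exp (- Re t * r)) \<longlongrightarrow> 0) at_top"
    using t by (intro filterlim_compose[OF exp_at_bot] filterlim_tendsto_neg_mult_at_bot[OF tendsto_const]) (auto simp: filterlim_ident)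
   then have "((\<lambda>r. M * cmod (exp (- t * x)) * exp (- Re t * r) / Re t) \<longlongrightarrow> M * cmod (exp (- t * x)) * 0 / Re t) at_top"
    using t by (intro tendsto_intros) auto
   then show ?thesis unfolding H_def b_def by simp
  qed
  fix R e :: real assume e: "e > 0"
  have "((\<lambda>N. M * exp (cmod t * R) * exp (- Re t * N)) \<longlongrightarrow> M * exp (cmod t * R) * 0) at_top"
   using t by (intro tendsto_mult tendsto_const filterlim_compose[OF exp_at_bot] filterlim_tendsto_neg_mult_at_bot[OF tendsto_const]) (auto simp: filterlim_ident)
  then have "\<forall>\<^sub>F N in at_top. M * exp (cmod t * R) * exp (- Re t * N) < e"
   using e by (intro order_tendstoD) auto
  then obtain N0 where N0: "\<And>N. N \<ge> N0 \<Longrightarrow> M * exp (cmod t * R) * exp (- Re t * N) < e"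
   by (auto simp: eventually_at_top_linorder)
  have "cmod (f (w + of_real N)) \<le> e" if "N \<ge> N0" "cmod w \<le> R" "w + of_real N \<in> ?S" for N w
  proof -
   have "cmod (exp (- t * w)) \<le> exp (cmod t * R)"
   proof -
    have "Re (- t * w) \<le> cmod (- t * w)" by (rule complex_Re_le_cmod)
    also have "\<dots> \<le> cmod t * R" using that by (simp add: norm_mult mult_left_mono)
    finally show ?thesis by simp
   qed
   then have "cmod (f (w + of_real N)) \<le> exp (cmod t * R) * exp (- Re t * N) * M"
    unfolding f_def norm_mult ex using g(2)[OF that(3)] by (intro mult_mono) auto
   then show ?thesis using N0[OF that(1)] by (simp add: mult_ac)
  qed
  then show "\<exists>N0. \<forall>N\<ge>N0. \<forall>w. cmod w \<le> R \<and> w + of_real N \<in> ?S \<longrightarrow> cmod (f (w + of_real N)) \<le> e" by blast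
 qed blast
 show ?thesis
 proof (rule that[of "\<lambda>x. exp (t * x) * h x"])
  fix x assume z: "x \<in> ?S"
  have ee: "exp (t * x) * exp (- t * x) = 1" by (simp add: exp_minus)
  show "((\<lambda>x. exp (t * x) * h x) has_field_derivative t * (exp (t * x) * h x) + g x) (at x)"
   using ee by (auto intro!: derivative_eq_intros h(1)[OF z] simp: f_def exp_minus)
  have "cmod (exp (t * x) * h x) \<le> cmod (exp (t * x)) * H x 0"
   unfolding norm_mult using h(2)[OF z] by (intro mult_left_mono) auto
  also have "\<dots> = M / Re t * cmod (exp (t * x) * exp (- t * x))"
   unfolding H_def b_def norm_mult by simp
  finally show "cmod (exp (t * x) * h x) \<le> M / Re t" unfolding ee by simp
 qed
qed

text \<open>By \<open>cone_compl_norm\<close> the integrand on the ray from \<open>q\<close> is at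
  most \<open>(M / c^2) / (|q| + r)^2\<close> with \<open>c^2 = (1 - \<kappa>) / 2\<close>; its
  integral is \<open>(M / c^2) / |q|\<close>, which is the stated constant.\<close>

lemma decaying_primitive_cone:
 assumes g: "g holomorphic_on cone_compl \<kappa> \<rho>" "\<And>q. q \<in> cone_compl \<kappa> \<rho> \<Longrightarrow> cmod (g q) \<le> M / (cmod q)\<^sup>2"
 obtains w where "\<And>q. q \<in> cone_compl \<kappa> \<rho> \<Longrightarrow> (w has_field_derivative g q) (at q)"
  "\<And>q. q \<in> cone_compl \<kappa> \<rho> \<Longrightarrow> cmod (w q) \<le> 2 * M / (1 - \<kappa>) / cmod q"
proof -
 let ?S = "cone_compl \<kappa> \<rho>"
 define M' where "M' = 2 * M / (1 - \<kappa>)"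
 define c where "c = sqrt ((1 - \<kappa>) / 2)"
 have c: "c > 0" "c\<^sup>2 = (1 - \<kappa>) / 2" using \<kappa> by (auto simp: c_def)
 have pos: "cmod q > 0" if "q \<in> ?S" for q
  using cone_compl_norm(2)[OF that order_refl] c(1) \<rho> unfolding c_def[symmetric]
  by (meson less_le_trans mult_pos_pos)
 have M: "0 \<le> M"
 proof -
  have "0 \<le> M / (cmod (of_real (\<rho> + 1)))\<^sup>2" using g(2)[OF cone_compl_base] norm_ge_zero order.trans by blast
  then show ?thesis using pos[OF cone_compl_base] by (simp add: zero_le_divide_iff)
 qed
 have M': "M' = M / c\<^sup>2" unfolding M'_def c(2) by simp
 define b where "b q r = M' / (cmod q + r)\<^sup>2" for q :: complex and r :: real
 define H where "H q r = M' / (cmod q + r)" for q :: complex and r :: real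
 obtain h where h: "\<And>q. q \<in> ?S \<Longrightarrow> (h has_field_derivative g q) (at q)"
  "\<And>q. q \<in> ?S \<Longrightarrow> cmod (h q) \<le> H q 0"
 proof (rule primitive_vanishing_at_right[OF g(1), of b H])
  fix q r assume z: "q \<in> ?S" and s: "0 \<le> (r::real)"
  have p: "0 < cmod q + r" by (rule add_pos_nonneg[OF pos[OF z] s])
  have "cmod (g (q + of_real r)) \<le> M / (cmod (q + of_real r))\<^sup>2" by (rule g(2)[OF cone_compl_right[OF z s]])
  also have "\<dots> \<le> M / (c * (cmod q + r))\<^sup>2"
   using cone_compl_norm(1)[OF z s] M c p unfolding c_def[symmetric]
   by (intro divide_left_mono power_mono mult_pos_pos zero_less_power pos[OF cone_compl_right[OF z s]]) auto
  also have "\<dots> = b q r" by (simp add: b_def M' power_mult_distrib)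
  finally show "cmod (g (q + of_real r)) \<le> b q r" .
  show "(H q has_real_derivative - b q r) (at r)"
   unfolding H_def b_def using p by (auto intro!: derivative_eq_intros simp: power2_eq_square)
 next
  fix q assume "q \<in> ?S"
  have "filterlim (\<lambda>r::real. cmod q + r) at_top at_top"
   by (rule filterlim_tendsto_add_at_top[OF tendsto_const filterlim_ident])
  then show "(H q \<longlongrightarrow> 0) at_top" unfolding H_def by (rule real_tendsto_divide_at_top[OF tendsto_const])
 next
  fix R e :: real assume e: "e > 0"
  have "cmod (g (w + of_real N)) \<le> e" if N: "N \<ge> \<bar>R\<bar> + 1 + M / e" and w: "cmod w \<le> R" "w + of_real N \<in> ?S" for N w
  proof -
   have Me: "0 \<le> M / e" using M e by simp
   have "cmod (w + of_real N) \<ge> \<bar>N\<bar> - cmod w" using norm_triangle_ineq4[of "w + of_real N" w] by simp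
   then have x: "cmod (w + of_real N) \<ge> 1 + M / e" using N w Me by linarith
   have "1 + M / e \<le> (cmod (w + of_real N))\<^sup>2"
    using x Me self_le_power[of "cmod (w + of_real N)" 2] by simp
   then have "M \<le> e * (cmod (w + of_real N))\<^sup>2" using e by (simp add: field_simps)
   then have "M / (cmod (w + of_real N))\<^sup>2 \<le> e" using pos[OF w(2)] by (simp add: divide_le_eq)
   then show ?thesis using g(2)[OF w(2)] by linarith
  qed
  then show "\<exists>N0. \<forall>N\<ge>N0. \<forall>w. cmod w \<le> R \<and> w + of_real N \<in> ?S \<longrightarrow> cmod (g (w + of_real N)) \<le> e" by blast
 qed blast
 show ?thesis using that[OF h(1)] h(2) by (simp add: H_def M'_def)
qed

end

text \<open>Successive approximation for a pair in which \<open>v\<close> has the growing rate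
  \<open>t\<close> and \<open>w\<close> tends to 1. The perturbation is integrated from the right
  end, by \<open>bounded_solution_cone\<close> for \<open>v\<close> and by
  \<open>decaying_primitive_cone\<close> for \<open>w\<close>; moving the vertex far enough to the
  right makes every step halve the bounds.\<close>

lemma cone_compl_system:
 fixes al be ga de :: "complex \<Rightarrow> complex"
 assumes t: "Re t > 0" and k: "0 \<le> k" "k < 1" and K: "0 \<le> K" and r0: "0 \<le> r0"
  and hol: "al holomorphic_on {\<zeta>. cmod \<zeta> > r0}" "be holomorphic_on {\<zeta>. cmod \<zeta> > r0}"
   "ga holomorphic_on {\<zeta>. cmod \<zeta> > r0}" "de holomorphic_on {\<zeta>. cmod \<zeta> > r0}"
  and bd: "\<And>\<zeta>. cmod \<zeta> > r0 \<Longrightarrow> cmod (al \<zeta>) \<le> K / cmod \<zeta>" "\<And>\<zeta>. cmod \<zeta> > r0 \<Longrightarrow> cmod (be \<zeta>) \<le> K"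
   "\<And>\<zeta>. cmod \<zeta> > r0 \<Longrightarrow> cmod (ga \<zeta>) \<le> K / (cmod \<zeta>)\<^sup>2" "\<And>\<zeta>. cmod \<zeta> > r0 \<Longrightarrow> cmod (de \<zeta>) \<le> K / (cmod \<zeta>)\<^sup>2"
 obtains \<rho> v w K' where "\<rho> > 0" "\<And>\<zeta>. \<zeta> \<in> cone_compl k \<rho> \<Longrightarrow> cmod \<zeta> > r0"
  "\<And>\<zeta>. \<zeta> \<in> cone_compl k \<rho> \<Longrightarrow> (v has_field_derivative t * v \<zeta> + (al \<zeta> * v \<zeta> + be \<zeta> * w \<zeta>)) (at \<zeta>)"
  "\<And>\<zeta>. \<zeta> \<in> cone_compl k \<rho> \<Longrightarrow> (w has_field_derivative ga \<zeta> * v \<zeta> + de \<zeta> * w \<zeta>) (at \<zeta>)"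
  "\<And>\<zeta>. \<zeta> \<in> cone_compl k \<rho> \<Longrightarrow> cmod (v \<zeta>) \<le> K'" "\<And>\<zeta>. \<zeta> \<in> cone_compl k \<rho> \<Longrightarrow> cmod (w \<zeta> - 1) \<le> K' / cmod \<zeta>"
proof -
 define c where "c = sqrt ((1 - k) / 2)"
 have c: "c > 0" using k by (auto simp: c_def)
 \<comment> \<open>These constants give \<open>cmod (be \<zeta>) \<le> Re t * H / 4\<close> and,
   through the size of \<rho>, also \<open>cmod (al \<zeta>) \<le> Re t / 4\<close> and
   \<open>B / cmod \<zeta> \<le> 1\<close>. Together they yield the factor 1/2 per step.\<close>
 define H where "H = 4 * K / Re t + 1"
 have H: "H \<ge> 1" using t K by (simp add: H_def)
 define B where "B = 4 * K * (H + 1) / (1 - k)"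
 have B: "0 \<le> B" using k K H by (simp add: B_def)
 define \<rho> where "\<rho> = (r0 + 4 * K / Re t + B + 1) / c"
 have sum1: "r0 + 4 * K / Re t + B + 1 \<ge> 1" using r0 K t B by simp
 have \<rho>: "\<rho> > 0" using sum1 c unfolding \<rho>_def by (intro divide_pos_pos) auto
 let ?S = "cone_compl k \<rho>"
 have zS: "cmod \<zeta> \<ge> r0 + 4 * K / Re t + B + 1" if "\<zeta> \<in> ?S" for \<zeta>
 proof -
  have "c * \<rho> \<le> cmod \<zeta>" using cone_compl_norm(2)[OF k \<rho> that order_refl] by (simp add: c_def)
  then show ?thesis using c by (simp add: \<rho>_def)
 qed
 have Kt: "0 \<le> 4 * K / Re t" using K t by simp
 have big: "cmod \<zeta> > r0" "cmod \<zeta> \<ge> 4 * K / Re t" "cmod \<zeta> \<ge> B" "cmod \<zeta> \<ge> 1" if "\<zeta> \<in> ?S" for \<zeta>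
  using zS[OF that] r0 Kt B by linarith+
 have sub: "?S \<subseteq> {\<zeta>. cmod \<zeta> > r0}" using big(1) by blast
 note hol' = hol[THEN holomorphic_on_subset, OF sub]
 define good where "good n pq \<longleftrightarrow> (case pq of (p, q) \<Rightarrow> p holomorphic_on ?S \<and> q holomorphic_on ?S \<and>
   (\<forall>\<zeta>\<in>?S. cmod (p \<zeta>) \<le> H / 2 ^ n \<and> cmod (q \<zeta>) \<le> 1 / 2 ^ n))" for n :: nat and pq
 define nxt where "nxt n pq pq' \<longleftrightarrow> (case pq of (p, q) \<Rightarrow> case pq' of (p', q') \<Rightarrow>
   (\<forall>\<zeta>\<in>?S. (p' has_field_derivative t * p' \<zeta> + (al \<zeta> * p \<zeta> + be \<zeta> * q \<zeta>)) (at \<zeta>) \<and>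
    (q' has_field_derivative ga \<zeta> * p \<zeta> + de \<zeta> * q \<zeta>) (at \<zeta>) \<and>
    cmod (q' \<zeta>) \<le> B / cmod \<zeta> / 2 ^ Suc n))" for n :: nat and pq pq'
 have step: "\<exists>pq'. good (Suc n) pq' \<and> nxt n pq pq'" if "good n pq" for n pq
 proof -
  obtain p q where pq: "pq = (p, q)" by fastforce
  have p: "p holomorphic_on ?S" "\<And>\<zeta>. \<zeta> \<in> ?S \<Longrightarrow> cmod (p \<zeta>) \<le> H / 2 ^ n"
   and q: "q holomorphic_on ?S" "\<And>\<zeta>. \<zeta> \<in> ?S \<Longrightarrow> cmod (q \<zeta>) \<le> 1 / 2 ^ n"
   using that by (auto simp: good_def pq)
  have b1: "cmod (al \<zeta> * p \<zeta> + be \<zeta> * q \<zeta>) \<le> Re t * H / 2 ^ Suc n" if z: "\<zeta> \<in> ?S" for \<zeta>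
  proof -
   have zz: "cmod \<zeta> > 0" using big(4)[OF z] by linarith
   have a1: "cmod (al \<zeta>) \<le> Re t / 4"
   proof -
    have "4 * K \<le> cmod \<zeta> * Re t" using big(2)[OF z] t by (simp add: field_simps)
    then have "K / cmod \<zeta> \<le> Re t / 4" using zz by (simp add: field_simps)
    then show ?thesis using bd(1)[OF big(1)[OF z]] by linarith
   qed
   have a2: "cmod (be \<zeta>) \<le> Re t * H / 4"
   proof -
    have "K \<le> Re t * H / 4" using t by (simp add: H_def field_simps)
    then show ?thesis using bd(2)[OF big(1)[OF z]] by linarith
   qed
   have "cmod (al \<zeta> * p \<zeta> + be \<zeta> * q \<zeta>) \<le> cmod (al \<zeta>) * cmod (p \<zeta>) + cmod (be \<zeta>) * cmod (q \<zeta>)"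
    by (rule order.trans[OF norm_triangle_ineq]) (simp add: norm_mult)
   also have "\<dots> \<le> Re t / 4 * (H / 2 ^ n) + Re t * H / 4 * (1 / 2 ^ n)"
    using t H by (intro add_mono mult_mono a1 a2 p(2) q(2) z) auto
   also have "\<dots> = Re t * H / 2 ^ Suc n" by (simp add: field_simps)
   finally show ?thesis .
  qed
  have b2: "cmod (ga \<zeta> * p \<zeta> + de \<zeta> * q \<zeta>) \<le> (K * (H + 1) / 2 ^ n) / (cmod \<zeta>)\<^sup>2" if z: "\<zeta> \<in> ?S" for \<zeta>
  proof -
   have "cmod (ga \<zeta> * p \<zeta> + de \<zeta> * q \<zeta>) \<le> cmod (ga \<zeta>) * cmod (p \<zeta>) + cmod (de \<zeta>) * cmod (q \<zeta>)"
    by (rule order.trans[OF norm_triangle_ineq]) (simp add: norm_mult)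
   also have "\<dots> \<le> K / (cmod \<zeta>)\<^sup>2 * (H / 2 ^ n) + K / (cmod \<zeta>)\<^sup>2 * (1 / 2 ^ n)"
    using K H by (intro add_mono mult_mono bd big(1) p(2) q(2) z) auto
   also have "\<dots> = (K * (H + 1) / 2 ^ n) / (cmod \<zeta>)\<^sup>2" by (cases "\<zeta> = 0") (simp_all add: field_simps)
   finally show ?thesis .
  qed
  have h1: "(\<lambda>\<zeta>. al \<zeta> * p \<zeta> + be \<zeta> * q \<zeta>) holomorphic_on ?S" by (intro holomorphic_intros hol' p q)
  have h2: "(\<lambda>\<zeta>. ga \<zeta> * p \<zeta> + de \<zeta> * q \<zeta>) holomorphic_on ?S" by (intro holomorphic_intros hol' p q)
  obtain p' where p': "\<And>\<zeta>. \<zeta> \<in> ?S \<Longrightarrow> (p' has_field_derivative t * p' \<zeta> + (al \<zeta> * p \<zeta> + be \<zeta> * q \<zeta>)) (at \<zeta>)"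
   "\<And>\<zeta>. \<zeta> \<in> ?S \<Longrightarrow> cmod (p' \<zeta>) \<le> (Re t * H / 2 ^ Suc n) / Re t"
   using bounded_solution_cone[OF k \<rho> h1 b1 t] by blast
  obtain q' where q': "\<And>\<zeta>. \<zeta> \<in> ?S \<Longrightarrow> (q' has_field_derivative ga \<zeta> * p \<zeta> + de \<zeta> * q \<zeta>) (at \<zeta>)"
   "\<And>\<zeta>. \<zeta> \<in> ?S \<Longrightarrow> cmod (q' \<zeta>) \<le> 2 * (K * (H + 1) / 2 ^ n) / (1 - k) / cmod \<zeta>"
   using decaying_primitive_cone[OF k \<rho> h2 b2] by blast
  have q'B: "cmod (q' \<zeta>) \<le> B / cmod \<zeta> / 2 ^ Suc n" if "\<zeta> \<in> ?S" for \<zeta>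
  proof -
   have "2 * (K * (H + 1) / 2 ^ n) / (1 - k) / cmod \<zeta> = B / cmod \<zeta> / 2 ^ Suc n"
    unfolding B_def by (simp add: divide_simps)
   then show ?thesis using q'(2)[OF that] by simp
  qed
  have "good (Suc n) (p', q')"
  proof -
   have "cmod (q' \<zeta>) \<le> 1 / 2 ^ Suc n" if "\<zeta> \<in> ?S" for \<zeta>
   proof -
    have "B / cmod \<zeta> \<le> 1" using big(3,4)[OF that] by (simp add: divide_le_eq)
    then have "B / cmod \<zeta> / 2 ^ Suc n \<le> 1 / 2 ^ Suc n" by (intro divide_right_mono) auto
    then show ?thesis using q'B[OF that] by linarith
   qed
   moreover have "cmod (p' \<zeta>) \<le> H / 2 ^ Suc n" if "\<zeta> \<in> ?S" for \<zeta> using p'(2)[OF that] t by simp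
   moreover have "p' holomorphic_on ?S" "q' holomorphic_on ?S"
    unfolding holomorphic_on_open[OF open_cone_compl] using p'(1) q'(1) by blast+
   ultimately show ?thesis by (simp add: good_def)
  qed
  moreover have "nxt n pq (p', q')" using p'(1) q'(1) q'B by (simp add: nxt_def pq)
  ultimately show ?thesis by blast
 qed
 have "\<exists>f. \<forall>n. (good n (f n) \<and> (n = 0 \<longrightarrow> f n = (\<lambda>_. 0, \<lambda>_. 1))) \<and> nxt n (f n) (f (Suc n))"
 proof (rule dependent_nat_choice)
  show "\<exists>x. good 0 x \<and> (0 = (0::nat) \<longrightarrow> x = (\<lambda>_. 0, \<lambda>_. 1))"
   using H by (auto simp: good_def)
 qed (use step in auto)
 then obtain f where f: "\<And>n. good n (f n)" "f 0 = (\<lambda>_. 0, \<lambda>_. 1)" "\<And>n. nxt n (f n) (f (Suc n))" by auto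
 define p where "p n = fst (f n)" for n
 define q where "q n = snd (f n)" for n
 have fpq: "f n = (p n, q n)" for n by (simp add: p_def q_def)
 have p0: "p 0 = (\<lambda>_. 0)" and q0: "q 0 = (\<lambda>_. 1)" using f(2) by (auto simp: p_def q_def)
 have pb: "cmod (p n \<zeta>) \<le> H / 2 ^ n" and qb: "cmod (q n \<zeta>) \<le> 1 / 2 ^ n" if "\<zeta> \<in> ?S" for n \<zeta>
  using f(1)[of n] that by (auto simp: good_def fpq)
 have pd: "(p (Suc n) has_field_derivative t * p (Suc n) \<zeta> + (al \<zeta> * p n \<zeta> + be \<zeta> * q n \<zeta>)) (at \<zeta>)"
  and qd: "(q (Suc n) has_field_derivative ga \<zeta> * p n \<zeta> + de \<zeta> * q n \<zeta>) (at \<zeta>)"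
  and qB: "cmod (q (Suc n) \<zeta>) \<le> B / cmod \<zeta> / 2 ^ Suc n" if "\<zeta> \<in> ?S" for n \<zeta>
  using f(3)[of n] that by (auto simp: nxt_def fpq)
 define p' where "p' n \<zeta> = (case n of 0 \<Rightarrow> 0 | Suc m \<Rightarrow> t * p (Suc m) \<zeta> + (al \<zeta> * p m \<zeta> + be \<zeta> * q m \<zeta>))" for n \<zeta>
 define q' where "q' n \<zeta> = (case n of 0 \<Rightarrow> 0 | Suc m \<Rightarrow> ga \<zeta> * p m \<zeta> + de \<zeta> * q m \<zeta>)" for n \<zeta>
 have pd': "(p n has_field_derivative p' n \<zeta>) (at \<zeta>)" if "\<zeta> \<in> ?S" for n \<zeta>
  using pd[OF that] by (cases n) (auto simp: p'_def p0)
 have qd': "(q n has_field_derivative q' n \<zeta>) (at \<zeta>)" if "\<zeta> \<in> ?S" for n \<zeta>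
  using qd[OF that] by (cases n) (auto simp: q'_def q0)
 have geo: "summable (\<lambda>n. complex_of_real (a / 2 ^ n))" for a :: real
  unfolding summable_of_real_iff using summable_mult[OF summable_geometric[of "1/2::real"], of a]
  by (simp add: power_divide)
 have ser: "\<exists>g g'. \<forall>\<zeta>\<in>?S. (\<lambda>n. F n \<zeta>) sums g \<zeta> \<and> (\<lambda>n. F' n \<zeta>) sums g' \<zeta> \<and> (g has_field_derivative g' \<zeta>) (at \<zeta>)"
  if "\<And>n \<zeta>. \<zeta> \<in> ?S \<Longrightarrow> (F n has_field_derivative F' n \<zeta>) (at \<zeta>)" "\<And>n \<zeta>. \<zeta> \<in> ?S \<Longrightarrow> cmod (F n \<zeta>) \<le> a / 2 ^ n" "a \<ge> 0"
  for F F' :: "nat \<Rightarrow> complex \<Rightarrow> complex" and a :: real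
 proof (rule series_and_derivative_comparison_complex[OF open_cone_compl that(1)])
  fix x assume "x \<in> ?S"
  show "\<exists>d h. 0 < d \<and> summable h \<and> range h \<subseteq> \<real>\<^sub>\<ge>\<^sub>0 \<and> (\<forall>\<^sub>F n in sequentially. \<forall>y\<in>ball x d \<inter> ?S. cmod (F n y) \<le> cmod (h n))"
  proof (intro exI[of _ 1] exI[of _ "\<lambda>n. complex_of_real (a / 2 ^ n)"] conjI geo)
   show "range (\<lambda>n. complex_of_real (a / 2 ^ n)) \<subseteq> \<real>\<^sub>\<ge>\<^sub>0"
    unfolding image_subset_iff nonneg_Reals_of_real_iff using that(3) by simp
   have "cmod (complex_of_real (a / 2 ^ n)) = a / 2 ^ n" for n unfolding norm_of_real using that(3) by simp
   then show "\<forall>\<^sub>F n in sequentially. \<forall>y\<in>ball x 1 \<inter> ?S. cmod (F n y) \<le> cmod (complex_of_real (a / 2 ^ n))"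
    using that(2) by (intro always_eventually) auto
  qed simp
 qed
 obtain v v' where v: "\<And>\<zeta>. \<zeta> \<in> ?S \<Longrightarrow> (\<lambda>n. p n \<zeta>) sums v \<zeta>" "\<And>\<zeta>. \<zeta> \<in> ?S \<Longrightarrow> (\<lambda>n. p' n \<zeta>) sums v' \<zeta>"
  "\<And>\<zeta>. \<zeta> \<in> ?S \<Longrightarrow> (v has_field_derivative v' \<zeta>) (at \<zeta>)"
  using ser[OF pd' pb] H by auto
 obtain w w' where w: "\<And>\<zeta>. \<zeta> \<in> ?S \<Longrightarrow> (\<lambda>n. q n \<zeta>) sums w \<zeta>" "\<And>\<zeta>. \<zeta> \<in> ?S \<Longrightarrow> (\<lambda>n. q' n \<zeta>) sums w' \<zeta>"
  "\<And>\<zeta>. \<zeta> \<in> ?S \<Longrightarrow> (w has_field_derivative w' \<zeta>) (at \<zeta>)"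
  using ser[OF qd' qb] by auto
 have pS: "(\<lambda>n. p (Suc n) \<zeta>) sums v \<zeta>" if "\<zeta> \<in> ?S" for \<zeta>
  using v(1)[OF that] sums_Suc_iff[of "\<lambda>n. p n \<zeta>" "v \<zeta>"] by (simp add: p0)
 have v': "v' \<zeta> = t * v \<zeta> + (al \<zeta> * v \<zeta> + be \<zeta> * w \<zeta>)" if "\<zeta> \<in> ?S" for \<zeta>
 proof -
  have "(\<lambda>n. p' (Suc n) \<zeta>) sums (t * v \<zeta> + (al \<zeta> * v \<zeta> + be \<zeta> * w \<zeta>))"
   unfolding p'_def nat.case by (intro sums_add sums_mult pS v(1) w(1) that)
  moreover have "(\<lambda>n. p' (Suc n) \<zeta>) sums v' \<zeta>"
   using v(2)[OF that] sums_Suc_iff[of "\<lambda>n. p' n \<zeta>" "v' \<zeta>"] by (simp add: p'_def)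
  ultimately show ?thesis by (rule sums_unique2[symmetric])
 qed
 have w': "w' \<zeta> = ga \<zeta> * v \<zeta> + de \<zeta> * w \<zeta>" if "\<zeta> \<in> ?S" for \<zeta>
 proof -
  have "(\<lambda>n. q' (Suc n) \<zeta>) sums (ga \<zeta> * v \<zeta> + de \<zeta> * w \<zeta>)"
   unfolding q'_def nat.case by (intro sums_add sums_mult v(1) w(1) that)
  moreover have "(\<lambda>n. q' (Suc n) \<zeta>) sums w' \<zeta>"
   using w(2)[OF that] sums_Suc_iff[of "\<lambda>n. q' n \<zeta>" "w' \<zeta>"] by (simp add: q'_def)
  ultimately show ?thesis by (rule sums_unique2[symmetric])
 qed
 have half: "(\<lambda>n. a / 2 ^ Suc n) sums a" for a :: real
  using sums_mult[OF power_half_series, of a] by (simp add: power_divide)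
 have bndsum: "cmod s \<le> a" if "F sums s" "\<And>n. cmod (F n) \<le> a / 2 ^ Suc n" for F s a
 proof -
  have "cmod (suminf F) \<le> (\<Sum>n. a / 2 ^ Suc n)"
   by (rule norm_suminf_le[OF that(2) sums_summable[OF half]])
  then show ?thesis using sums_unique[OF that(1)] sums_unique[OF half[of a]] by simp
 qed
 show ?thesis
 proof (rule that[of \<rho> v w "max H B"])
  show "\<rho> > 0" by (rule \<rho>)
  fix \<zeta> assume z: "\<zeta> \<in> ?S"
  show "cmod \<zeta> > r0" by (rule big(1)[OF z])
  show "(v has_field_derivative t * v \<zeta> + (al \<zeta> * v \<zeta> + be \<zeta> * w \<zeta>)) (at \<zeta>)" using v(3)[OF z] v'[OF z] by simp
  show "(w has_field_derivative ga \<zeta> * v \<zeta> + de \<zeta> * w \<zeta>) (at \<zeta>)" using w(3)[OF z] w'[OF z] by simp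
  have "cmod (v \<zeta>) \<le> H" using bndsum[OF pS[OF z]] pb[OF z] by blast
  then show "cmod (v \<zeta>) \<le> max H B" by simp
  have "(\<lambda>n. q (Suc n) \<zeta>) sums (w \<zeta> - 1)"
   using w(1)[OF z] sums_Suc_iff[of "\<lambda>n. q n \<zeta>" "w \<zeta> - 1"] by (simp add: q0)
  then have "cmod (w \<zeta> - 1) \<le> B / cmod \<zeta>" using bndsum qB[OF z] by blast
  also have "\<dots> \<le> max H B / cmod \<zeta>" by (intro divide_right_mono) auto
  finally show "cmod (w \<zeta> - 1) \<le> max H B / cmod \<zeta>" .
 qed
qed

section \<open>Systems with an irregular singular point at infinity and their logarithmic
  form\<close>

text \<open>Conjugation by the permutation of the two basis vectors. It reverses the signs of the
  formal exponents, so one construction of a recessive column serves for both columns.\<close>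

definition swap2 :: "complex^2^2 \<Rightarrow> complex^2^2" where
 "swap2 A = mat2 (A $ 2 $ 2) (A $ 2 $ 1) (A $ 1 $ 2) (A $ 1 $ 1)"

lemma swap2_entry [simp]:
 "swap2 A $ 1 $ 1 = A $ 2 $ 2" "swap2 A $ 1 $ 2 = A $ 2 $ 1"
 "swap2 A $ 2 $ 1 = A $ 1 $ 2" "swap2 A $ 2 $ 2 = A $ 1 $ 1"
 by (simp_all add: swap2_def)

lemma det_swap2 [simp]: "det (swap2 A) = det A"
 by (simp add: det_2 algebra_simps)

lemma has_mderiv_swap2: "has_mderiv X D z \<Longrightarrow> has_mderiv (\<lambda>z. swap2 (X z)) (swap2 D) z"
 by (simp add: has_mderiv_iff)

lemma mat_holo_swap2: "mat_holo X S \<Longrightarrow> mat_holo (\<lambda>z. swap2 (X z)) S"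
 by (simp add: mat_holo_def forall_2)

text \<open>Systems \<open>X' = B X\<close> near infinity with \<open>B = (s/4 - k/(2 l)) \<sigma>\<^sub>3 + O(1/l)\<close>, the diagonal of the error being
 \<open>O(1/l\<^sup>2)\<close>.\<close>

definition rank1_system :: "real \<Rightarrow> complex \<Rightarrow> (complex \<Rightarrow> complex^2^2) \<Rightarrow> bool" where
 "rank1_system s k B \<longleftrightarrow> mat_holo B {l. 1 < cmod l} \<and> trace_free B {l. 1 < cmod l} \<and>
   (\<exists>K\<ge>0. \<forall>l. 2 < cmod l \<longrightarrow> cmod (B l $ 1 $ 1 - (of_real s / 4 - k / (2 * l))) \<le> K / (cmod l)\<^sup>2 \<and>
    cmod (B l $ 1 $ 2) \<le> K / cmod l \<and> cmod (B l $ 2 $ 1) \<le> K / cmod l)"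

lemma rank1_system_swap2:
 assumes "rank1_system s k B"
 shows "rank1_system (- s) (- k) (\<lambda>l. swap2 (B l))"
proof -
 obtain K where K: "K \<ge> 0" "\<And>l. 2 < cmod l \<Longrightarrow> cmod (B l $ 1 $ 1 - (of_real s / 4 - k / (2 * l))) \<le> K / (cmod l)\<^sup>2 \<and>
    cmod (B l $ 1 $ 2) \<le> K / cmod l \<and> cmod (B l $ 2 $ 1) \<le> K / cmod l"
  and tr: "\<And>l. 1 < cmod l \<Longrightarrow> B l $ 2 $ 2 = - B l $ 1 $ 1"
  using assms by (auto simp: rank1_system_def trace_free_def)
 have "cmod (B l $ 2 $ 2 - (of_real (- s) / 4 - (- k) / (2 * l))) = cmod (B l $ 1 $ 1 - (of_real s / 4 - k / (2 * l)))"
  if "2 < cmod l" for l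
 proof -
  have "B l $ 2 $ 2 - (of_real (- s) / 4 - (- k) / (2 * l)) = - (B l $ 1 $ 1 - (of_real s / 4 - k / (2 * l)))"
   using tr[of l] that by simp
  then show ?thesis by (simp only: norm_minus_cancel)
 qed
 then have "\<forall>l. 2 < cmod l \<longrightarrow> cmod (swap2 (B l) $ 1 $ 1 - (of_real (- s) / 4 - (- k) / (2 * l))) \<le> K / (cmod l)\<^sup>2 \<and>
    cmod (swap2 (B l) $ 1 $ 2) \<le> K / cmod l \<and> cmod (swap2 (B l) $ 2 $ 1) \<le> K / cmod l"
  using K(2) by simp
 then show ?thesis
  using assms K(1) mat_holo_swap2 unfolding rank1_system_def trace_free_def by auto
qed

text \<open>The system in the coordinate \<open>h = ln l\<close>. On the half plane
  \<open>Re h > 0\<close>, which covers \<open>|l| > 1\<close>, solutions and the power of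
  \<open>l\<close> in the formal exponent are single-valued.\<close>

definition log_system :: "(complex \<Rightarrow> complex^2^2) \<Rightarrow> complex \<Rightarrow> complex^2^2" where
 "log_system B h = scale_mat (exp h) (B (exp h))"

definition log_plane :: "complex set" where "log_plane = {h. 0 < Re h}"

lemma log_plane: "open log_plane" "convex log_plane" "connected log_plane" "starlike log_plane"
proof -
 show "open log_plane" unfolding log_plane_def by (rule open_halfspace_Re_gt)
 show c: "convex log_plane" unfolding log_plane_def by (rule convex_halfspace_Re_gt)
 show "connected log_plane" by (rule convex_connected[OF c])
 show "starlike log_plane" by (rule convex_imp_starlike[OF c]) (auto simp: log_plane_def intro!: exI[of _ 1])
qed

lemma log_system_holo:
 assumes "mat_holo B {l. 1 < cmod l}"
 shows "mat_holo (log_system B) log_plane"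
 unfolding mat_holo_def log_system_def scale_mat_entry
proof (intro allI holomorphic_intros)
 fix i j
 have "(\<lambda>l. B l $ i $ j) holomorphic_on {l. 1 < cmod l}" using assms by (simp add: mat_holo_def)
 then have "((\<lambda>l. B l $ i $ j) \<circ> exp) holomorphic_on log_plane"
  by (intro holomorphic_on_compose_gen[where t = "{l. 1 < cmod l}"] holomorphic_intros) (auto simp: log_plane_def)
 then show "(\<lambda>w. B (exp w) $ i $ j) holomorphic_on log_plane" by (simp add: o_def)
qed

lemma log_system_trace_free: "trace_free B {l. 1 < cmod l} \<Longrightarrow> trace_free (log_system B) log_plane"
 by (simp add: trace_free_def log_system_def log_plane_def)

lemma mat_ode_log_compose:
 assumes "mat_ode (log_system B) H log_plane" "l \<noteq> 0" "(lg has_field_derivative 1 / l) (at l)" "exp (lg l) = l" "lg l \<in> log_plane"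
 shows "has_mderiv (\<lambda>l. H (lg l)) (B l ** H (lg l)) l"
proof -
 have "has_mderiv (\<lambda>l. H (lg l)) (scale_mat (1 / l) (log_system B (lg l) ** H (lg l))) l"
  by (rule has_mderiv_chain[OF mat_odeD[OF assms(1,5)] assms(3)])
 moreover have "scale_mat (1 / l) (log_system B (lg l) ** H (lg l)) = B l ** H (lg l)"
  using assms(2,4) by (simp add: log_system_def mat_eq_iff mat_mult_entry field_simps)
 ultimately show ?thesis by simp
qed

text \<open>In the direction \<open>cis b\<close> the second formal exponential decays, so the
  second column of a canonical solution is the recessive solution there. Its asymptotics hold far
  beyond the half plane of decay, namely off a cone about the opposite direction that shrinks as
  \<open>k\<close> tends to 1. The first column is filled with zeros.\<close>

lemma recessive_column:
 assumes B: "rank1_system s m B" and b: "s * cos b > 0" and k: "0 \<le> k" "k < 1"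
 obtains p K' F where "p > 0"
  "\<And>l. l / cis b \<in> cone_compl k p \<Longrightarrow> 2 < cmod l"
  "\<And>l. l / cis b \<in> cone_compl k p \<Longrightarrow> has_mderiv F (B l ** F l) l"
  "\<And>l. F l $ 1 $ 1 = 0" "\<And>l. F l $ 2 $ 1 = 0"
  "\<And>l. l / cis b \<in> cone_compl k p \<Longrightarrow>
    cmod (F l $ 1 $ 2 * exp (of_real s * l / 4 - m * (Ln (l / cis b) + \<i> * of_real b) / 2)) \<le> K' / cmod l"
  "\<And>l. l / cis b \<in> cone_compl k p \<Longrightarrow>
    cmod (F l $ 2 $ 2 * exp (of_real s * l / 4 - m * (Ln (l / cis b) + \<i> * of_real b) / 2) - 1) \<le> K' / cmod l"
proof -
 obtain K where K: "K \<ge> 0" "\<And>l. 2 < cmod l \<Longrightarrow> cmod (B l $ 1 $ 1 - (of_real s / 4 - m / (2 * l))) \<le> K / (cmod l)\<^sup>2"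
    "\<And>l. 2 < cmod l \<Longrightarrow> cmod (B l $ 1 $ 2) \<le> K / cmod l" "\<And>l. 2 < cmod l \<Longrightarrow> cmod (B l $ 2 $ 1) \<le> K / cmod l"
  and tr: "\<And>l. 1 < cmod l \<Longrightarrow> B l $ 2 $ 2 = - B l $ 1 $ 1" and hB: "mat_holo B {l. 1 < cmod l}"
  using B by (auto simp: rank1_system_def trace_free_def)
 define a where "a = cis b"
 have a: "cmod a = 1" "a \<noteq> 0" by (simp_all add: a_def)
 define e where "e l = B l $ 1 $ 1 - (of_real s / 4 - m / (2 * l))" for l
 define T where "T = {x::complex. cmod x > 2}"
 have hBr: "(\<lambda>x. B (a * x) $ i $ j) holomorphic_on T" for i j
 proof -
  have "(\<lambda>l. B l $ i $ j) holomorphic_on {l. 1 < cmod l}" using hB by (simp add: mat_holo_def)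
  then have "((\<lambda>l. B l $ i $ j) \<circ> (\<lambda>x. a * x)) holomorphic_on T"
   by (intro holomorphic_on_compose_gen[where t = "{l. 1 < cmod l}"] holomorphic_intros) (auto simp: T_def norm_mult a)
  then show ?thesis by (simp add: o_def)
 qed
 \<comment> \<open>With \<open>l = a * x\<close> the column is sought as
   \<open>E * (v / l, w)\<close>, where \<open>E\<close> is the decaying formal exponential. The
   division by \<open>l\<close> makes \<open>be\<close> bounded and \<open>ga\<close> of order
   \<open>1 / |x|^2\<close>, as \<open>cone_compl_system\<close> demands; the rate
   \<open>a * of_real s / 2\<close> is the difference of the two exponents.\<close>
 define al where "al x = a * ((1 - m) / (a * x) + e (a * x))" for x
 define be where "be x = a * (a * x) * B (a * x) $ 1 $ 2" for x
 define ga where "ga x = a * B (a * x) $ 2 $ 1 / (a * x)" for x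
 define de where "de x = - a * e (a * x)" for x
 define K0 where "K0 = cmod (1 - m) + K"
 have K0: "0 \<le> K0" "K \<le> K0" using K(1) by (auto simp: K0_def)
 have pos: "Re (a * of_real s / 2) > 0" using b by (simp add: a_def mult.commute)
 have eb: "cmod (e (a * x)) \<le> K / (cmod x)\<^sup>2" if "cmod x > 2" for x
  using K(2)[of "a * x"] that by (simp add: e_def norm_mult a)
 obtain p v w K' where p: "p > 0" and big: "\<And>x. x \<in> cone_compl k p \<Longrightarrow> cmod x > 2"
  and v: "\<And>x. x \<in> cone_compl k p \<Longrightarrow> (v has_field_derivative (a * of_real s / 2) * v x + (al x * v x + be x * w x)) (at x)"
  and w: "\<And>x. x \<in> cone_compl k p \<Longrightarrow> (w has_field_derivative ga x * v x + de x * w x) (at x)"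
  and vb: "\<And>x. x \<in> cone_compl k p \<Longrightarrow> cmod (v x) \<le> K'" and wb: "\<And>x. x \<in> cone_compl k p \<Longrightarrow> cmod (w x - 1) \<le> K' / cmod x"
 proof (rule cone_compl_system[OF pos k K0(1), of 2 al be ga de])
  show "al holomorphic_on {x. 2 < cmod x}" "be holomorphic_on {x. 2 < cmod x}"
   "ga holomorphic_on {x. 2 < cmod x}" "de holomorphic_on {x. 2 < cmod x}"
   unfolding al_def be_def ga_def de_def e_def T_def[symmetric]
   by (intro holomorphic_intros hBr; auto simp: T_def a)+
  fix x :: complex assume z: "cmod x > 2"
  then have z0: "x \<noteq> 0" by auto
  have "cmod (al x) \<le> cmod (1 - m) / cmod x + cmod (e (a * x))"
   unfolding al_def norm_mult a by (rule order.trans[OF mult_left_mono[OF norm_triangle_ineq]]) (simp_all add: norm_divide norm_mult a)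
  also have "cmod (e (a * x)) \<le> K / (cmod x)\<^sup>2" by (rule eb[OF z])
  also have "K / (cmod x)\<^sup>2 \<le> K / cmod x"
   using z z0 K(1) self_le_power[of "cmod x" 2] by (intro divide_left_mono) auto
  finally show "cmod (al x) \<le> K0 / cmod x" by (simp add: K0_def add_divide_distrib)
  have "cmod (be x) = cmod x * cmod (B (a * x) $ 1 $ 2)" by (simp add: be_def norm_mult a)
  also have "\<dots> \<le> cmod x * (K / cmod x)"
   using K(3)[of "a * x"] z by (intro mult_left_mono) (auto simp: norm_mult a)
  finally show "cmod (be x) \<le> K0" using z0 K0 by simp
  have "cmod (ga x) = cmod (B (a * x) $ 2 $ 1) / cmod x" by (simp add: ga_def norm_mult norm_divide a)
  also have "\<dots> \<le> (K / cmod x) / cmod x"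
   using K(4)[of "a * x"] z by (intro divide_right_mono) (auto simp: norm_mult a)
  also have "\<dots> \<le> K0 / (cmod x)\<^sup>2" using K0 by (simp add: power2_eq_square divide_right_mono)
  finally show "cmod (ga x) \<le> K0 / (cmod x)\<^sup>2" .
  have "cmod (de x) = cmod (e (a * x))" by (simp add: de_def norm_mult a)
  also note eb[OF z]
  also have "K / (cmod x)\<^sup>2 \<le> K0 / (cmod x)\<^sup>2" using K0 by (intro divide_right_mono) auto
  finally show "cmod (de x) \<le> K0 / (cmod x)\<^sup>2" .
 qed (use that in auto)
 define lg where "lg l = Ln (l / cis b) + \<i> * of_real b" for l
 define E where "E l = exp (- of_real s * l / 4 + m * lg l / 2)" for l
 define f1 where "f1 l = E l * (v (l / a) / l)" for l
 define f2 where "f2 l = E l * w (l / a)" for l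
 define F where "F l = mat2 0 (f1 l) 0 (f2 l)" for l
 have EE: "E l * exp (of_real s * l / 4 - m * lg l / 2) = 1" for l
  unfolding E_def by (simp flip: exp_add)
 show ?thesis
 proof (rule that[of p F K'])
  show "p > 0" by (rule p)
  fix l show "F l $ 1 $ 1 = 0" "F l $ 2 $ 1 = 0" by (simp_all add: F_def)
 next
  fix l assume "l / cis b \<in> cone_compl k p"
  then have l: "l / a \<in> cone_compl k p" by (simp add: a_def)
  show l2: "2 < cmod l" using big[OF l] by (simp add: norm_divide a)
  have l0: "l \<noteq> 0" using l2 by auto
  \<comment> \<open>The cut of \<open>Ln\<close> lies inside the removed cone because
    \<open>k < 1\<close>.\<close>
  have nr: "l / a \<notin> \<real>\<^sub>\<le>\<^sub>0"
  proof
   assume "l / a \<in> \<real>\<^sub>\<le>\<^sub>0"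
   then obtain r where r: "r \<le> 0" "l / a = of_real r" by (auto elim!: nonpos_Reals_cases)
   have "k * cmod (of_real r - of_real p) + Re (of_real r - of_real p) > 0"
    using l unfolding r(2) by (simp add: cone_compl_def)
   moreover have "cmod (of_real r - of_real p :: complex) = p - r"
    using r p norm_of_real[of "r - p", where ?'a = complex] by simp
   ultimately have "k * (p - r) > p - r" by simp
   moreover have "k * (p - r) \<le> 1 * (p - r)" using k r p by (intro mult_right_mono) auto
   ultimately show False by simp
  qed
  have dl: "(lg has_field_derivative 1 / l) (at l)"
   unfolding lg_def a_def[symmetric] using nr l0 a(2) by (auto intro!: derivative_eq_intros simp: field_simps)
  have dE: "(E has_field_derivative E l * (- of_real s / 4 + m / (2 * l))) (at l)"
  proof -
   have "((\<lambda>l. - of_real s * l / 4 + m * lg l / 2) has_field_derivative (- of_real s / 4 + m * (1 / l) / 2)) (at l)"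
    by (auto intro!: derivative_eq_intros dl)
   from DERIV_fun_exp[OF this] show ?thesis unfolding E_def by (simp add: mult.commute)
  qed
  have dv: "((\<lambda>l. v (l / a)) has_field_derivative (of_real s / 2 * v (l / a) + (((1 - m) / l + e l) * v (l / a) + l * B l $ 1 $ 2 * w (l / a)))) (at l)"
  proof -
   have "((\<lambda>l. v (l / a)) has_field_derivative ((a * of_real s / 2) * v (l / a) + (al (l / a) * v (l / a) + be (l / a) * w (l / a))) * (1 / a)) (at l)"
    by (rule DERIV_chain2[where f = v and g = "\<lambda>l. l / a", OF v[OF l]]) (auto intro!: derivative_eq_intros simp: a)
   then show ?thesis by (rule DERIV_cong) (use a(2) l0 in \<open>simp add: al_def be_def field_simps\<close>)
  qed
  have dw: "((\<lambda>l. w (l / a)) has_field_derivative (B l $ 2 $ 1 / l * v (l / a) - e l * w (l / a))) (at l)"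
  proof -
   have "((\<lambda>l. w (l / a)) has_field_derivative (ga (l / a) * v (l / a) + de (l / a) * w (l / a)) * (1 / a)) (at l)"
    by (rule DERIV_chain2[where f = w and g = "\<lambda>l. l / a", OF w[OF l]]) (auto intro!: derivative_eq_intros simp: a)
   then show ?thesis by (rule DERIV_cong) (use a(2) l0 in \<open>simp add: ga_def de_def field_simps\<close>)
  qed
  have B11: "B l $ 1 $ 1 = of_real s / 4 - m / (2 * l) + e l" by (simp add: e_def)
  have B22: "B l $ 2 $ 2 = - (of_real s / 4 - m / (2 * l) + e l)" using tr[of l] l2 B11 by simp
  have d1: "(f1 has_field_derivative (B l $ 1 $ 1 * f1 l + B l $ 1 $ 2 * f2 l)) (at l)"
   unfolding f1_def
   by (rule DERIV_cong[OF DERIV_mult[OF dE DERIV_divide[OF dv DERIV_ident l0]]])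
     (use l0 in \<open>simp add: B11 f2_def field_simps\<close>)
  have d2: "(f2 has_field_derivative (B l $ 2 $ 1 * f1 l + B l $ 2 $ 2 * f2 l)) (at l)"
   unfolding f2_def by (rule DERIV_cong[OF DERIV_mult[OF dE dw]]) (use l0 in \<open>simp add: B22 f1_def field_simps\<close>)
  show "has_mderiv F (B l ** F l) l"
   unfolding has_mderiv_iff mat_mult_entry F_def mat2_entry using d1 d2 by simp
  have nw: "cmod (l / a) = cmod l" by (simp add: norm_divide a)
  have "F l $ 1 $ 2 * exp (of_real s * l / 4 - m * lg l / 2) = v (l / a) / l * (E l * exp (of_real s * l / 4 - m * lg l / 2))"
   by (simp only: F_def mat2_entry f1_def mult_ac)
  then show "cmod (F l $ 1 $ 2 * exp (of_real s * l / 4 - m * (Ln (l / cis b) + \<i> * of_real b) / 2)) \<le> K' / cmod l"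
   unfolding EE unfolding lg_def using vb[OF l] by (simp add: norm_divide divide_right_mono)
  have "F l $ 2 $ 2 * exp (of_real s * l / 4 - m * lg l / 2) = w (l / a) * (E l * exp (of_real s * l / 4 - m * lg l / 2))"
   by (simp only: F_def mat2_entry f2_def mult_ac)
  then show "cmod (F l $ 2 $ 2 * exp (of_real s * l / 4 - m * (Ln (l / cis b) + \<i> * of_real b) / 2) - 1) \<le> K' / cmod l"
   unfolding EE unfolding lg_def using wb[OF l] by (simp add: nw)
 qed
qed

text \<open>For arguments within \<open>pi - 2 * d\<close> of \<open>b\<close> the real part is at
  least \<open>- cos (2 * d)\<close> times the modulus, while the cone only asks for
  \<open>- cos d\<close>. The positive difference \<open>a\<close> absorbs the shift of the vertex
  once the modulus is large.\<close>

lemma exp_in_cone_compl: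
 assumes d: "0 < d" "d < pi / 2"
 obtains R where "R > 0" "\<And>h. R \<le> Re h \<Longrightarrow> \<bar>Im h - b\<bar> \<le> pi - 2 * d \<Longrightarrow> exp h / cis b \<in> cone_compl (cos d) r"
proof -
 define a where "a = cos d - cos (2 * d)"
 have a: "a > 0" unfolding a_def using cos_monotone_0_pi[of d "2 * d"] d by simp
 define R where "R = max 1 (ln ((2 * \<bar>r\<bar> + 1) / a))"
 have "exp h / cis b \<in> cone_compl (cos d) r" if e: "R \<le> Re h" "\<bar>Im h - b\<bar> \<le> pi - 2 * d" for h
 proof -
  define z where "z = exp h / cis b"
  define x where "x = exp (Re h)"
  have "(2 * \<bar>r\<bar> + 1) / a \<le> x"
  proof -
   have "ln ((2 * \<bar>r\<bar> + 1) / a) \<le> Re h" using e(1) by (simp add: R_def)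
   then have "exp (ln ((2 * \<bar>r\<bar> + 1) / a)) \<le> x" by (simp add: x_def)
   then show ?thesis using a by simp
  qed
  then have x: "2 * \<bar>r\<bar> + 1 \<le> a * x" using a by (simp add: field_simps)
  have nz: "cmod z = x" by (simp add: z_def x_def norm_divide)
  have zz: "z = of_real x * cis (Im h - b)"
   unfolding z_def x_def exp_eq_polar[of h] by (simp add: cis_divide[symmetric])
  have "cos (pi - 2 * d) \<le> cos \<bar>Im h - b\<bar>"
   using e(2) d by (intro cos_monotone_0_pi_le) auto
  then have "- cos (2 * d) \<le> cos (Im h - b)" by (simp add: cos_abs_real)
  then have "x * (- cos (2 * d)) \<le> x * cos (Im h - b)" by (intro mult_left_mono) (auto simp: x_def)
  then have re: "Re z \<ge> - cos (2 * d) * x" by (simp add: zz mult.commute)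
  have "x - \<bar>r\<bar> \<le> cmod (z - of_real r)" using norm_triangle_ineq2[of z "of_real r"] by (simp add: nz)
  moreover have c: "0 \<le> cos d" "cos d \<le> 1" using d by (auto intro!: cos_ge_zero)
  ultimately have "cos d * (x - \<bar>r\<bar>) \<le> cos d * cmod (z - of_real r)" by (intro mult_left_mono)
  moreover have "cos d * \<bar>r\<bar> \<le> 1 * \<bar>r\<bar>" using c by (intro mult_right_mono) auto
  ultimately have "cos d * cmod (z - of_real r) + Re (z - of_real r) \<ge> a * x - 2 * \<bar>r\<bar>"
   using re unfolding a_def by (simp add: algebra_simps)
  then show ?thesis using x unfolding cone_compl_def z_def[symmetric] mem_Collect_eq by linarith
 qed
 then show ?thesis using that[of R] by (simp add: R_def)
qed

text \<open>The column \<open>C\<close> consists of the connection coefficients of the recessive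
  solution with respect to a fundamental matrix on the whole of \<open>log_plane\<close>; it
  continues that solution beyond the sector in which its asymptotics are known, and allows columns
  from different sectors to be combined.\<close>

lemma recessive_column_log:
 assumes B: "rank1_system s m B" and b: "s * cos b > 0" and d: "0 < d" "d < pi / 2"
  and H: "mat_ode (log_system B) H log_plane" "\<And>h. h \<in> log_plane \<Longrightarrow> det (H h) = 1"
 obtains C :: "complex^2^2" and K R where "C $ 1 $ 1 = 0" "C $ 2 $ 1 = 0"
  "\<And>h. R \<le> Re h \<Longrightarrow> \<bar>Im h - b\<bar> \<le> pi - 2 * d \<Longrightarrow>
    cmod ((H h ** C) $ 1 $ 2 * exp (of_real s * exp h / 4 - m * h / 2)) \<le> K * exp (- Re h)"
  "\<And>h. R \<le> Re h \<Longrightarrow> \<bar>Im h - b\<bar> \<le> pi - 2 * d \<Longrightarrow>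
    cmod ((H h ** C) $ 2 $ 2 * exp (of_real s * exp h / 4 - m * h / 2) - 1) \<le> K * exp (- Re h)"
proof -
 have a: "0 \<le> cos d" "cos d < 1"
  using d cos_monotone_0_pi[of 0 d] by (auto intro!: cos_ge_zero)
 obtain p K' F where p: "p > 0"
  and big: "\<And>l. l / cis b \<in> cone_compl (cos d) p \<Longrightarrow> 2 < cmod l"
  and F: "\<And>l. l / cis b \<in> cone_compl (cos d) p \<Longrightarrow> has_mderiv F (B l ** F l) l"
  and F0: "\<And>l. F l $ 1 $ 1 = 0" "\<And>l. F l $ 2 $ 1 = 0"
  and F1: "\<And>l. l / cis b \<in> cone_compl (cos d) p \<Longrightarrow>
    cmod (F l $ 1 $ 2 * exp (of_real s * l / 4 - m * (Ln (l / cis b) + \<i> * of_real b) / 2)) \<le> K' / cmod l"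
  and F2: "\<And>l. l / cis b \<in> cone_compl (cos d) p \<Longrightarrow>
    cmod (F l $ 2 $ 2 * exp (of_real s * l / 4 - m * (Ln (l / cis b) + \<i> * of_real b) / 2) - 1) \<le> K' / cmod l"
  using recessive_column[OF B b a] by metis
 define D where "D = {l. l / cis b \<in> cone_compl (cos d) p}"
 have D_eq: "D = (\<lambda>z. cis b * z) ` cone_compl (cos d) p"
  unfolding D_def by (auto simp: image_iff intro!: bexI[of _ "l / cis b" for l])
 have "open D" unfolding D_def using open_vimage[OF open_cone_compl[of "cos d" p], of "\<lambda>l. l / cis b"]
  by (simp add: vimage_def continuous_intros)
 have "connected D" unfolding D_eq
  by (intro connected_continuous_image continuous_intros connected_cone_compl a p)
 define l0 where "l0 = cis b * of_real (p + 1)"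
 have l0: "l0 \<in> D" unfolding D_eq l0_def using cone_compl_base[OF a p] by blast
 define lg where "lg l = Ln (l / cis b) + \<i> * of_real b" for l
 have exp_lg: "exp (lg l) = l" if "l \<noteq> 0" for l
  unfolding lg_def exp_add using that by (simp add: cis_conv_exp[symmetric])
 have lgH: "lg l \<in> log_plane" if "l \<in> D" for l
 proof -
  have l2: "2 < cmod l" using big that by (simp add: D_def)
  then have "l / cis b \<noteq> 0" by auto
  then have "Re (lg l) = ln (cmod l)" unfolding lg_def using Re_Ln[of "l / cis b"] by (simp add: norm_divide)
  then show ?thesis using l2 ln_gt_zero[of "cmod l"] by (simp add: log_plane_def)
 qed
 have dlg: "(lg has_field_derivative 1 / l) (at l)" if "l \<in> D" for l
 proof -
  have l: "l / cis b \<in> cone_compl (cos d) p" using that by (simp add: D_def)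
  have l0: "l \<noteq> 0" using big[OF l] by auto
  have nr: "l / cis b \<notin> \<real>\<^sub>\<le>\<^sub>0"
  proof
   assume "l / cis b \<in> \<real>\<^sub>\<le>\<^sub>0"
   then obtain r where r: "r \<le> 0" "l / cis b = of_real r" by (auto elim!: nonpos_Reals_cases)
   have "cos d * cmod (of_real r - of_real p) + Re (of_real r - of_real p) > 0"
    using l unfolding r(2) by (simp add: cone_compl_def)
   moreover have "cmod (of_real r - of_real p :: complex) = p - r"
    using r p norm_of_real[of "r - p", where ?'a = complex] by simp
   ultimately have "cos d * (p - r) > p - r" by simp
   moreover have "cos d * (p - r) \<le> 1 * (p - r)" using a r p by (intro mult_right_mono) auto
   ultimately show False by simp
  qed
  show ?thesis unfolding lg_def using nr l0 by (auto intro!: derivative_eq_intros simp: field_simps)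
 qed
 have odeF: "mat_ode B F D" using F by (simp add: mat_ode_def D_def)
 have odeP: "mat_ode B (\<lambda>l. H (lg l)) D"
  unfolding mat_ode_def
 proof
  fix l assume l: "l \<in> D"
  have "l \<noteq> 0" using big[of l] l by (auto simp: D_def)
  then show "has_mderiv (\<lambda>l. H (lg l)) (B l ** H (lg l)) l"
   using mat_ode_log_compose[OF H(1) _ dlg[OF l] exp_lg lgH[OF l]] by simp
 qed
 have tf: "trace_free B D"
 proof -
  have "trace_free B {l. 1 < cmod l}" using B by (simp add: rank1_system_def)
  then show ?thesis using big by (force simp: trace_free_def D_def)
 qed
 define C where "C = adj2 (H (lg l0)) ** F l0"
 have FC: "F l = H (lg l) ** C" if "l \<in> D" for l
  unfolding C_def by (rule mat_ode_unique[OF odeP odeF tf \<open>open D\<close> \<open>connected D\<close> l0 H(2)[OF lgH[OF l0]] that])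
 obtain R where R: "R > 0" "\<And>h. R \<le> Re h \<Longrightarrow> \<bar>Im h - b\<bar> \<le> pi - 2 * d \<Longrightarrow> exp h / cis b \<in> cone_compl (cos d) p"
  using exp_in_cone_compl[OF d] by blast
 have lgexp: "lg (exp h) = h" if "\<bar>Im h - b\<bar> \<le> pi - 2 * d" for h
 proof -
  have "exp h / cis b = exp (h - \<i> * of_real b)" by (simp add: exp_diff cis_conv_exp)
  moreover have "Ln (exp (h - \<i> * of_real b)) = h - \<i> * of_real b"
   by (rule Ln_exp) (use that d in auto)
  ultimately show ?thesis by (simp add: lg_def)
 qed
 show ?thesis
 proof (rule that[of C R K'])
  show "C $ 1 $ 1 = 0" "C $ 2 $ 1 = 0" by (simp_all add: C_def mat_mult_entry F0)
  fix h assume e: "R \<le> Re h" "\<bar>Im h - b\<bar> \<le> pi - 2 * d"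
  have c: "exp h / cis b \<in> cone_compl (cos d) p" by (rule R(2)[OF e])
  then have "exp h \<in> D" by (simp add: D_def)
  then have FP: "F (exp h) = H h ** C" using FC lgexp[OF e(2)] by simp
  have k: "K' / cmod (exp h) = K' * exp (- Re h)" by (simp add: exp_minus divide_inverse)
  show "cmod ((H h ** C) $ 1 $ 2 * exp (of_real s * exp h / 4 - m * h / 2)) \<le> K' * exp (- Re h)"
   using F1[OF c] unfolding k FP lg_def[symmetric] lgexp[OF e(2)] .
  show "cmod ((H h ** C) $ 2 $ 2 * exp (of_real s * exp h / 4 - m * h / 2) - 1) \<le> K' * exp (- Re h)"
   using F2[OF c] unfolding k FP lg_def[symmetric] lgexp[OF e(2)] .
 qed
qed

section \<open>Canonical solutions\<close>

text \<open>The defining asymptotics in the coordinate \<open>h = ln l\<close>, where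
  \<open>exp (- Re h)\<close> is \<open>1 / |l|\<close>. The aperture \<open>d\<close> is fixed
  because the constants \<open>K\<close> and \<open>R\<close> may depend on it.\<close>

definition canonical_asymp :: "real \<Rightarrow> complex \<Rightarrow> (complex \<Rightarrow> complex^2^2) \<Rightarrow> real \<Rightarrow> bool" where
 "canonical_asymp t k F d \<longleftrightarrow> (\<exists>K R. \<forall>h. R \<le> Re h \<and> \<bar>Im h - pi / 2\<bar> \<le> pi - d \<longrightarrow>
   (\<forall>i j. cmod ((F h ** exp_sigma3 (- ((of_real t * exp h - 2 * k * h) / 4)) - mat 1) $ i $ j) \<le> K * exp (- Re h)))"

lemma canonical_asympE:
 assumes "canonical_asymp t k F d"
 obtains K R where "K > 0" "R > 0" "\<And>h i j. R \<le> Re h \<Longrightarrow> \<bar>Im h - pi / 2\<bar> \<le> pi - d \<Longrightarrow>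
   cmod ((F h ** exp_sigma3 (- ((of_real t * exp h - 2 * k * h) / 4)) - mat 1) $ i $ j) \<le> K * exp (- Re h)"
proof -
 obtain K R where KR: "\<And>h i j. R \<le> Re h \<Longrightarrow> \<bar>Im h - pi / 2\<bar> \<le> pi - d \<Longrightarrow>
   cmod ((F h ** exp_sigma3 (- ((of_real t * exp h - 2 * k * h) / 4)) - mat 1) $ i $ j) \<le> K * exp (- Re h)"
  using assms unfolding canonical_asymp_def by blast
 show ?thesis
 proof (rule that[of "max K 1" "max R 1"])
  fix h and i j :: 2
  assume "max R 1 \<le> Re h" "\<bar>Im h - pi / 2\<bar> \<le> pi - d"
  then have "cmod ((F h ** exp_sigma3 (- ((of_real t * exp h - 2 * k * h) / 4)) - mat 1) $ i $ j) \<le> K * exp (- Re h)"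
   by (intro KR) auto
  also have "\<dots> \<le> max K 1 * exp (- Re h)" by (intro mult_right_mono) auto
  finally show "cmod ((F h ** exp_sigma3 (- ((of_real t * exp h - 2 * k * h) / 4)) - mat 1) $ i $ j) \<le> max K 1 * exp (- Re h)" .
 qed auto
qed

lemma canonical_asymp_mono: "canonical_asymp t k F d \<Longrightarrow> d \<le> d' \<Longrightarrow> canonical_asymp t k F d'"
 unfolding canonical_asymp_def by (meson diff_left_mono order.trans)

lemma exp_sigma3_entry [simp]:
 "exp_sigma3 w $ 1 $ 1 = exp w" "exp_sigma3 w $ 1 $ 2 = 0" "exp_sigma3 w $ 2 $ 1 = 0" "exp_sigma3 w $ 2 $ 2 = exp (- w)"
 by (simp_all add: exp_sigma3_def)

lemma exp_sigma3_add: "exp_sigma3 a ** exp_sigma3 b = exp_sigma3 (a + b)"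
 by (simp add: mat_eq_iff mat_mult_entry exp_add exp_minus exp_diff divide_inverse)

lemma exp_sigma3_0 [simp]: "exp_sigma3 0 = mat 1"
 by (simp add: mat_eq_iff)

lemma det_exp_sigma3 [simp]: "det (exp_sigma3 w) = 1"
 by (simp add: det_2 exp_minus)

text \<open>Near the ray of argument \<open>pi / 2\<close> the second column is recessive for
  slightly smaller arguments and the first one for slightly larger ones. Each is built in a
  direction tilted by \<open>d\<close> and is controlled within \<open>pi - 2 * d\<close> of it; the
  common sector reaches \<open>pi - 3 * d\<close> to both sides of \<open>pi / 2\<close>.\<close>

lemma canonical_solution_log_exists_aux:
 assumes B: "rank1_system t b B" and t: "t > 0" and d: "0 < d" "d < pi / 4"
 obtains F where "mat_ode (log_system B) F log_plane" "canonical_asymp t b F (3 * d)"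
proof -
 have hB: "mat_holo B {l. 1 < cmod l}" "trace_free B {l. 1 < cmod l}" using B by (auto simp: rank1_system_def)
 obtain H where H: "mat_ode (log_system B) H log_plane" "\<And>h. h \<in> log_plane \<Longrightarrow> det (H h) = 1"
  using mat_ode_fundamental[OF log_plane(1,4) log_system_holo[OF hB(1)] log_system_trace_free[OF hB(2)]] by blast
 have c2: "t * cos (pi / 2 - d) > 0" using t d by (simp add: cos_diff sin_gt_zero)
 have c1: "- t * cos (pi / 2 + d) > 0" using t d by (simp add: cos_add sin_gt_zero)
 have d2: "d < pi / 2" using d by simp
 obtain C2 :: "complex^2^2" and K2 R2 where C2: "C2 $ 1 $ 1 = 0" "C2 $ 2 $ 1 = 0"
  and b2: "\<And>h. R2 \<le> Re h \<Longrightarrow> \<bar>Im h - (pi / 2 - d)\<bar> \<le> pi - 2 * d \<Longrightarrow>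
    cmod ((H h ** C2) $ 1 $ 2 * exp (of_real t * exp h / 4 - b * h / 2)) \<le> K2 * exp (- Re h)"
  "\<And>h. R2 \<le> Re h \<Longrightarrow> \<bar>Im h - (pi / 2 - d)\<bar> \<le> pi - 2 * d \<Longrightarrow>
    cmod ((H h ** C2) $ 2 $ 2 * exp (of_real t * exp h / 4 - b * h / 2) - 1) \<le> K2 * exp (- Re h)"
  using recessive_column_log[OF B c2 d(1) d2 H] by metis
 have Hs: "mat_ode (log_system (\<lambda>l. swap2 (B l))) (\<lambda>h. swap2 (H h)) log_plane"
  unfolding mat_ode_def
 proof
  fix h assume "h \<in> log_plane"
  from has_mderiv_swap2[OF mat_odeD[OF H(1) this]]
  show "has_mderiv (\<lambda>h. swap2 (H h)) (log_system (\<lambda>l. swap2 (B l)) h ** swap2 (H h)) h"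
   by (rule back_subst[where P = "\<lambda>D. has_mderiv _ D _"]) (simp add: mat_eq_iff mat_mult_entry log_system_def algebra_simps)
 qed
 obtain C1 :: "complex^2^2" and K1 R1 where C1: "C1 $ 1 $ 1 = 0" "C1 $ 2 $ 1 = 0"
  and b1: "\<And>h. R1 \<le> Re h \<Longrightarrow> \<bar>Im h - (pi / 2 + d)\<bar> \<le> pi - 2 * d \<Longrightarrow>
    cmod ((swap2 (H h) ** C1) $ 1 $ 2 * exp (of_real (- t) * exp h / 4 - (- b) * h / 2)) \<le> K1 * exp (- Re h)"
  "\<And>h. R1 \<le> Re h \<Longrightarrow> \<bar>Im h - (pi / 2 + d)\<bar> \<le> pi - 2 * d \<Longrightarrow>
    cmod ((swap2 (H h) ** C1) $ 2 $ 2 * exp (of_real (- t) * exp h / 4 - (- b) * h / 2) - 1) \<le> K1 * exp (- Re h)"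
  using recessive_column_log[OF rank1_system_swap2[OF B] c1 d(1) d2 Hs] H(2) by (metis det_swap2)
 \<comment> \<open>\<open>swap2 C1\<close> has only a first column and \<open>C2\<close> only a
   second one, so the sum juxtaposes the two recessive solutions.\<close>
 define F where "F h = H h ** (swap2 C1 + C2)" for h
 have ent: "F h $ 1 $ 1 = (swap2 (H h) ** C1) $ 2 $ 2" "F h $ 2 $ 1 = (swap2 (H h) ** C1) $ 1 $ 2"
  "F h $ 1 $ 2 = (H h ** C2) $ 1 $ 2" "F h $ 2 $ 2 = (H h ** C2) $ 2 $ 2" for h
  by (simp_all add: F_def mat_mult_entry C1 C2 algebra_simps)
 have ode: "mat_ode (log_system B) F log_plane" unfolding F_def by (rule mat_ode_mult_const[OF H(1)])
 have "canonical_asymp t b F (3 * d)"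
  unfolding canonical_asymp_def
 proof (rule exI[of _ "max K1 K2"], rule exI[of _ "max R1 R2"], intro allI impI)
  fix h and i j :: 2
  assume e: "max R1 R2 \<le> Re h \<and> \<bar>Im h - pi / 2\<bar> \<le> pi - 3 * d"
  let ?G = "F h ** exp_sigma3 (- ((of_real t * exp h - 2 * b * h) / 4)) - mat 1"
  have e1: "R1 \<le> Re h" "\<bar>Im h - (pi / 2 + d)\<bar> \<le> pi - 2 * d"
   and e2: "R2 \<le> Re h" "\<bar>Im h - (pi / 2 - d)\<bar> \<le> pi - 2 * d" using e d by auto
  have x: "- ((of_real t * exp h - 2 * b * h) / 4) = of_real (- t) * exp h / 4 - (- b) * h / 2"
   "- (of_real (- t) * exp h / 4 - (- b) * h / 2) = of_real t * exp h / 4 - b * h / 2" by (simp_all add: field_simps)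
  have k: "K1 * exp (- Re h) \<le> max K1 K2 * exp (- Re h)" "K2 * exp (- Re h) \<le> max K1 K2 * exp (- Re h)"
   by (auto intro!: mult_right_mono)
  have G: "?G $ 1 $ 1 = (swap2 (H h) ** C1) $ 2 $ 2 * exp (of_real (- t) * exp h / 4 - (- b) * h / 2) - 1"
   "?G $ 2 $ 1 = (swap2 (H h) ** C1) $ 1 $ 2 * exp (of_real (- t) * exp h / 4 - (- b) * h / 2)"
   "?G $ 1 $ 2 = (H h ** C2) $ 1 $ 2 * exp (of_real t * exp h / 4 - b * h / 2)"
   "?G $ 2 $ 2 = (H h ** C2) $ 2 $ 2 * exp (of_real t * exp h / 4 - b * h / 2) - 1"
   unfolding vector_minus_component mat_mult_entry[of "F h"] exp_sigma3_entry mat_1_entry ent x by simp_all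
  have "cmod (?G $ 1 $ 1) \<le> max K1 K2 * exp (- Re h)" unfolding G by (rule order.trans[OF b1(2)[OF e1] k(1)])
  moreover have "cmod (?G $ 2 $ 1) \<le> max K1 K2 * exp (- Re h)" unfolding G by (rule order.trans[OF b1(1)[OF e1] k(1)])
  moreover have "cmod (?G $ 1 $ 2) \<le> max K1 K2 * exp (- Re h)" unfolding G by (rule order.trans[OF b2(1)[OF e2] k(2)])
  moreover have "cmod (?G $ 2 $ 2) \<le> max K1 K2 * exp (- Re h)" unfolding G by (rule order.trans[OF b2(2)[OF e2] k(2)])
  ultimately show "cmod (?G $ i $ j) \<le> max K1 K2 * exp (- Re h)" using exhaust_2[of i] exhaust_2[of j] by metis
 qed
 then show ?thesis using that ode by blast
qed

section \<open>Decay along rays and uniqueness of canonical solutions\<close>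

text \<open>Since the modulus of the variable is \<open>exp r\<close>, this is ordinary exponential
  decay along a ray of argument \<open>c\<close>. The rate is left open so that the notion survives
  multiplication by factors of smaller exponential growth.\<close>

definition decays_along :: "(complex \<Rightarrow> complex^2^2) \<Rightarrow> 2 \<Rightarrow> real \<Rightarrow> bool" where
 "decays_along F j c \<longleftrightarrow> (\<exists>k>0. \<exists>C R. \<forall>r\<ge>R. \<forall>i. cmod (F (Complex r c) $ i $ j) \<le> C * exp (- (k * exp r)))"

lemma decays_alongE:
 assumes "decays_along F j c"
 obtains k C R where "k > 0" "C > 0" "R > 0" "\<And>r i. r \<ge> R \<Longrightarrow> cmod (F (Complex r c) $ i $ j) \<le> C * exp (- (k * exp r))"
proof -
 obtain k C R where k: "k > 0" and b: "\<And>r i. r \<ge> R \<Longrightarrow> cmod (F (Complex r c) $ i $ j) \<le> C * exp (- (k * exp r))"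
  using assms unfolding decays_along_def by blast
 show ?thesis
 proof (rule that[of k "max C 1" "max R 1"])
  fix r i assume "max R 1 \<le> r"
  then have "cmod (F (Complex r c) $ i $ j) \<le> C * exp (- (k * exp r))" by (intro b) auto
  also have "\<dots> \<le> max C 1 * exp (- (k * exp r))" by (intro mult_right_mono) auto
  finally show "cmod (F (Complex r c) $ i $ j) \<le> max C 1 * exp (- (k * exp r))" .
 qed (use k in auto)
qed

lemma linear_le_exp:
 fixes a :: real
 assumes "a > 0" "b \<ge> 0"
 obtains C where "\<And>r. b * r \<le> a * exp r + C"
proof -
 define e where "e = a / (b + 1)"
 have e: "e > 0" using assms by (simp add: e_def)
 have "b * r \<le> a * exp r + b * (- ln e)" for r
 proof -
  have "r + ln e \<le> exp (r + ln e)" using exp_ge_add_one_self[of "r + ln e"] by linarith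
  then have "r \<le> e * exp r - ln e" using e by (simp add: exp_add mult.commute)
  then have "b * r \<le> b * (e * exp r - ln e)" using assms by (intro mult_left_mono)
  also have "\<dots> = (b * e) * exp r + b * (- ln e)" by (simp add: algebra_simps)
  also have "\<dots> \<le> a * exp r + b * (- ln e)"
  proof -
   have "b * e \<le> a" using assms by (simp add: e_def field_simps)
   then show ?thesis using mult_right_mono[of "b * e" a "exp r"] by simp
  qed
  finally show ?thesis .
 qed
 then show ?thesis using that by blast
qed

lemma recessive_factor_bound:
 assumes "s * cos c > 0"
 obtains k C where "k > 0" "\<And>r. r \<ge> 0 \<Longrightarrow> cmod (exp (- ((of_real s * exp (Complex r c) - 2 * b * Complex r c) / 4))) \<le> C * exp (- (k * exp r))"
proof -
 \<comment> \<open>Half of the rate \<open>s * cos c / 4\<close>. The other half absorbs the power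
   of the variable, whose logarithm is only linear in \<open>r\<close>.\<close>
 define k where "k = s * cos c / 8"
 have k: "k > 0" using assms by (simp add: k_def)
 obtain C where C: "\<And>r. cmod b / 2 * r \<le> k * exp r + C"
  using linear_le_exp[of k "cmod b / 2"] k by auto
 have "cmod (exp (- ((of_real s * exp (Complex r c) - 2 * b * Complex r c) / 4))) \<le> exp (C + cmod b / 2 * \<bar>c\<bar>) * exp (- (k * exp r))"
  if r: "r \<ge> 0" for r
 proof -
  have "Re (b * Complex r c) \<le> cmod b * (r + \<bar>c\<bar>)"
  proof -
   have "Re (b * Complex r c) \<le> cmod b * cmod (Complex r c)"
    using complex_Re_le_cmod[of "b * Complex r c"] by (simp add: norm_mult)
   also have "\<dots> \<le> cmod b * (r + \<bar>c\<bar>)"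
    using cmod_le[of "Complex r c"] r by (intro mult_left_mono) auto
   finally show ?thesis .
  qed
  then have "Re (- ((of_real s * exp (Complex r c) - 2 * b * Complex r c) / 4)) \<le> - 2 * k * exp r + cmod b * (r + \<bar>c\<bar>) / 2"
   by (simp add: k_def Re_exp field_simps del: Re_complex_div_lt_0)
  also have "\<dots> \<le> (C + cmod b / 2 * \<bar>c\<bar>) + - (k * exp r)" using C[of r] by (simp add: field_simps)
  finally show ?thesis unfolding norm_exp_eq_Re exp_add[symmetric] by simp
 qed
 then show ?thesis using that k by blast
qed

lemma canonical_asymp_decays:
 assumes "canonical_asymp t m F (pi / 2)" "t > 0"
 shows "0 < c \<Longrightarrow> c < pi / 2 \<Longrightarrow> decays_along F 2 c" "pi / 2 < c \<Longrightarrow> c < pi \<Longrightarrow> decays_along F 1 c"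
proof -
 define w where "w h = (of_real t * exp h - 2 * m * h) / 4" for h
 obtain K R where K: "K > 0" "R > 0" "\<And>h i j. R \<le> Re h \<Longrightarrow> \<bar>Im h - pi / 2\<bar> \<le> pi - pi / 2 \<Longrightarrow>
   cmod ((F h ** exp_sigma3 (- w h) - mat 1) $ i $ j) \<le> K * exp (- Re h)"
  using canonical_asympE[OF assms(1)] unfolding w_def[symmetric] by blast
 have bd: "cmod ((F h ** exp_sigma3 (- w h)) $ i $ j) \<le> K + 1"
  if "R \<le> Re h" "\<bar>Im h - pi / 2\<bar> \<le> pi - pi / 2" for h i j
 proof -
  have "cmod ((F h ** exp_sigma3 (- w h)) $ i $ j) \<le> cmod ((F h ** exp_sigma3 (- w h) - mat 1) $ i $ j) + cmod ((mat 1 :: complex^2^2) $ i $ j)"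
   using norm_triangle_ineq[of "(F h ** exp_sigma3 (- w h) - mat 1) $ i $ j" "(mat 1 :: complex^2^2) $ i $ j"] by simp
  also have "cmod ((mat 1 :: complex^2^2) $ i $ j) \<le> 1" by (simp add: mat_def)
  also have "cmod ((F h ** exp_sigma3 (- w h) - mat 1) $ i $ j) \<le> K * exp (- Re h)" by (rule K(3)[OF that])
  also have "K * exp (- Re h) \<le> K * 1" using K that by (intro mult_left_mono) auto
  finally show ?thesis by simp
 qed
 have e1: "F h $ i $ 1 = (F h ** exp_sigma3 (- w h)) $ i $ 1 * exp (w h)" for h i
  by (simp add: mat_mult_entry exp_minus)
 have e2: "F h $ i $ 2 = (F h ** exp_sigma3 (- w h)) $ i $ 2 * exp (- w h)" for h i
  by (simp add: mat_mult_entry exp_minus)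
 { assume c: "0 < c" "c < pi / 2"
  have "t * cos c > 0" using assms(2) c by (intro mult_pos_pos cos_gt_zero_pi) auto
  from recessive_factor_bound[OF this, of m] obtain k C where k: "k > 0"
   and C: "\<And>r. r \<ge> 0 \<Longrightarrow> cmod (exp (- w (Complex r c))) \<le> C * exp (- (k * exp r))"
   unfolding w_def by blast
  have "cmod (F (Complex r c) $ i $ 2) \<le> ((K + 1) * C) * exp (- (k * exp r))" if "R \<le> r" for r i
  proof -
   have "cmod (F (Complex r c) $ i $ 2) \<le> (K + 1) * (C * exp (- (k * exp r)))"
    unfolding e2[of "Complex r c"] norm_mult using K(1,2) that c by (intro mult_mono bd C) (auto simp: abs_if)
   then show ?thesis by (simp add: mult_ac)
  qed
  then show "decays_along F 2 c" unfolding decays_along_def using k by blast }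
 { assume c: "pi / 2 < c" "c < pi"
  have "cos c < 0" using cos_gt_zero_pi[of "pi - c"] c by simp
  then have "(- t) * cos c > 0" using assms(2) by (simp add: mult_pos_neg)
  from recessive_factor_bound[OF this, of "- m"] obtain k C where k: "k > 0"
   and C: "\<And>r. r \<ge> 0 \<Longrightarrow> cmod (exp (w (Complex r c))) \<le> C * exp (- (k * exp r))"
  proof -
   assume a: "\<And>k C. 0 < k \<Longrightarrow> (\<And>r. 0 \<le> r \<Longrightarrow> cmod (exp (w (Complex r c))) \<le> C * exp (- (k * exp r))) \<Longrightarrow> thesis"
    and b: "\<And>thesis. (\<And>k C. 0 < k \<Longrightarrow> (\<And>r. 0 \<le> r \<Longrightarrow> cmod (exp (- ((complex_of_real (- t) * exp (Complex r c) - 2 * - m * Complex r c) / 4))) \<le> C * exp (- (k * exp r))) \<Longrightarrow> thesis) \<Longrightarrow> thesis"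
   have x: "- ((complex_of_real (- t) * exp (Complex r c) - 2 * - m * Complex r c) / 4) = w (Complex r c)" for r
    by (simp add: w_def field_simps)
   show thesis using b a unfolding x by blast
  qed
  have "cmod (F (Complex r c) $ i $ 1) \<le> ((K + 1) * C) * exp (- (k * exp r))" if "R \<le> r" for r i
  proof -
   have "cmod (F (Complex r c) $ i $ 1) \<le> (K + 1) * (C * exp (- (k * exp r)))"
    unfolding e1[of "Complex r c"] norm_mult using K(1,2) that c by (intro mult_mono bd C) (auto simp: abs_if)
   then show ?thesis by (simp add: mult_ac)
  qed
  then show "decays_along F 1 c" unfolding decays_along_def using k by blast }
qed

text \<open>A solution that decays along a ray is unique up to scaling, since the Wronskian of two of them is a
 constant that tends to zero.\<close>

lemma decays_wronskian:
 assumes "decays_along Y j c" "decays_along Y' j c"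
  and "\<And>r. r > 0 \<Longrightarrow> Y (Complex r c) $ 1 $ j * Y' (Complex r c) $ 2 $ j - Y (Complex r c) $ 2 $ j * Y' (Complex r c) $ 1 $ j = W"
 shows "W = 0"
proof -
 obtain k C R where k: "k > 0" "C > 0" "R > 0" "\<And>r i. r \<ge> R \<Longrightarrow> cmod (Y (Complex r c) $ i $ j) \<le> C * exp (- (k * exp r))"
  using decays_alongE[OF assms(1)] by blast
 obtain k' C' R' where k': "k' > 0" "C' > 0" "R' > 0" "\<And>r i. r \<ge> R' \<Longrightarrow> cmod (Y' (Complex r c) $ i $ j) \<le> C' * exp (- (k' * exp r))"
  using decays_alongE[OF assms(2)] by blast
 have lim: "((\<lambda>r. a * exp (- (k * exp r))) \<longlongrightarrow> 0) at_top" if "k > 0" for a k :: real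
 proof -
  have "((\<lambda>r. a * exp (- k * exp r)) \<longlongrightarrow> a * 0) at_top"
   using that by (intro tendsto_mult tendsto_const filterlim_compose[OF exp_at_bot]
     filterlim_tendsto_neg_mult_at_bot[OF tendsto_const _ exp_at_top]) auto
  then show ?thesis by simp
 qed
 have "((\<lambda>r. 2 * (C * exp (- (k * exp r)) * (C' * exp (- (k' * exp r))))) \<longlongrightarrow> 2 * (0 * 0)) at_top"
  by (intro tendsto_mult tendsto_const lim k(1) k'(1))
 moreover have "\<forall>\<^sub>F r in at_top. cmod W \<le> 2 * (C * exp (- (k * exp r)) * (C' * exp (- (k' * exp r))))"
  unfolding eventually_at_top_linorder
 proof (intro exI[of _ "max R R'"] allI impI)
  fix r assume r: "max R R' \<le> r"
  then have "W = Y (Complex r c) $ 1 $ j * Y' (Complex r c) $ 2 $ j - Y (Complex r c) $ 2 $ j * Y' (Complex r c) $ 1 $ j"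
   using assms(3)[of r] k(3) by simp
  then have "cmod W \<le> cmod (Y (Complex r c) $ 1 $ j) * cmod (Y' (Complex r c) $ 2 $ j) + cmod (Y (Complex r c) $ 2 $ j) * cmod (Y' (Complex r c) $ 1 $ j)"
   using norm_triangle_ineq4 by (metis norm_mult)
  also have "\<dots> \<le> C * exp (- (k * exp r)) * (C' * exp (- (k' * exp r))) + C * exp (- (k * exp r)) * (C' * exp (- (k' * exp r)))"
   using k(2) k'(2) r by (intro add_mono mult_mono k(4) k'(4)) auto
  finally show "cmod W \<le> 2 * (C * exp (- (k * exp r)) * (C' * exp (- (k' * exp r))))" by (simp only: mult_2)
 qed
 ultimately have "cmod W \<le> 2 * (0 * 0)"
  by (intro tendsto_lowerbound[where F = at_top]) auto
 then show ?thesis by simp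
qed

text \<open>Decay on two rays, one for each column, determines a unimodular solution up to a
  diagonal right factor. This weak form of canonicity is the one carried through the deformation in
  \<open>s\<close>.\<close>

lemma decays_along_unique:
 assumes "\<And>r c. r > 0 \<Longrightarrow> c \<in> {c1, c2} \<Longrightarrow> F' (Complex r c) = F (Complex r c) ** K \<and> det (F (Complex r c)) = 1"
  and "decays_along F 2 c2" "decays_along F' 2 c2" "decays_along F 1 c1" "decays_along F' 1 c1"
 shows "K $ 1 $ 2 = 0" "K $ 2 $ 1 = 0"
proof -
 have "- K $ 1 $ 2 = 0"
 proof (rule decays_wronskian[OF assms(2,3)])
  fix r :: real assume "r > 0"
  then have a: "F' (Complex r c2) = F (Complex r c2) ** K" and d: "det (F (Complex r c2)) = 1" using assms(1) by auto
  have "F (Complex r c2) $ 1 $ 2 * F' (Complex r c2) $ 2 $ 2 - F (Complex r c2) $ 2 $ 2 * F' (Complex r c2) $ 1 $ 2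
   = - (det (F (Complex r c2)) * K $ 1 $ 2)"
   unfolding a det_2 by (simp add: mat_mult_entry algebra_simps)
  then show "F (Complex r c2) $ 1 $ 2 * F' (Complex r c2) $ 2 $ 2 - F (Complex r c2) $ 2 $ 2 * F' (Complex r c2) $ 1 $ 2 = - K $ 1 $ 2"
   using d by simp
 qed
 then show "K $ 1 $ 2 = 0" by simp
 show "K $ 2 $ 1 = 0"
 proof (rule decays_wronskian[OF assms(4,5)])
  fix r :: real assume "r > 0"
  then have a: "F' (Complex r c1) = F (Complex r c1) ** K" and d: "det (F (Complex r c1)) = 1" using assms(1) by auto
  have "F (Complex r c1) $ 1 $ 1 * F' (Complex r c1) $ 2 $ 1 - F (Complex r c1) $ 2 $ 1 * F' (Complex r c1) $ 1 $ 1
   = det (F (Complex r c1)) * K $ 2 $ 1"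
   unfolding a det_2 by (simp add: mat_mult_entry algebra_simps)
  then show "F (Complex r c1) $ 1 $ 1 * F' (Complex r c1) $ 2 $ 1 - F (Complex r c1) $ 2 $ 1 * F' (Complex r c1) $ 1 $ 1 = K $ 2 $ 1"
   using d by simp
 qed
qed

lemma canonical_asymp_tendsto:
 assumes "canonical_asymp t k W d" "d \<le> pi"
 shows "((\<lambda>r. (W (Complex r (pi / 2)) ** exp_sigma3 (- ((of_real t * exp (Complex r (pi / 2)) - 2 * k * Complex r (pi / 2)) / 4))) $ i $ j)
  \<longlongrightarrow> mat 1 $ i $ j) at_top"
proof -
 obtain K R where K: "K > 0" "R > 0" "\<And>h i j. R \<le> Re h \<Longrightarrow> \<bar>Im h - pi / 2\<bar> \<le> pi - d \<Longrightarrow>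
   cmod ((W h ** exp_sigma3 (- ((of_real t * exp h - 2 * k * h) / 4)) - mat 1) $ i $ j) \<le> K * exp (- Re h)"
  using canonical_asympE[OF assms(1)] by blast
 have "((\<lambda>r. (W (Complex r (pi / 2)) ** exp_sigma3 (- ((of_real t * exp (Complex r (pi / 2)) - 2 * k * Complex r (pi / 2)) / 4)) - mat 1) $ i $ j)
  \<longlongrightarrow> 0) at_top"
 proof (rule Lim_null_comparison)
  show "\<forall>\<^sub>F r in at_top. cmod ((W (Complex r (pi / 2)) ** exp_sigma3 (- ((of_real t * exp (Complex r (pi / 2)) - 2 * k * Complex r (pi / 2)) / 4)) - mat 1) $ i $ j)
    \<le> K * exp (- r)"
   unfolding eventually_at_top_linorder using K(3)[of "Complex r (pi / 2)" for r] assms(2) by (intro exI[of _ R]) auto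
  have "((\<lambda>r::real. K * exp (- r)) \<longlongrightarrow> K * 0) at_top"
   by (intro tendsto_mult tendsto_const filterlim_compose[OF exp_at_bot] filterlim_uminus_at_bot_at_top)
  then show "((\<lambda>r::real. K * exp (- r)) \<longlongrightarrow> 0) at_top" by simp
 qed
 from tendsto_add[OF this tendsto_const[of "mat 1 $ i $ j"]] show ?thesis by simp
qed

text \<open>The exponential factor has determinant 1, so the constant determinant equals its limit
  on the middle ray, which is that of the identity.\<close>

lemma canonical_asymp_det:
 assumes "canonical_asymp t k W e" "e \<le> pi" "\<And>r. r > 0 \<Longrightarrow> det (W (Complex r (pi / 2))) = d"
 shows "d = 1"
proof -
 define P where "P r = W (Complex r (pi / 2)) ** exp_sigma3 (- ((of_real t * exp (Complex r (pi / 2)) - 2 * k * Complex r (pi / 2)) / 4))" for r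
 have P: "((\<lambda>r. P r $ i $ j) \<longlongrightarrow> mat 1 $ i $ j) at_top" for i j
  unfolding P_def by (rule canonical_asymp_tendsto[OF assms(1,2)])
 have "((\<lambda>r. det (P r)) \<longlongrightarrow> det (mat 1 :: complex^2^2)) at_top"
  unfolding det_2 by (intro tendsto_intros P)
 moreover have "((\<lambda>r. det (P r)) \<longlongrightarrow> d) at_top"
 proof (rule tendsto_eventually)
  have "det (P r) = d" if "r > 0" for r using assms(3)[OF that] by (simp add: P_def det_mul)
  then show "\<forall>\<^sub>F r in at_top. det (P r) = d" using eventually_gt_at_top[of "0::real"] by (rule eventually_mono[rotated]) auto
 qed
 ultimately have "d = det (mat 1 :: complex^2^2)" by (metis tendsto_unique trivial_limit_at_top_linorder)
 then show ?thesis by simp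
qed

text \<open>Decay on the rays of argument \<open>pi / 4\<close> and \<open>3 * pi / 4\<close>
  removes the off-diagonal entries of \<open>K\<close>; on the ray of argument \<open>pi / 2\<close>
  both normalised solutions tend to the identity, which fixes the diagonal.\<close>

lemma canonical_asymp_unique:
 assumes "canonical_asymp t k W (pi / 4)" "canonical_asymp t k W' (pi / 4)" "t > 0"
  and rel: "\<And>h. h \<in> log_plane \<Longrightarrow> W' h = W h ** K \<and> det (W h) = 1"
 shows "K = mat 1"
proof -
 have m: "canonical_asymp t k W (pi / 2)" "canonical_asymp t k W' (pi / 2)"
  using assms(1,2) by (auto intro: canonical_asymp_mono)
 have lp: "Complex r c \<in> log_plane" if "r > 0" for r c using that by (simp add: log_plane_def)
 have K0: "K $ 1 $ 2 = 0" "K $ 2 $ 1 = 0"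
  using decays_along_unique[of "3 * pi / 4" "pi / 4" W' W K] rel[OF lp]
   canonical_asymp_decays[OF m(1) assms(3)] canonical_asymp_decays[OF m(2) assms(3)] by auto
 define w where "w r = - ((of_real t * exp (Complex r (pi / 2)) - 2 * k * Complex r (pi / 2)) / 4)" for r
 have eq: "(W' (Complex r (pi / 2)) ** exp_sigma3 (w r)) $ i $ i = (W (Complex r (pi / 2)) ** exp_sigma3 (w r)) $ i $ i * K $ i $ i"
  if "r > 0" for r i
 proof -
  have "W' (Complex r (pi / 2)) = W (Complex r (pi / 2)) ** K" using rel[OF lp[OF that]] by simp
  then show ?thesis using exhaust_2[of i] by (auto simp: mat_mult_entry K0)
 qed
 have "K $ i $ i = 1" for i
 proof -
  have l1: "((\<lambda>r. (W (Complex r (pi / 2)) ** exp_sigma3 (w r)) $ i $ i * K $ i $ i) \<longlongrightarrow> mat 1 $ i $ i * K $ i $ i) at_top"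
   unfolding w_def by (intro tendsto_intros canonical_asymp_tendsto[OF assms(1)]) auto
  have a1: "((\<lambda>r. (W' (Complex r (pi / 2)) ** exp_sigma3 (w r)) $ i $ i) \<longlongrightarrow> mat 1 $ i $ i * K $ i $ i) at_top"
  proof (rule Lim_transform_eventually[OF l1])
   show "\<forall>\<^sub>F r in at_top. (W (Complex r (pi / 2)) ** exp_sigma3 (w r)) $ i $ i * K $ i $ i = (W' (Complex r (pi / 2)) ** exp_sigma3 (w r)) $ i $ i"
    using eventually_gt_at_top[of "0::real"] by (rule eventually_mono) (simp add: eq)
  qed
  have a2: "((\<lambda>r. (W' (Complex r (pi / 2)) ** exp_sigma3 (w r)) $ i $ i) \<longlongrightarrow> mat 1 $ i $ i) at_top"
   unfolding w_def by (rule canonical_asymp_tendsto[OF assms(2)]) auto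
  have "mat 1 $ i $ i * K $ i $ i = mat 1 $ i $ i" by (rule tendsto_unique[OF _ a1 a2]) simp
  then show ?thesis by (simp add: mat_def)
 qed
 then show ?thesis using K0 by (simp add: mat_eq_iff)
qed

lemma det_canonical_log:
 assumes "rank1_system t k B" "mat_ode (log_system B) F log_plane" "canonical_asymp t k F d" "d \<le> pi" "h \<in> log_plane"
 shows "det (F h) = 1"
proof -
 have tf: "trace_free (log_system B) log_plane" using assms(1) log_system_trace_free by (simp add: rank1_system_def)
 have "det (F (Complex r (pi / 2))) = det (F h)" if "r > 0" for r
  by (rule det_mat_ode_const[OF assms(2) tf log_plane(1,3) assms(5)]) (use that in \<open>simp add: log_plane_def\<close>)
 then show ?thesis using canonical_asymp_det[OF assms(3,4)] by blast
qed

text \<open>The auxiliary construction depends on the aperture. By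
  \<open>canonical_asymp_unique\<close> the solutions for all smaller apertures coincide with the
  one for \<open>pi / 4\<close>, which therefore has the asymptotics on every closed
  subsector.\<close>

theorem canonical_solution_log_exists:
 assumes B: "rank1_system t k B" and t: "t > 0"
 obtains F where "mat_ode (log_system B) F log_plane" "\<And>h. h \<in> log_plane \<Longrightarrow> det (F h) = 1"
  "\<And>\<delta>. \<delta> > 0 \<Longrightarrow> canonical_asymp t k F \<delta>"
proof -
 have tf: "trace_free (log_system B) log_plane" using B log_system_trace_free by (simp add: rank1_system_def)
 obtain F where F: "mat_ode (log_system B) F log_plane" "canonical_asymp t k F (3 * (pi / 12))"
  using canonical_solution_log_exists_aux[OF B t, of "pi / 12"] by auto
 have a: "canonical_asymp t k F (pi / 4)" using F(2) by simp
 have d: "det (F h) = 1" if "h \<in> log_plane" for h by (rule det_canonical_log[OF B F(1) a _ that]) simp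
 have "canonical_asymp t k F \<delta>" if "\<delta> > 0" for \<delta>
 proof -
  \<comment> \<open>The construction with parameter \<open>\<delta>'\<close> has aperture
    \<open>3 * \<delta>'\<close>; this must not exceed \<delta>, for the claim, nor
    \<open>pi / 4\<close>, for the comparison.\<close>
  define \<delta>' where "\<delta>' = min \<delta> (pi / 4) / 3"
  have \<delta>': "0 < \<delta>'" "\<delta>' < pi / 4" "3 * \<delta>' \<le> \<delta>" "3 * \<delta>' \<le> pi / 4" using that by (auto simp: \<delta>'_def min_def)
  obtain F' where F': "mat_ode (log_system B) F' log_plane" "canonical_asymp t k F' (3 * \<delta>')"
   using canonical_solution_log_exists_aux[OF B t \<delta>'(1,2)] by auto
  have 1: "1 \<in> log_plane" by (simp add: log_plane_def)
  define K where "K = adj2 (F 1) ** F' 1"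
  have rel: "F' h = F h ** K" if "h \<in> log_plane" for h
   unfolding K_def by (rule mat_ode_unique[OF F(1) F'(1) tf log_plane(1,3) 1 d[OF 1] that])
  have "K = mat 1"
   by (rule canonical_asymp_unique[OF a canonical_asymp_mono[OF F'(2) \<delta>'(4)] t]) (use rel d in blast)
  then have eq: "F' h = F h" if "h \<in> log_plane" for h using rel[OF that] by simp
  obtain K' R where KR: "R > 0" "\<And>h i j. R \<le> Re h \<Longrightarrow> \<bar>Im h - pi / 2\<bar> \<le> pi - 3 * \<delta>' \<Longrightarrow>
    cmod ((F' h ** exp_sigma3 (- ((of_real t * exp h - 2 * k * h) / 4)) - mat 1) $ i $ j) \<le> K' * exp (- Re h)"
   using canonical_asympE[OF F'(2)] by metis
  have "canonical_asymp t k F (3 * \<delta>')"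
   unfolding canonical_asymp_def
  proof (rule exI[of _ K'], rule exI[of _ R], intro allI impI)
   fix h and i j :: 2
   assume e: "R \<le> Re h \<and> \<bar>Im h - pi / 2\<bar> \<le> pi - 3 * \<delta>'"
   then have "h \<in> log_plane" using KR(1) by (simp add: log_plane_def)
   then show "cmod ((F h ** exp_sigma3 (- ((of_real t * exp h - 2 * k * h) / 4)) - mat 1) $ i $ j) \<le> K' * exp (- Re h)"
    using KR(2)[of h i j] e eq by simp
  qed
  then show ?thesis using \<delta>'(3) by (rule canonical_asymp_mono)
 qed
 then show ?thesis using that F(1) d by blast
qed

section \<open>Translation between the logarithmic plane and the cut plane\<close>

lemma sector2_log:
 assumes "l \<in> sector2"
 shows "exp (ln2 l) = l" "ln2 l \<in> log_plane" "Im (ln2 l) = arg2 l" "exp (- Re (ln2 l)) = 1 / cmod l"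
  "(ln2 has_field_derivative 1 / l) (at l)" "l \<noteq> 0"
proof -
 have l: "1 < cmod l" "\<bar>Arg (- \<i> * l)\<bar> < pi" using assms by (auto simp: sector2_def arg2_def)
 show l0: "l \<noteq> 0" using l by auto
 have nz: "- \<i> * l \<noteq> 0" using l0 by simp
 have ee: "exp (\<i> * complex_of_real (pi / 2)) = \<i>" using exp_pi_i[of ] by (simp add: exp_eq_polar complex_eq_iff)
 show "exp (ln2 l) = l" unfolding ln2_def exp_add ee exp_Ln[OF nz] by (simp add: algebra_simps)
 have "Re (ln2 l) = ln (cmod l)" unfolding ln2_def using Re_Ln[OF nz] by (simp add: norm_mult)
 then show "ln2 l \<in> log_plane" "exp (- Re (ln2 l)) = 1 / cmod l"
  using l ln_gt_zero[of "cmod l"] l0 by (auto simp: log_plane_def exp_minus divide_inverse)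
 show "Im (ln2 l) = arg2 l" unfolding ln2_def arg2_def using Arg_eq_Im_Ln[OF nz] by simp
 have "- \<i> * l \<notin> \<real>\<^sub>\<le>\<^sub>0"
 proof
  assume "- \<i> * l \<in> \<real>\<^sub>\<le>\<^sub>0"
  then have "Arg (- \<i> * l) = pi" using nz Arg_eq_pi_iff[of "- \<i> * l"] complex_nonpos_Reals_iff[of "- \<i> * l"]
   by (auto simp: complex_is_Real_iff complex_eq_iff)
  then show False using l by simp
 qed
 then show "(ln2 has_field_derivative 1 / l) (at l)"
  unfolding ln2_def using l0 by (auto intro!: derivative_eq_intros simp: field_simps)
qed

lemma exp_in_sector2:
 assumes "Re h > 0" "\<bar>Im h - pi / 2\<bar> < pi"
 shows "ln2 (exp h) = h" "exp h \<in> sector2" "arg2 (exp h) = Im h"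
proof -
 have i: "- \<i> = exp (- \<i> * complex_of_real (pi / 2))" by (simp add: exp_eq_polar complex_eq_iff)
 have "- \<i> * exp h = exp (- \<i> * complex_of_real (pi / 2)) * exp h"
  by (rule arg_cong[where f = "\<lambda>x. x * exp h", OF i])
 then have e: "- \<i> * exp h = exp (h - \<i> * complex_of_real (pi / 2))" by (simp add: exp_add[symmetric])
 have L: "Ln (exp (h - \<i> * complex_of_real (pi / 2))) = h - \<i> * complex_of_real (pi / 2)"
  by (rule Ln_exp) (use assms(2) in auto)
 show "ln2 (exp h) = h" unfolding ln2_def e L by simp
 have nz: "- \<i> * exp h \<noteq> 0" by simp
 have "Arg (- \<i> * exp h) = Im h - pi / 2"
  by (simp only: e Arg_eq_Im_Ln[OF exp_not_eq_zero] L) simp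
 then show "arg2 (exp h) = Im h" by (simp add: arg2_def)
 then show "exp h \<in> sector2" using assms by (simp add: sector2_def)
qed

lemma canonical_solution2I:
 assumes W: "mat_ode (log_system B) W log_plane" "\<And>d. d > 0 \<Longrightarrow> canonical_asymp t k W d"
 shows "canonical_solution2 B k t (\<lambda>l. W (ln2 l))"
 unfolding canonical_solution2_def
proof (intro conjI)
 show "\<forall>l\<in>sector2. \<forall>i j. ((\<lambda>l. W (ln2 l) $ i $ j) has_field_derivative (B l ** W (ln2 l)) $ i $ j) (at l)"
 proof
  fix l assume l: "l \<in> sector2"
  have "has_mderiv (\<lambda>l. W (ln2 l)) (B l ** W (ln2 l)) l"
   by (rule mat_ode_log_compose[OF W(1) sector2_log(6)[OF l] sector2_log(5)[OF l] sector2_log(1)[OF l] sector2_log(2)[OF l]])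
  then show "\<forall>i j. ((\<lambda>l. W (ln2 l) $ i $ j) has_field_derivative (B l ** W (ln2 l)) $ i $ j) (at l)"
   by (simp add: has_mderiv_def)
 qed
 define w where "w l = (of_real t * l - 2 * k * ln2 l) / 4" for l
 define G where "G l = W (ln2 l) ** exp_sigma3 (- w l) - mat 1" for l
 show "\<exists>G. (\<forall>l\<in>sector2. W (ln2 l) = (mat 1 + G l) ** exp_sigma3 ((of_real t * l - 2 * k * ln2 l) / 4)) \<and>
     (\<forall>d>0. \<forall>i j. (\<lambda>l. G l $ i $ j) \<in>
       O[inf at_infinity (principal {l. \<bar>arg2 l - pi / 2\<bar> \<le> pi - d})](\<lambda>l. 1 / l))"
 proof (intro exI[of _ G] conjI ballI allI impI)
  fix l assume "l \<in> sector2"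
  have "mat 1 + G l = W (ln2 l) ** exp_sigma3 (- w l)" by (simp add: G_def)
  then show "W (ln2 l) = (mat 1 + G l) ** exp_sigma3 ((of_real t * l - 2 * k * ln2 l) / 4)"
   unfolding w_def[symmetric] by (simp add: matrix_mul_assoc[symmetric] exp_sigma3_add)
 next
  fix d :: real and i j :: 2 assume d: "d > 0"
  obtain K R where K: "K > 0" "R > 0" "\<And>h i j. R \<le> Re h \<Longrightarrow> \<bar>Im h - pi / 2\<bar> \<le> pi - d \<Longrightarrow>
    cmod ((W h ** exp_sigma3 (- ((of_real t * exp h - 2 * k * h) / 4)) - mat 1) $ i $ j) \<le> K * exp (- Re h)"
   using canonical_asympE[OF W(2)[OF d]] by blast
  show "(\<lambda>l. G l $ i $ j) \<in> O[inf at_infinity (principal {l. \<bar>arg2 l - pi / 2\<bar> \<le> pi - d})](\<lambda>l. 1 / l)"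
  proof (rule bigoI[of _ K])
   show "\<forall>\<^sub>F l in inf at_infinity (principal {l. \<bar>arg2 l - pi / 2\<bar> \<le> pi - d}). norm (G l $ i $ j) \<le> K * norm (1 / l)"
    unfolding eventually_inf_principal eventually_at_infinity
   proof (intro exI[of _ "exp R"] allI impI)
    fix l :: complex assume l: "exp R \<le> norm l" "l \<in> {l. \<bar>arg2 l - pi / 2\<bar> \<le> pi - d}"
    have "1 < exp R" using K(2) by simp
    then have "1 < cmod l" using l(1) by linarith
    then have s: "l \<in> sector2" using l d by (simp add: sector2_def)
    have "exp R \<le> exp (Re (ln2 l))" using l(1) sector2_log(4)[OF s] sector2_log(6)[OF s]
     by (simp add: exp_minus field_simps)
    then have "R \<le> Re (ln2 l)" by simp
    from K(3)[OF this, of i j] show "norm (G l $ i $ j) \<le> K * norm (1 / l)"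
     using l(2) by (simp add: sector2_log[OF s] G_def w_def norm_divide)
   qed
  qed
 qed
qed

lemma canonical_solution2D:
 assumes "canonical_solution2 B k t Y"
 shows "mat_ode B Y sector2" "d > 0 \<Longrightarrow> canonical_asymp t k (\<lambda>h. Y (exp h)) d"
proof -
 show "mat_ode B Y sector2"
  using assms unfolding canonical_solution2_def mat_ode_def has_mderiv_def by blast
 obtain G where G: "\<And>l. l \<in> sector2 \<Longrightarrow> Y l = (mat 1 + G l) ** exp_sigma3 ((of_real t * l - 2 * k * ln2 l) / 4)"
  "\<And>d i j. d > 0 \<Longrightarrow> (\<lambda>l. G l $ i $ j) \<in> O[inf at_infinity (principal {l. \<bar>arg2 l - pi / 2\<bar> \<le> pi - d})](\<lambda>l. 1 / l)"
  using assms unfolding canonical_solution2_def by blast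
 assume d: "d > 0"
 have "\<exists>K b. \<forall>l. b \<le> cmod l \<longrightarrow> \<bar>arg2 l - pi / 2\<bar> \<le> pi - d \<longrightarrow> cmod (G l $ i $ j) \<le> K * (1 / cmod l)" for i j
 proof -
  obtain K where "\<forall>\<^sub>F l in inf at_infinity (principal {l. \<bar>arg2 l - pi / 2\<bar> \<le> pi - d}). norm (G l $ i $ j) \<le> K * norm (1 / l)"
   using landau_o.bigE[OF G(2)[OF d, of i j]] by blast
  then show ?thesis unfolding eventually_inf_principal eventually_at_infinity by (auto simp: norm_divide)
 qed
 then obtain K b where Kb: "\<And>i j l. b i j \<le> cmod l \<Longrightarrow> \<bar>arg2 l - pi / 2\<bar> \<le> pi - d \<Longrightarrow> cmod (G l $ i $ j) \<le> K i j * (1 / cmod l)"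
  by metis
 define K' where "K' = (\<Sum>i\<in>UNIV. \<Sum>j\<in>UNIV. \<bar>K i j\<bar>)"
 define b' where "b' = (\<Sum>i\<in>UNIV. \<Sum>j\<in>UNIV. \<bar>b i j\<bar>) + 1"
 have leK: "\<bar>f i j\<bar> \<le> (\<Sum>i\<in>UNIV. \<Sum>j\<in>UNIV. \<bar>f i j\<bar>)" for f :: "2 \<Rightarrow> 2 \<Rightarrow> real" and i j
  using exhaust_2[of i] exhaust_2[of j] by (auto simp: sum_2)
 show "canonical_asymp t k (\<lambda>h. Y (exp h)) d"
  unfolding canonical_asymp_def
 proof (rule exI[of _ K'], rule exI[of _ "max 1 b'"], intro allI impI)
  fix h and i j :: 2
  assume e: "max 1 b' \<le> Re h \<and> \<bar>Im h - pi / 2\<bar> \<le> pi - d"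
  have e': "Re h > 0" "\<bar>Im h - pi / 2\<bar> < pi" using e d by auto
  note s = exp_in_sector2[OF e']
  have "Y (exp h) ** exp_sigma3 (- ((of_real t * exp h - 2 * k * h) / 4)) - mat 1 = G (exp h)"
   unfolding G(1)[OF s(2)] s(1) by (simp add: matrix_mul_assoc[symmetric] exp_sigma3_add)
  moreover have "cmod (G (exp h) $ i $ j) \<le> K' * exp (- Re h)"
  proof -
   have "b i j \<le> cmod (exp h)"
   proof -
    have "b' \<le> Re h" using e by simp
    then show ?thesis using leK[of b i j] exp_ge_add_one_self[of "Re h"] unfolding norm_exp_eq_Re b'_def by linarith
   qed
   then have "cmod (G (exp h) $ i $ j) \<le> K i j * (1 / cmod (exp h))" using Kb[of i j "exp h"] s(3) e by simp
   also have "\<dots> \<le> K' * (1 / cmod (exp h))" using leK[of K i j] by (intro mult_right_mono) (auto simp: K'_def)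
   finally show ?thesis by (simp add: exp_minus divide_inverse)
  qed
  ultimately show "cmod ((Y (exp h) ** exp_sigma3 (- ((of_real t * exp h - 2 * k * h) / 4)) - mat 1) $ i $ j) \<le> K' * exp (- Re h)"
   by simp
 qed
qed

section \<open>Isomonodromic deformation\<close>

lemma sigma3_entry [simp]:
 "sigma3 $ 1 $ 1 = 1" "sigma3 $ 1 $ 2 = 0" "sigma3 $ 2 $ 1 = 0" "sigma3 $ 2 $ 2 = - 1"
 by (simp_all add: sigma3_def)

section \<open>Two-pole systems and their rotation to fixed poles\<close>

text \<open>\<open>P0\<close> is the residue at \<open>- c\<close> and \<open>P1\<close> the one at
  \<open>c\<close>. With \<open>r = t\<close> and \<open>c = exp (\<i> * of_real \<phi>)\<close>
  this is the system in \<lambda> up to a constant diagonal conjugation; with \<open>c = 1\<close>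
  it is the normalised form whose poles do not depend on \<open>arg x\<close>.\<close>

definition two_pole :: "complex \<Rightarrow> complex \<Rightarrow> complex^2^2 \<Rightarrow> complex^2^2 \<Rightarrow> complex \<Rightarrow> complex^2^2" where
 "two_pole r c P0 P1 l = scale_mat (r / 4) sigma3 + scale_mat (1 / (l + c)) P0 + scale_mat (1 / (l - c)) P1"

lemma two_pole_entry: "two_pole r c P0 P1 l $ i $ j = r / 4 * sigma3 $ i $ j + P0 $ i $ j / (l + c) + P1 $ i $ j / (l - c)"
 by (simp add: two_pole_def)

lemma two_pole_holo:
 assumes "c \<notin> S" "- c \<notin> S"
 shows "mat_holo (two_pole r c P0 P1) S"
proof -
 have "l + c \<noteq> 0" "l - c \<noteq> 0" if "l \<in> S" for l using assms that by (auto simp: eq_neg_iff_add_eq_0[symmetric])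
 then show ?thesis unfolding mat_holo_def two_pole_entry by (auto intro!: holomorphic_intros)
qed

lemma two_pole_trace_free:
 assumes "P0 $ 2 $ 2 = - P0 $ 1 $ 1" "P1 $ 2 $ 2 = - P1 $ 1 $ 1"
 shows "trace_free (two_pole r c P0 P1) S"
 using assms by (simp add: trace_free_def two_pole_entry)

text \<open>Each pole term differs from its residue divided by \<open>l\<close> by
  \<open>O(1 / |l|^2)\<close>, so the sum of the residues supplies the \<open>1 / l\<close> term of
  the diagonal and with it the power in the formal exponent.\<close>

lemma two_pole_rank1:
 assumes tr: "P0 $ 2 $ 2 = - P0 $ 1 $ 1" "P1 $ 2 $ 2 = - P1 $ 1 $ 1"
  and sum: "P0 $ 1 $ 1 + P1 $ 1 $ 1 = - k / 2" and c: "cmod c = 1"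
 shows "rank1_system t k (two_pole (of_real t) c P0 P1)"
proof -
 define K where "K = 2 * norm P0 + 2 * norm P1"
 have inv: "cmod (1 / (l + d)) \<le> 2 / cmod l" "cmod (1 / (l + d) - 1 / l) \<le> 2 / (cmod l)\<^sup>2"
  if "2 < cmod l" "cmod d = 1" for l d
 proof -
  have g: "cmod l / 2 \<le> cmod (l + d)" using norm_triangle_ineq4[of "l + d" d] that by simp
  have p: "0 < cmod l" using that by linarith
  have p2: "0 < cmod (l + d)" using g p by linarith
  have n0: "l \<noteq> 0" "l + d \<noteq> 0" using p p2 by auto
  have "cmod (1 / (l + d)) = 1 / cmod (l + d)" by (simp add: norm_divide)
  also have "\<dots> \<le> 1 / (cmod l / 2)" using g p p2 by (intro divide_left_mono mult_pos_pos) auto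
  finally show 1: "cmod (1 / (l + d)) \<le> 2 / cmod l" by simp
  have "1 / (l + d) - 1 / l = - d * (1 / (l + d)) / l" using n0 by (simp add: field_simps)
  then have "cmod (1 / (l + d) - 1 / l) = cmod (1 / (l + d)) / cmod l" using that by (simp add: norm_mult norm_divide)
  also have "\<dots> \<le> 2 / cmod l / cmod l" using 1 by (intro divide_right_mono) auto
  finally show "cmod (1 / (l + d) - 1 / l) \<le> 2 / (cmod l)\<^sup>2" by (simp add: power2_eq_square)
 qed
 have bnd: "cmod (a * x + b * y) \<le> (2 * norm P0 + 2 * norm P1) * q"
  if "cmod a \<le> norm P0" "cmod b \<le> norm P1" "cmod x \<le> 2 * q" "cmod y \<le> 2 * q" for a b x y q
 proof -
  have "cmod (a * x + b * y) \<le> cmod a * cmod x + cmod b * cmod y" by (metis norm_mult norm_triangle_ineq)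
  also have "\<dots> \<le> norm P0 * (2 * q) + norm P1 * (2 * q)" using that by (intro add_mono mult_mono) auto
  finally show ?thesis by (simp add: algebra_simps)
 qed
 have b1: "cmod (two_pole (of_real t) c P0 P1 l $ 1 $ 1 - (of_real t / 4 - k / (2 * l))) \<le> K / (cmod l)\<^sup>2" if l: "2 < cmod l" for l
 proof -
  have "k = - 2 * (P0 $ 1 $ 1 + P1 $ 1 $ 1)" using sum by (simp add: field_simps)
  then have "k / (2 * l) = (- 2 * (P0 $ 1 $ 1 + P1 $ 1 $ 1)) / (2 * l)" by (rule arg_cong)
  also have "\<dots> = - (P0 $ 1 $ 1 / l) - P1 $ 1 $ 1 / l" using l by (cases "l = 0") (simp_all add: field_simps)
  finally have th: "k / (2 * l) = - (P0 $ 1 $ 1 / l) - P1 $ 1 $ 1 / l" .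
  have "two_pole (of_real t) c P0 P1 l $ 1 $ 1 - (of_real t / 4 - k / (2 * l))
    = P0 $ 1 $ 1 * (1 / (l + c) - 1 / l) + P1 $ 1 $ 1 * (1 / (l + - c) - 1 / l)"
   unfolding th by (simp add: two_pole_entry algebra_simps)
  also have "cmod \<dots> \<le> K * (1 / (cmod l)\<^sup>2)"
   unfolding K_def using inv(2)[OF l, of c] inv(2)[OF l, of "- c"] c by (intro bnd norm_entry_le) auto
  finally show ?thesis by simp
 qed
 have b2: "cmod (two_pole (of_real t) c P0 P1 l $ i $ j) \<le> K / cmod l" if l: "2 < cmod l" and ij: "sigma3 $ i $ j = 0" for l i j
 proof -
  have "two_pole (of_real t) c P0 P1 l $ i $ j = P0 $ i $ j * (1 / (l + c)) + P1 $ i $ j * (1 / (l + - c))"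
   by (simp add: two_pole_entry ij)
  also have "cmod \<dots> \<le> K * (1 / cmod l)"
   unfolding K_def using inv(1)[OF l, of c] inv(1)[OF l, of "- c"] c by (intro bnd norm_entry_le) auto
  finally show ?thesis by simp
 qed
 have "mat_holo (two_pole (of_real t) c P0 P1) {l. 1 < cmod l}" by (rule two_pole_holo) (use c in auto)
 then show ?thesis
  unfolding rank1_system_def using two_pole_trace_free[OF tr] b1 b2 by (auto intro!: exI[of _ K] simp: K_def)
qed

text \<open>Rotating the variable is a translation of \<open>h\<close> along the imaginary axis. It
  moves the poles to \<open>1\<close> and \<open>- 1\<close> and transfers the phase to the leading
  coefficient, which becomes \<open>exp s\<close>.\<close>

lemma two_pole_log_rotate:
 assumes "exp s = of_real t * exp (\<i> * of_real f)"
 shows "log_system (two_pole (of_real t) (exp (\<i> * of_real f)) P0 P1) (h + \<i> * of_real f) = log_system (two_pole (exp s) 1 P0 P1) h"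
proof -
 define c where "c = exp (\<i> * of_real f)"
 have c: "c \<noteq> 0" by (simp add: c_def)
 have e: "exp (h + \<i> * of_real f) = exp h * c" by (simp add: exp_add c_def)
 have a1: "a / (exp h * c + c) = a / (exp h + 1) / c" "a / (exp h * c - c) = a / (exp h - 1) / c" for a
 proof -
  have "exp h * c + c = (exp h + 1) * c" "exp h * c - c = (exp h - 1) * c" by (simp_all add: algebra_simps)
  then show "a / (exp h * c + c) = a / (exp h + 1) / c" "a / (exp h * c - c) = a / (exp h - 1) / c" by simp_all
 qed
 have "log_system (two_pole (of_real t) c P0 P1) (h + \<i> * of_real f) $ i $ j = log_system (two_pole (exp s) 1 P0 P1) h $ i $ j" for i j
 proof -
  have "c * (of_real t / 4 * r + u / c + v / c) = of_real t * c / 4 * r + u + v" for r u v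
   using c by (simp add: field_simps)
  then show ?thesis
   unfolding log_system_def scale_mat_entry two_pole_entry e a1 assms c_def[symmetric] by (simp only: mult.assoc)
 qed
 then show ?thesis by (simp add: vec_eq_iff c_def)
qed

lemma log_plane_imag_shift: "h + \<i> * of_real f \<in> log_plane \<longleftrightarrow> h \<in> log_plane"
 by (simp add: log_plane_def)

lemma decays_along_shift: "decays_along (\<lambda>h. F (h + \<i> * of_real f)) j c \<longleftrightarrow> decays_along F j (c + f)"
proof -
 have "Complex r c + \<i> * of_real f = Complex r (c + f)" for r by (simp add: complex_eq_iff)
 then show ?thesis by (simp add: decays_along_def)
qed

text \<open>Canonicity reduced to decay, in the coordinate in which the poles are \<open>1\<close>
  and \<open>- 1\<close>. For \<open>f = Im s\<close> the two sectors move backwards with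
  \<open>Im s\<close>; their dependence on the sheet of \<open>x\<close> is the whole source of the
  shift of the label.\<close>

definition canonical_at :: "real \<Rightarrow> (complex \<Rightarrow> complex^2^2) \<Rightarrow> bool" where
 "canonical_at f F \<longleftrightarrow> (\<forall>c. 0 < c + f \<and> c + f < pi / 2 \<longrightarrow> decays_along F 2 c) \<and>
   (\<forall>c. pi / 2 < c + f \<and> c + f < pi \<longrightarrow> decays_along F 1 c)"

lemma canonical_at_exists:
 assumes tr: "P0 $ 2 $ 2 = - P0 $ 1 $ 1" "P1 $ 2 $ 2 = - P1 $ 1 $ 1"
  and sum: "P0 $ 1 $ 1 + P1 $ 1 $ 1 = - k / 2"
 obtains F where "mat_ode (log_system (two_pole (exp s) 1 P0 P1)) F log_plane"
  "\<And>h. h \<in> log_plane \<Longrightarrow> det (F h) = 1" "canonical_at (Im s) F"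
proof -
 define t where "t = exp (Re s)"
 define c where "c = exp (\<i> * of_real (Im s))"
 have t: "t > 0" by (simp add: t_def)
 have c: "cmod c = 1" by (simp add: c_def)
 have es: "exp s = of_real t * exp (\<i> * of_real (Im s))"
  unfolding t_def using exp_eq_polar[of s] by (simp add: cis_conv_exp)
 obtain F where F: "mat_ode (log_system (two_pole (of_real t) c P0 P1)) F log_plane" "\<And>h. h \<in> log_plane \<Longrightarrow> det (F h) = 1"
  "\<And>d. d > 0 \<Longrightarrow> canonical_asymp t k F d"
  using canonical_solution_log_exists[OF two_pole_rank1[OF tr sum c] t] by blast
 show ?thesis
 proof (rule that[of "\<lambda>h. F (h + \<i> * of_real (Im s))"])
  show "mat_ode (log_system (two_pole (exp s) 1 P0 P1)) (\<lambda>h. F (h + \<i> * of_real (Im s))) log_plane"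
   unfolding mat_ode_def
  proof
   fix h assume "h \<in> log_plane"
   then have "h + \<i> * of_real (Im s) \<in> log_plane" by (simp add: log_plane_imag_shift)
   moreover have "((\<lambda>h. h + \<i> * of_real (Im s)) has_field_derivative 1) (at h)"
    by (auto intro!: derivative_eq_intros)
   ultimately
   have "has_mderiv (\<lambda>h. F (h + \<i> * of_real (Im s)))
     (scale_mat 1 (log_system (two_pole (of_real t) c P0 P1) (h + \<i> * of_real (Im s)) ** F (h + \<i> * of_real (Im s)))) h"
    by (intro has_mderiv_chain[where f = "\<lambda>h. h + \<i> * of_real (Im s)"] mat_odeD[OF F(1)])
   then show "has_mderiv (\<lambda>h. F (h + \<i> * of_real (Im s)))
     (log_system (two_pole (exp s) 1 P0 P1) h ** F (h + \<i> * of_real (Im s))) h"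
    unfolding c_def two_pole_log_rotate[OF es] by (simp add: scale_mat_def vec_lambda_eta)
  qed
  show "det (F (h + \<i> * of_real (Im s))) = 1" if "h \<in> log_plane" for h
   using F(2) that by (simp add: log_plane_imag_shift)
  have "canonical_asymp t k F (pi / 2)" using F(3) by simp
  from canonical_asymp_decays[OF this t] show "canonical_at (Im s) (\<lambda>h. F (h + \<i> * of_real (Im s)))"
   unfolding canonical_at_def decays_along_shift by blast
 qed
qed

text \<open>Serves to differentiate the transport matrix in the spectral variable: a candidate for
  the derivative is known there, and Gronwall's inequality bounds the remainder
  quadratically.\<close>

lemma has_field_derivative_quadratic:
 fixes f :: "complex \<Rightarrow> complex"
 assumes "\<And>h. cmod h \<le> 1 \<Longrightarrow> cmod (f (z + h) - f z - h * d) \<le> M * (cmod h)\<^sup>2"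
 shows "(f has_field_derivative d) (at z)"
 unfolding DERIV_def
proof (rule Lim_transform2)
 show "((\<lambda>h. d) \<longlongrightarrow> d) (at 0)" by simp
 show "((\<lambda>h. d - (f (z + h) - f z) / h) \<longlongrightarrow> 0) (at 0)"
 proof (rule Lim_null_comparison)
  have "((\<lambda>h. M * cmod h) \<longlongrightarrow> M * cmod 0) (at 0)" by (intro tendsto_intros)
  then show "((\<lambda>h. M * cmod h) \<longlongrightarrow> 0) (at 0)" by simp
  show "\<forall>\<^sub>F h in at 0. norm (d - (f (z + h) - f z) / h) \<le> M * cmod h"
   unfolding eventually_at
  proof (intro exI[of _ 1] conjI ballI impI)
   fix h :: complex assume h: "h \<noteq> 0 \<and> dist h 0 < 1"
   then have "d - (f (z + h) - f z) / h = - ((f (z + h) - f z - h * d) / h)" by (simp add: field_simps)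
   then have "norm (d - (f (z + h) - f z) / h) = cmod (f (z + h) - f z - h * d) / cmod h" by (simp add: norm_divide)
   also have "\<dots> \<le> M * (cmod h)\<^sup>2 / cmod h" using h by (intro divide_right_mono assms) auto
   also have "\<dots> = M * cmod h" using h by (simp add: power2_eq_square)
   finally show "norm (d - (f (z + h) - f z) / h) \<le> M * cmod h" .
  qed simp
 qed
qed

lemma exp_log_plane_avoids: "h \<in> log_plane \<Longrightarrow> exp h \<in> - {1, - 1}"
proof -
 assume "h \<in> log_plane"
 then have "exp (Re h) > 1" by (simp add: log_plane_def)
 then have "cmod (exp h) > 1" by simp
 then show ?thesis by (metis ComplI insertE norm_minus_cancel norm_one order_less_irrefl singletonD)
qed

section \<open>Zero curvature and the flow in the deformation parameter\<close>

definition comm :: "complex^2^2 \<Rightarrow> complex^2^2 \<Rightarrow> complex^2^2" where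
 "comm A B = A ** B - B ** A"

text \<open>The system for \<open>(y, z, u)\<close> in commutator form, with
  \<open>s = ln x\<close>. Each residue evolves by the commutator with the deformation matrix
  \<open>CC z s\<close> taken at its own pole: \<open>z = - 1\<close> for \<open>A0\<close> and
  \<open>z = 1\<close> for \<open>A1\<close>.\<close>

locale isomonodromic =
 fixes A0 A1 :: "complex \<Rightarrow> complex^2^2" and G :: "complex set" and \<theta> :: complex
 assumes G: "open G" "connected G"
  and tr: "\<And>s. s \<in> G \<Longrightarrow> A0 s $ 2 $ 2 = - A0 s $ 1 $ 1" "\<And>s. s \<in> G \<Longrightarrow> A1 s $ 2 $ 2 = - A1 s $ 1 $ 1"
  and sum: "\<And>s. s \<in> G \<Longrightarrow> A0 s $ 1 $ 1 + A1 s $ 1 $ 1 = - \<theta> / 2"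
  and dA0: "\<And>s. s \<in> G \<Longrightarrow> has_mderiv A0 (comm (A0 s + A1 s + scale_mat (\<theta> / 2) sigma3) (A0 s)) s"
  and dA1: "\<And>s. s \<in> G \<Longrightarrow> has_mderiv A1 (comm (scale_mat (exp s / 2) sigma3 + (A0 s + A1 s + scale_mat (\<theta> / 2) sigma3)) (A1 s)) s"
begin

definition AA :: "complex \<Rightarrow> complex \<Rightarrow> complex^2^2" where
 "AA s = two_pole (exp s) 1 (A0 s) (A1 s)"

text \<open>The off-diagonal part of \<open>A0 s + A1 s\<close>: by \<open>tr\<close> and
  \<open>sum\<close> the multiple of \<open>sigma3\<close> cancels its diagonal.\<close>

definition C0 :: "complex \<Rightarrow> complex^2^2" where
 "C0 s = A0 s + A1 s + scale_mat (\<theta> / 2) sigma3"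

definition CC :: "complex \<Rightarrow> complex \<Rightarrow> complex^2^2" where
 "CC z s = scale_mat (exp s * (z + 1) / 4) sigma3 + C0 s"

lemma C0_holo: "mat_holo C0 G"
proof -
 have "has_mderiv C0 (comm (C0 s) (A0 s) + comm (scale_mat (exp s / 2) sigma3 + C0 s) (A1 s) + 0) s" if "s \<in> G" for s
  unfolding C0_def by (intro has_mderiv_add dA0 dA1 that has_mderiv_const)
 from mat_holo_if_mderiv[OF this G(1)] show ?thesis .
qed

lemma CC_holo: "mat_holo (CC z) G"
 using C0_holo unfolding mat_holo_def CC_def vector_add_component scale_mat_entry
 by (auto intro!: holomorphic_intros)

lemma CC_trace_free: "trace_free (CC z) G"
 using tr by (simp add: trace_free_def CC_def C0_def)

lemma CC_add: "CC (z + h) s = CC z s + scale_mat (h * exp s / 4) sigma3"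
 by (simp add: mat_eq_iff CC_def algebra_simps add_divide_distrib)

text \<open>The compatibility condition of the equation in \<open>x\<close> with coefficient
  \<open>AA s x\<close> and the equation in \<open>s\<close> with coefficient \<open>CC x s\<close>.
  The last summand is the derivative of \<open>CC x s\<close> with respect to
  \<open>x\<close>.\<close>

lemma zero_curvature:
 assumes "s \<in> G" "x \<noteq> 1" "x \<noteq> - 1"
 shows "has_mderiv (\<lambda>s. AA s x) (CC x s ** AA s x - AA s x ** CC x s + scale_mat (exp s / 4) sigma3) s"
proof -
 have e: "((\<lambda>s. exp s / 4) has_field_derivative exp s / 4) (at s)" by (auto intro!: derivative_eq_intros)
 have c: "((\<lambda>s. a) has_field_derivative 0) (at s)" for a :: complex by simp
 have z: "x + 1 \<noteq> 0" "x - 1 \<noteq> 0" using assms by (auto simp: eq_neg_iff_add_eq_0)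
 have "has_mderiv (\<lambda>s. AA s x) ((scale_mat (exp s / 4) sigma3 + scale_mat (exp s / 4) 0) +
   (scale_mat 0 (A0 s) + scale_mat (1 / (x + 1)) (comm (C0 s) (A0 s))) +
   (scale_mat 0 (A1 s) + scale_mat (1 / (x - 1)) (comm (scale_mat (exp s / 2) sigma3 + C0 s) (A1 s)))) s"
  unfolding AA_def two_pole_def C0_def
  by (intro has_mderiv_add has_mderiv_scale e c has_mderiv_const dA0 dA1 assms(1))
 also have "((scale_mat (exp s / 4) sigma3 + scale_mat (exp s / 4) 0) +
   (scale_mat 0 (A0 s) + scale_mat (1 / (x + 1)) (comm (C0 s) (A0 s))) +
   (scale_mat 0 (A1 s) + scale_mat (1 / (x - 1)) (comm (scale_mat (exp s / 2) sigma3 + C0 s) (A1 s))))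
  = CC x s ** AA s x - AA s x ** CC x s + scale_mat (exp s / 4) sigma3" (is "?L = ?R")
 proof -
  have lin: "CC x s ** AA s x - AA s x ** CC x s =
   scale_mat (exp s / 4) (comm (C0 s) sigma3) + scale_mat (exp s / 4) (comm sigma3 (A0 s + A1 s))
   + scale_mat (1 / (x + 1)) (comm (C0 s) (A0 s)) + scale_mat (1 / (x - 1)) (comm (scale_mat (exp s / 2) sigma3 + C0 s) (A1 s))"
  proof -
   define a where "a = 1 / (x + 1)"
   define b where "b = 1 / (x - 1)"
   define q where "q = exp s * (x + 1) / 4"
   define e where "e = exp s"
   \<comment> \<open>The factor \<open>x + 1\<close> in \<open>CC\<close> cancels the pole at
     \<open>- 1\<close>. At the other pole, \<open>x + 1 = (x - 1) + 2\<close> leaves the extra term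
     that appears in the equation of \<open>A1\<close>.\<close>
   have k: "q * a = e / 4" "q * b = e / 4 + e / 2 * b"
   proof -
    have ab: "(x + 1) * a = 1" "(x - 1) * b = 1" using z by (simp_all add: a_def b_def)
    have "q * a = e / 4 * ((x + 1) * a)" by (simp add: q_def e_def)
    then show "q * a = e / 4" unfolding ab by simp
    have "q * b = e / 4 * ((x - 1) * b) + e / 2 * b" by (simp add: q_def e_def algebra_simps diff_divide_distrib)
    then show "q * b = e / 4 + e / 2 * b" unfolding ab by simp
   qed
   have "CC x s ** AA s x - AA s x ** CC x s = scale_mat (q * a) (comm sigma3 (A0 s)) + scale_mat (q * b) (comm sigma3 (A1 s))
     + scale_mat (exp s / 4) (comm (C0 s) sigma3) + scale_mat a (comm (C0 s) (A0 s)) + scale_mat b (comm (C0 s) (A1 s))"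
    unfolding CC_def AA_def two_pole_def comm_def a_def[symmetric] b_def[symmetric] q_def[symmetric]
    by (simp add: mat_eq_iff mat_mult_entry algebra_simps)
   also have "\<dots> = scale_mat (exp s / 4) (comm (C0 s) sigma3) + scale_mat (exp s / 4) (comm sigma3 (A0 s + A1 s))
    + scale_mat a (comm (C0 s) (A0 s)) + scale_mat b (comm (scale_mat (exp s / 2) sigma3 + C0 s) (A1 s))"
    unfolding k e_def comm_def by (simp add: mat_eq_iff mat_mult_entry algebra_simps)
   finally show ?thesis unfolding a_def b_def .
  qed
  have "comm sigma3 (A0 s + A1 s) = - comm (C0 s) sigma3"
   by (simp add: comm_def C0_def mat_eq_iff mat_mult_entry algebra_simps)
  then have "scale_mat (exp s / 4) (comm (C0 s) sigma3) + scale_mat (exp s / 4) (comm sigma3 (A0 s + A1 s)) = 0"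
   by (simp add: mat_eq_iff)
  then show ?thesis unfolding lin by (simp add: mat_eq_iff)
 qed
 finally show ?thesis .
qed

text \<open>The flow in \<open>s\<close> at fixed \<open>v\<close>.  It has no singularity at \<open>v = 1, - 1\<close> and intertwines the systems at
 different values of \<open>s\<close>.\<close>

lemma transport_exists:
 assumes s': "s' \<in> G"
 obtains T a b d0 where "d0 > 0" "ball s' d0 \<subseteq> G" "a \<ge> 0" "b \<ge> 0"
  "\<And>v s. s \<in> ball s' d0 \<Longrightarrow> norm (T v s) \<le> norm (mat 1 :: complex^2^2) * exp ((a * cmod v + b) * dist s' s)"
  "\<And>v s. s \<in> ball s' d0 \<Longrightarrow> det (T v s) = 1"
  "\<And>v s. s \<in> ball s' d0 \<Longrightarrow> v \<noteq> 1 \<Longrightarrow> v \<noteq> - 1 \<Longrightarrow>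
    has_mderiv (\<lambda>v. T v s) (AA s v ** T v s - T v s ** AA s' v) v"
proof -
 obtain r where r: "r > 0" "cball s' r \<subseteq> G" using G(1) s' open_contains_cball by blast
 define S where "S = ball s' r"
 have S: "open S" "S \<subseteq> G" "S \<subseteq> cball s' r" "s' \<in> S" "connected S" using r by (auto simp: S_def)
 have seg: "closed_segment s' z \<subseteq> S" if "z \<in> S" for z
  using that S(4) convex_ball[of s' r] unfolding S_def by (simp add: closed_segment_subset)
 have hol: "mat_holo (CC v) S" for v using CC_holo S(2) by (rule mat_holo_subset)
 have tf: "trace_free (CC v) S" for v using CC_trace_free[of v] S(2) by (auto simp: trace_free_def)
 have "\<exists>X. X s' = mat 1 \<and> mat_ode (CC v) X S" for v
  using mat_ode_exists[OF S(1) seg S(4) hol] by metis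
 then obtain T where T: "\<And>v. T v s' = mat 1" "\<And>v. mat_ode (CC v) (T v) S" by metis
 obtain k0 where k0: "k0 > 0" "\<And>s. s \<in> cball s' r \<Longrightarrow> norm (C0 s) \<le> k0"
  using mat_holo_bounded[OF C0_holo compact_cball r(2)] by blast
 have "bounded (exp ` cball s' r)" by (intro compact_imp_bounded compact_continuous_image continuous_intros compact_cball)
 then obtain k1 where k1: "k1 > 0" "\<And>s. s \<in> cball s' r \<Longrightarrow> cmod (exp s) \<le> k1"
  unfolding bounded_pos by auto
 define n3 where "n3 = norm (sigma3 :: complex^2^2)"
 define p where "p = k1 * n3 / 4"
 define q where "q = p + k0"
 have p: "0 \<le> p" "0 \<le> q" "0 \<le> n3" using k1 k0 by (auto simp: p_def q_def n3_def)
 have nE: "norm (scale_mat (exp s / 4) sigma3) \<le> p" if "s \<in> S" for s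
  unfolding norm_scale_mat norm_divide using k1(2)[of s] that S(3) p(3)
  by (auto simp: p_def n3_def[symmetric] intro!: mult_right_mono)
 have nC: "norm (CC v s) \<le> p * cmod v + q" if "s \<in> S" for v s
 proof -
  have "norm (CC v s) \<le> norm (scale_mat (exp s * (v + 1) / 4) sigma3) + norm (C0 s)"
   unfolding CC_def by (rule norm_triangle_ineq)
  also have "norm (C0 s) \<le> k0" using k0(2) that S(3) by blast
  also have "norm (scale_mat (exp s * (v + 1) / 4) sigma3) = cmod (v + 1) * norm (scale_mat (exp s / 4) sigma3)"
   by (simp add: norm_scale_mat norm_mult norm_divide)
  also have "\<dots> \<le> (cmod v + 1) * p"
   using nE[OF that] norm_triangle_ineq[of v 1] by (intro mult_mono) auto
  finally show ?thesis by (simp add: q_def algebra_simps)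
 qed
 define N1 where "N1 = norm (mat 1 :: complex^2^2)"
 have gr: "norm (X s) \<le> (norm (X s') + e * r) * exp (8 * (p * m + q) * dist s' s)"
  if X: "\<And>w. w \<in> S \<Longrightarrow> has_mderiv X (CC v w ** X w + E w) w" and E: "\<And>w. w \<in> S \<Longrightarrow> norm (E w) \<le> e" "0 \<le> e"
   and m: "cmod v \<le> m" and s: "s \<in> S" for X E v e m s
 proof -
  have m0: "0 \<le> m" using m norm_ge_zero order.trans by blast
  have "norm (X s) \<le> (norm (X s') + e * dist s' s) * exp (8 * (p * m + q) * dist s' s)"
  proof (rule mat_gronwall)
   fix w assume w: "w \<in> closed_segment s' s"
   then have wS: "w \<in> S" using seg[OF s] by blast
   show "has_mderiv X (CC v w ** X w + E w) w" by (rule X[OF wS])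
   have "norm (CC v w ** X w + E w) \<le> 8 * norm (CC v w) * norm (X w) + e"
    by (rule order.trans[OF norm_triangle_ineq]) (intro add_mono norm_mat_mult_le E wS)
   also have "8 * norm (CC v w) * norm (X w) \<le> 8 * (p * m + q) * norm (X w)"
   proof (intro mult_right_mono mult_left_mono)
    show "norm (CC v w) \<le> p * m + q" using nC[OF wS, of v] mult_left_mono[OF m p(1)] by linarith
   qed auto
   finally show "norm (CC v w ** X w + E w) \<le> 8 * (p * m + q) * norm (X w) + e" by simp
  qed (use p m0 E in auto)
  also have "\<dots> \<le> (norm (X s') + e * r) * exp (8 * (p * m + q) * dist s' s)"
   using s E(2) by (intro mult_right_mono add_mono mult_left_mono) (auto simp: S_def)
  finally show ?thesis .
 qed
 have Tode: "has_mderiv (T v) (CC v w ** T v w + 0) w" if "w \<in> S" for v w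
  using mat_odeD[OF T(2) that] by simp
 have nT: "norm (T v s) \<le> N1 * exp (8 * (p * m + q) * dist s' s)" if "s \<in> S" "cmod v \<le> m" for v s m
  using gr[of "T v" v "\<lambda>_. 0" 0 m s] Tode that by (simp add: T(1) N1_def)
 show ?thesis
 proof (rule that[of r "8 * p" "8 * q" T])
  show "r > 0" "ball s' r \<subseteq> G" "0 \<le> 8 * p" "0 \<le> 8 * q" using r S(2) p by (auto simp: S_def)
  fix v s assume "s \<in> ball s' r"
  then have s: "s \<in> S" by (simp add: S_def)
  show "norm (T v s) \<le> norm (mat 1 :: complex^2^2) * exp ((8 * p * cmod v + 8 * q) * dist s' s)"
   using nT[OF s order_refl, of v] by (simp add: N1_def algebra_simps)
  show "det (T v s) = 1"
   using det_mat_ode_const[OF T(2) tf S(1) S(5) S(4) s] by (simp add: T(1))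
  assume z: "v \<noteq> 1" "v \<noteq> - 1"
  \<comment> \<open>The expected derivative of \<open>T v s\<close> in \<open>v\<close>. By zero
    curvature \<open>Q\<close> satisfies the equation in \<open>s\<close> that results from
    differentiating the one for \<open>T\<close> with respect to \<open>v\<close>, and both start
    from 0 at \<open>s'\<close>.\<close>
  define Q where "Q s = AA s v ** T v s - T v s ** AA s' v" for s
  have Qd: "has_mderiv Q (CC v w ** Q w + scale_mat (exp w / 4) sigma3 ** T v w) w" if w: "w \<in> S" for w
  proof -
   have "has_mderiv Q (((CC v w ** AA w v - AA w v ** CC v w + scale_mat (exp w / 4) sigma3) ** T v w
     + AA w v ** (CC v w ** T v w)) - (CC v w ** T v w) ** AA s' v) w"
    unfolding Q_def
    by (intro has_mderiv_diff has_mderiv_mult zero_curvature has_mderiv_mult_const(1) mat_odeD[OF T(2)] w z) (use S(2) w in auto)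
   also have "((CC v w ** AA w v - AA w v ** CC v w + scale_mat (exp w / 4) sigma3) ** T v w
     + AA w v ** (CC v w ** T v w)) - (CC v w ** T v w) ** AA s' v
    = CC v w ** Q w + scale_mat (exp w / 4) sigma3 ** T v w"
    unfolding Q_def by (simp add: mat_eq_iff mat_mult_entry algebra_simps)
   finally show ?thesis .
  qed
  have Q0: "Q s' = 0" by (simp add: Q_def T(1))
  define m where "m = cmod v + 1"
  define L where "L = exp (8 * (p * m + q) * r)"
  have m: "0 \<le> m" by (simp add: m_def)
  have L: "exp (8 * (p * m + q) * dist s' w) \<le> L" if "w \<in> S" for w
   unfolding L_def using that p m by (auto simp: S_def intro!: mult_left_mono)
  have NT: "norm (T x w) \<le> N1 * L" if "w \<in> S" "cmod x \<le> m" for x w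
  proof -
   have "norm (T x w) \<le> N1 * exp (8 * (p * m + q) * dist s' w)" by (rule nT[OF that])
   also have "\<dots> \<le> N1 * L" by (intro mult_left_mono L that) (simp add: N1_def)
   finally show ?thesis .
  qed
  have L0: "0 \<le> L" "0 \<le> N1" by (auto simp: L_def N1_def)
  define M1 where "M1 = 8 * p * (N1 * L) * r * L"
  have M1: "0 \<le> M1" using p L0 r by (simp add: M1_def)
  have D1: "norm (T (v + h) w - T v w) \<le> cmod h * M1" if h: "cmod h \<le> 1" and w: "w \<in> S" for h w
  proof -
   have zh: "cmod (v + h) \<le> m" "cmod v \<le> m" using h norm_triangle_ineq[of v h] by (auto simp: m_def)
   define e where "e = cmod h * (8 * p * (N1 * L))"
   have e0: "0 \<le> e" using p L0 by (simp add: e_def)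
   have "norm (T (v + h) w - T v w) \<le> (norm (T (v + h) s' - T v s') + e * r) * exp (8 * (p * m + q) * dist s' w)"
   proof (rule gr[where E = "\<lambda>w. scale_mat (h * exp w / 4) sigma3 ** T (v + h) w", OF _ _ e0 zh(2) w])
    fix w assume w: "w \<in> S"
    have "has_mderiv (\<lambda>w. T (v + h) w - T v w) (CC (v + h) w ** T (v + h) w - CC v w ** T v w) w"
     by (intro has_mderiv_diff mat_odeD[OF T(2)] w)
    also have "CC (v + h) w ** T (v + h) w - CC v w ** T v w = CC v w ** (T (v + h) w - T v w) + scale_mat (h * exp w / 4) sigma3 ** T (v + h) w"
     unfolding CC_add by (simp add: mat_eq_iff mat_mult_entry algebra_simps)
    finally show "has_mderiv (\<lambda>w. T (v + h) w - T v w) (CC v w ** (T (v + h) w - T v w) + scale_mat (h * exp w / 4) sigma3 ** T (v + h) w) w" .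
    have "norm (scale_mat (h * exp w / 4) sigma3 ** T (v + h) w) \<le> 8 * norm (scale_mat (h * exp w / 4) sigma3) * norm (T (v + h) w)"
     by (rule norm_mat_mult_le)
    also have "norm (scale_mat (h * exp w / 4) sigma3) = cmod h * norm (scale_mat (exp w / 4) sigma3)"
     by (simp add: norm_scale_mat norm_mult norm_divide)
    also have "8 * (cmod h * norm (scale_mat (exp w / 4) sigma3)) * norm (T (v + h) w) \<le> 8 * (cmod h * p) * (N1 * L)"
     by (intro mult_mono mult_left_mono nE NT w zh) (use p in auto)
    finally show "norm (scale_mat (h * exp w / 4) sigma3 ** T (v + h) w) \<le> e" by (simp add: e_def mult_ac)
   qed
   also have "\<dots> \<le> (e * r) * L" unfolding T(1) using L[OF w] e0 r by (simp add: mult_left_mono)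
   finally show ?thesis by (simp add: e_def M1_def mult_ac)
  qed
  define M2 where "M2 = 8 * p * M1 * r * L"
  \<comment> \<open>The remainder of the linear approximation solves the flow equation with a
    forcing term that contains the difference estimated in \<open>D1\<close>; one more application
    of Gronwall's inequality makes it quadratic in \<open>h\<close>.\<close>
  have D2: "norm (T (v + h) s - T v s - scale_mat h (Q s)) \<le> M2 * (cmod h)\<^sup>2" if h: "cmod h \<le> 1" for h
  proof -
   have zm: "cmod v \<le> m" by (simp add: m_def)
   define e where "e = cmod h * (8 * p * (cmod h * M1))"
   have e0: "0 \<le> e" using p M1 by (simp add: e_def)
   have "norm (T (v + h) s - T v s - scale_mat h (Q s)) \<le> (norm (T (v + h) s' - T v s' - scale_mat h (Q s')) + e * r) * exp (8 * (p * m + q) * dist s' s)"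
   proof (rule gr[where E = "\<lambda>w. scale_mat (h * exp w / 4) sigma3 ** (T (v + h) w - T v w)", OF _ _ e0 zm s])
    fix w assume w: "w \<in> S"
    have hd: "((\<lambda>_. h) has_field_derivative 0) (at w)" by simp
    have "has_mderiv (\<lambda>w. T (v + h) w - T v w - scale_mat h (Q w)) (CC (v + h) w ** T (v + h) w - CC v w ** T v w
      - (scale_mat 0 (Q w) + scale_mat h (CC v w ** Q w + scale_mat (exp w / 4) sigma3 ** T v w))) w"
     by (intro has_mderiv_diff mat_odeD[OF T(2)] w has_mderiv_scale hd Qd)
    also have "CC (v + h) w ** T (v + h) w - CC v w ** T v w
      - (scale_mat 0 (Q w) + scale_mat h (CC v w ** Q w + scale_mat (exp w / 4) sigma3 ** T v w))
     = CC v w ** (T (v + h) w - T v w - scale_mat h (Q w)) + scale_mat (h * exp w / 4) sigma3 ** (T (v + h) w - T v w)"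
     unfolding CC_add by (simp add: mat_eq_iff mat_mult_entry algebra_simps)
    finally show "has_mderiv (\<lambda>w. T (v + h) w - T v w - scale_mat h (Q w))
     (CC v w ** (T (v + h) w - T v w - scale_mat h (Q w)) + scale_mat (h * exp w / 4) sigma3 ** (T (v + h) w - T v w)) w" .
    have "norm (scale_mat (h * exp w / 4) sigma3 ** (T (v + h) w - T v w)) \<le> 8 * norm (scale_mat (h * exp w / 4) sigma3) * norm (T (v + h) w - T v w)"
     by (rule norm_mat_mult_le)
    also have "norm (scale_mat (h * exp w / 4) sigma3) = cmod h * norm (scale_mat (exp w / 4) sigma3)"
     by (simp add: norm_scale_mat norm_mult norm_divide)
    also have "8 * (cmod h * norm (scale_mat (exp w / 4) sigma3)) * norm (T (v + h) w - T v w) \<le> 8 * (cmod h * p) * (cmod h * M1)"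
     by (intro mult_mono mult_left_mono nE D1 w h) (use p in auto)
    finally show "norm (scale_mat (h * exp w / 4) sigma3 ** (T (v + h) w - T v w)) \<le> e" by (simp add: e_def mult_ac)
   qed
   also have "\<dots> \<le> (e * r) * L"
   proof -
    have "scale_mat h 0 = 0" by (simp add: mat_eq_iff)
    then show ?thesis unfolding T(1) Q0 using L[OF s] e0 r by (simp add: mult_left_mono)
   qed
   finally show ?thesis by (simp add: e_def M2_def mult_ac power2_eq_square)
  qed
  show "has_mderiv (\<lambda>v. T v s) (AA s v ** T v s - T v s ** AA s' v) v"
   unfolding Q_def[symmetric] has_mderiv_def
  proof (intro allI has_field_derivative_quadratic[where M = M2])
   fix i j :: 2 and h :: complex assume "cmod h \<le> 1"
   from D2[OF this] norm_entry_le[of "T (v + h) s - T v s - scale_mat h (Q s)" i j]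
   show "cmod (T (v + h) s $ i $ j - T v s $ i $ j - h * Q s $ i $ j) \<le> M2 * (cmod h)\<^sup>2" by simp
  qed
 qed
qed

definition fundamental_at :: "complex \<Rightarrow> (complex \<Rightarrow> complex^2^2) \<Rightarrow> bool" where
 "fundamental_at s F \<longleftrightarrow> mat_ode (log_system (AA s)) F log_plane \<and> (\<forall>h\<in>log_plane. det (F h) = 1) \<and> canonical_at (Im s) F"

lemma AA_trace_free: "s \<in> G \<Longrightarrow> trace_free (AA s) S"
 unfolding AA_def by (rule two_pole_trace_free[OF tr])

lemma fundamental_at_exists: "s \<in> G \<Longrightarrow> \<exists>F. fundamental_at s F"
 using canonical_at_exists[OF tr sum, of s s] unfolding fundamental_at_def AA_def by metis

text \<open>The gauge matrix \<open>T\<close> is a function of \<open>exp h\<close>, not merely of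
  \<open>h\<close>; being single-valued, it leaves the monodromy of what it multiplies unchanged.
  Decaying fundamental solutions at one point differ by diagonal factors, so the relation can be
  demanded of all of them at once.\<close>

definition intertwined :: "complex \<Rightarrow> complex \<Rightarrow> bool" where
 "intertwined s' s \<longleftrightarrow> (\<exists>T. mat_holo T (- {1, - 1}) \<and> (\<forall>z. z \<noteq> 1 \<and> z \<noteq> - 1 \<longrightarrow> det (T z) = 1) \<and>
   (\<forall>F' F. fundamental_at s' F' \<and> fundamental_at s F \<longrightarrow>
    (\<exists>D. D $ 1 $ 2 = 0 \<and> D $ 2 $ 1 = 0 \<and> det D = 1 \<and> (\<forall>h\<in>log_plane. T (exp h) ** F' h = F h ** D))))"

lemma intertwined_sym:
 assumes "intertwined s' s"
 shows "intertwined s s'"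
proof -
 obtain T where T: "mat_holo T (- {1, - 1})" "\<And>z. z \<noteq> 1 \<Longrightarrow> z \<noteq> - 1 \<Longrightarrow> det (T z) = 1"
  "\<And>F' F. fundamental_at s' F' \<Longrightarrow> fundamental_at s F \<Longrightarrow>
    \<exists>D. D $ 1 $ 2 = 0 \<and> D $ 2 $ 1 = 0 \<and> det D = 1 \<and> (\<forall>h\<in>log_plane. T (exp h) ** F' h = F h ** D)"
  using assms unfolding intertwined_def by blast
 show ?thesis unfolding intertwined_def
 proof (intro exI[of _ "\<lambda>z. adj2 (T z)"] conjI allI impI)
  show "mat_holo (\<lambda>z. adj2 (T z)) (- {1, - 1})" by (rule mat_holo_adj2[OF T(1)])
  show "det (adj2 (T z)) = 1" if "z \<noteq> 1 \<and> z \<noteq> - 1" for z using T(2) that by simp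
  fix F F' assume "fundamental_at s F \<and> fundamental_at s' F'"
  then obtain D where D: "D $ 1 $ 2 = 0" "D $ 2 $ 1 = 0" "det D = 1" "\<And>h. h \<in> log_plane \<Longrightarrow> T (exp h) ** F' h = F h ** D"
   using T(3) by blast
  show "\<exists>D. D $ 1 $ 2 = 0 \<and> D $ 2 $ 1 = 0 \<and> det D = 1 \<and> (\<forall>h\<in>log_plane. adj2 (T (exp h)) ** F h = F' h ** D)"
  proof (intro exI[of _ "adj2 D"] conjI ballI)
   fix h assume e: "h \<in> log_plane"
   have d: "det (T (exp h)) = 1" using T(2) exp_log_plane_avoids[OF e] by blast
   have "F h = (T (exp h) ** F' h) ** adj2 D" unfolding D(4)[OF e] by (rule adj2_cancel(3)[OF D(3), symmetric])
   then show "adj2 (T (exp h)) ** F h = F' h ** adj2 D"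
    using adj2_cancel(2)[OF d] by (simp add: matrix_mul_assoc[symmetric])
  qed (use D in auto)
 qed
qed

lemma intertwined_trans:
 assumes "intertwined s1 s2" "intertwined s2 s3" "s2 \<in> G"
 shows "intertwined s1 s3"
proof -
 obtain T where T: "mat_holo T (- {1, - 1})" "\<And>z. z \<noteq> 1 \<Longrightarrow> z \<noteq> - 1 \<Longrightarrow> det (T z) = 1"
  "\<And>F' F. fundamental_at s1 F' \<Longrightarrow> fundamental_at s2 F \<Longrightarrow>
    \<exists>D. D $ 1 $ 2 = 0 \<and> D $ 2 $ 1 = 0 \<and> det D = 1 \<and> (\<forall>h\<in>log_plane. T (exp h) ** F' h = F h ** D)"
  using assms(1) unfolding intertwined_def by blast
 obtain T' where T': "mat_holo T' (- {1, - 1})" "\<And>z. z \<noteq> 1 \<Longrightarrow> z \<noteq> - 1 \<Longrightarrow> det (T' z) = 1"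
  "\<And>F' F. fundamental_at s2 F' \<Longrightarrow> fundamental_at s3 F \<Longrightarrow>
    \<exists>D. D $ 1 $ 2 = 0 \<and> D $ 2 $ 1 = 0 \<and> det D = 1 \<and> (\<forall>h\<in>log_plane. T' (exp h) ** F' h = F h ** D)"
  using assms(2) unfolding intertwined_def by blast
 show ?thesis unfolding intertwined_def
 proof (intro exI[of _ "\<lambda>z. T' z ** T z"] conjI allI impI)
  show "mat_holo (\<lambda>z. T' z ** T z) (- {1, - 1})" by (rule mat_holo_mult[OF T'(1) T(1)])
  show "det (T' z ** T z) = 1" if "z \<noteq> 1 \<and> z \<noteq> - 1" for z using T(2) T'(2) that by (simp add: det_mul)
  fix F1 F3 assume f: "fundamental_at s1 F1 \<and> fundamental_at s3 F3"
  obtain F2 where f2: "fundamental_at s2 F2" using fundamental_at_exists[OF assms(3)] by blast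
  obtain D where D: "D $ 1 $ 2 = 0" "D $ 2 $ 1 = 0" "det D = 1" "\<And>h. h \<in> log_plane \<Longrightarrow> T (exp h) ** F1 h = F2 h ** D"
   using T(3) f f2 by blast
  obtain D' where D': "D' $ 1 $ 2 = 0" "D' $ 2 $ 1 = 0" "det D' = 1" "\<And>h. h \<in> log_plane \<Longrightarrow> T' (exp h) ** F2 h = F3 h ** D'"
   using T'(3) f f2 by blast
  show "\<exists>D. D $ 1 $ 2 = 0 \<and> D $ 2 $ 1 = 0 \<and> det D = 1 \<and> (\<forall>h\<in>log_plane. (T' (exp h) ** T (exp h)) ** F1 h = F3 h ** D)"
  proof (intro exI[of _ "D' ** D"] conjI ballI)
   fix h assume e: "h \<in> log_plane"
   have "(T' (exp h) ** T (exp h)) ** F1 h = T' (exp h) ** (F2 h ** D)"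
    unfolding matrix_mul_assoc[symmetric] D(4)[OF e] ..
   also have "\<dots> = (F3 h ** D') ** D" unfolding matrix_mul_assoc D'(4)[OF e] ..
   finally show "(T' (exp h) ** T (exp h)) ** F1 h = F3 h ** (D' ** D)" by (simp add: matrix_mul_assoc)
  qed (use D D' in \<open>auto simp: mat_mult_entry det_mul\<close>)
 qed
qed

text \<open>Transport by a short step costs at most part of the decay rate, so recessive columns
  stay recessive. The two reference rays lie in the middle of the sectors belonging to
  \<open>s'\<close> and remain in those belonging to \<open>s\<close> while the imaginary parts
  differ by less than \<open>pi / 4\<close>. Then \<open>decays_along_unique\<close> compares the
  transported solution with the one at \<open>s\<close>.\<close>

lemma intertwined_local:
 assumes s': "s' \<in> G"
 shows "\<exists>m>0. ball s' m \<subseteq> G \<and> (\<forall>s\<in>ball s' m. intertwined s' s)"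
proof -
 obtain T a b r where r: "r > 0" "ball s' r \<subseteq> G" and ab: "a \<ge> 0" "b \<ge> 0"
  and nT: "\<And>z s. s \<in> ball s' r \<Longrightarrow> norm (T z s) \<le> norm (mat 1 :: complex^2^2) * exp ((a * cmod z + b) * dist s' s)"
  and dT: "\<And>z s. s \<in> ball s' r \<Longrightarrow> det (T z s) = 1"
  and T': "\<And>z s. s \<in> ball s' r \<Longrightarrow> z \<noteq> 1 \<Longrightarrow> z \<noteq> - 1 \<Longrightarrow>
    has_mderiv (\<lambda>z. T z s) (AA s z ** T z s - T z s ** AA s' z) z"
  using transport_exists[OF s'] by metis
 define c1 where "c1 = 3 * pi / 4 - Im s'"
 define c2 where "c2 = pi / 4 - Im s'"
 \<comment> \<open>A reference solution, needed because the admissible step must be fixed before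
   \<open>F'\<close> is given. Any other \<open>F'\<close> differs from it by a diagonal factor and
   inherits its decay rates.\<close>
 obtain F0 where F0: "fundamental_at s' F0" using fundamental_at_exists[OF s'] by blast
 have dec0: "decays_along F0 1 c1" "decays_along F0 2 c2"
  using F0 unfolding fundamental_at_def canonical_at_def by (auto simp: c1_def c2_def)
 obtain k1 K1 R1 where k1: "k1 > 0" "\<And>r i. r \<ge> R1 \<Longrightarrow> cmod (F0 (Complex r c1) $ i $ 1) \<le> K1 * exp (- (k1 * exp r))" "K1 > 0"
  using decays_alongE[OF dec0(1)] by metis
 obtain k2 K2 R2 where k2: "k2 > 0" "\<And>r i. r \<ge> R2 \<Longrightarrow> cmod (F0 (Complex r c2) $ i $ 2) \<le> K2 * exp (- (k2 * exp r))" "K2 > 0"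
  using decays_alongE[OF dec0(2)] by metis
 \<comment> \<open>The last two bounds leave at least half of each decay rate after multiplication
   by \<open>T\<close>; \<open>a + 1\<close> rather than \<open>a\<close> avoids dividing by
   zero.\<close>
 define m where "m = Min {r, pi / 4, k1 / (2 * (a + 1)), k2 / (2 * (a + 1))}"
 have m: "m > 0" "m \<le> r" "m \<le> pi / 4" "m \<le> k1 / (2 * (a + 1))" "m \<le> k2 / (2 * (a + 1))"
 proof -
  show "m > 0" using r(1) k1(1) k2(1) ab(1) by (auto simp: m_def)
  show "m \<le> r" "m \<le> pi / 4" "m \<le> k1 / (2 * (a + 1))" "m \<le> k2 / (2 * (a + 1))"
   unfolding m_def by (rule Min_le; simp)+
 qed
 have tr_dec: "decays_along (\<lambda>h. T (exp h) s ** F h) j c"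
  if s: "s \<in> ball s' m" and k: "k > 0" "m \<le> k / (2 * (a + 1))" and K: "K > 0"
   and d: "\<And>r i. r \<ge> R \<Longrightarrow> cmod (F (Complex r c) $ i $ j) \<le> K * exp (- (k * exp r))" for s k K R F j c
 proof -
  define N where "N = norm (mat 1 :: complex^2^2)"
  define e where "e = dist s' s"
  have e: "0 \<le> e" "e < m" using s by (auto simp: e_def)
  have ae: "a * e \<le> k / 2"
  proof -
   have "(a + 1) * e \<le> (a + 1) * (k / (2 * (a + 1)))" using e k ab by (intro mult_left_mono) auto
   also have "\<dots> = k / 2" using ab by (simp add: field_simps)
   finally show ?thesis using e by (simp add: algebra_simps)
  qed
  have "cmod ((T (exp (Complex r c)) s ** F (Complex r c)) $ i $ j) \<le> (2 * N * exp (b * e) * K) * exp (- ((k / 2) * exp r))" if "R \<le> r" for r i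
  proof -
   have n: "norm (T (exp (Complex r c)) s) \<le> N * exp ((a * exp r + b) * e)"
    using nT[of s "exp (Complex r c)"] s m(2) by (simp add: N_def e_def)
   have "cmod ((T (exp (Complex r c)) s ** F (Complex r c)) $ i $ j) \<le>
     cmod (T (exp (Complex r c)) s $ i $ 1) * cmod (F (Complex r c) $ 1 $ j) + cmod (T (exp (Complex r c)) s $ i $ 2) * cmod (F (Complex r c) $ 2 $ j)"
    unfolding mat_mult_entry by (rule order.trans[OF norm_triangle_ineq]) (simp add: norm_mult)
   also have "\<dots> \<le> N * exp ((a * exp r + b) * e) * (K * exp (- (k * exp r))) + N * exp ((a * exp r + b) * e) * (K * exp (- (k * exp r)))"
    by (intro add_mono mult_mono d that order.trans[OF norm_entry_le n]) (auto simp: N_def)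
   also have "\<dots> = (2 * N * exp (b * e) * K) * exp (a * e * exp r - k * exp r)"
    by (simp add: exp_add exp_diff exp_minus field_simps)
   also have "\<dots> \<le> (2 * N * exp (b * e) * K) * exp (- ((k / 2) * exp r))"
   proof (intro mult_left_mono)
    have "a * e * exp r \<le> (k / 2) * exp r" using ae by (intro mult_right_mono) auto
    moreover have "k * exp r = (k / 2) * exp r + (k / 2) * exp r" by simp
    ultimately have "a * e * exp r - k * exp r \<le> - ((k / 2) * exp r)" by linarith
    then show "exp (a * e * exp r - k * exp r) \<le> exp (- ((k / 2) * exp r))" by (simp only: exp_le_cancel_iff)
   qed (use K in \<open>auto simp: N_def\<close>)
   finally show ?thesis .
  qed
  then show ?thesis unfolding decays_along_def using half_gt_zero[OF k(1)] by blast
 qed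
 have "intertwined s' s" if s: "s \<in> ball s' m" for s
  unfolding intertwined_def
 proof (intro exI[of _ "\<lambda>z. T z s"] conjI allI impI)
  have sr: "s \<in> ball s' r" using s m(2) by auto
  then have sG: "s \<in> G" using r(2) by blast
  show "mat_holo (\<lambda>z. T z s) (- {1, - 1})"
  proof (rule mat_holo_if_mderiv)
   show "has_mderiv (\<lambda>z. T z s) (AA s z ** T z s - T z s ** AA s' z) z" if "z \<in> - {1, - 1}" for z
    using T'[OF sr] that by simp
  qed (simp add: open_Compl finite_imp_closed)
  show "det (T z s) = 1" for z by (rule dT[OF sr])
  fix F' F assume "fundamental_at s' F' \<and> fundamental_at s F"
  then have f': "mat_ode (log_system (AA s')) F' log_plane" "\<And>h. h \<in> log_plane \<Longrightarrow> det (F' h) = 1" "canonical_at (Im s') F'"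
   and f: "mat_ode (log_system (AA s)) F log_plane" "\<And>h. h \<in> log_plane \<Longrightarrow> det (F h) = 1" "canonical_at (Im s) F"
   by (auto simp: fundamental_at_def)
  define X where "X h = T (exp h) s ** F' h" for h
  have X: "mat_ode (log_system (AA s)) X log_plane"
   unfolding mat_ode_def
  proof
   fix h assume e: "h \<in> log_plane"
   have n: "exp h \<noteq> 1" "exp h \<noteq> - 1" using exp_log_plane_avoids[OF e] by auto
   have "has_mderiv X (scale_mat (exp h) (AA s (exp h) ** T (exp h) s - T (exp h) s ** AA s' (exp h)) ** F' h
     + T (exp h) s ** (log_system (AA s') h ** F' h)) h"
    unfolding X_def by (intro has_mderiv_mult mat_odeD[OF f'(1) e] has_mderiv_chain[where f = exp] T'[OF sr n] DERIV_exp)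
   also have "scale_mat (exp h) (AA s (exp h) ** T (exp h) s - T (exp h) s ** AA s' (exp h)) ** F' h
     + T (exp h) s ** (log_system (AA s') h ** F' h) = log_system (AA s) h ** X h"
    unfolding X_def log_system_def by (simp add: mat_eq_iff mat_mult_entry algebra_simps)
   finally show "has_mderiv X (log_system (AA s) h ** X h) h" .
  qed
  have tf: "trace_free (log_system (AA s)) log_plane" by (rule log_system_trace_free[OF AA_trace_free[OF sG]])
  have 1: "1 \<in> log_plane" by (simp add: log_plane_def)
  define D where "D = adj2 (F 1) ** X 1"
  have XD: "X h = F h ** D" if "h \<in> log_plane" for h
   unfolding D_def by (rule mat_ode_unique[OF f(1) X tf log_plane(1,3) 1 f(2)[OF 1] that])
  have dX: "det (X 1) = 1" using f'(2)[OF 1] dT[OF sr] by (simp add: X_def det_mul)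
  have detD: "det D = 1" using f(2)[OF 1] dX by (simp add: D_def det_mul)
  have "\<bar>Im s - Im s'\<bar> < m" using s abs_Im_le_cmod[of "s - s'"] by (auto simp: dist_norm norm_minus_commute)
  then have im: "\<bar>Im s - Im s'\<bar> < pi / 4" using m(3) by linarith
  have "0 < c2 + Im s" "c2 + Im s < pi / 2" "pi / 2 < c1 + Im s" "c1 + Im s < pi"
   using im unfolding c1_def c2_def abs_less_iff by linarith+
  then have decf: "decays_along F 1 c1" "decays_along F 2 c2"
   using f(3) unfolding canonical_at_def by blast+
  have dec': "decays_along F' 1 c1" "decays_along F' 2 c2"
   using f'(3) unfolding canonical_at_def by (auto simp: c1_def c2_def)
  have rel: "F' h = F0 h ** (adj2 (F0 1) ** F' 1)" if "h \<in> log_plane" for h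
   using F0 that 1 unfolding fundamental_at_def
   by (intro mat_ode_unique[OF _ f'(1) log_system_trace_free[OF AA_trace_free[OF s']] log_plane(1,3)]) auto
  have lp: "Complex r c \<in> log_plane" if "r > 0" for r c using that by (simp add: log_plane_def)
  define E where "E = adj2 (F0 1) ** F' 1"
  have E0: "E $ 1 $ 2 = 0" "E $ 2 $ 1 = 0"
   using decays_along_unique[OF _ dec0(2) dec'(2) dec0(1) dec'(1), of E] rel[OF lp] F0 lp
   unfolding E_def fundamental_at_def by auto
  have decX: "decays_along X 1 c1" "decays_along X 2 c2"
  proof -
   have a1: "cmod (F' (Complex r c1) $ i $ 1) \<le> (K1 * (cmod (E $ 1 $ 1) + 1)) * exp (- (k1 * exp r))" if "r \<ge> max R1 1" for r i
   proof -
    have "cmod (F' (Complex r c1) $ i $ 1) = cmod (F0 (Complex r c1) $ i $ 1) * cmod (E $ 1 $ 1)"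
     using rel[OF lp, of r c1] that unfolding E_def[symmetric] by (simp add: mat_mult_entry E0 norm_mult)
    also have "\<dots> \<le> (K1 * exp (- (k1 * exp r))) * (cmod (E $ 1 $ 1) + 1)"
     using that k1(3) by (intro mult_mono k1(2)) auto
    finally show ?thesis by (simp add: mult_ac)
   qed
   have a2: "cmod (F' (Complex r c2) $ i $ 2) \<le> (K2 * (cmod (E $ 2 $ 2) + 1)) * exp (- (k2 * exp r))" if "r \<ge> max R2 1" for r i
   proof -
    have "cmod (F' (Complex r c2) $ i $ 2) = cmod (F0 (Complex r c2) $ i $ 2) * cmod (E $ 2 $ 2)"
     using rel[OF lp, of r c2] that unfolding E_def[symmetric] by (simp add: mat_mult_entry E0 norm_mult)
    also have "\<dots> \<le> (K2 * exp (- (k2 * exp r))) * (cmod (E $ 2 $ 2) + 1)"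
     using that k2(3) by (intro mult_mono k2(2)) auto
    finally show ?thesis by (simp add: mult_ac)
   qed
   have p: "K1 * (cmod (E $ 1 $ 1) + 1) > 0" "K2 * (cmod (E $ 2 $ 2) + 1) > 0"
    using k1(3) k2(3) by (auto intro!: mult_pos_pos add_nonneg_pos)
   show "decays_along X 1 c1" unfolding X_def by (rule tr_dec[OF s k1(1) m(4) p(1) a1])
   show "decays_along X 2 c2" unfolding X_def by (rule tr_dec[OF s k2(1) m(5) p(2) a2])
  qed
  have "D $ 1 $ 2 = 0" "D $ 2 $ 1 = 0"
   using decays_along_unique[OF _ decf(2) decX(2) decf(1) decX(1), of D] XD[OF lp] f(2)[OF lp] by auto
  then show "\<exists>D. D $ 1 $ 2 = 0 \<and> D $ 2 $ 1 = 0 \<and> det D = 1 \<and> (\<forall>h\<in>log_plane. T (exp h) s ** F' h = F h ** D)"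
   using XD detD unfolding X_def by blast
 qed
 then show ?thesis using m r(2) by (intro exI[of _ m]) auto
qed

text \<open>Being intertwined is symmetric and transitive and holds nearby; on a connected set such
  a relation holds between any two points.\<close>

theorem isomonodromy: "s' \<in> G \<Longrightarrow> s \<in> G \<Longrightarrow> intertwined s' s"
proof (rule connected_equivalence_relation[OF G(2)])
 fix a assume "a \<in> G"
 from intertwined_local[OF this] obtain e where "e > 0" "ball a e \<subseteq> G" "\<forall>s\<in>ball a e. intertwined a s" by blast
 then show "\<exists>T. openin (top_of_set G) T \<and> a \<in> T \<and> (\<forall>x\<in>T. intertwined a x)"
  by (intro exI[of _ "ball a e"]) (auto intro: open_subset)
qed (auto intro: intertwined_sym intertwined_trans)

end

section \<open>Sheets and monodromy\<close>

definition upper :: "complex set" where "upper = {z. Im z > 0}"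
definition lower :: "complex set" where "lower = {z. Im z < 0}"

definition slit :: "real set \<Rightarrow> complex set" where
 "slit J = {z. Im z = 0 \<longrightarrow> Re z \<notin> J}"

text \<open>The letter names the open real interval that is kept: left of \<open>- 1\<close>,
  between the poles, right of \<open>1\<close>.\<close>

abbreviation "slitL \<equiv> slit {-1..}"
abbreviation "slitM \<equiv> slit ({..-1} \<union> {1..})"
abbreviation "slitR \<equiv> slit {..1}"

lemma half_planes: "open upper" "open lower" "connected upper" "connected lower"
 unfolding upper_def lower_def
 by (auto intro: open_halfspace_Im_gt open_halfspace_Im_lt convex_connected convex_halfspace_Im_gt convex_halfspace_Im_lt)

lemma open_slit: "closed J \<Longrightarrow> open (slit J)"
proof -
 assume J: "closed J"
 have "- slit J = {z. Im z = 0} \<inter> Re -` J" by (auto simp: slit_def)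
 moreover have "closed ({z. Im z = 0} \<inter> Re -` J)"
  by (intro closed_Int closed_Collect_eq continuous_intros closed_vimage J)
 ultimately show ?thesis by (simp add: open_closed)
qed

lemma starlike_slit:
 assumes "c \<notin> J" "\<And>x r. x \<notin> J \<Longrightarrow> 0 \<le> r \<Longrightarrow> r \<le> 1 \<Longrightarrow> c + r * (x - c) \<notin> J"
 shows "starlike (slit J)"
 unfolding starlike_def
proof (intro bexI[of _ "of_real c"] ballI subsetI)
 show "of_real c \<in> slit J" using assms(1) by (simp add: slit_def)
 fix z v assume z: "z \<in> slit J" and "v \<in> closed_segment (of_real c) z"
 then obtain r where r: "0 \<le> r" "r \<le> 1" "v = of_real c + of_real r * (z - of_real c)"
  unfolding closed_segment_iff_affine by blast
 have im: "Im v = r * Im z" and re: "Re v = c + r * (Re z - c)" by (simp_all add: r(3))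
 show "v \<in> slit J" unfolding slit_def mem_Collect_eq
 proof
  assume "Im v = 0"
  then consider "r = 0" | "Im z = 0" using im by auto
  then show "Re v \<notin> J"
  proof cases
   case 1 then show ?thesis using assms(1) re by simp
  next
   case 2 then show ?thesis using assms(2)[OF _ r(1,2)] z re by (simp add: slit_def)
  qed
 qed
qed

lemma slits:
 "open slitL" "open slitM" "open slitR" "starlike slitL" "starlike slitM" "starlike slitR"
 "1 \<notin> slitL" "- 1 \<notin> slitL" "1 \<notin> slitM" "- 1 \<notin> slitM" "1 \<notin> slitR" "- 1 \<notin> slitR"
 "upper \<subseteq> slit J" "lower \<subseteq> slit J"
proof -
 show "starlike slitL"
 proof (rule starlike_slit[of "-2"])
  fix x r :: real assume "x \<notin> {-1..}" "0 \<le> r" "r \<le> 1"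
  then have "r * (x + 2) < 1" using mult_left_le_one_le[of "x + 2" r] mult_nonneg_nonpos[of r "x + 2"] by (cases "x + 2 \<ge> 0") auto
  then show "- 2 + r * (x - - 2) \<notin> {-1..}" by simp
 qed simp
 show "starlike slitR"
 proof (rule starlike_slit[of 2])
  fix x r :: real assume "x \<notin> {..1}" "0 \<le> r" "r \<le> 1"
  then have "r * (2 - x) < 1" using mult_left_le_one_le[of "2 - x" r] mult_nonneg_nonpos[of r "2 - x"] by (cases "2 - x \<ge> 0") auto
  then have "r * (x - 2) > - 1" by (simp add: algebra_simps)
  then show "2 + r * (x - 2) \<notin> {..1}" by simp
 qed simp
 show "starlike slitM"
 proof (rule starlike_slit[of 0])
  fix x r :: real assume "x \<notin> {..-1} \<union> {1..}" "0 \<le> r" "r \<le> 1"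
  then have "\<bar>x\<bar> < 1" "\<bar>r * x\<bar> \<le> \<bar>x\<bar>" by (auto simp: abs_mult mult_left_le_one_le)
  then have "\<bar>r * x\<bar> < 1" by linarith
  then show "0 + r * (x - 0) \<notin> {..-1} \<union> {1..}" by (auto simp: abs_less_iff)
 qed simp
 show "open slitL" "open slitR" by (simp_all add: open_slit)
 show "open slitM" by (intro open_slit closed_Un) simp_all
qed (auto simp: slit_def upper_def lower_def)

definition sheets :: "(complex \<Rightarrow> complex^2^2) \<Rightarrow> (complex \<Rightarrow> complex^2^2) \<Rightarrow>
  (complex \<Rightarrow> complex^2^2) \<Rightarrow> (complex \<Rightarrow> complex^2^2) \<Rightarrow> (complex \<Rightarrow> complex^2^2) \<Rightarrow> bool" where
 "sheets A X XL XM XR \<longleftrightarrow>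
   mat_ode A XL slitL \<and> mat_ode A XM slitM \<and> mat_ode A XR slitR \<and>
   (\<forall>z\<in>upper. XL z = X z \<and> XM z = X z \<and> XR z = X z) \<and>
   (\<forall>z\<in>slitL. det (XL z) = 1) \<and> (\<forall>z\<in>slitM. det (XM z) = 1) \<and> (\<forall>z\<in>slitR. det (XR z) = 1)"

text \<open>An anticlockwise loop about \<open>- 1\<close> leaves the upper half plane through the
  left interval and returns through the middle one, so in the lower half plane \<open>XL\<close> has
  to be expressed by \<open>XM\<close>. The loop about \<open>1\<close> does the same with
  \<open>XM\<close> and \<open>XR\<close>.\<close>

definition jumps :: "(complex \<Rightarrow> complex^2^2) \<Rightarrow> (complex \<Rightarrow> complex^2^2) \<Rightarrow> (complex \<Rightarrow> complex^2^2) \<Rightarrow>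
  complex^2^2 \<Rightarrow> complex^2^2 \<Rightarrow> bool" where
 "jumps XL XM XR M0 M1 \<longleftrightarrow> (\<forall>z\<in>lower. XL z = XM z ** M0 \<and> XM z = XR z ** M1)"

lemma extend_solution:
 assumes "open U" "starlike U" "upper \<subseteq> U" "mat_holo A U" "trace_free A U"
  and X: "mat_ode A X upper" "\<And>z. z \<in> upper \<Longrightarrow> det (X z) = 1"
 obtains Z where "mat_ode A Z U" "\<And>z. z \<in> U \<Longrightarrow> det (Z z) = 1" "\<And>z. z \<in> upper \<Longrightarrow> Z z = X z"
proof -
 obtain W where W: "mat_ode A W U" "\<And>z. z \<in> U \<Longrightarrow> det (W z) = 1"
  using mat_ode_fundamental[OF assms(1,2,4,5)] by blast
 have i: "\<i> \<in> upper" by (simp add: upper_def)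
 then have iU: "\<i> \<in> U" using assms(3) by blast
 define C where "C = adj2 (W \<i>) ** X \<i>"
 show ?thesis
 proof (rule that[of "\<lambda>z. W z ** C"])
  show "mat_ode A (\<lambda>z. W z ** C) U" by (rule mat_ode_mult_const[OF W(1)])
  show "det (W z ** C) = 1" if "z \<in> U" for z
   using W(2) that iU X(2)[OF i] by (simp add: det_mul C_def)
  have tf: "trace_free A upper" using assms(3,5) by (auto simp: trace_free_def)
  show "W z ** C = X z" if "z \<in> upper" for z
   unfolding C_def
   by (rule mat_ode_unique[OF mat_ode_subset[OF W(1) assms(3)] X(1) tf half_planes(1,3) i W(2)[OF iU] that, symmetric])
 qed
qed

lemma sheets_exist:
 assumes tr: "P0 $ 2 $ 2 = - P0 $ 1 $ 1" "P1 $ 2 $ 2 = - P1 $ 1 $ 1"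
  and X: "mat_ode (two_pole x 1 P0 P1) X upper" "\<And>z. z \<in> upper \<Longrightarrow> det (X z) = 1"
 obtains XL XM XR where "sheets (two_pole x 1 P0 P1) X XL XM XR"
proof -
 let ?A = "two_pole x 1 P0 P1"
 obtain XL where L: "mat_ode ?A XL slitL" "\<And>z. z \<in> slitL \<Longrightarrow> det (XL z) = 1" "\<And>z. z \<in> upper \<Longrightarrow> XL z = X z"
  using extend_solution[OF slits(1,4,13) two_pole_holo[OF slits(7,8)] two_pole_trace_free[OF tr] X] by blast
 obtain XM where M: "mat_ode ?A XM slitM" "\<And>z. z \<in> slitM \<Longrightarrow> det (XM z) = 1" "\<And>z. z \<in> upper \<Longrightarrow> XM z = X z"
  using extend_solution[OF slits(2,5,13) two_pole_holo[OF slits(9,10)] two_pole_trace_free[OF tr] X] by blast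
 obtain XR where R: "mat_ode ?A XR slitR" "\<And>z. z \<in> slitR \<Longrightarrow> det (XR z) = 1" "\<And>z. z \<in> upper \<Longrightarrow> XR z = X z"
  using extend_solution[OF slits(3,6,13) two_pole_holo[OF slits(11,12)] two_pole_trace_free[OF tr] X] by blast
 show ?thesis using that L M R unfolding sheets_def by blast
qed

lemma mat_ode_exp:
 assumes "mat_ode A X U" "\<And>h. h \<in> V \<Longrightarrow> exp h \<in> U"
 shows "mat_ode (log_system A) (\<lambda>h. X (exp h)) V"
 unfolding mat_ode_def
proof
 fix h assume "h \<in> V"
 from has_mderiv_chain[where f = exp, OF mat_odeD[OF assms(1) assms(2)[OF this]] DERIV_exp]
 show "has_mderiv (\<lambda>h. X (exp h)) (log_system A h ** X (exp h)) h"
  by (simp add: log_system_def scaleC_mat_mult)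
qed

lemma Im_exp_pos: "0 < Im h \<Longrightarrow> Im h < pi \<Longrightarrow> exp h \<in> upper"
 by (simp add: upper_def Im_exp sin_gt_zero)

text \<open>A large anticlockwise circle goes down through the left interval and comes back through
  the right one. In the lower half plane \<open>XL = XM ** M0 = XR ** M1 ** M0\<close>, which
  explains the order of the factors.\<close>

lemma big_circle:
 assumes tr: "P0 $ 2 $ 2 = - P0 $ 1 $ 1" "P1 $ 2 $ 2 = - P1 $ 1 $ 1"
  and sh: "sheets (two_pole x 1 P0 P1) X XL XM XR" "jumps XL XM XR M0 M1"
  and F: "mat_ode (log_system (two_pole x 1 P0 P1)) F log_plane" "\<And>h. h \<in> log_plane \<Longrightarrow> det (F h) = 1"
  and FX: "\<And>h. h \<in> log_plane \<Longrightarrow> 0 < Im h \<Longrightarrow> Im h < pi \<Longrightarrow> F h = X (exp h)"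
  and h: "h \<in> log_plane"
 shows "F (h + period) = F h ** (M1 ** M0)"
proof -
 let ?A = "log_system (two_pole x 1 P0 P1)"
 note sh' = sh(1)[unfolded sheets_def] and j = sh(2)[unfolded jumps_def]
 \<comment> \<open>Overlapping windows of width \<open>2 * pi\<close>: \<open>exp\<close> maps
   \<open>S 0\<close> into \<open>slitL\<close> and \<open>S pi\<close> into \<open>slitR\<close>,
   and the change from one to the other takes place over the lower half plane.\<close>
 define S where "S a = {h. 0 < Re h \<and> a < Im h \<and> Im h < a + 2 * pi}" for a
 have S: "open (S a)" "connected (S a)" "S a \<subseteq> log_plane" for a
 proof -
  have e: "S a = {h. 0 < Re h} \<inter> {h. a < Im h} \<inter> {h. Im h < a + 2 * pi}" by (auto simp: S_def)
  show "open (S a)" unfolding e by (intro open_Int open_halfspace_Re_gt open_halfspace_Im_gt open_halfspace_Im_lt)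
  show "connected (S a)" unfolding e
   by (intro convex_connected convex_Int convex_halfspace_Re_gt convex_halfspace_Im_gt convex_halfspace_Im_lt)
  show "S a \<subseteq> log_plane" by (auto simp: S_def log_plane_def)
 qed
 have tf: "trace_free ?A V" for V
  using two_pole_trace_free[OF tr, of x 1 UNIV] by (simp add: trace_free_def log_system_def)
 have low: "exp h \<in> lower" if "pi < Im h" "Im h < 2 * pi" for h
 proof -
  have "sin (Im h - pi) > 0" using that by (intro sin_gt_zero) auto
  then show ?thesis by (simp add: lower_def Im_exp mult_pos_neg)
 qed
 have eL: "exp h \<in> slitL" if "h \<in> S 0" for h
 proof (cases "Im h = pi")
  case True
  have "exp h = of_real (- exp (Re h))" using True by (simp add: exp_eq_polar cis_conv_exp[symmetric])
  moreover have "exp (Re h) > 1" using that by (simp add: S_def)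
  ultimately show ?thesis by (simp add: slit_def)
 next
  case False
  then consider "Im h < pi" | "Im h > pi" by linarith
  then show ?thesis using Im_exp_pos[of h] low[of h] slits(13,14) that by cases (auto simp: S_def)
 qed
 have per: "exp (h + period) = exp h" for h by (simp add: exp_add)
 have eR: "exp h \<in> slitR" if "h \<in> S pi" for h
 proof (cases "Im h = 2 * pi")
  case True
  have "exp h = of_real (exp (Re h))" using True by (simp add: exp_eq_polar)
  moreover have "exp (Re h) > 1" using that by (simp add: S_def)
  ultimately show ?thesis by (simp add: slit_def)
 next
  case False
  then consider "Im h < 2 * pi" | "Im h > 2 * pi" by linarith
  then show ?thesis
  proof cases
   case 1 then show ?thesis using low[of h] slits(14) that by (auto simp: S_def)
  next
   case 2
   have "exp (h - period) \<in> upper" using 2 that by (intro Im_exp_pos) (auto simp: S_def)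
   then show ?thesis using per[of "h - period"] slits(13) by auto
  qed
 qed
 define p1 where "p1 = Complex 1 (pi / 2)"
 have p1: "p1 \<in> S 0" "p1 \<in> log_plane" by (simp_all add: p1_def S_def log_plane_def)
 have L: "F h = XL (exp h)" if "h \<in> S 0" for h
 proof (rule mat_ode_unique_eq[OF mat_ode_subset[OF F(1) S(3)] mat_ode_exp[OF _ eL] tf S(1,2) p1(1) F(2)[OF p1(2)] that])
  show "mat_ode (two_pole x 1 P0 P1) XL slitL" using sh' by blast
  have "exp p1 \<in> upper" by (rule Im_exp_pos) (simp_all add: p1_def)
  then show "F p1 = XL (exp p1)" using FX[OF p1(2)] sh' by (simp add: p1_def)
 qed
 define p2 where "p2 = Complex 1 (3 * pi / 2)"
 have p2: "p2 \<in> S 0" "p2 \<in> S pi" "p2 \<in> log_plane" by (simp_all add: p2_def S_def log_plane_def)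
 have R: "F h = XR (exp h) ** (M1 ** M0)" if "h \<in> S pi" for h
 proof (rule mat_ode_unique_eq[OF mat_ode_subset[OF F(1) S(3)] mat_ode_mult_const[OF mat_ode_exp[OF _ eR]] tf S(1,2) p2(2) F(2)[OF p2(3)] that])
  show "mat_ode (two_pole x 1 P0 P1) XR slitR" using sh' by blast
  have "exp p2 \<in> lower" by (rule low) (simp_all add: p2_def)
  then have "XL (exp p2) = XR (exp p2) ** M1 ** M0" using j by simp
  then show "F p2 = XR (exp p2) ** (M1 ** M0)" using L[OF p2(1)] by (simp add: matrix_mul_assoc)
 qed
 have strip: "F (h + period) = F h ** (M1 ** M0)" if "h \<in> log_plane" "0 < Im h" "Im h < pi" for h
 proof -
  have "h + period \<in> S pi" using that by (simp add: S_def log_plane_def)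
  from R[OF this] have "F (h + period) = XR (exp h) ** (M1 ** M0)" unfolding per .
  also have "XR (exp h) = F h" using Im_exp_pos[OF that(2,3)] sh' FX[OF that] by simp
  finally show ?thesis .
 qed
 have ode2: "mat_ode ?A (\<lambda>h. F (h + period)) log_plane"
  by (rule mat_ode_translate[OF F(1)]) (simp add: log_plane_def log_system_def per)
 have "F h ** (M1 ** M0) = F (h + period)"
 proof -
  have "F (h + period) = F h ** (adj2 (F p1) ** F (p1 + period))"
   by (rule mat_ode_unique[OF F(1) ode2 tf log_plane(1,3) p1(2) F(2)[OF p1(2)] h])
  also have "F (p1 + period) = F p1 ** (M1 ** M0)" by (rule strip[OF p1(2)]) (simp_all add: p1_def)
  also have "adj2 (F p1) ** (F p1 ** (M1 ** M0)) = M1 ** M0" by (rule adj2_cancel(2)[OF F(2)[OF p1(2)]])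
  finally show ?thesis ..
 qed
 then show ?thesis ..
qed

section \<open>Analytic continuation along lassos\<close>

definition germ_family :: "(real \<Rightarrow> complex) \<Rightarrow> (real \<Rightarrow> complex \<Rightarrow> complex^2^2) \<Rightarrow> bool" where
 "germ_family g F \<longleftrightarrow> (\<forall>r\<in>{0..1}. \<exists>U e. open U \<and> e > 0 \<and>
      (\<forall>i j. (\<lambda>l. F r l $ i $ j) holomorphic_on U) \<and>
      (\<forall>r'\<in>{0..1}. \<bar>r' - r\<bar> < e \<longrightarrow>
       g r' \<in> U \<and> (\<forall>\<^sub>F l in nhds (g r'). F r' l = F r l)))"

lemma analytic_continuation_along_iff:
 "analytic_continuation_along p f g \<longleftrightarrow> (\<exists>F. germ_family p F \<and>
   (\<forall>\<^sub>F l in nhds (p 0). F 0 l = f l) \<and> (\<forall>\<^sub>F l in nhds (p 1). F 1 l = g l))"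
 unfolding analytic_continuation_along_def germ_family_def by simp

lemma mat_holo_identity:
 assumes "mat_holo X S" "mat_holo Y S" "open S" "connected S" "p \<in> S" "\<forall>\<^sub>F l in nhds p. X l = Y l" "z \<in> S"
 shows "X z = Y z"
proof -
 obtain T where T: "open T" "p \<in> T" "\<And>l. l \<in> T \<Longrightarrow> X l = Y l"
  using assms(6) by (auto simp: eventually_nhds)
 have "X z $ i $ j = Y z $ i $ j" for i j
 proof (rule analytic_continuation_open[of "S \<inter> T" S "\<lambda>w. X w $ i $ j" "\<lambda>w. Y w $ i $ j"])
  show "(\<lambda>w. X w $ i $ j) holomorphic_on S" "(\<lambda>w. Y w $ i $ j) holomorphic_on S"
   using assms(1,2) by (auto simp: mat_holo_def)
 qed (use T assms in auto)
 then show ?thesis by (simp add: vec_eq_iff)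
qed

text \<open>By the identity theorem, agreement of the germ with \<open>W\<close> is a locally
  constant property of the parameter, and the interval is connected. The equivalence form lets a
  continuation be followed forwards from its start and backwards from its end.\<close>

lemma germ_family_in_domain:
 assumes F: "germ_family g F" and ab: "0 \<le> a" "a \<le> b" "b \<le> 1" and g: "continuous_on {a..b} g"
  and U: "open U" "\<And>t. t \<in> {a..b} \<Longrightarrow> g t \<in> U" and W: "mat_holo W U"
 shows "(\<forall>\<^sub>F l in nhds (g a). F a l = W l) \<longleftrightarrow> (\<forall>\<^sub>F l in nhds (g b). F b l = W l)"
proof -
 define P where "P t \<longleftrightarrow> (\<forall>\<^sub>F l in nhds (g t). F t l = W l)" for t
 have loc: "\<exists>T. openin (top_of_set {a..b}) T \<and> t \<in> T \<and> (\<forall>x\<in>T. P t \<longleftrightarrow> P x)" if t: "t \<in> {a..b}" for t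
 proof -
  have t01: "t \<in> {0..1}" using t ab by auto
  obtain V d where V': "open V \<and> d > 0 \<and> (\<forall>i j. (\<lambda>l. F t l $ i $ j) holomorphic_on V) \<and>
    (\<forall>t'\<in>{0..1}. \<bar>t' - t\<bar> < d \<longrightarrow> g t' \<in> V \<and> (\<forall>\<^sub>F l in nhds (g t'). F t' l = F t l))"
   using bspec[OF F[unfolded germ_family_def] t01] by blast
  then have V: "open V" "d > 0" "mat_holo (F t) V"
   unfolding mat_holo_def by blast+
  have V4: "g t' \<in> V" "\<forall>\<^sub>F l in nhds (g t'). F t' l = F t l" if "t' \<in> {0..1}" "\<bar>t' - t\<bar> < d" for t'
   using V' that by blast+
  have "g t \<in> V \<inter> U" using V4(1)[OF t01] V(2) U(2)[OF t] by auto
  then obtain r where r: "r > 0" "ball (g t) r \<subseteq> V \<inter> U" using V(1) U(1) open_contains_ball by (metis open_Int)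
  define B where "B = ball (g t) r"
  have B: "open B" "connected B" "B \<subseteq> V" "B \<subseteq> U" "g t \<in> B" using r by (auto simp: B_def)
  define T where "T = {x \<in> {a..b}. g x \<in> B} \<inter> ball t d"
  have "openin (top_of_set {a..b}) T" unfolding T_def
  proof -
   have "openin (top_of_set {a..b}) ({a..b} \<inter> g -` B)" by (rule continuous_openin_preimage_gen[OF g B(1)])
   then have "openin (top_of_set {a..b}) ({a..b} \<inter> g -` B \<inter> ball t d)" by (rule openin_Int_open) simp
   then show "openin (top_of_set {a..b}) ({x \<in> {a..b}. g x \<in> B} \<inter> ball t d)"
    by (rule back_subst[where P = "openin _"]) auto
  qed
  moreover have "t \<in> T" using t B V(2) by (simp add: T_def)
  moreover have "P t \<longleftrightarrow> P x" if x: "x \<in> T" for x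
  proof -
   have xx: "x \<in> {0..1}" "\<bar>x - t\<bar> < d" "g x \<in> B" using x ab by (auto simp: T_def dist_real_def)
   have e: "\<forall>\<^sub>F l in nhds (g x). F x l = F t l" by (rule V4(2)[OF xx(1,2)])
   have hB: "mat_holo (F t) B" "mat_holo W B" using V(3) W B by (auto intro: mat_holo_subset)
   have evB: "\<forall>\<^sub>F l in nhds q. l \<in> B" if "q \<in> B" for q using B(1) that by (rule eventually_nhds_in_open)
   show ?thesis
   proof
    assume "P t"
    then have "F t l = W l" if "l \<in> B" for l
     using mat_holo_identity[OF hB B(1,2) B(5) _ that] by (simp add: P_def)
    then have "\<forall>\<^sub>F l in nhds (g x). F t l = W l" using evB[OF xx(3)] by (auto elim: eventually_mono)
    with e show "P x" unfolding P_def by eventually_elim simp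
   next
    assume "P x"
    then have "\<forall>\<^sub>F l in nhds (g x). F t l = W l" unfolding P_def using e by eventually_elim simp
    then have "F t l = W l" if "l \<in> B" for l
     using mat_holo_identity[OF hB B(1,2) xx(3) _ that] by simp
    then show "P t" unfolding P_def using evB[OF B(5)] by (auto elim: eventually_mono)
   qed
  qed
  ultimately show ?thesis by blast
 qed
 have "P a \<longleftrightarrow> P b"
  by (rule connected_equivalence_relation[of "{a..b}" a b "\<lambda>x y. P x \<longleftrightarrow> P y"]) (use loc ab in auto)
 then show ?thesis by (simp add: P_def)
qed

text \<open>Division by \<open>c\<close> rotates the poles to \<open>1\<close> and
  \<open>- 1\<close>. The base point stays in the upper half plane because
  \<open>\<bar>f\<bar> < pi / 2\<close>, hence so do the straight pieces, and only the circle
  crosses the real axis.\<close>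

lemma lasso_shape:
 assumes f: "\<bar>f\<bar> < pi / 2" and R: "R > 1" and r: "0 < r" and a: "a = 1 \<or> a = (- 1::real)"
 defines "c \<equiv> exp (\<i> * of_real f)"
 defines "g \<equiv> lasso R r (of_real a * c)"
 obtains w where "0 < w" "w < pi"
  "\<And>k. 0 \<le> k \<Longrightarrow> k \<le> 1 / 2 \<Longrightarrow> g k / c \<in> upper"
  "\<And>k. 1 / 2 \<le> k \<Longrightarrow> k \<le> 3 / 4 \<Longrightarrow> g k / c = of_real a + of_real r * cis (w + 2 * pi * (4 * k - 2))"
  "\<And>k. 3 / 4 \<le> k \<Longrightarrow> k \<le> 1 \<Longrightarrow> g k / c \<in> upper"
  "continuous_on {0..1} g" "g 0 = \<i> * of_real R" "g 1 = \<i> * of_real R"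
proof -
 define p where "p = \<i> * complex_of_real R"
 define b where "b = of_real a * c"
 define m where "m = Arg (p - b)"
 define q where "q = b + of_real r * exp (\<i> * of_real m)"
 have c: "c \<noteq> 0" "c = cis f" by (simp_all add: c_def cis_conv_exp)
 have g: "g = linepath p q +++ (part_circlepath b r m (m + 2 * pi) +++ linepath q p)"
  unfolding g_def lasso_def Let_def p_def q_def m_def b_def ..
 have im: "Im (p - b) > 0"
 proof -
  have "Im (p - b) = R - a * sin f" by (simp add: p_def b_def c)
  moreover have "a * sin f \<le> 1" using a sin_le_one[of f] sin_ge_minus_one[of f] by auto
  ultimately show ?thesis using R by simp
 qed
 then have nz: "p - b \<noteq> 0" by auto
 have m: "0 < m" "m < pi" using im Arg_lt_pi[of "p - b"] by (auto simp: m_def)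
 define w where "w = m - f"
 have pc: "Im (p / c) = R * cos f"
 proof -
  have "p / c = p * cis (- f)" unfolding c(2) by (simp add: cis_divide divide_inverse)
  then show ?thesis by (simp add: p_def)
 qed
 have cosp: "cos f > 0" using f by (intro cos_gt_zero_pi) auto
 have "(p - b) / c = of_real (cmod (p - b)) * cis w"
 proof -
  have "p - b = of_real (cmod (p - b)) * cis m" unfolding m_def using Arg_eq[OF nz] by (simp add: cis_conv_exp)
  then have "(p - b) / c = of_real (cmod (p - b)) * (cis m / cis f)" unfolding c(2) by (metis times_divide_eq_right)
  then show ?thesis by (simp add: cis_divide w_def)
 qed
 moreover have "Im ((p - b) / c) = R * cos f" using pc c(1) by (simp add: diff_divide_distrib b_def)
 ultimately have "cmod (p - b) * sin w > 0" using cosp R by simp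
 then have s: "sin w > 0" using nz by (simp add: zero_less_mult_iff)
 have w1: "- pi < w" "w < 3 * pi / 2" using m f by (auto simp: w_def)
 have w: "0 < w" "w < pi"
 proof -
  show "0 < w"
  proof (rule ccontr)
   assume "\<not> 0 < w"
   then have "sin (- w) \<ge> 0" using w1 by (intro sin_ge_zero) auto
   then show False using s by simp
  qed
  show "w < pi"
  proof (rule ccontr)
   assume "\<not> w < pi"
   then have "sin (w - pi) \<ge> 0" using w1 by (intro sin_ge_zero) auto
   then show False using s by simp
  qed
 qed
 have ec: "exp (\<i> * of_real x) / c = cis (x - f)" for x by (simp add: c(2) cis_conv_exp[symmetric] cis_divide)
 have qc: "q / c = of_real a + of_real r * cis w"
  using c(1) ec[of m] by (simp add: q_def b_def add_divide_distrib w_def flip: times_divide_eq_right)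
 have pu: "p / c \<in> upper" using pc cosp R by (simp add: upper_def)
 have qu: "q / c \<in> upper" unfolding qc using r s by (simp add: upper_def)
 have line: "linepath x y k / c \<in> upper" if "x / c \<in> upper" "y / c \<in> upper" "0 \<le> k" "k \<le> 1" for x y k
 proof -
  have "linepath x y k / c = linepath (x / c) (y / c) k"
   by (simp add: linepath_def scaleR_conv_of_real add_divide_distrib)
  moreover have "linepath (x / c) (y / c) k \<in> closed_segment (x / c) (y / c)" using that by (intro linepath_in_path) auto
  moreover have "closed_segment (x / c) (y / c) \<subseteq> upper"
   using that by (intro closed_segment_subset) (auto simp: upper_def convex_halfspace_Im_gt)
  ultimately show ?thesis by auto
 qed
 show ?thesis
 proof (rule that[OF w])
  show "g k / c \<in> upper" if "0 \<le> k" "k \<le> 1 / 2" for k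
   using line[OF pu qu, of "2 * k"] that by (simp add: g joinpaths_def)
  have e1: "exp (\<i> * (2 * complex_of_real pi)) = 1" using exp_two_pi_i by (simp add: mult_ac)
  have circ_start: "part_circlepath b r m (m + 2 * pi) 0 = q" and circ_end: "part_circlepath b r m (m + 2 * pi) 1 = q"
   by (simp_all add: part_circlepath_def linepath_def q_def exp_add distrib_left e1)
  \<comment> \<open>The joins run the first segment for \<open>k\<close> up to 1/2, the circle for
    \<open>k\<close> up to 3/4 and the second segment afterwards, so the parameter on the circle is
    \<open>4 * k - 2\<close>.\<close>
  show "g k / c = of_real a + of_real r * cis (w + 2 * pi * (4 * k - 2))" if t: "1 / 2 \<le> k" "k \<le> 3 / 4" for k
  proof -
   have "g k = part_circlepath b r m (m + 2 * pi) (4 * k - 2)"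
   proof (cases "k = 1 / 2")
    case True
    show ?thesis unfolding True using circ_start by (simp add: g joinpaths_def linepath_def)
   next
    case False
    then show ?thesis using t by (simp add: g joinpaths_def algebra_simps)
   qed
   also have "\<dots> = b + of_real r * exp (\<i> * of_real (m + 2 * pi * (4 * k - 2)))"
    by (simp add: part_circlepath_def linepath_def algebra_simps)
   finally have "g k / c = b / c + of_real r * (exp (\<i> * of_real (m + 2 * pi * (4 * k - 2))) / c)"
    by (simp add: add_divide_distrib)
   then show ?thesis unfolding ec using c(1) by (simp add: b_def w_def algebra_simps)
  qed
  show "g k / c \<in> upper" if t: "3 / 4 \<le> k" "k \<le> 1" for k
  proof -
   have "g k = linepath q p (4 * k - 3)"
   proof (cases "k = 3 / 4")
    case True
    show ?thesis unfolding True using circ_end by (simp add: g joinpaths_def linepath_def)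
   next
    case False
    then show ?thesis using t by (simp add: g joinpaths_def algebra_simps)
   qed
   then show ?thesis using line[OF qu pu, of "4 * k - 3"] t by simp
  qed
  have "path g" unfolding g
   by (intro path_join_imp path_linepath path_part_circlepath)
     (simp_all add: pathstart_def pathfinish_def circ_start circ_end pathstart_join pathfinish_join joinpaths_def linepath_def)
  then show "continuous_on {0..1} g" by (simp add: path_def)
  show "g 0 = \<i> * of_real R" "g 1 = \<i> * of_real R"
   by (simp_all add: g joinpaths_def linepath_def p_def)
 qed
qed

text \<open>The continuation is followed with \<open>W1\<close> from the start and with
  \<open>W2 ** N\<close> backwards from the end. The two meet at \<open>k = 5 / 8\<close>, half-way
  around the circle: its angle \<open>w + pi\<close> there puts the point in the lower half plane.
  On the way \<open>W1\<close> crosses the axis to the left of the pole and \<open>W2\<close> to the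
  right.\<close>

lemma lasso_jump:
 assumes f: "\<bar>f\<bar> < pi / 2" and R: "R > 1" and r: "0 < r" and a: "a = 1 \<or> a = (- 1::real)"
  and U: "open U1" "open U2" "upper \<subseteq> U1" "upper \<subseteq> U2" "lower \<subseteq> U1" "lower \<subseteq> U2"
   "of_real (a - r) \<in> U1" "of_real (a + r) \<in> U2"
  and W: "mat_holo W1 U1" "mat_holo W2 U2"
  and cont: "analytic_continuation_along (lasso R r (of_real a * exp (\<i> * of_real f))) Y (\<lambda>l. Y l ** N)"
  and Y: "\<forall>\<^sub>F l in nhds (\<i> * of_real R). Y l = W1 (l / exp (\<i> * of_real f))"
   "\<forall>\<^sub>F l in nhds (\<i> * of_real R). Y l = W2 (l / exp (\<i> * of_real f))"
 shows "\<exists>x\<in>lower. \<forall>\<^sub>F z in nhds x. W1 z = W2 z ** N"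
proof -
 define c where "c = exp (\<i> * of_real f)"
 have c: "c \<noteq> 0" by (simp add: c_def)
 define p where "p = lasso R r (of_real a * c)"
 obtain w where w: "0 < w" "w < pi"
  and g1: "\<And>k. 0 \<le> k \<Longrightarrow> k \<le> 1 / 2 \<Longrightarrow> p k / c \<in> upper"
  and g2: "\<And>k. 1 / 2 \<le> k \<Longrightarrow> k \<le> 3 / 4 \<Longrightarrow> p k / c = of_real a + of_real r * cis (w + 2 * pi * (4 * k - 2))"
  and g3: "\<And>k. 3 / 4 \<le> k \<Longrightarrow> k \<le> 1 \<Longrightarrow> p k / c \<in> upper"
  and g: "continuous_on {0..1} p" "p 0 = \<i> * of_real R" "p 1 = \<i> * of_real R"
  using lasso_shape[OF f R r a] unfolding p_def c_def by metis
 have circ: "of_real a + of_real r * cis \<psi> \<in> (if \<psi> < pi then upper else if \<psi> = pi then {of_real (a - r)} else if \<psi> < 2 * pi then lower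
   else if \<psi> = 2 * pi then {of_real (a + r)} else upper)" if "0 < \<psi>" "\<psi> < 3 * pi" for \<psi>
 proof -
  have s1: "sin \<psi> > 0" if "\<psi> < pi" using \<open>0 < \<psi>\<close> that by (rule sin_gt_zero)
  have s2: "sin \<psi> < 0" if "pi < \<psi>" "\<psi> < 2 * pi" using sin_gt_zero[of "\<psi> - pi"] that by simp
  have s3: "sin \<psi> > 0" if "2 * pi < \<psi>" using sin_gt_zero[of "\<psi> - 2 * pi"] that \<open>\<psi> < 3 * pi\<close> by (simp add: sin_diff)
  show ?thesis using s1 s2 s3 r
   by (auto simp: upper_def lower_def zero_less_mult_iff mult_less_0_iff)
 qed
 have h1: "p k / c \<in> U1" if "0 \<le> k" "k \<le> 5 / 8" for k
 proof (cases "k \<le> 1 / 2")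
  case True
  then show ?thesis using g1 that U(3) by blast
 next
  case False
  define \<psi> where "\<psi> = w + 2 * pi * (4 * k - 2)"
  have "0 < 2 * pi * (4 * k - 2)" using False by simp
  moreover have "2 * pi * (4 * k - 2) \<le> 2 * pi * (1 / 2)" using that by (intro mult_left_mono) auto
  ultimately have "0 < \<psi>" "\<psi> < 2 * pi" using w unfolding \<psi>_def by linarith+
  then show ?thesis using circ[of \<psi>] g2[of k] False that U(3,5,7) unfolding \<psi>_def by (auto split: if_splits)
 qed
 have h2: "p k / c \<in> U2" if "5 / 8 \<le> k" "k \<le> 1" for k
 proof (cases "3 / 4 \<le> k")
  case True
  then show ?thesis using g3 that U(4) by blast
 next
  case False
  define \<psi> where "\<psi> = w + 2 * pi * (4 * k - 2)"
  have "2 * pi * (1 / 2) \<le> 2 * pi * (4 * k - 2)" using that by (intro mult_left_mono) auto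
  moreover have "2 * pi * (4 * k - 2) \<le> 2 * pi * 1" using False by (intro mult_left_mono) auto
  ultimately have "pi < \<psi>" "\<psi> < 3 * pi" using w unfolding \<psi>_def by linarith+
  then show ?thesis using circ[of \<psi>] g2[of k] False that U(4,6,8) pi_gt_zero unfolding \<psi>_def by (auto split: if_splits)
 qed
 obtain F where F: "germ_family p F" "\<forall>\<^sub>F l in nhds (p 0). F 0 l = Y l" "\<forall>\<^sub>F l in nhds (p 1). F 1 l = Y l ** N"
  using cont unfolding analytic_continuation_along_iff p_def c_def by blast
 have vim: "open {l. l / c \<in> U}" if "open U" for U
  using open_vimage[OF that, of "\<lambda>l. l / c"] by (simp add: vimage_def continuous_intros c)
 have hol: "mat_holo (\<lambda>l. W (l / c)) {l. l / c \<in> U}" if "mat_holo W U" for W U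
  by (rule mat_holo_compose[OF that]) (use c in \<open>auto intro!: holomorphic_intros\<close>)
 have "\<forall>\<^sub>F l in nhds (p 0). F 0 l = W1 (l / c)"
  using F(2) Y(1) unfolding g(2) c_def[symmetric] by eventually_elim simp
 then have e1: "\<forall>\<^sub>F l in nhds (p (5 / 8)). F (5 / 8) l = W1 (l / c)"
  using germ_family_in_domain[OF F(1), of 0 "5 / 8" "{l. l / c \<in> U1}" "\<lambda>l. W1 (l / c)"]
   continuous_on_subset[OF g(1)] vim[OF U(1)] h1 hol[OF W(1)] by auto
 have hol2: "mat_holo (\<lambda>l. W2 (l / c) ** N) {l. l / c \<in> U2}" by (rule mat_holo_mult[OF hol[OF W(2)] mat_holo_const])
 have "\<forall>\<^sub>F l in nhds (p 1). F 1 l = W2 (l / c) ** N"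
  using F(3) Y(2) unfolding g(3) c_def[symmetric] by eventually_elim simp
 then have e2: "\<forall>\<^sub>F l in nhds (p (5 / 8)). F (5 / 8) l = W2 (l / c) ** N"
  using germ_family_in_domain[OF F(1), of "5 / 8" 1 "{l. l / c \<in> U2}" "\<lambda>l. W2 (l / c) ** N"]
   continuous_on_subset[OF g(1)] vim[OF U(2)] h2 hol2 by auto
 define x where "x = p (5 / 8) / c"
 have "x = of_real a + of_real r * cis (w + pi)" using g2[of "5 / 8"] by (simp add: x_def)
 then have "x \<in> lower" using r sin_gt_zero[OF w] by (simp add: lower_def)
 moreover have "\<forall>\<^sub>F z in nhds x. W1 z = W2 z ** N"
 proof -
  have cz: "c * x = p (5 / 8)" using c by (simp add: x_def)
  have "\<forall>\<^sub>F l in nhds (c * x). W1 (l / c) = W2 (l / c) ** N"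
   using e1 e2 unfolding cz by eventually_elim simp
  moreover have "filterlim (\<lambda>z. c * z) (nhds (c * x)) (nhds x)"
   by (intro tendsto_mult tendsto_const filterlim_ident)
  ultimately have "\<forall>\<^sub>F z in nhds x. W1 (c * z / c) = W2 (c * z / c) ** N"
   by (rule eventually_compose_filterlim)
  then show ?thesis using c by simp
 qed
 ultimately show ?thesis by blast
qed

text \<open>One admissible lasso for each pole suffices: the resulting identity near one point of
  the lower half plane spreads over all of it.\<close>

lemma monodromy_jumps:
 assumes f: "\<bar>f\<bar> < pi / 2"
  and sh: "sheets A X XL XM XR"
  and Y: "\<And>l. l / exp (\<i> * of_real f) \<in> upper \<Longrightarrow> 1 < cmod l \<Longrightarrow> Y l = X (l / exp (\<i> * of_real f))"
  and cont: "analytic_continuation_along (lasso 101 (1/2) (- exp (\<i> * of_real f))) Y (\<lambda>l. Y l ** N0)"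
   "analytic_continuation_along (lasso 101 (1/2) (exp (\<i> * of_real f))) Y (\<lambda>l. Y l ** N1)"
 shows "jumps XL XM XR N0 N1"
proof -
 define c where "c = exp (\<i> * of_real f)"
 have c: "c \<noteq> 0" "c = cis f" by (simp_all add: c_def cis_conv_exp)
 note sh' = sh[unfolded sheets_def]
 have hol: "mat_holo XL slitL" "mat_holo XM slitM" "mat_holo XR slitR"
  using sh' mat_ode_holo slits(1-3) by blast+
 have ev: "\<forall>\<^sub>F l in nhds (\<i> * of_real 101). l / c \<in> upper \<and> 1 < cmod l"
 proof -
  have "open {l. l / c \<in> upper}"
   using open_vimage[OF half_planes(1), of "\<lambda>l. l / c"] by (simp add: vimage_def continuous_intros c)
  then have "open ({l. l / c \<in> upper} \<inter> {l. 1 < cmod l})"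
   by (intro open_Int open_Collect_less continuous_intros) auto
  moreover have "\<i> * of_real 101 / c \<in> upper"
  proof -
   have "\<i> * of_real 101 / c = \<i> * of_real 101 * cis (- f)" unfolding c(2) by (simp add: cis_divide divide_inverse)
   moreover have "cos f > 0" using f by (intro cos_gt_zero_pi) auto
   ultimately show ?thesis by (simp add: upper_def)
  qed
  ultimately have "\<forall>\<^sub>F l in nhds (\<i> * of_real 101). l \<in> {l. l / c \<in> upper} \<inter> {l. 1 < cmod l}"
   by (intro eventually_nhds_in_open) (auto simp: norm_mult)
  then show ?thesis by simp
 qed
 have evX: "\<forall>\<^sub>F l in nhds (\<i> * of_real 101). Y l = Z (l / c)" if "\<And>x. x \<in> upper \<Longrightarrow> Z x = X x" for Z
  using ev by eventually_elim (use that Y c_def in auto)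
 have YL: "\<forall>\<^sub>F l in nhds (\<i> * of_real 101). Y l = XL (l / c)" by (rule evX) (use sh' in blast)
 have YM: "\<forall>\<^sub>F l in nhds (\<i> * of_real 101). Y l = XM (l / c)" by (rule evX) (use sh' in blast)
 have YR: "\<forall>\<^sub>F l in nhds (\<i> * of_real 101). Y l = XR (l / c)" by (rule evX) (use sh' in blast)
 have c0: "analytic_continuation_along (lasso 101 (1/2) (of_real (- 1) * exp (\<i> * of_real f))) Y (\<lambda>l. Y l ** N0)"
  and c1: "analytic_continuation_along (lasso 101 (1/2) (of_real 1 * exp (\<i> * of_real f))) Y (\<lambda>l. Y l ** N1)"
  using cont by simp_all
 obtain x0 where z0: "x0 \<in> lower" "\<forall>\<^sub>F z in nhds x0. XL z = XM z ** N0"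
  using lasso_jump[OF f _ _ _ slits(1,2,13,13,14,14) _ _ hol(1,2) c0 YL[unfolded c_def] YM[unfolded c_def]]
  by (auto simp: slit_def)
 obtain x1 where z1: "x1 \<in> lower" "\<forall>\<^sub>F z in nhds x1. XM z = XR z ** N1"
  using lasso_jump[OF f _ _ _ slits(2,3,13,13,14,14) _ _ hol(2,3) c1 YM[unfolded c_def] YR[unfolded c_def]]
  by (auto simp: slit_def)
 have hl: "mat_holo XL lower" "mat_holo XM lower" "mat_holo XR lower"
  using hol slits(14) mat_holo_subset by blast+
 show ?thesis unfolding jumps_def
 proof (intro ballI conjI)
  fix x assume z: "x \<in> lower"
  show "XL x = XM x ** N0"
   by (rule mat_holo_identity[OF hl(1) mat_holo_mult[OF hl(2) mat_holo_const] half_planes(2,4) z0 z])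
  show "XM x = XR x ** N1"
   by (rule mat_holo_identity[OF hl(2) mat_holo_mult[OF hl(3) mat_holo_const] half_planes(2,4) z1 z])
 qed
qed

text \<open>A factor that is holomorphic near the path multiplies every germ from the left, whereas
  monodromy acts from the right; so the two do not interfere.\<close>

lemma analytic_continuation_along_mult:
 assumes "analytic_continuation_along p f g" and V: "open V" "\<And>r. r \<in> {0..1} \<Longrightarrow> p r \<in> V" and L: "mat_holo L V"
  and f': "\<forall>\<^sub>F l in nhds (p 0). f' l = L l ** f l ** K" and g': "\<forall>\<^sub>F l in nhds (p 1). g' l = L l ** g l ** K"
 shows "analytic_continuation_along p f' g'"
proof -
 obtain F where F: "germ_family p F" "\<forall>\<^sub>F l in nhds (p 0). F 0 l = f l" "\<forall>\<^sub>F l in nhds (p 1). F 1 l = g l"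
  using assms(1) unfolding analytic_continuation_along_iff by blast
 have "germ_family p (\<lambda>r l. L l ** F r l ** K)"
  unfolding germ_family_def
 proof
  fix r :: real assume r: "r \<in> {0..1}"
  obtain U e where U: "open U \<and> e > 0 \<and> (\<forall>i j. (\<lambda>l. F r l $ i $ j) holomorphic_on U) \<and>
    (\<forall>r'\<in>{0..1}. \<bar>r' - r\<bar> < e \<longrightarrow> p r' \<in> U \<and> (\<forall>\<^sub>F l in nhds (p r'). F r' l = F r l))"
   using bspec[OF F(1)[unfolded germ_family_def] r] by blast
  have "mat_holo (F r) (U \<inter> V)" using U by (intro mat_holo_subset[of _ U "U \<inter> V"]) (auto simp: mat_holo_def)
  then have "mat_holo (\<lambda>l. L l ** F r l ** K) (U \<inter> V)"
   by (intro mat_holo_mult mat_holo_const mat_holo_subset[OF L]) auto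
  moreover have "p r' \<in> U \<inter> V \<and> (\<forall>\<^sub>F l in nhds (p r'). L l ** F r' l ** K = L l ** F r l ** K)"
   if t: "r' \<in> {0..1}" "\<bar>r' - r\<bar> < e" for r'
  proof -
   have "\<forall>\<^sub>F l in nhds (p r'). F r' l = F r l" using U t by blast
   then have "\<forall>\<^sub>F l in nhds (p r'). L l ** F r' l ** K = L l ** F r l ** K" by eventually_elim simp
   then show ?thesis using U t V(2) by blast
  qed
  ultimately show "\<exists>U e. open U \<and> e > 0 \<and> (\<forall>i j. (\<lambda>l. (L l ** F r l ** K) $ i $ j) holomorphic_on U) \<and>
      (\<forall>r'\<in>{0..1}. \<bar>r' - r\<bar> < e \<longrightarrow> p r' \<in> U \<and> (\<forall>\<^sub>F l in nhds (p r'). L l ** F r' l ** K = L l ** F r l ** K))"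
   using U V(1) unfolding mat_holo_def by (intro exI[of _ "U \<inter> V"] exI[of _ e]) auto
 qed
 moreover have "\<forall>\<^sub>F l in nhds (p 0). L l ** F 0 l ** K = f' l" using F(2) f' by eventually_elim simp
 moreover have "\<forall>\<^sub>F l in nhds (p 1). L l ** F 1 l ** K = g' l" using F(3) g' by eventually_elim simp
 ultimately show ?thesis unfolding analytic_continuation_along_iff by blast
qed

lemma lasso_avoids:
 assumes f: "\<bar>f\<bar> < pi / 2" and R: "R > 1" and r: "0 < r" "r < 1" and a: "a = 1 \<or> a = (- 1::real)" and t: "t \<in> {0..1}"
 shows "lasso R r (of_real a * exp (\<i> * of_real f)) t / exp (\<i> * of_real f) \<in> - {1, - 1}"
proof -
 define c where "c = exp (\<i> * of_real f)"
 obtain w where g1: "\<And>t. 0 \<le> t \<Longrightarrow> t \<le> 1 / 2 \<Longrightarrow> lasso R r (of_real a * c) t / c \<in> upper"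
  and g2: "\<And>t. 1 / 2 \<le> t \<Longrightarrow> t \<le> 3 / 4 \<Longrightarrow> lasso R r (of_real a * c) t / c = of_real a + of_real r * cis (w + 2 * pi * (4 * t - 2))"
  and g3: "\<And>t. 3 / 4 \<le> t \<Longrightarrow> t \<le> 1 \<Longrightarrow> lasso R r (of_real a * c) t / c \<in> upper"
  using lasso_shape[OF f R r(1) a] unfolding c_def by metis
 have u: "upper \<subseteq> - {1, - 1}" by (auto simp: upper_def)
 consider "t \<le> 1 / 2" | "1 / 2 \<le> t" "t \<le> 3 / 4" | "3 / 4 \<le> t" by linarith
 then have "lasso R r (of_real a * c) t / c \<in> - {1, - 1}"
 proof cases
  case 1
  then have "lasso R r (of_real a * c) t / c \<in> upper" using t by (intro g1) auto
  then show ?thesis using u by blast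
 next
  case 3
  then have "lasso R r (of_real a * c) t / c \<in> upper" using t by (intro g3) auto
  then show ?thesis using u by blast
 next
  case 2
  define z where "z = lasso R r (of_real a * c) t / c"
  have n: "cmod (z - of_real a) = r" using g2[OF 2] r by (simp add: z_def norm_mult)
  have "z \<noteq> 1 \<and> z \<noteq> - 1"
  proof (intro conjI notI)
   assume "z = 1"
   then have "cmod (1 - of_real a) = r" using n by simp
   then show False using a r by auto
  next
   assume "z = - 1"
   then have "cmod (- 1 - of_real a) = r" using n by simp
   then show False using a r by auto
  qed
  then show ?thesis by (simp add: z_def)
 qed
 then show ?thesis by (simp add: c_def)
qed

section \<open>The linear system of the fifth Painleve equation\<close>

definition good_set :: "(complex \<Rightarrow> complex) \<Rightarrow> (complex \<Rightarrow> complex) \<Rightarrow> (complex \<Rightarrow> complex) \<Rightarrow> complex set" where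
 "good_set y z u = {s. y analytic_on {s} \<and> z analytic_on {s} \<and> u analytic_on {s} \<and> y s \<noteq> 0 \<and> u s \<noteq> 0}"

lemma good_set_cosparse:
 assumes "PV_system k0 k1 kinf y z u"
 shows "\<forall>\<^sub>\<approx>s. s \<in> good_set y z u"
proof -
 have m: "y meromorphic_on UNIV" "z meromorphic_on UNIV" "u meromorphic_on UNIV"
  and e: "\<forall>\<^sub>\<approx>s. y s \<noteq> 0 \<and> u s \<noteq> 0 \<and> PV_system_at k0 k1 kinf y z u s"
  using assms by (auto simp: PV_system_def nicely_meromorphic_on_def)
 show ?thesis
  using e meromorphic_on_imp_analytic_cosparse[OF m(1)] meromorphic_on_imp_analytic_cosparse[OF m(2)]
   meromorphic_on_imp_analytic_cosparse[OF m(3)]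
  by eventually_elim (simp add: good_set_def)
qed

text \<open>Removing a closed discrete set leaves the plane connected, so isomonodromy links any two
  regular points, also points on different sheets over the same \<open>x\<close>.\<close>

lemma good_set_open_connected:
 assumes "PV_system k0 k1 kinf y z u"
 shows "open (good_set y z u)" "connected (good_set y z u)"
proof -
 have sp: "- good_set y z u sparse_in UNIV"
  using good_set_cosparse[OF assms] by (simp add: eventually_cosparse Compl_eq)
 show "open (good_set y z u)" using sparse_in_UNIV_imp_closed[OF sp] by (simp add: open_closed)
 have "connected (UNIV - (- good_set y z u))" by (rule sparse_imp_connected[OF _ _ _ sp]) auto
 then show "connected (good_set y z u)" by (simp add: Diff_eq)
qed

lemma isCont_eq_if_eventually_eq:
 fixes f g :: "complex \<Rightarrow> complex"
 assumes "isCont f s" "isCont g s" "\<forall>\<^sub>F x in at s. f x = g x"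
 shows "f s = g s"
proof -
 have "(f \<longlongrightarrow> g s) (at s)"
  by (rule Lim_transform_eventually[of g _ _ f]) (use assms in \<open>auto simp: isCont_def elim: eventually_mono\<close>)
 then show ?thesis using assms(1) unfolding isCont_def by (rule LIM_unique[rotated])
qed

text \<open>\<open>PV_system\<close> grants the equations only off a discrete set. At regular points
  both sides are continuous, so the equations hold there without exception.\<close>

lemma PV_system_good:
 assumes "PV_system k0 k1 kinf y z u" and s: "s \<in> good_set y z u"
 shows "PV_system_at k0 k1 kinf y z u s"
proof -
 have an: "y analytic_on {s}" "z analytic_on {s}" "u analytic_on {s}" and nz: "y s \<noteq> 0" "u s \<noteq> 0"
  using s by (auto simp: good_set_def)
 have "\<forall>\<^sub>\<approx>s. y s \<noteq> 0 \<and> u s \<noteq> 0 \<and> PV_system_at k0 k1 kinf y z u s"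
  using assms(1) by (simp add: PV_system_def)
 then have ev: "\<forall>\<^sub>F s in at s. y s \<noteq> 0 \<and> u s \<noteq> 0 \<and> PV_system_at k0 k1 kinf y z u s"
  by (rule eventually_cosparse_imp_eventually_at) simp
 have c: "isCont y s" "isCont z s" "isCont u s" "isCont (deriv y) s" "isCont (deriv z) s" "isCont (deriv u) s"
  using an analytic_deriv by (auto intro: analytic_at_imp_isCont)
 show ?thesis
  unfolding PV_system_at_def Let_def
 proof (intro conjI)
  show "exp s * ddx y s = exp s * y s - 2 * z s * (y s - 1)\<^sup>2 - (y s - 1) * ((k0 - k1 + kinf) / 2 * y s - (3 * k0 + k1 + kinf) / 2)"
   by (rule isCont_eq_if_eventually_eq)
     (use ev in \<open>auto simp: PV_system_at_def Let_def ddx_def intro!: continuous_intros c elim: eventually_mono\<close>)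
  show "exp s * ddx z s = y s * z s * (z s + (k0 - k1 + kinf) / 2) - inverse (y s) * (z s + k0) * (z s + (k0 + k1 + kinf) / 2)"
   by (rule isCont_eq_if_eventually_eq)
     (use ev nz in \<open>auto simp: PV_system_at_def Let_def ddx_def intro!: continuous_intros c elim: eventually_mono\<close>)
  show "exp s * (ddx u s / u s) = - 2 * z s - k0 + y s * (z s + (k0 - k1 + kinf) / 2) + inverse (y s) * (z s + (k0 + k1 + kinf) / 2)"
   by (rule isCont_eq_if_eventually_eq)
     (use ev nz in \<open>auto simp: PV_system_at_def Let_def ddx_def intro!: continuous_intros c elim: eventually_mono\<close>)
 qed
qed

lemma A0_A1_entries [simp]:
 "A0_mat k0 z u $ 1 $ 1 = z + k0 / 2" "A0_mat k0 z u $ 1 $ 2 = - u * (z + k0)"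
 "A0_mat k0 z u $ 2 $ 1 = inverse u * z" "A0_mat k0 z u $ 2 $ 2 = - z - k0 / 2"
 "A1_mat k0 k1 kinf y z u $ 1 $ 1 = - z - (k0 + kinf) / 2"
 "A1_mat k0 k1 kinf y z u $ 1 $ 2 = u * y * (z + (k0 - k1 + kinf) / 2)"
 "A1_mat k0 k1 kinf y z u $ 2 $ 1 = - inverse (u * y) * (z + (k0 + k1 + kinf) / 2)"
 "A1_mat k0 k1 kinf y z u $ 2 $ 2 = z + (k0 + kinf) / 2"
 by (simp_all add: A0_mat_def A1_mat_def)

lemma A0_A1_trace:
 "A0_mat k0 z u $ 2 $ 2 = - A0_mat k0 z u $ 1 $ 1"
 "A1_mat k0 k1 kinf y z u $ 2 $ 2 = - A1_mat k0 k1 kinf y z u $ 1 $ 1"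
 "A0_mat k0 z u $ 1 $ 1 + A1_mat k0 k1 kinf y z u $ 1 $ 1 = - kinf / 2"
 by (simp_all add: field_simps)

text \<open>The verification is a computation with the eight matrix entries: written out, the
  commutator equations are the three scalar equations and their consequences for the products of
  \<open>y\<close>, \<open>z\<close> and \<open>u\<close>.\<close>

lemma PV_isomonodromic:
 assumes PV: "PV_system k0 k1 kinf y z u"
 shows "isomonodromic (\<lambda>s. A0_mat k0 (z s) (u s)) (\<lambda>s. A1_mat k0 k1 kinf (y s) (z s) (u s)) (good_set y z u) kinf"
proof
 show "open (good_set y z u)" "connected (good_set y z u)" by (rule good_set_open_connected[OF PV])+
 fix s assume s: "s \<in> good_set y z u"
 show "A0_mat k0 (z s) (u s) $ 2 $ 2 = - A0_mat k0 (z s) (u s) $ 1 $ 1"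
  "A1_mat k0 k1 kinf (y s) (z s) (u s) $ 2 $ 2 = - A1_mat k0 k1 kinf (y s) (z s) (u s) $ 1 $ 1"
  "A0_mat k0 (z s) (u s) $ 1 $ 1 + A1_mat k0 k1 kinf (y s) (z s) (u s) $ 1 $ 1 = - kinf / 2"
  by (rule A0_A1_trace)+
 have nz: "y s \<noteq> 0" "u s \<noteq> 0" using s by (auto simp: good_set_def)
 have d: "(y has_field_derivative deriv y s) (at s)" "(z has_field_derivative deriv z s) (at s)" "(u has_field_derivative deriv u s) (at s)"
  using s by (auto simp: good_set_def intro!: analytic_derivI)
 define x where "x = exp s"
 define a where "a = (k0 - k1 + kinf) / 2"
 define c where "c = (k0 + k1 + kinf) / 2"
 \<comment> \<open>Reciprocals of \<open>y\<close> and \<open>u\<close> become independent letters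
   subject to \<open>v * y s = 1\<close> and \<open>w * u s = 1\<close>, which turns the remaining
   goals into polynomial identities.\<close>
 define v where "v = inverse (y s)"
 define w where "w = inverse (u s)"
 have v: "v * y s = 1" "y s * v = 1" and w: "w * u s = 1" "u s * w = 1" using nz by (auto simp: v_def w_def)
 have sys: "deriv y s = x * y s - 2 * z s * (y s - 1)\<^sup>2 - (y s - 1) * (a * y s - (k0 + c))"
  "deriv z s = y s * z s * (z s + a) - v * (z s + k0) * (z s + c)"
  "deriv u s = u s * (- 2 * z s - k0 + y s * (z s + a) + v * (z s + c))"
 proof -
  have b: "(3 * k0 + k1 + kinf) / 2 = k0 + c" by (simp add: c_def field_simps)
  have ys: "exp s * ddx y s = exp s * y s - 2 * z s * (y s - 1)\<^sup>2 - (y s - 1) * (a * y s - (k0 + c))"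
   and zs: "exp s * ddx z s = y s * z s * (z s + a) - v * (z s + k0) * (z s + c)"
   and us: "exp s * (ddx u s / u s) = - 2 * z s - k0 + y s * (z s + a) + v * (z s + c)"
   using PV_system_good[OF PV s] unfolding PV_system_at_def Let_def b a_def[symmetric] c_def[symmetric] v_def[symmetric] by auto
  show "deriv y s = x * y s - 2 * z s * (y s - 1)\<^sup>2 - (y s - 1) * (a * y s - (k0 + c))" using ys by (simp add: ddx_def x_def)
  show "deriv z s = y s * z s * (z s + a) - v * (z s + k0) * (z s + c)" using zs by (simp add: ddx_def)
  have "deriv u s = u s * (exp s * (ddx u s / u s))" using nz by (simp add: ddx_def)
  then show "deriv u s = u s * (- 2 * z s - k0 + y s * (z s + a) + v * (z s + c))" unfolding us .
 qed
 \<comment> \<open>Half-parameters, chosen to clear all denominators.\<close>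
 define h where "h = k0 / 2"
 define m where "m = (k0 + kinf) / 2"
 define X where "X = exp s / 2"
 have par: "k0 / 2 = h" "k0 = 2 * h" "(k0 + kinf) / 2 = m" "kinf / 2 = m - h" "a = 2 * m - c" "exp s / 2 = X"
  by (simp_all add: h_def m_def a_def c_def X_def field_simps)
 have x: "x = 2 * X" by (simp add: x_def X_def)
 have inv: "inverse (u s * y s) = w * v" "inverse (u s) = w" by (simp_all add: v_def w_def)
 have dw: "((\<lambda>s. inverse (u s)) has_field_derivative - (w * deriv u s * w)) (at s)"
  unfolding w_def by (rule DERIV_cong[OF DERIV_inverse_fun[OF d(3) nz(2)]]) simp
 have dvw: "((\<lambda>s. - inverse (u s * y s)) has_field_derivative (w * v * (deriv u s * y s + u s * deriv y s) * (w * v))) (at s)"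
  by (rule DERIV_cong[OF DERIV_minus[OF DERIV_inverse_fun[OF DERIV_mult[OF d(3,1)]]]])
    (use nz in \<open>simp_all add: v_def w_def algebra_simps\<close>)
 note expand = comm_def vector_minus_component vector_add_component mat_mult_entry A0_A1_entries scale_mat_entry sigma3_entry
 show "has_mderiv (\<lambda>s. A0_mat k0 (z s) (u s)) (comm (A0_mat k0 (z s) (u s) + A1_mat k0 k1 kinf (y s) (z s) (u s) + scale_mat (kinf / 2) sigma3) (A0_mat k0 (z s) (u s))) s"
  unfolding has_mderiv_iff expand par(1,3,4) a_def[symmetric] c_def[symmetric] inv
 proof (intro conjI, goal_cases)
  case 1 show ?case by (rule DERIV_cong[OF DERIV_add[OF d(2) DERIV_const]]) (simp only: sys x inv par(2,5), use w in algebra)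
 next
  case 2 show ?case by (rule DERIV_cong[OF DERIV_mult[OF DERIV_minus[OF d(3)] DERIV_add[OF d(2) DERIV_const]]]) (simp only: sys x inv par(2,5), algebra)
 next
  case 3 show ?case by (rule DERIV_cong[OF DERIV_mult[OF dw d(2)]]) (simp only: sys x inv par(2,5), use w in algebra)
 next
  case 4 show ?case by (rule DERIV_cong[OF DERIV_diff[OF DERIV_minus[OF d(2)] DERIV_const]]) (simp only: sys x inv par(2,5), use w in algebra)
 qed
 show "has_mderiv (\<lambda>s. A1_mat k0 k1 kinf (y s) (z s) (u s)) (comm (scale_mat (exp s / 2) sigma3 + (A0_mat k0 (z s) (u s) + A1_mat k0 k1 kinf (y s) (z s) (u s) + scale_mat (kinf / 2) sigma3)) (A1_mat k0 k1 kinf (y s) (z s) (u s))) s"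
  unfolding has_mderiv_iff expand par(1,3,4,6) a_def[symmetric] c_def[symmetric] inv
 proof (intro conjI, goal_cases)
  case 1 show ?case by (rule DERIV_cong[OF DERIV_diff[OF DERIV_minus[OF d(2)] DERIV_const]]) (simp only: sys x inv par(2,5), use v w in algebra)
 next
  case 2 show ?case by (rule DERIV_cong[OF DERIV_mult[OF DERIV_mult[OF d(3,1)] DERIV_add[OF d(2) DERIV_const]]]) (simp only: sys x inv par(2,5), use v w in algebra)
 next
  case 3 show ?case by (rule DERIV_cong[OF DERIV_mult[OF dvw DERIV_add[OF d(2) DERIV_const]]]) (simp only: sys x inv par(2,5), use v w in algebra)
 next
  case 4 show ?case by (rule DERIV_cong[OF DERIV_add[OF d(2) DERIV_const]]) (simp only: sys x inv par(2,5), use v w in algebra)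
 qed
qed

section \<open>From the system in \<lambda> to the normalised two-pole system\<close>

definition varpi :: "complex \<Rightarrow> real \<Rightarrow> real \<Rightarrow> complex" where
 "varpi kinf f t = exp (\<i> * of_real f) * of_real t / 4 + kinf / 2 * (\<i> * of_real f + of_real (ln 2))"

definition conj_exp :: "complex \<Rightarrow> complex^2^2 \<Rightarrow> complex^2^2" where
 "conj_exp w A = exp_sigma3 (- w) ** A ** exp_sigma3 w"

lemma conj_exp_diag [simp]: "conj_exp w A $ 1 $ 1 = A $ 1 $ 1" "conj_exp w A $ 2 $ 2 = A $ 2 $ 2"
 by (simp_all add: conj_exp_def mat_mult_entry exp_minus)

lemma exp_sigma3_cancel:
 "exp_sigma3 w ** (exp_sigma3 (- w) ** A) = A" "exp_sigma3 (- w) ** (exp_sigma3 w ** A) = A"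
 by (simp_all add: matrix_mul_assoc exp_sigma3_add)

lemma two_pole_conj_exp:
 "two_pole r c (conj_exp w P0) (conj_exp w P1) l = conj_exp w (two_pole r c P0 P1 l)"
proof -
 have "conj_exp w sigma3 = sigma3" by (simp add: mat_eq_iff conj_exp_def mat_mult_entry exp_minus)
 moreover have "conj_exp w (A + B) = conj_exp w A + conj_exp w B" for A B
  unfolding conj_exp_def by (simp add: mat_eq_iff mat_mult_entry algebra_simps)
 moreover have "conj_exp w (scale_mat k A) = scale_mat k (conj_exp w A)" for k A
  unfolding conj_exp_def by (simp add: scaleC_mat_mult)
 ultimately show ?thesis by (simp add: two_pole_def)
qed

lemma log_system_conj_exp:
 "log_system (two_pole r c (conj_exp w P0) (conj_exp w P1)) h = conj_exp w (log_system (two_pole r c P0 P1) h)"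
 unfolding log_system_def two_pole_conj_exp by (simp add: conj_exp_def scaleC_mat_mult)

text \<open>The substitution gives \<open>\<xi> = (l + c) / (2 * c)\<close> and
  \<open>\<xi> - 1 = (l - c) / (2 * c)\<close>. The factor \<open>1 / (2 * c)\<close> from the chain
  rule then restores the residues and turns \<open>x / 2\<close> into \<open>t / 4\<close>.\<close>

lemma Y_coeff_eq:
 "Y_coeff k0 k1 kinf f t y z u = two_pole (of_real t) (exp (\<i> * of_real f))
   (conj_exp (varpi kinf f t) (A0_mat k0 z u)) (conj_exp (varpi kinf f t) (A1_mat k0 k1 kinf y z u))"
proof
 fix l
 define c where "c = exp (\<i> * of_real f)"
 define w where "w = varpi kinf f t"
 have c: "c \<noteq> 0" "exp (- \<i> * of_real f) = inverse c" by (simp_all add: c_def exp_minus)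
 define \<xi> where "\<xi> = (inverse c * l + 1) / 2"
 have x1: "inverse c / 2 * (1 / \<xi>) = 1 / (l + c)" and x2: "inverse c / 2 * (1 / (\<xi> - 1)) = 1 / (l - c)"
 proof -
  have "\<xi> = (l + c) / (2 * c)" "\<xi> - 1 = (l - c) / (2 * c)" using c(1) by (simp_all add: \<xi>_def field_simps)
  then show "inverse c / 2 * (1 / \<xi>) = 1 / (l + c)" "inverse c / 2 * (1 / (\<xi> - 1)) = 1 / (l - c)"
   using c(1) by (simp_all add: field_simps)
 qed
 have x0: "inverse c / 2 * (c * of_real t / 2) = of_real t / 4" using c(1) by simp
 have "Y_coeff k0 k1 kinf f t y z u l = scale_mat (inverse c / 2) (conj_exp w (Xi_coeff k0 k1 kinf (c * of_real t) y z u \<xi>))"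
  unfolding Y_coeff_def Let_def c(2) c_def[symmetric] \<xi>_def w_def varpi_def conj_exp_def by simp
 also have "\<dots> = conj_exp w (scale_mat (inverse c / 2) (Xi_coeff k0 k1 kinf (c * of_real t) y z u \<xi>))"
  by (simp add: conj_exp_def scaleC_mat_mult)
 also have "scale_mat (inverse c / 2) (Xi_coeff k0 k1 kinf (c * of_real t) y z u \<xi>)
   = two_pole (of_real t) c (A0_mat k0 z u) (A1_mat k0 k1 kinf y z u) l"
 proof -
  have "scale_mat (inverse c / 2) (Xi_coeff k0 k1 kinf (c * of_real t) y z u \<xi>) $ i $ j
   = (inverse c / 2 * (c * of_real t / 2)) * sigma3 $ i $ j + (inverse c / 2 * (1 / \<xi>)) * A0_mat k0 z u $ i $ j
    + (inverse c / 2 * (1 / (\<xi> - 1))) * A1_mat k0 k1 kinf y z u $ i $ j" for i j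
   unfolding Xi_coeff_def by (simp add: algebra_simps)
  then show ?thesis unfolding x0 x1 x2 by (simp add: vec_eq_iff two_pole_def)
 qed
 finally show "Y_coeff k0 k1 kinf f t y z u l = two_pole (of_real t) (exp (\<i> * of_real f))
   (conj_exp (varpi kinf f t) (A0_mat k0 z u)) (conj_exp (varpi kinf f t) (A1_mat k0 k1 kinf y z u)) l"
  unfolding two_pole_conj_exp c_def w_def .
qed

lemma Y_coeff_rank1: "rank1_system t kinf (Y_coeff k0 k1 kinf f t y z u)"
 unfolding Y_coeff_eq by (rule two_pole_rank1) (simp_all add: field_simps)

lemma decays_along_mult_left:
 assumes "decays_along X j c"
 shows "decays_along (\<lambda>h. C ** X h) j c"
proof -
 obtain k K R where k: "k > 0" "K > 0" "\<And>r i. r \<ge> R \<Longrightarrow> cmod (X (Complex r c) $ i $ j) \<le> K * exp (- (k * exp r))"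
  using decays_alongE[OF assms] by metis
 have "cmod ((C ** X (Complex r c)) $ i $ j) \<le> (2 * norm C * K) * exp (- (k * exp r))" if "r \<ge> R" for r i
 proof -
  have "cmod ((C ** X (Complex r c)) $ i $ j) \<le> cmod (C $ i $ 1) * cmod (X (Complex r c) $ 1 $ j) + cmod (C $ i $ 2) * cmod (X (Complex r c) $ 2 $ j)"
   unfolding mat_mult_entry by (rule order.trans[OF norm_triangle_ineq]) (simp add: norm_mult)
  also have "\<dots> \<le> norm C * (K * exp (- (k * exp r))) + norm C * (K * exp (- (k * exp r)))"
   using that by (intro add_mono mult_mono k(3) norm_entry_le) auto
  finally show ?thesis by (simp add: algebra_simps)
 qed
 then show ?thesis unfolding decays_along_def using k(1) by blast
qed

text \<open>The part over \<open>sector2\<close> in the rotated logarithmic coordinate, where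
  \<lambda> is \<open>exp (h + \<i> * of_real f)\<close>.\<close>

definition wide_strip :: "real \<Rightarrow> complex set" where
 "wide_strip f = {h. 0 < Re h \<and> \<bar>Im h + f - pi / 2\<bar> < pi}"

lemma wide_strip: "open (wide_strip f)" "connected (wide_strip f)" "wide_strip f \<subseteq> log_plane"
proof -
 have e: "wide_strip f = {h. 0 < Re h} \<inter> {h. - pi / 2 - f < Im h} \<inter> {h. Im h < 3 * pi / 2 - f}"
  by (auto simp: wide_strip_def)
 show "open (wide_strip f)" unfolding e by (intro open_Int open_halfspace_Re_gt open_halfspace_Im_gt open_halfspace_Im_lt)
 show "connected (wide_strip f)" unfolding e
  by (intro convex_connected convex_Int convex_halfspace_Re_gt convex_halfspace_Im_gt convex_halfspace_Im_lt)
 show "wide_strip f \<subseteq> log_plane" by (auto simp: wide_strip_def log_plane_def)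
qed

lemma log_system_two_pole_trace_free:
 assumes "P0 $ 2 $ 2 = - P0 $ 1 $ 1" "P1 $ 2 $ 2 = - P1 $ 1 $ 1"
 shows "trace_free (log_system (two_pole x c P0 P1)) V"
 using two_pole_trace_free[OF assms, of x c UNIV] by (simp add: trace_free_def log_system_def)

text \<open>Multiplying by \<open>exp_sigma3 (varpi kinf f t)\<close> undoes the normalisation of
  \<open>Y\<close> and gives a solution of the normalised system. It has the same decaying columns
  as \<open>F\<close>, so the two differ by a diagonal matrix; both determinants are 1, by the
  asymptotics of \<open>Y\<close> and by assumption.\<close>

lemma canonical_solution2_fundamental:
 fixes k0 k1 kinf y z u :: complex
 defines "A0 \<equiv> A0_mat k0 z u" and "A1 \<equiv> A1_mat k0 k1 kinf y z u"
 assumes Y: "canonical_solution2 (Y_coeff k0 k1 kinf f t y z u) kinf t Y" and t: "t > 0"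
  and s: "exp s = of_real t * exp (\<i> * of_real f)"
  and F: "mat_ode (log_system (two_pole (exp s) 1 A0 A1)) F log_plane" "\<And>h. h \<in> log_plane \<Longrightarrow> det (F h) = 1" "canonical_at f F"
 obtains D where "D $ 1 $ 2 = 0" "D $ 2 $ 1 = 0" "det D = 1"
  "\<And>h. h \<in> wide_strip f \<Longrightarrow> exp_sigma3 (varpi kinf f t) ** Y (exp (h + \<i> * of_real f)) = F h ** D"
proof -
 define w where "w = varpi kinf f t"
 define B where "B = Y_coeff k0 k1 kinf f t y z u"
 define Z where "Z h = exp_sigma3 w ** Y (exp (h + \<i> * of_real f))" for h
 have B: "B = two_pole (of_real t) (exp (\<i> * of_real f)) (conj_exp w A0) (conj_exp w A1)"
  unfolding B_def w_def A0_def A1_def by (rule Y_coeff_eq)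
 let ?L = "log_system (two_pole (exp s) 1 A0 A1)"
 have tr: "A0 $ 2 $ 2 = - A0 $ 1 $ 1" "A1 $ 2 $ 2 = - A1 $ 1 $ 1" unfolding A0_def A1_def by (rule A0_A1_trace)+
 have tf: "trace_free ?L V" for V by (rule log_system_two_pole_trace_free[OF tr])
 have sec: "exp (h + \<i> * of_real f) \<in> sector2" if "h \<in> wide_strip f" for h
  using that by (intro exp_in_sector2(2)) (auto simp: wide_strip_def)
 have odeY: "mat_ode B Y sector2" and asy: "\<And>\<delta>. \<delta> > 0 \<Longrightarrow> canonical_asymp t kinf (\<lambda>h. Y (exp h)) \<delta>"
  using canonical_solution2D[OF Y] by (auto simp: B_def)
 have Zode: "mat_ode ?L Z (wide_strip f)"
  unfolding mat_ode_def
 proof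
  fix h assume e: "h \<in> wide_strip f"
  have d: "((\<lambda>h. exp (h + \<i> * of_real f)) has_field_derivative exp (h + \<i> * of_real f)) (at h)"
   by (auto intro!: derivative_eq_intros)
  have "has_mderiv Z (exp_sigma3 w ** scale_mat (exp (h + \<i> * of_real f)) (B (exp (h + \<i> * of_real f)) ** Y (exp (h + \<i> * of_real f)))) h"
   unfolding Z_def by (rule has_mderiv_mult_const(2)[OF has_mderiv_chain[OF mat_odeD[OF odeY sec[OF e]] d]])
  also have "scale_mat (exp (h + \<i> * of_real f)) (B (exp (h + \<i> * of_real f)) ** Y (exp (h + \<i> * of_real f)))
    = log_system B (h + \<i> * of_real f) ** Y (exp (h + \<i> * of_real f))"
   by (simp add: log_system_def scaleC_mat_mult)
  also have "log_system B (h + \<i> * of_real f) = conj_exp w (?L h)"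
   unfolding B log_system_conj_exp two_pole_log_rotate[OF s] ..
  also have "exp_sigma3 w ** (conj_exp w (?L h) ** Y (exp (h + \<i> * of_real f))) = ?L h ** Z h"
   unfolding conj_exp_def Z_def by (simp add: matrix_mul_assoc[symmetric] exp_sigma3_cancel)
  finally show "has_mderiv Z (?L h ** Z h) h" .
 qed
 define p where "p = Complex 1 (pi / 2 - f)"
 have p: "p \<in> wide_strip f" "p \<in> log_plane" using wide_strip(3) by (auto simp: p_def wide_strip_def log_plane_def)
 have "det (Z p) = 1"
 proof (rule canonical_asymp_det[OF asy[of "pi / 2"]])
  fix r :: real assume r: "r > 0"
  have q: "Complex r (pi / 2 - f) \<in> wide_strip f" using r by (simp add: wide_strip_def)
  have "det (Z (Complex r (pi / 2 - f))) = det (Z p)"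
   by (rule det_mat_ode_const[OF Zode tf wide_strip(1,2) p(1) q])
  moreover have "Complex r (pi / 2 - f) + \<i> * of_real f = Complex r (pi / 2)" by (simp add: complex_eq_iff)
  ultimately show "det (Y (exp (Complex r (pi / 2)))) = det (Z p)" by (simp add: Z_def det_mul)
 qed auto
 define D where "D = adj2 (F p) ** Z p"
 have rel: "Z h = F h ** D" if "h \<in> wide_strip f" for h
  unfolding D_def
  by (rule mat_ode_unique[OF mat_ode_subset[OF F(1) wide_strip(3)] Zode tf wide_strip(1,2) p(1) F(2)[OF p(2)] that])
 have "canonical_asymp t kinf (\<lambda>h. Y (exp h)) (pi / 2)" by (rule asy) simp
 note dec = canonical_asymp_decays[OF this t]
 have dZ: "decays_along Z 2 (pi / 4 - f)" "decays_along Z 1 (3 * pi / 4 - f)"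
  unfolding Z_def
  by (intro decays_along_mult_left decays_along_shift[THEN iffD2, of "\<lambda>h. Y (exp h)"], use dec in simp)+
 have dP: "decays_along F 2 (pi / 4 - f)" "decays_along F 1 (3 * pi / 4 - f)"
  using F(3) unfolding canonical_at_def by auto
 have rr: "Z (Complex r c) = F (Complex r c) ** D \<and> det (F (Complex r c)) = 1"
  if "r > 0" "c \<in> {3 * pi / 4 - f, pi / 4 - f}" for r c
 proof -
  have "Complex r c \<in> wide_strip f" using that by (auto simp: wide_strip_def)
  then show ?thesis using rel F(2) wide_strip(3) by blast
 qed
 have "D $ 1 $ 2 = 0" "D $ 2 $ 1 = 0"
  using decays_along_unique[OF rr dP(1) dZ(1) dP(2) dZ(2)] by auto
 moreover have "det D = 1" using \<open>det (Z p) = 1\<close> F(2)[OF p(2)] by (simp add: D_def det_mul)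
 ultimately show ?thesis using that rel unfolding Z_def w_def by blast
qed

text \<open>\<open>F\<close> lives over the outside of the unit disc only. Over the upper half plane
  it extends to the inside as well, which is needed because the cuts and the poles are approached
  from there.\<close>

lemma solution_upper:
 fixes k0 k1 kinf y z u :: complex
 defines "A0 \<equiv> A0_mat k0 z u" and "A1 \<equiv> A1_mat k0 k1 kinf y z u"
 assumes Y: "canonical_solution2 (Y_coeff k0 k1 kinf f t y z u) kinf t Y" and t: "t > 0" and f: "\<bar>f\<bar> < pi / 2"
  and s: "exp s = of_real t * exp (\<i> * of_real f)"
  and F: "mat_ode (log_system (two_pole (exp s) 1 A0 A1)) F log_plane" "\<And>h. h \<in> log_plane \<Longrightarrow> det (F h) = 1"
  and D: "det D = 1"
   "\<And>h. h \<in> wide_strip f \<Longrightarrow> exp_sigma3 (varpi kinf f t) ** Y (exp (h + \<i> * of_real f)) = F h ** D"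
 obtains X where "mat_ode (two_pole (exp s) 1 A0 A1) X upper" "\<And>x. x \<in> upper \<Longrightarrow> det (X x) = 1"
  "\<And>h. h \<in> log_plane \<Longrightarrow> 0 < Im h \<Longrightarrow> Im h < pi \<Longrightarrow> X (exp h) = F h ** D"
  "\<And>l. l / exp (\<i> * of_real f) \<in> upper \<Longrightarrow> 1 < cmod l \<Longrightarrow> exp_sigma3 (varpi kinf f t) ** Y l = X (l / exp (\<i> * of_real f))"
proof -
 let ?A = "two_pole (exp s) 1 A0 A1"
 have tr: "A0 $ 2 $ 2 = - A0 $ 1 $ 1" "A1 $ 2 $ 2 = - A1 $ 1 $ 1" unfolding A0_def A1_def by (rule A0_A1_trace)+
 have tf: "trace_free (log_system ?A) V" for V by (rule log_system_two_pole_trace_free[OF tr])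
 have "starlike upper" unfolding upper_def
  by (rule convex_imp_starlike[OF convex_halfspace_Im_gt]) (auto intro!: exI[of _ \<i>])
 then obtain W where W: "mat_ode ?A W upper" "\<And>x. x \<in> upper \<Longrightarrow> det (W x) = 1"
  using mat_ode_fundamental[OF half_planes(1) _ two_pole_holo two_pole_trace_free[OF tr], of 1 "exp s"]
  by (auto simp: upper_def)
 define S where "S = {h. 0 < Re h} \<inter> {h. 0 < Im h} \<inter> {h. Im h < pi}"
 have S: "open S" "connected S" "S \<subseteq> log_plane" "S \<subseteq> wide_strip f"
 proof -
  show "open S" unfolding S_def by (intro open_Int open_halfspace_Re_gt open_halfspace_Im_gt open_halfspace_Im_lt)
  show "connected S" unfolding S_def
   by (intro convex_connected convex_Int convex_halfspace_Re_gt convex_halfspace_Im_gt convex_halfspace_Im_lt)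
  show "S \<subseteq> log_plane" "S \<subseteq> wide_strip f" using f by (auto simp: S_def log_plane_def wide_strip_def)
 qed
 define p where "p = Complex 1 (pi / 2)"
 have p: "p \<in> S" "p \<in> log_plane" by (auto simp: p_def S_def log_plane_def)
 have eS: "exp h \<in> upper" if "h \<in> S" for h using that by (intro Im_exp_pos) (auto simp: S_def)
 define C where "C = adj2 (W (exp p)) ** (F p ** D)"
 define X where "X x = W x ** C" for x
 have Xo: "mat_ode ?A X upper" unfolding X_def by (rule mat_ode_mult_const[OF W(1)])
 have Xd: "det (X x) = 1" if "x \<in> upper" for x
  using W(2)[OF that] W(2)[OF eS[OF p(1)]] F(2)[OF p(2)] D(1) by (simp add: X_def C_def det_mul)
 have XS: "X (exp h) = F h ** D" if "h \<in> S" for h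
 proof (rule mat_ode_unique_eq[OF mat_ode_exp[OF Xo eS] mat_ode_mult_const[OF mat_ode_subset[OF F(1) S(3)]] tf S(1,2) p(1) Xd[OF eS[OF p(1)]] that])
  show "X (exp p) = F p ** D" unfolding X_def C_def by (rule adj2_cancel(1)[OF W(2)[OF eS[OF p(1)]]])
 qed
 show ?thesis
 proof (rule that[OF Xo Xd])
  show "X (exp h) = F h ** D" if "h \<in> log_plane" "0 < Im h" "Im h < pi" for h
   using that by (intro XS) (auto simp: S_def log_plane_def)
  fix l assume l: "l / exp (\<i> * of_real f) \<in> upper" "1 < cmod l"
  define x where "x = l / exp (\<i> * of_real f)"
  have z: "x \<in> upper" "1 < cmod x" "x \<noteq> 0" using l by (auto simp: x_def norm_divide)
  define h where "h = Ln x"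
  have e: "exp h = x" using z by (simp add: h_def)
  have "h \<in> S"
  proof -
   have "Re h > 0" using z Re_Ln[OF z(3)] ln_gt_zero[of "cmod x"] by (simp add: h_def)
   moreover have "0 < Im h" "Im h < pi" using Im_Ln_pos_lt_imp[of x] Im_Ln_pos_lt[OF z(3)] z(1) by (auto simp: h_def upper_def)
   ultimately show ?thesis by (simp add: S_def)
  qed
  then have "X x = F h ** D" using XS e by metis
  also have "\<dots> = exp_sigma3 (varpi kinf f t) ** Y (exp (h + \<i> * of_real f))" using D(2) S(4) \<open>h \<in> S\<close> by auto
  also have "exp (h + \<i> * of_real f) = l" by (simp add: exp_add e x_def)
  finally show "exp_sigma3 (varpi kinf f t) ** Y l = X (l / exp (\<i> * of_real f))" by (simp add: x_def)
 qed
qed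

lemma data_sheets:
 fixes k0 k1 kinf y z u :: complex
 defines "A0 \<equiv> A0_mat k0 z u" and "A1 \<equiv> A1_mat k0 k1 kinf y z u"
 assumes Y: "canonical_solution2 (Y_coeff k0 k1 kinf f t y z u) kinf t Y" and t: "t > 0" and f: "\<bar>f\<bar> < pi / 2"
  and cont: "analytic_continuation_along (lasso 101 (1/2) (- exp (\<i> * of_real f))) Y (\<lambda>l. Y l ** N0)"
   "analytic_continuation_along (lasso 101 (1/2) (exp (\<i> * of_real f))) Y (\<lambda>l. Y l ** N1)"
  and s: "exp s = of_real t * exp (\<i> * of_real f)"
  and F: "mat_ode (log_system (two_pole (exp s) 1 A0 A1)) F log_plane" "\<And>h. h \<in> log_plane \<Longrightarrow> det (F h) = 1"
  and D: "det D = 1"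
   "\<And>h. h \<in> wide_strip f \<Longrightarrow> exp_sigma3 (varpi kinf f t) ** Y (exp (h + \<i> * of_real f)) = F h ** D"
 obtains X XL XM XR where "sheets (two_pole (exp s) 1 A0 A1) X XL XM XR" "jumps XL XM XR N0 N1"
  "\<And>h. h \<in> log_plane \<Longrightarrow> 0 < Im h \<Longrightarrow> Im h < pi \<Longrightarrow> X (exp h) = F h ** D"
proof -
 have tr: "A0 $ 2 $ 2 = - A0 $ 1 $ 1" "A1 $ 2 $ 2 = - A1 $ 1 $ 1" unfolding A0_def A1_def by (rule A0_A1_trace)+
 define w where "w = varpi kinf f t"
 obtain X where X: "mat_ode (two_pole (exp s) 1 A0 A1) X upper" "\<And>x. x \<in> upper \<Longrightarrow> det (X x) = 1"
  "\<And>h. h \<in> log_plane \<Longrightarrow> 0 < Im h \<Longrightarrow> Im h < pi \<Longrightarrow> X (exp h) = F h ** D"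
  "\<And>l. l / exp (\<i> * of_real f) \<in> upper \<Longrightarrow> 1 < cmod l \<Longrightarrow> exp_sigma3 w ** Y l = X (l / exp (\<i> * of_real f))"
  using solution_upper[OF Y t f s F[unfolded A0_def A1_def] D] unfolding A0_def A1_def w_def by metis
 obtain XL XM XR where sh: "sheets (two_pole (exp s) 1 A0 A1) X XL XM XR"
  using sheets_exist[OF tr X(1,2)] by blast
 have c: "analytic_continuation_along g (\<lambda>l. exp_sigma3 w ** Y l) (\<lambda>l. (exp_sigma3 w ** Y l) ** N)"
  if "analytic_continuation_along g Y (\<lambda>l. Y l ** N)" for g N
  by (rule analytic_continuation_along_mult[OF that open_UNIV _ mat_holo_const[of "exp_sigma3 w"], where K = "mat 1"])
    (simp_all add: matrix_mul_assoc)
 have "jumps XL XM XR N0 N1"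
  by (rule monodromy_jumps[OF f sh X(4) c[OF cont(1)] c[OF cont(2)]])
 from that[OF sh this X(3)] show ?thesis .
qed

text \<open>\<open>big_circle\<close> applies to \<open>F ** D\<close>, whose jumps are the given
  matrices; returning to \<open>F\<close> conjugates the product by \<open>D\<close>.\<close>

lemma full_turn:
 fixes k0 k1 kinf y z u :: complex
 defines "A0 \<equiv> A0_mat k0 z u" and "A1 \<equiv> A1_mat k0 k1 kinf y z u"
 assumes Y: "canonical_solution2 (Y_coeff k0 k1 kinf f t y z u) kinf t Y" and t: "t > 0" and f: "\<bar>f\<bar> < pi / 2"
  and cont: "analytic_continuation_along (lasso 101 (1/2) (- exp (\<i> * of_real f))) Y (\<lambda>l. Y l ** N0)"
   "analytic_continuation_along (lasso 101 (1/2) (exp (\<i> * of_real f))) Y (\<lambda>l. Y l ** N1)"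
  and s: "exp s = of_real t * exp (\<i> * of_real f)"
  and F: "mat_ode (log_system (two_pole (exp s) 1 A0 A1)) F log_plane" "\<And>h. h \<in> log_plane \<Longrightarrow> det (F h) = 1"
  and D: "det D = 1"
   "\<And>h. h \<in> wide_strip f \<Longrightarrow> exp_sigma3 (varpi kinf f t) ** Y (exp (h + \<i> * of_real f)) = F h ** D"
  and h: "h \<in> log_plane"
 shows "F (h + period) = F h ** (D ** (N1 ** N0) ** adj2 D)"
proof -
 have tr: "A0 $ 2 $ 2 = - A0 $ 1 $ 1" "A1 $ 2 $ 2 = - A1 $ 1 $ 1" unfolding A0_def A1_def by (rule A0_A1_trace)+
 obtain X XL XM XR where sh: "sheets (two_pole (exp s) 1 A0 A1) X XL XM XR" "jumps XL XM XR N0 N1"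
  "\<And>x. x \<in> log_plane \<Longrightarrow> 0 < Im x \<Longrightarrow> Im x < pi \<Longrightarrow> X (exp x) = F x ** D"
  using data_sheets[OF Y t f cont s F[unfolded A0_def A1_def] D] unfolding A0_def A1_def by metis
 have "(\<lambda>x. F x ** D) (h + period) = (F h ** D) ** (N1 ** N0)"
  by (rule big_circle[OF tr sh(1,2) mat_ode_mult_const[OF F(1)] _ _ h]) (use F(2) D(1) sh(3) in \<open>auto simp: det_mul\<close>)
 then have "F (h + period) ** D ** adj2 D = F h ** D ** (N1 ** N0) ** adj2 D" by simp
 then show ?thesis using adj2_cancel(3)[OF D(1)] by (simp add: matrix_mul_assoc)
qed

section \<open>Integer powers of unimodular matrices\<close>

lemma matrix_inv_det_1:
 fixes A :: "complex^2^2"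
 assumes "det A = 1"
 shows "matrix_inv A = adj2 A"
proof -
 have "A ** adj2 A = mat 1 \<and> adj2 A ** A = mat 1" using adj2_inverse[OF assms] by simp
 then show ?thesis unfolding matrix_inv_def
 proof (rule some_equality)
  fix A' assume "A ** A' = mat 1 \<and> A' ** A = mat 1"
  then show "A' = adj2 A" using adj2_cancel(2)[OF assms, of A'] by simp
 qed
qed

lemma funpow_mult_right: "(((**) A) ^^ n) (mat 1) ** A = A ** (((**) A) ^^ n) (mat 1)" for A :: "complex^2^2"
 by (induction n) (auto simp: matrix_mul_assoc[symmetric])

lemma det_funpow: "det A = 1 \<Longrightarrow> det ((((**) A) ^^ n) (mat 1)) = 1" for A :: "complex^2^2"
 by (induction n) (auto simp: det_mul)

lemma det_mat_powi:
 assumes "det A = 1"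
 shows "det (mat_powi A p) = 1"
 unfolding mat_powi_def matrix_inv_det_1[OF assms] using det_funpow[OF assms] det_funpow[of "adj2 A"] assms by simp

lemma funpow_adj2: "(((**) (adj2 A)) ^^ n) (mat 1) = adj2 ((((**) A) ^^ n) (mat 1))" for A :: "complex^2^2"
proof (induction n)
 case (Suc n)
 have "adj2 A ** adj2 ((((**) A) ^^ n) (mat 1)) = adj2 ((((**) A) ^^ n) (mat 1) ** A)" by (simp add: adj2_mult)
 then show ?case using Suc by (simp add: funpow_mult_right)
qed simp

lemma mat_powi_minus:
 assumes "det A = 1"
 shows "mat_powi A (- p) = adj2 (mat_powi A p)"
proof -
 have "mat_powi A p = (if 0 \<le> p then (((**) A) ^^ nat p) (mat 1) else adj2 ((((**) A) ^^ nat (- p)) (mat 1)))" for p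
  unfolding mat_powi_def matrix_inv_det_1[OF assms] funpow_adj2 ..
 then show ?thesis by (cases "p = 0") (auto simp: not_le)
qed

lemma mat_powi_conj:
 assumes "det A = 1" "det C = 1"
 shows "mat_powi (C ** A ** adj2 C) p = C ** mat_powi A p ** adj2 C"
proof -
 have f: "(((**) (C ** B ** adj2 C)) ^^ n) (mat 1) = C ** (((**) B) ^^ n) (mat 1) ** adj2 C" for B n
 proof (induction n)
  case 0
  then show ?case using adj2_inverse(1)[OF assms(2)] by simp
 next
  case (Suc n)
  have "(((**) (C ** B ** adj2 C)) ^^ Suc n) (mat 1) = (C ** B ** adj2 C) ** (C ** (((**) B) ^^ n) (mat 1) ** adj2 C)"
   using Suc by simp
  also have "\<dots> = C ** (B ** (adj2 C ** (C ** ((((**) B) ^^ n) (mat 1) ** adj2 C))))"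
   by (simp only: matrix_mul_assoc)
  also have "\<dots> = C ** (((**) B) ^^ Suc n) (mat 1) ** adj2 C"
   unfolding adj2_cancel(2)[OF assms(2)] by (simp add: matrix_mul_assoc)
  finally show ?case .
 qed
 have d: "det (C ** A ** adj2 C) = 1" using assms by (simp add: det_mul)
 have a: "adj2 (C ** A ** adj2 C) = C ** adj2 A ** adj2 C" by (simp add: adj2_mult matrix_mul_assoc)
 show ?thesis unfolding mat_powi_def matrix_inv_det_1[OF d] matrix_inv_det_1[OF assms(1)] a f by simp
qed

lemma mat_powi_nat: "mat_powi A (int n) = (((**) A) ^^ n) (mat 1)"
 by (simp add: mat_powi_def)

lemma mat_powi_shift:
 fixes \<Psi> :: "complex \<Rightarrow> complex^2^2"
 assumes "\<And>h. h \<in> log_plane \<Longrightarrow> \<Psi> (h + period) = \<Psi> h ** M" "det M = 1" "h \<in> log_plane"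
 shows "\<Psi> (h + period * of_int p) = \<Psi> h ** mat_powi M p"
proof -
 have nat: "\<Psi> (h + period * of_nat n) = \<Psi> h ** mat_powi M (int n)" if "h \<in> log_plane" for h n
  unfolding mat_powi_nat
 proof (induction n)
  case (Suc n)
  have "h + period * of_nat n \<in> log_plane" using that by (simp add: log_plane_def)
  from assms(1)[OF this] have "\<Psi> (h + period * of_nat (Suc n)) = \<Psi> h ** ((((**) M) ^^ n) (mat 1) ** M)"
   using Suc by (simp add: algebra_simps matrix_mul_assoc)
  then show ?case by (simp add: funpow_mult_right)
 qed simp
 show ?thesis
 proof (cases p)
  case (nonneg n)
  then show ?thesis using nat[OF assms(3), of n] by simp
 next
  case (neg n)
  \<comment> \<open>For negative \<open>p\<close> the nonnegative case is applied at the translated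
    point and solved for its value there.\<close>
  define h' where "h' = h + period * of_int p"
  have e': "h' \<in> log_plane" using assms(3) by (simp add: h'_def log_plane_def)
  have "\<Psi> h = \<Psi> h' ** mat_powi M (int (Suc n))"
   using nat[OF e', of "Suc n"] by (simp add: h'_def neg algebra_simps)
  then have "\<Psi> h ** adj2 (mat_powi M (int (Suc n))) = \<Psi> h' ** mat_powi M (int (Suc n)) ** adj2 (mat_powi M (int (Suc n)))"
   by (rule arg_cong)
  also have "\<dots> = \<Psi> h'" by (rule adj2_cancel(3)[OF det_mat_powi[OF assms(2)]])
  finally have "\<Psi> h ** adj2 (mat_powi M (int (Suc n))) = \<Psi> h'" .
  then show ?thesis unfolding h'_def neg mat_powi_minus[OF assms(2)] by simp
 qed
qed

section \<open>Gauge classes and the shift of the label\<close>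

lemma pow_sigma3_entry [simp]:
 "pow_sigma3 c $ 1 $ 1 = c" "pow_sigma3 c $ 1 $ 2 = 0" "pow_sigma3 c $ 2 $ 1 = 0" "pow_sigma3 c $ 2 $ 2 = inverse c"
 by (simp_all add: pow_sigma3_def)

lemma pow_sigma3_facts:
 assumes "c \<noteq> 0"
 shows "det (pow_sigma3 c) = 1" "pow_sigma3 (inverse c) = adj2 (pow_sigma3 c)"
 using assms by (simp_all add: det_2 mat_eq_iff)

lemma gauge_rel_iff:
 "((M0, M1), (N0, N1)) \<in> gauge_rel \<longleftrightarrow> (\<exists>c. c \<noteq> 0 \<and> N0 = pow_sigma3 c ** M0 ** adj2 (pow_sigma3 c) \<and> N1 = pow_sigma3 c ** M1 ** adj2 (pow_sigma3 c))"
 unfolding gauge_rel_def using pow_sigma3_facts(2) by auto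

lemma gauge_relE:
 assumes "(M, N) \<in> gauge_rel"
 obtains c where "c \<noteq> 0" "fst N = pow_sigma3 c ** fst M ** adj2 (pow_sigma3 c)" "snd N = pow_sigma3 c ** snd M ** adj2 (pow_sigma3 c)"
 using assms gauge_rel_iff[of "fst M" "snd M" "fst N" "snd N"] by auto

lemma gauge_relI:
 assumes "c \<noteq> 0" "fst N = pow_sigma3 c ** fst M ** adj2 (pow_sigma3 c)" "snd N = pow_sigma3 c ** snd M ** adj2 (pow_sigma3 c)"
 shows "(M, N) \<in> gauge_rel"
 using assms by (cases M; cases N) (auto simp: gauge_rel_iff)

lemma equiv_gauge_rel: "equiv UNIV gauge_rel"
proof (rule equivI)
 show "gauge_rel \<subseteq> UNIV \<times> UNIV" by simp
 show "refl gauge_rel"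
 proof (rule reflI)
  fix M
  have "pow_sigma3 1 = mat 1" by (simp add: mat_eq_iff)
  then show "(M, M) \<in> gauge_rel" by (intro gauge_relI[of 1]) simp_all
 qed
 show "sym gauge_rel"
 proof (rule symI)
  fix M N assume "(M, N) \<in> gauge_rel"
  then obtain c where c: "c \<noteq> 0" "fst N = pow_sigma3 c ** fst M ** adj2 (pow_sigma3 c)" "snd N = pow_sigma3 c ** snd M ** adj2 (pow_sigma3 c)"
   by (rule gauge_relE)
  note d = pow_sigma3_facts[OF c(1)]
  show "(N, M) \<in> gauge_rel"
   by (rule gauge_relI[of "inverse c"])
     (use c(1) in \<open>simp_all add: d(2) c(2,3) matrix_mul_assoc[symmetric] adj2_cancel[OF d(1)] adj2_inverse(2)[OF d(1)]\<close>)
 qed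
 show "trans gauge_rel"
 proof (rule transI)
  fix L M N assume "(L, M) \<in> gauge_rel" "(M, N) \<in> gauge_rel"
  then obtain c d where c: "c \<noteq> 0" "fst M = pow_sigma3 c ** fst L ** adj2 (pow_sigma3 c)" "snd M = pow_sigma3 c ** snd L ** adj2 (pow_sigma3 c)"
   and d: "d \<noteq> 0" "fst N = pow_sigma3 d ** fst M ** adj2 (pow_sigma3 d)" "snd N = pow_sigma3 d ** snd M ** adj2 (pow_sigma3 d)"
   by (elim gauge_relE)
  have "pow_sigma3 (d * c) = pow_sigma3 d ** pow_sigma3 c" by (simp add: mat_eq_iff mat_mult_entry)
  then show "(L, N) \<in> gauge_rel"
   by (intro gauge_relI[of "d * c"]) (use c d in \<open>simp_all add: adj2_mult matrix_mul_assoc\<close>)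
 qed
qed

lemma gauge_class_eq_iff: "gauge_class M = gauge_class N \<longleftrightarrow> (M, N) \<in> gauge_rel"
 unfolding gauge_class_def using eq_equiv_class_iff[OF equiv_gauge_rel] by auto

lemma shifted_pair_eq:
 fixes p :: int and N :: "(complex^2^2) \<times> (complex^2^2)"
 assumes "det (snd N ** fst N) = 1"
 defines "P \<equiv> mat_powi (snd N ** fst N) p"
 shows "shifted_pair p N = (P ** fst N ** adj2 P, P ** snd N ** adj2 P)"
 unfolding shifted_pair_def Let_def P_def mat_powi_minus[OF assms(1)] ..

text \<open>The gauge factor conjugates the product of the pair and hence its powers, so it can be
  pulled out of the shifted pair: the shift is well defined on classes.\<close>

lemma shifted_pair_gauge:
 assumes "(M, N) \<in> gauge_rel" "det (fst M) = 1" "det (snd M) = 1"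
 shows "(shifted_pair p M, shifted_pair p N) \<in> gauge_rel"
proof -
 obtain c where c: "c \<noteq> 0" "fst N = pow_sigma3 c ** fst M ** adj2 (pow_sigma3 c)" "snd N = pow_sigma3 c ** snd M ** adj2 (pow_sigma3 c)"
  by (rule gauge_relE[OF assms(1)])
 define g where "g = pow_sigma3 c"
 have g: "det g = 1" using pow_sigma3_facts(1)[OF c(1)] by (simp add: g_def)
 have dM: "det (snd M ** fst M) = 1" using assms by (simp add: det_mul)
 have prod: "snd N ** fst N = g ** (snd M ** fst M) ** adj2 g"
  unfolding c(2,3) g_def[symmetric] by (simp add: matrix_mul_assoc[symmetric] adj2_cancel[OF g])
 have dN: "det (snd N ** fst N) = 1" unfolding prod using dM g by (simp add: det_mul)
 define P where "P = mat_powi (snd M ** fst M) p"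
 have PN: "mat_powi (snd N ** fst N) p = g ** P ** adj2 g" unfolding prod P_def by (rule mat_powi_conj[OF dM g])
 show ?thesis
  unfolding shifted_pair_eq[OF dM] shifted_pair_eq[OF dN] PN P_def[symmetric]
  by (rule gauge_relI[OF c(1)])
    (simp_all add: c(2,3) g_def[symmetric] adj2_mult matrix_mul_assoc[symmetric] adj2_cancel[OF g])
qed

lemma trace_conj:
 assumes "det P = 1"
 shows "trace (P ** A ** adj2 P) = trace (A :: complex^2^2)"
proof -
 have "trace (P ** A ** adj2 P) = trace (adj2 P ** (P ** A))" by (rule trace_mul_sym)
 then show ?thesis by (simp add: adj2_cancel(2)[OF assms])
qed

text \<open>The condition at infinity is the upper left entry of \<open>snd M ** fst M\<close>, the
  very matrix whose powers conjugate the pair in the shift.\<close>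

lemma monodromy_pairs_iff:
 "M \<in> monodromy_pairs k0 k1 kinf \<longleftrightarrow> det (fst M) = 1 \<and> det (snd M) = 1 \<and>
   (snd M ** fst M) $ 1 $ 1 = exp (- of_real pi * \<i> * kinf) \<and>
   trace (fst M) = 2 * cos (of_real pi * k0) \<and> trace (snd M) = 2 * cos (of_real pi * k1)"
 unfolding monodromy_pairs_def by (cases M) (auto simp: mat_mult_entry mult.commute)

lemma monodromy_pairs_gauge:
 assumes "(M, N) \<in> gauge_rel" "M \<in> monodromy_pairs k0 k1 kinf"
 shows "N \<in> monodromy_pairs k0 k1 kinf"
proof -
 obtain c where c: "c \<noteq> 0" "fst N = pow_sigma3 c ** fst M ** adj2 (pow_sigma3 c)" "snd N = pow_sigma3 c ** snd M ** adj2 (pow_sigma3 c)"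
  by (rule gauge_relE[OF assms(1)])
 define g where "g = pow_sigma3 c"
 have g: "det g = 1" using pow_sigma3_facts(1)[OF c(1)] by (simp add: g_def)
 have prod: "snd N ** fst N = g ** (snd M ** fst M) ** adj2 g"
  unfolding c(2,3) g_def[symmetric] by (simp add: matrix_mul_assoc[symmetric] adj2_cancel[OF g])
 have "(g ** A ** adj2 g) $ 1 $ 1 = A $ 1 $ 1" for A using c(1) by (simp add: g_def mat_mult_entry)
 then have "(snd N ** fst N) $ 1 $ 1 = (snd M ** fst M) $ 1 $ 1" unfolding prod .
 then show ?thesis
  using assms(2) g unfolding monodromy_pairs_iff c(2,3) g_def[symmetric] by (simp add: det_mul trace_conj)
qed

lemma gauge_class_in_manifold:
 "gauge_class M \<in> monodromy_manifold k0 k1 kinf \<longleftrightarrow> M \<in> monodromy_pairs k0 k1 kinf"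
proof
 assume "gauge_class M \<in> monodromy_manifold k0 k1 kinf"
 then obtain N where N: "N \<in> monodromy_pairs k0 k1 kinf" "gauge_class N = gauge_class M"
  unfolding monodromy_manifold_def quotient_def gauge_class_def by auto
 then show "M \<in> monodromy_pairs k0 k1 kinf" using monodromy_pairs_gauge gauge_class_eq_iff by blast
qed (auto simp: monodromy_manifold_def quotient_def gauge_class_def)

text \<open>Traces and determinants are invariant under conjugation. The condition at infinity
  survives because \<open>P\<close> is a power of \<open>Q\<close> and so commutes with it: the
  product of the shifted pair is again \<open>Q\<close>.\<close>

lemma shifted_pair_monodromy_pairs:
 assumes "M \<in> monodromy_pairs k0 k1 kinf"
 shows "shifted_pair p M \<in> monodromy_pairs k0 k1 kinf"
proof -
 define Q where "Q = snd M ** fst M"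
 have d: "det (fst M) = 1" "det (snd M) = 1" "det Q = 1" using assms by (auto simp: monodromy_pairs_iff det_mul Q_def)
 define P where "P = mat_powi Q p"
 have P: "det P = 1" unfolding P_def by (rule det_mat_powi[OF d(3)])
 \<comment> \<open>\<open>mat_powi_conj\<close> for the conjugation of \<open>Q\<close> by itself,
   which leaves \<open>Q\<close> and therefore its powers fixed.\<close>
 have "P = Q ** P ** adj2 Q"
  unfolding P_def using mat_powi_conj[OF d(3,3), of p] adj2_cancel(3)[OF d(3), of Q] by simp
 then have comm: "P ** Q = Q ** P" using adj2_cancel(4)[OF d(3), of "Q ** P"] by simp
 have "(P ** snd M ** adj2 P) ** (P ** fst M ** adj2 P) = P ** Q ** adj2 P"
  by (simp add: matrix_mul_assoc[symmetric] adj2_cancel[OF P] Q_def)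
 also have "\<dots> = Q" unfolding comm by (rule adj2_cancel(3)[OF P])
 finally have e: "(P ** snd M ** adj2 P) ** (P ** fst M ** adj2 P) = Q" .
 have se: "shifted_pair p M = (P ** fst M ** adj2 P, P ** snd M ** adj2 P)"
  using shifted_pair_eq[of M p] d(3) by (simp add: Q_def P_def)
 show ?thesis
  using assms P unfolding monodromy_pairs_iff se fst_conv snd_conv e
  by (simp add: det_mul trace_conj Q_def)
qed

section \<open>Transport of monodromy data between two sheets\<close>

lemma sector2_eventually:
 assumes "R > 1"
 shows "\<forall>\<^sub>F l in nhds (\<i> * of_real R). l \<in> sector2"
proof -
 have "open {l. Im l > 1}" by (rule open_halfspace_Im_gt)
 then have "\<forall>\<^sub>F l in nhds (\<i> * of_real R). l \<in> {l. Im l > 1}"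
  using assms by (intro eventually_nhds_in_open) auto
 then show ?thesis
 proof eventually_elim
  case (elim l)
  then have "1 < cmod l" using abs_Im_le_cmod[of l] by auto
  moreover have "- \<i> * l \<noteq> 0" using elim by auto
  moreover have "Re (- \<i> * l) > 0" using elim by simp
  ultimately have "\<bar>Im (Ln (- \<i> * l))\<bar> < pi / 2" using Re_Ln_pos_lt by blast
  then have "\<bar>Arg (- \<i> * l)\<bar> < pi" using Arg_eq_Im_Ln[OF \<open>- \<i> * l \<noteq> 0\<close>] pi_gt_zero by linarith
  then show ?case using \<open>1 < cmod l\<close> by (simp add: sector2_def arg2_def)
 qed
qed

lemma log_system_periodic: "log_system B (h + period * of_int p) = log_system B h"
proof -
 have "exp (h + period * of_int p) = exp h"
  using exp_integer_2pi[of "of_int p"] by (simp add: exp_add mult_ac)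
 then show ?thesis by (simp add: log_system_def)
qed

lemma fundamental_shift:
 assumes "mat_ode (log_system B) F log_plane"
 shows "mat_ode (log_system B) (\<lambda>h. F (h + period * of_int p)) log_plane"
 by (rule mat_ode_translate[OF assms]) (simp add: log_plane_def log_system_periodic)

text \<open>The isomonodromic deformation from \<open>s0\<close> to \<open>s1\<close> keeps the monodromy of the continued solution, but rotates
 the sector of the canonical solution by \<open>-2 \<pi> p\<close>.  Returning to the original sector costs \<open>-p\<close> turns around all
 singular points.\<close>

lemma monodromy_data_shift:
 assumes PV: "PV_system k0 k1 kinf y z u" and s0: "s0 \<in> good_set y z u" and s1: "s1 \<in> good_set y z u"
  and im: "Im s1 = Im s0 + 2 * pi * of_int p" and f: "\<bar>Im s0\<bar> < pi / 2"
  and data: "monodromy_data k0 k1 kinf (Im s0) (exp (Re s0)) (y s0) (z s0) (u s0) N"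
  and det: "det (fst N) = 1" "det (snd N) = 1"
 obtains N' where "monodromy_data k0 k1 kinf (Im s0) (exp (Re s1)) (y s1) (z s1) (u s1) N'"
  "(shifted_pair p N, N') \<in> gauge_rel"
proof -
 interpret iso: isomonodromic "\<lambda>s. A0_mat k0 (z s) (u s)" "\<lambda>s. A1_mat k0 k1 kinf (y s) (z s) (u s)" "good_set y z u" kinf
  by (rule PV_isomonodromic[OF PV])
 define f where "f = Im s0"
 define t0 where "t0 = exp (Re s0)"
 define t1 where "t1 = exp (Re s1)"
 define c where "c = exp (\<i> * of_real f)"
 have ph: "\<bar>f\<bar> < pi / 2" using f by (simp add: f_def)
 have t: "t0 > 0" "t1 > 0" by (simp_all add: t0_def t1_def)
 have es0: "exp s0 = of_real t0 * exp (\<i> * of_real f)"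
  unfolding t0_def f_def using exp_eq_polar[of s0] by (simp add: cis_conv_exp)
 have es1: "exp s1 = of_real t1 * exp (\<i> * of_real f)"
 proof -
  have "exp s1 = of_real t1 * cis (f + 2 * pi * of_int p)" using exp_eq_polar[of s1] im by (simp add: t1_def f_def)
  also have "cis (f + 2 * pi * of_int p) = cis f" by (simp add: cis_mult[symmetric] cis_multiple_2pi)
  finally show ?thesis by (simp add: cis_conv_exp)
 qed
 obtain Y where Y: "canonical_solution2 (Y_coeff k0 k1 kinf f t0 (y s0) (z s0) (u s0)) kinf t0 Y"
  and cont: "\<And>R r. R > 100 \<Longrightarrow> 0 < r \<Longrightarrow> r < 1 \<Longrightarrow> analytic_continuation_along (lasso R r (- c)) Y (\<lambda>l. Y l ** fst N)"
   "\<And>R r. R > 100 \<Longrightarrow> 0 < r \<Longrightarrow> r < 1 \<Longrightarrow> analytic_continuation_along (lasso R r c) Y (\<lambda>l. Y l ** snd N)"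
  using data unfolding monodromy_data_def f_def[symmetric] t0_def[symmetric] c_def by blast
 obtain W0 where f0: "iso.fundamental_at s0 W0" using iso.fundamental_at_exists[OF s0] by blast
 obtain W1 where f1: "iso.fundamental_at s1 W1" using iso.fundamental_at_exists[OF s1] by blast
 note F0 = f0[unfolded iso.fundamental_at_def iso.AA_def] and F1 = f1[unfolded iso.fundamental_at_def iso.AA_def]
 have o0: "mat_ode (log_system (two_pole (exp s0) 1 (A0_mat k0 (z s0) (u s0)) (A1_mat k0 k1 kinf (y s0) (z s0) (u s0)))) W0 log_plane"
  and d0: "\<And>h. h \<in> log_plane \<Longrightarrow> det (W0 h) = 1" and c0: "canonical_at f W0" using F0 by (auto simp: f_def)
 have o1: "mat_ode (log_system (two_pole (exp s1) 1 (A0_mat k0 (z s1) (u s1)) (A1_mat k0 k1 kinf (y s1) (z s1) (u s1)))) W1 log_plane"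
  and d1: "\<And>h. h \<in> log_plane \<Longrightarrow> det (W1 h) = 1" and c1: "canonical_at (f + 2 * pi * of_int p) W1" using F1 im by (auto simp: f_def)
 obtain D0 where D0: "D0 $ 1 $ 2 = 0" "D0 $ 2 $ 1 = 0" "det D0 = 1"
  "\<And>h. h \<in> wide_strip f \<Longrightarrow> exp_sigma3 (varpi kinf f t0) ** Y (exp (h + \<i> * of_real f)) = W0 h ** D0"
  using canonical_solution2_fundamental[OF Y t(1) es0 o0 d0 c0] by blast
 define Q where "Q = snd N ** fst N"
 have dQ: "det Q = 1" using det by (simp add: Q_def det_mul)
 define P where "P = mat_powi Q p"
 have dP: "det P = 1" unfolding P_def by (rule det_mat_powi[OF dQ])
 have turn: "W0 (h + period) = W0 h ** (D0 ** Q ** adj2 D0)" if "h \<in> log_plane" for h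
  unfolding Q_def
  using full_turn[OF Y t(1) ph cont(1)[unfolded c_def] cont(2)[unfolded c_def] es0 o0 d0 D0(3,4) that] by simp
 \<comment> \<open>The full turn of \<open>W0\<close> is the product \<open>Q\<close> seen through
   \<open>D0\<close>; its power with exponent \<open>- p\<close> involves \<open>adj2 P\<close>, the
   inverse of the power that defines the shift.\<close>
 have turns: "W0 (h + period * of_int (- p)) = W0 h ** (D0 ** adj2 P ** adj2 D0)" if "h \<in> log_plane" for h
 proof -
  have "det (D0 ** Q ** adj2 D0) = 1" using D0(3) dQ by (simp add: det_mul)
  from mat_powi_shift[where \<Psi> = W0, OF turn this that, of "- p"] show ?thesis
   unfolding mat_powi_conj[OF dQ D0(3)] mat_powi_minus[OF dQ] P_def .
 qed
 obtain T where T: "mat_holo T (- {1, - 1})"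
  "\<And>W' W. iso.fundamental_at s0 W' \<Longrightarrow> iso.fundamental_at s1 W \<Longrightarrow>
    \<exists>D. D $ 1 $ 2 = 0 \<and> D $ 2 $ 1 = 0 \<and> det D = 1 \<and> (\<forall>h\<in>log_plane. T (exp h) ** W' h = W h ** D)"
  using iso.isomonodromy[OF s0 s1] unfolding iso.intertwined_def by blast
 obtain D1 where D1: "D1 $ 1 $ 2 = 0" "D1 $ 2 $ 1 = 0" "det D1 = 1" "\<And>h. h \<in> log_plane \<Longrightarrow> T (exp h) ** W0 h = W1 h ** D1"
  using T(2)[OF f0 f1] by blast
 obtain WY where PY: "mat_ode (log_system (Y_coeff k0 k1 kinf f t1 (y s1) (z s1) (u s1))) WY log_plane"
  "\<And>d. d > 0 \<Longrightarrow> canonical_asymp t1 kinf WY d"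
  using canonical_solution_log_exists[OF Y_coeff_rank1 t(2)] by metis
 define Y' where "Y' l = WY (ln2 l)" for l
 have Y': "canonical_solution2 (Y_coeff k0 k1 kinf f t1 (y s1) (z s1) (u s1)) kinf t1 Y'"
  unfolding Y'_def by (rule canonical_solution2I[OF PY])
 \<comment> \<open>Translation by \<open>- p\<close> periods brings the canonical sector of
   \<open>s1\<close> back to the one with \<open>f = Im s0\<close>, which is the sector in which the
   data at \<open>s1\<close> are defined.\<close>
 define Ws where "Ws h = W1 (h + period * of_int (- p))" for h
 have lpp: "h + period * of_int k \<in> log_plane" if "h \<in> log_plane" for h k
  using that by (simp add: log_plane_def)
 have os: "mat_ode (log_system (two_pole (exp s1) 1 (A0_mat k0 (z s1) (u s1)) (A1_mat k0 k1 kinf (y s1) (z s1) (u s1)))) Ws log_plane"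
  unfolding Ws_def by (rule fundamental_shift[OF o1])
 have ds: "det (Ws h) = 1" if "h \<in> log_plane" for h unfolding Ws_def by (rule d1[OF lpp[OF that]])
 have cs: "canonical_at f Ws"
 proof -
  have e: "Ws = (\<lambda>h. W1 (h + \<i> * of_real (- 2 * pi * of_int p)))"
  proof
   fix h
   have "h + period * of_int (- p) = h + \<i> * of_real (- 2 * pi * of_int p)" by simp
   then show "Ws h = W1 (h + \<i> * of_real (- 2 * pi * of_int p))" unfolding Ws_def by (rule arg_cong)
  qed
  have a: "c + - 2 * pi * of_int p + (f + 2 * pi * of_int p) = c + f" for c :: real by simp
  show ?thesis unfolding e canonical_at_def decays_along_shift
   using c1 unfolding canonical_at_def by (metis a)
 qed
 obtain D2 where D2: "D2 $ 1 $ 2 = 0" "D2 $ 2 $ 1 = 0" "det D2 = 1"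
  "\<And>h. h \<in> wide_strip f \<Longrightarrow> exp_sigma3 (varpi kinf f t1) ** Y' (exp (h + \<i> * of_real f)) = Ws h ** D2"
  using canonical_solution2_fundamental[OF Y' t(2) es1 os ds cs] by blast
 define w0 where "w0 = varpi kinf f t0"
 define w1 where "w1 = varpi kinf f t1"
 \<comment> \<open>In \<open>Y' l = L l ** Y l ** K\<close> the left factor is single-valued off the
   poles. The right factor is constant: \<open>adj2 P\<close> for the turns, times a diagonal matrix
   \<open>D'\<close> that collects the three normalisations.\<close>
 define L where "L l = exp_sigma3 (- w1) ** T (l / c) ** exp_sigma3 w0" for l
 define D' where "D' = adj2 D0 ** adj2 D1 ** D2"
 define K where "K = adj2 P ** D'"
 have cnz: "c \<noteq> 0" by (simp add: c_def)
 have rel: "Y' l = L l ** Y l ** K" if l: "l \<in> sector2" for l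
 proof -
  define h where "h = ln2 l - \<i> * of_real f"
  have ws: "h \<in> wide_strip f"
   using sector2_log(2,3)[OF l] l by (simp add: wide_strip_def h_def log_plane_def sector2_def)
  then have lp: "h \<in> log_plane" using wide_strip(3) by blast
  have el: "exp (h + \<i> * of_real f) = l" using sector2_log(1)[OF l] by (simp add: h_def)
  have ee: "exp h = l / c" using sector2_log(1)[OF l] by (simp add: h_def exp_diff c_def)
  define h' where "h' = h + period * of_int (- p)"
  have lp': "h' \<in> log_plane" unfolding h'_def by (rule lpp[OF lp])
  have ee': "exp h' = l / c"
   unfolding h'_def exp_add ee using exp_integer_2pi[of "of_int (- p)"] by (simp add: mult_ac)
  have P1: "W1 h' = T (l / c) ** W0 h' ** adj2 D1"
   using D1(4)[OF lp'] adj2_cancel(3)[OF D1(3), of "W1 h'"] unfolding ee' by simp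
  have P0: "W0 h' = W0 h ** (D0 ** adj2 P ** adj2 D0)" unfolding h'_def by (rule turns[OF lp])
  have E0: "W0 h ** D0 = exp_sigma3 w0 ** Y l" using D0(4)[OF ws] unfolding el w0_def by simp
  have "exp_sigma3 w1 ** Y' l = W1 h' ** D2" using D2(4)[OF ws] unfolding el w1_def Ws_def h'_def .
  also have "\<dots> = T (l / c) ** (W0 h ** D0) ** (adj2 P ** (adj2 D0 ** adj2 D1 ** D2))"
   unfolding P1 P0 by (simp add: matrix_mul_assoc)
  also have "\<dots> = T (l / c) ** (exp_sigma3 w0 ** Y l) ** K" unfolding E0 K_def D'_def ..
  finally have "exp_sigma3 (- w1) ** (exp_sigma3 w1 ** Y' l) = exp_sigma3 (- w1) ** (T (l / c) ** (exp_sigma3 w0 ** Y l) ** K)" by simp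
  then show ?thesis unfolding exp_sigma3_cancel L_def by (simp add: matrix_mul_assoc)
 qed
 have dD': "det D' = 1" "D' $ 1 $ 2 = 0" "D' $ 2 $ 1 = 0"
  using D0 D1 D2 by (simp_all add: D'_def det_mul mat_mult_entry)
 have dK: "det K = 1" using dD' dP by (simp add: K_def det_mul)
 define N' where "N' = (adj2 K ** fst N ** K, adj2 K ** snd N ** K)"
 have Lh: "mat_holo L {l. l / c \<in> - {1, - 1}}"
 proof -
  have "mat_holo (\<lambda>l. T (l / c)) {l. l / c \<in> - {1, - 1}}"
   by (rule mat_holo_compose[OF T(1)]) (use cnz in \<open>auto intro!: holomorphic_intros\<close>)
  then show ?thesis unfolding L_def by (intro mat_holo_mult mat_holo_const)
 qed
 have opV: "open {l. l / c \<in> - {1, - 1}}"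
  using open_vimage[of "- {1, - 1 :: complex}" "\<lambda>l. l / c"] by (simp add: vimage_def continuous_intros cnz open_Compl)
 have newcont: "analytic_continuation_along (lasso R r (of_real a * c)) Y' (\<lambda>l. Y' l ** (adj2 K ** M ** K))"
  if R: "R > 100" and r: "0 < r" "r < 1" and a: "a = 1 \<or> a = (- 1 :: real)"
   and old: "analytic_continuation_along (lasso R r (of_real a * c)) Y (\<lambda>l. Y l ** M)" for R r a M
 proof (rule analytic_continuation_along_mult[OF old opV _ Lh])
  have R1: "R > 1" using R by simp
  show "lasso R r (of_real a * c) q \<in> {l. l / c \<in> - {1, - 1}}" if "q \<in> {0..1}" for q
   using lasso_avoids[OF ph R1 r a that] by (simp add: c_def)
  have e: "lasso R r (of_real a * c) 0 = \<i> * of_real R" "lasso R r (of_real a * c) 1 = \<i> * of_real R"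
   using lasso_shape[OF ph R1 r(1) a] unfolding c_def by metis+
  show "\<forall>\<^sub>F l in nhds (lasso R r (of_real a * c) 0). Y' l = L l ** Y l ** K"
   unfolding e using sector2_eventually[OF R1] by eventually_elim (rule rel)
  show "\<forall>\<^sub>F l in nhds (lasso R r (of_real a * c) 1). Y' l ** (adj2 K ** M ** K) = L l ** (Y l ** M) ** K"
   unfolding e using sector2_eventually[OF R1]
  proof eventually_elim
   case (elim l)
   have "Y' l ** (adj2 K ** M ** K) = (L l ** Y l) ** (K ** (adj2 K ** (M ** K)))"
    unfolding rel[OF elim] by (simp add: matrix_mul_assoc)
   then show ?case unfolding adj2_cancel(1)[OF dK] by (simp add: matrix_mul_assoc)
  qed
 qed
 have "monodromy_data k0 k1 kinf f t1 (y s1) (z s1) (u s1) N'"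
  unfolding monodromy_data_def c_def[symmetric]
 proof (intro exI[of _ Y'] conjI Y' allI impI)
  fix R r :: real assume "100 < R \<and> 0 < r \<and> r < 1"
  then have R: "R > 100" and r: "0 < r" "r < 1" by auto
  show "analytic_continuation_along (lasso R r (- c)) Y' (\<lambda>l. Y' l ** fst N')"
   using newcont[OF R r, of "- 1" "fst N"] cont(1)[OF R r] by (simp add: N'_def)
  show "analytic_continuation_along (lasso R r c) Y' (\<lambda>l. Y' l ** snd N')"
   using newcont[OF R r, of 1 "snd N"] cont(2)[OF R r] by (simp add: N'_def)
 qed
 moreover have "(shifted_pair p N, N') \<in> gauge_rel"
 proof -
  have se: "shifted_pair p N = (P ** fst N ** adj2 P, P ** snd N ** adj2 P)"
   using shifted_pair_eq[of N p] dQ by (simp add: Q_def P_def)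
  show ?thesis
 proof (rule gauge_relI[of "D' $ 2 $ 2"])
  have pd: "D' $ 1 $ 1 * D' $ 2 $ 2 = 1" using dD' by (simp add: det_2)
  then show nz: "D' $ 2 $ 2 \<noteq> 0" by auto
  have inv: "inverse (D' $ 2 $ 2) = D' $ 1 $ 1" using pd nz by (simp add: field_simps)
  \<comment> \<open>The new data are the shifted pair conjugated by the inverse of the diagonal
    matrix \<open>D'\<close>; of determinant 1, that inverse has the form required of a gauge
    factor.\<close>
  have g: "pow_sigma3 (D' $ 2 $ 2) = adj2 D'" by (simp add: mat_eq_iff inv dD')
  show "fst N' = pow_sigma3 (D' $ 2 $ 2) ** fst (shifted_pair p N) ** adj2 (pow_sigma3 (D' $ 2 $ 2))"
   "snd N' = pow_sigma3 (D' $ 2 $ 2) ** snd (shifted_pair p N) ** adj2 (pow_sigma3 (D' $ 2 $ 2))"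
   unfolding g se N'_def K_def
   by (simp_all add: adj2_mult matrix_mul_assoc)
 qed
 qed
 ultimately show ?thesis using that unfolding f_def t1_def by blast
qed

section \<open>Translation of solutions on the universal covering\<close>

lemma eventually_at_shift:
 fixes s :: complex
 assumes "eventually P (at (s + a))"
 shows "eventually (\<lambda>s. P (s + a)) (at s)"
proof -
 obtain d where d: "d > 0" "\<And>x. x \<noteq> s + a \<Longrightarrow> dist x (s + a) < d \<Longrightarrow> P x"
  using assms unfolding eventually_at by auto
 show ?thesis unfolding eventually_at using d(1) d(2)[of "x + a" for x] by (intro exI[of _ d]) auto
qed

lemma cosparse_shift:
 fixes a :: complex
 assumes "\<forall>\<^sub>\<approx>s. P s"
 shows "\<forall>\<^sub>\<approx>s. P (s + a)"
proof -
 have "eventually P (at (s + a))" for s using assms unfolding eventually_cosparse_open_eq[OF open_UNIV] by simp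
 then have "eventually (\<lambda>s. P (s + a)) (at s)" for s by (rule eventually_at_shift)
 then show ?thesis unfolding eventually_cosparse_open_eq[OF open_UNIV] by simp
qed

lemma nicely_meromorphic_shift:
 fixes a :: complex
 assumes "f nicely_meromorphic_on UNIV"
 shows "(\<lambda>s. f (s + a)) nicely_meromorphic_on UNIV"
 unfolding nicely_meromorphic_on_def
proof (intro conjI ballI)
 have "f meromorphic_on UNIV" using assms unfolding nicely_meromorphic_on_def by blast
 moreover have "(\<lambda>s. s + a) analytic_on UNIV" by (intro analytic_intros)
 ultimately show "(\<lambda>s. f (s + a)) meromorphic_on UNIV" by (rule meromorphic_on_compose) simp
 fix s
 have e: "f \<circ> (+) a = (\<lambda>s. f (s + a))" by (simp add: fun_eq_iff add.commute)
 have fl: "filterlim f F (at (s + a)) \<longleftrightarrow> filterlim (\<lambda>s. f (s + a)) F (at s)" for F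
  using filterlim_shift_iff[of f a F "s + a", unfolded e add_diff_cancel_right'] by (rule sym)
 have "(is_pole f (s + a) \<and> f (s + a) = 0) \<or> f \<midarrow>s + a\<rightarrow> f (s + a)" using assms unfolding nicely_meromorphic_on_def by blast
 then show "(is_pole (\<lambda>s. f (s + a)) s \<and> f (s + a) = 0) \<or> (\<lambda>s. f (s + a)) \<midarrow>s\<rightarrow> f (s + a)"
  unfolding is_pole_def fl .
qed

lemma deriv_shift: "deriv (\<lambda>s. f (s + a)) = (\<lambda>s. deriv f (s + a :: complex))"
 unfolding deriv_def DERIV_shift ..

lemma exp_2pi_shift: "exp (s + period * of_int p) = exp s"
 using exp_integer_2pi[of "of_int p"] by (simp add: exp_add mult_ac)

lemma ddx_shift:
 "ddx (\<lambda>s. f (s + period * of_int p)) = (\<lambda>s. ddx f (s + period * of_int p))"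
 by (rule ext) (simp add: ddx_def deriv_shift exp_2pi_shift)

lemma PV_solution_shift:
 assumes "PV_solution k0 k1 kinf y"
 shows "PV_solution k0 k1 kinf (\<lambda>s. y (s + period * of_int p))"
proof -
 have "PV_at k0 k1 kinf (\<lambda>s. y (s + period * of_int p)) s \<longleftrightarrow> PV_at k0 k1 kinf y (s + period * of_int p)" for s
  unfolding PV_at_def ddx_shift exp_2pi_shift ..
 then show ?thesis
  using assms cosparse_shift[of "\<lambda>s. y s \<noteq> 0 \<and> y s \<noteq> 1 \<and> PV_at k0 k1 kinf y s" "period * of_int p"]
  unfolding PV_solution_def by (simp add: nicely_meromorphic_shift)
qed

lemma PV_system_shift:
 assumes "PV_system k0 k1 kinf y z u"
 shows "PV_system k0 k1 kinf (\<lambda>s. y (s + period * of_int p)) (\<lambda>s. z (s + period * of_int p))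
   (\<lambda>s. u (s + period * of_int p))"
proof -
 have "PV_system_at k0 k1 kinf (\<lambda>s. y (s + period * of_int p)) (\<lambda>s. z (s + period * of_int p))
   (\<lambda>s. u (s + period * of_int p)) s \<longleftrightarrow> PV_system_at k0 k1 kinf y z u (s + period * of_int p)" for s
  unfolding PV_system_at_def ddx_shift exp_2pi_shift ..
 then show ?thesis
  using assms cosparse_shift[of "\<lambda>s. y s \<noteq> 0 \<and> u s \<noteq> 0 \<and> PV_system_at k0 k1 kinf y z u s" "period * of_int p"]
  unfolding PV_system_def by (simp add: nicely_meromorphic_shift)
qed

lemma analytic_shift: "(\<lambda>s. f (s + a)) analytic_on {s} \<longleftrightarrow> f analytic_on {s + a :: complex}"
proof
 assume "f analytic_on {s + a}"
 then have "(f \<circ> (\<lambda>s. s + a)) analytic_on {s}" by (intro analytic_on_compose analytic_intros) auto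
 then show "(\<lambda>s. f (s + a)) analytic_on {s}" by (simp add: o_def)
next
 assume "(\<lambda>s. f (s + a)) analytic_on {s}"
 then have "((\<lambda>s. f (s + a)) \<circ> (\<lambda>s. s - a)) analytic_on {s + a}" by (intro analytic_on_compose analytic_intros) auto
 then show "f analytic_on {s + a}" by (simp add: o_def)
qed

lemma PV_labelled_shift:
 assumes M: "M \<in> monodromy_pairs k0 k1 kinf" and lab: "PV_labelled k0 k1 kinf (gauge_class M) y"
 shows "PV_labelled k0 k1 kinf (gauge_class (shifted_pair p M)) (\<lambda>s. y (s + period * of_int p))"
proof -
 obtain z u where PV: "PV_system k0 k1 kinf y z u" and sol: "PV_solution k0 k1 kinf y"
  and dat: "\<And>s. \<bar>Im s\<bar> < pi / 2 \<Longrightarrow> s \<in> good_set y z u \<Longrightarrow>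
   \<exists>N. monodromy_data k0 k1 kinf (Im s) (exp (Re s)) (y s) (z s) (u s) N \<and> gauge_class N = gauge_class M"
  using lab unfolding PV_labelled_def good_set_def by blast
 show ?thesis
  unfolding PV_labelled_def
 proof (rule conjI[OF PV_solution_shift[OF sol]], rule exI, rule exI, rule conjI[OF PV_system_shift[OF PV]], rule allI, rule impI)
  fix s
  define s1 where "s1 = s + period * of_int p"
  assume "\<bar>Im s\<bar> < pi / 2 \<and> (\<lambda>s. y (s + period * of_int p)) analytic_on {s} \<and>
   (\<lambda>s. z (s + period * of_int p)) analytic_on {s} \<and> (\<lambda>s. u (s + period * of_int p)) analytic_on {s} \<and>
   y (s + period * of_int p) \<noteq> 0 \<and> u (s + period * of_int p) \<noteq> 0"
  then have im: "\<bar>Im s\<bar> < pi / 2" and s1: "s1 \<in> good_set y z u"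
   by (auto simp: analytic_shift good_set_def s1_def)
  have "\<forall>\<^sub>F s in at s. s \<in> good_set y z u"
   by (rule eventually_cosparse_imp_eventually_at[OF good_set_cosparse[OF PV]]) simp
  then obtain d where d: "d > 0" "\<And>x. x \<noteq> s \<Longrightarrow> dist x s < d \<Longrightarrow> x \<in> good_set y z u"
   unfolding eventually_at by auto
  \<comment> \<open>The point \<open>s\<close> itself may be singular for the untranslated
    functions. A point to its right with the same imaginary part is used instead; the moduli of
    \<open>x\<close> at the two ends of the transport need not agree.\<close>
  define s0 where "s0 = s + of_real (d / 2)"
  have s0: "s0 \<in> good_set y z u" using d(1) by (intro d(2)) (auto simp: s0_def dist_norm)
  have im0: "Im s0 = Im s" by (simp add: s0_def)
  obtain N where N: "monodromy_data k0 k1 kinf (Im s0) (exp (Re s0)) (y s0) (z s0) (u s0) N" "gauge_class N = gauge_class M"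
   using dat[of s0] im s0 im0 by auto
  have rel: "(N, M) \<in> gauge_rel" using N(2) by (simp add: gauge_class_eq_iff)
  then have "N \<in> monodromy_pairs k0 k1 kinf" using M N(2) gauge_class_in_manifold by metis
  then have det: "det (fst N) = 1" "det (snd N) = 1" by (auto simp: monodromy_pairs_iff)
  have ims: "Im s1 = Im s0 + 2 * pi * of_int p" "\<bar>Im s0\<bar> < pi / 2" using im by (simp_all add: s1_def im0)
  obtain N' where N': "monodromy_data k0 k1 kinf (Im s0) (exp (Re s1)) (y s1) (z s1) (u s1) N'"
   "(shifted_pair p N, N') \<in> gauge_rel"
   by (rule monodromy_data_shift[OF PV s0 s1 ims N(1) det])
  have "gauge_class N' = gauge_class (shifted_pair p N)" using N'(2) gauge_class_eq_iff by metis
  also have "\<dots> = gauge_class (shifted_pair p M)" using shifted_pair_gauge[OF rel det] gauge_class_eq_iff by blast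
  finally show "\<exists>N. monodromy_data k0 k1 kinf (Im s) (exp (Re s)) (y (s + period * of_int p))
    (z (s + period * of_int p)) (u (s + period * of_int p)) N \<and>
    gauge_class N = gauge_class (shifted_pair p M)"
   using N'(1) unfolding im0 by (intro exI[of _ N']) (simp add: s1_def)
 qed
qed

section \<open>Singular points of the first kind\<close>

text \<open>Polynomial growth excludes essential singularities, so every entry that does not vanish
  identically has an order at 0. Factoring out the least of these orders leaves a holomorphic matrix
  with nonzero value at 0.\<close>

lemma matrix_pole:
 fixes F :: "complex \<Rightarrow> complex^2^2"
 assumes r: "r > 0" and F: "mat_holo F (ball 0 r - {0})"
  and growth: "\<And>q i j. q \<in> ball 0 r - {0} \<Longrightarrow> cmod (q ^ N * F q $ i $ j) \<le> C"
  and q0: "q0 \<in> ball 0 r - {0}" "F q0 \<noteq> 0"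
 obtains m :: int and r' :: real and H :: "complex \<Rightarrow> complex^2^2" where "0 < r'" "r' \<le> r" "mat_holo H (ball 0 r')" "H 0 \<noteq> 0"
  "\<And>q. q \<in> ball 0 r' - {0} \<Longrightarrow> F q = scale_mat (q powi m) (H q)"
proof -
 define S where "S = ball 0 r - {0 :: complex}"
 have S: "open S" "connected S" unfolding S_def by (auto intro!: connected_punctured_ball open_Diff)
 have hol: "(\<lambda>q. F q $ i $ j) holomorphic_on S" for i j using F by (simp add: mat_holo_def S_def)
 have iso: "isolated_singularity_at (\<lambda>q. F q $ i $ j) 0" for i j
  unfolding isolated_singularity_at_def
  using hol[of i j] S(1) r by (intro exI[of _ r]) (simp add: S_def analytic_on_open)
 have ness: "not_essential (\<lambda>q. F q $ i $ j) 0" for i j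
 proof -
  have "(\<lambda>q. q ^ N * F q $ i $ j) holomorphic_on ball 0 r - {0}"
   using hol[of i j] by (auto intro!: holomorphic_intros simp: S_def)
  moreover have "eventually (\<lambda>q. norm (q ^ N * F q $ i $ j) \<le> C) (at 0)"
   using growth r unfolding eventually_at by (intro exI[of _ r]) auto
  ultimately obtain g where g: "g holomorphic_on ball 0 r" "\<And>q. q \<in> ball 0 r - {0} \<Longrightarrow> g q = q ^ N * F q $ i $ j"
   using holomorphic_on_extend_bounded[of "\<lambda>q. q ^ N * F q $ i $ j" "ball 0 r" 0] r by auto
  have "g analytic_on {0}" using g(1) r unfolding analytic_at by (intro exI[of _ "ball 0 r"]) auto
  then have "not_essential (\<lambda>q. g q / q ^ N) 0"
   using g(1) r
   by (intro not_essential_divide not_essential_holomorphic[of g "ball 0 r"] not_essential_analytic isolated_singularity_at_analytic)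
     (auto intro!: analytic_intros simp: analytic_on_open)
  moreover have "\<forall>\<^sub>F q in at 0. g q / q ^ N = F q $ i $ j"
   unfolding eventually_at using r by (intro exI[of _ r]) (auto simp: g(2))
  ultimately show ?thesis using not_essential_cong[of "\<lambda>q. g q / q ^ N" "\<lambda>q. F q $ i $ j" 0 0] by simp
 qed
 \<comment> \<open>Identically vanishing entries have no order and stay out of the minimum.\<close>
 define Nz where "Nz = {(i, j). \<exists>q\<in>S. F q $ i $ j \<noteq> 0}"
 have "\<exists>n g \<rho>. \<rho> > 0 \<and> g 0 \<noteq> 0 \<and> g holomorphic_on cball 0 \<rho> \<and> (\<forall>q\<in>cball 0 \<rho> - {0}. F q $ fst p $ snd p = g q * q powi n)"
  if p: "p \<in> Nz" for p
 proof -
  define f where "f = (\<lambda>q. F q $ fst p $ snd p)"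
  obtain q1 where q1: "q1 \<in> S" "f q1 \<noteq> 0" using p by (auto simp: Nz_def f_def)
  have "\<exists>\<^sub>F q in at 0. f q \<noteq> 0"
  proof (rule ccontr)
   assume "\<not> (\<exists>\<^sub>F q in at 0. f q \<noteq> 0)"
   then have "\<forall>\<^sub>F q in at 0. f q = 0" by (simp add: frequently_def)
   then obtain d where d: "d > 0" "\<And>q. q \<noteq> 0 \<Longrightarrow> dist q 0 < d \<Longrightarrow> f q = 0" unfolding eventually_at by auto
   define e where "e = min d r"
   have e: "e > 0" using d(1) r by (simp add: e_def)
   have "f q1 = 0"
   proof (rule analytic_continuation_open[of "ball 0 e - {0}" S f "\<lambda>_. 0"])
    have "of_real (e / 2) \<in> ball (0::complex) e - {0}" using e by auto
    then show "ball (0::complex) e - {0} \<noteq> {}" by blast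
   qed (use S hol[of "fst p" "snd p"] q1 d(2) in \<open>auto simp: f_def e_def S_def intro!: open_Diff\<close>)
   then show False using q1(2) by simp
  qed
  then have "zor_poly f 0 0 \<noteq> 0 \<and> (\<exists>r>0. zor_poly f 0 holomorphic_on cball 0 r \<and>
    (\<forall>w\<in>cball 0 r - {0}. f w = zor_poly f 0 w * (w - 0) powi zorder f 0 \<and> zor_poly f 0 w \<noteq> 0))"
   using iso[of "fst p" "snd p"] ness[of "fst p" "snd p"] unfolding f_def by (intro zorder_exist)
  then show ?thesis unfolding f_def diff_zero by blast
 qed
 then obtain n g \<rho> where ngr: "\<And>p. p \<in> Nz \<Longrightarrow> \<rho> p > 0 \<and> g p 0 \<noteq> 0 \<and> g p holomorphic_on cball 0 (\<rho> p) \<and>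
   (\<forall>q\<in>cball 0 (\<rho> p) - {0}. F q $ fst p $ snd p = g p q * q powi n p)" by metis
 obtain i0 j0 where "F q0 $ i0 $ j0 \<noteq> 0" using q0(2) by (auto simp: vec_eq_iff)
 then have "(i0, j0) \<in> Nz" using q0(1) unfolding Nz_def S_def by blast
 then have Nz: "finite Nz" "Nz \<noteq> {}" by auto
 define m where "m = Min (n ` Nz)"
 define r' where "r' = Min (insert r (\<rho> ` Nz))"
 have m: "m \<le> n p" if "p \<in> Nz" for p using that Nz by (simp add: m_def)
 have "m \<in> n ` Nz" unfolding m_def using Nz by (intro Min_in) auto
 then obtain p0 where p0: "p0 \<in> Nz" "n p0 = m" by blast
 have r': "r' > 0" "r' \<le> r" using Nz r ngr by (auto simp: r'_def)
 have r'\<rho>: "r' \<le> \<rho> p" if "p \<in> Nz" for p unfolding r'_def using that Nz by (intro Min_le) auto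
 define H :: "complex \<Rightarrow> complex^2^2" where "H q = (\<chi> i j. if (i, j) \<in> Nz then q ^ nat (n (i, j) - m) * g (i, j) q else 0)" for q
 show ?thesis
 proof (rule that[OF r'])
  show "mat_holo H (ball 0 r')"
   unfolding mat_holo_def
  proof (intro allI)
   fix i j
   show "(\<lambda>q. H q $ i $ j) holomorphic_on ball 0 r'"
   proof (cases "(i, j) \<in> Nz")
    case True
    then have "g (i, j) holomorphic_on ball 0 r'"
     using ngr[OF True] r'\<rho>[OF True] by (elim conjE holomorphic_on_subset) auto
    then show ?thesis using True by (auto simp: H_def intro!: holomorphic_intros)
   qed (simp add: H_def)
  qed
  show "H 0 \<noteq> 0"
  proof
   assume "H 0 = 0"
   then have "H 0 $ fst p0 $ snd p0 = 0" by simp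
   then show False using p0 ngr[OF p0(1)] by (simp add: H_def)
  qed
  fix q assume q: "q \<in> ball 0 r' - {0 :: complex}"
  have "F q $ i $ j = q powi m * H q $ i $ j" for i j
  proof (cases "(i, j) \<in> Nz")
   case True
   have "F q $ i $ j = g (i, j) q * q powi n (i, j)" using ngr[OF True] r'\<rho>[OF True] q by auto
   also have "n (i, j) = m + int (nat (n (i, j) - m))" using m[OF True] by simp
   also have "q powi \<dots> = q powi m * q ^ nat (n (i, j) - m)"
    using q power_int_add[of q m "int (nat (n (i, j) - m))"] by (simp only: power_int_of_nat) simp
   finally show ?thesis using True by (simp add: H_def)
  next
   case False
   then show ?thesis using q r'(2) by (auto simp: Nz_def S_def H_def)
  qed
  then show "F q = scale_mat (q powi m) (H q)" by (simp add: mat_eq_iff)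
 qed
qed

text \<open>The logarithmic covering of the punctured unit disc, with
  \<open>q = exp v\<close>.\<close>

definition left_plane :: "complex set" where "left_plane = {v. Re v < 0}"

lemma left_plane: "open left_plane" "connected left_plane" "starlike left_plane" "v \<in> left_plane \<Longrightarrow> exp v \<in> ball 0 1"
 "v \<in> left_plane \<Longrightarrow> v + period \<in> left_plane"
proof -
 have "convex left_plane" unfolding left_plane_def by (rule convex_halfspace_Re_lt)
 moreover have "- 1 \<in> left_plane" by (simp add: left_plane_def)
 ultimately show "connected left_plane" "starlike left_plane" by (auto intro: convex_connected convex_imp_starlike)
qed (auto simp: left_plane_def open_halfspace_Re_lt)

lemma periodic_int:
 fixes T :: "complex \<Rightarrow> 'a"
 assumes per: "\<And>v. v \<in> left_plane \<Longrightarrow> T (v + period) = T v" and v: "v \<in> left_plane"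
 shows "T (v + period * of_int k) = T v"
proof -
 have lp: "v + period * of_int k \<in> left_plane" if "v \<in> left_plane" for v k using that by (simp add: left_plane_def)
 have nat: "T (v + period * of_int (int n)) = T v" if "v \<in> left_plane" for v n
 proof (induction n)
  case (Suc n)
  have "v + period * of_int (int (Suc n)) = (v + period * of_int (int n)) + period"
   by (simp add: algebra_simps)
  then show ?case using per[OF lp[OF that, of "int n"]] Suc by (simp only:)
 qed simp
 show ?thesis
 proof (cases "k \<ge> 0")
  case True
  then show ?thesis using nat[OF v, of "nat k"] by simp
 next
  case False
  have "T ((v + period * of_int k) + period * of_int (int (nat (- k)))) = T (v + period * of_int k)"
   by (rule nat[OF lp[OF v]])
  then show ?thesis using False by simp
 qed
qed

lemma descend:
 assumes T: "mat_holo T left_plane" and per: "\<And>v. v \<in> left_plane \<Longrightarrow> T (v + period) = T v"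
 obtains F where "mat_holo F (ball 0 1 - {0})" "\<And>v. v \<in> left_plane \<Longrightarrow> F (exp v) = T v"
proof
 define F where "F q = T (Ln q)" for q
 have lp: "v \<in> left_plane" if "exp v \<in> ball 0 1" for v using that by (simp add: left_plane_def)
 have eq: "T v = F (exp v)" if "v \<in> left_plane" for v
 proof -
  have "exp (Ln (exp v)) = exp v" by simp
  then obtain k where k: "Ln (exp v) = v + of_real (of_int (2 * k) * pi) * \<i>" unfolding exp_eq by blast
  have "T (v + period * of_int k) = T v" by (rule periodic_int[where T = T, OF per that])
  then show ?thesis unfolding F_def k by (simp add: mult_ac)
 qed
 then show "F (exp v) = T v" if "v \<in> left_plane" for v using that by simp
 show "mat_holo F (ball 0 1 - {0})"
 proof (rule mat_holo_if_mderiv)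
  fix q0 :: complex assume q0: "q0 \<in> ball 0 1 - {0}"
  define U where "U = {q. q / q0 \<in> - \<real>\<^sub>\<le>\<^sub>0} \<inter> (ball 0 1 - {0})"
  \<comment> \<open>A branch of the logarithm that is holomorphic at \<open>q0\<close> even if
    \<open>q0\<close> lies on the cut of \<open>Ln\<close>.\<close>
  define lg where "lg q = Ln (q / q0) + Ln q0" for q
  have "open {q. q / q0 \<in> - \<real>\<^sub>\<le>\<^sub>0}"
   using open_vimage[of "- \<real>\<^sub>\<le>\<^sub>0" "\<lambda>q. q / q0"] q0 by (simp add: vimage_def continuous_intros)
  then have U: "open U" "q0 \<in> U" using q0 by (auto simp: U_def intro!: open_Int open_Diff)
  have lge: "exp (lg q) = q" if "q \<in> U" for q using that q0 by (simp add: lg_def exp_add U_def)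
  have "(lg has_field_derivative 1 / q0) (at q0)"
   unfolding lg_def using q0 by (auto intro!: derivative_eq_intros)
  moreover obtain D where "has_mderiv T D (lg q0)"
   using mat_holo_imp_mderiv[OF T left_plane(1) lp[of "lg q0"]] lge[OF U(2)] q0 by auto
  ultimately have "has_mderiv (\<lambda>q. T (lg q)) (scale_mat (1 / q0) D) q0"
   by (intro has_mderiv_chain[where f = lg])
  then have "has_mderiv F (scale_mat (1 / q0) D) q0"
  proof (rule has_mderiv_transform[OF _ U])
   fix q assume q: "q \<in> U"
   then have "exp (lg q) \<in> ball 0 1" unfolding lge[OF q] by (simp add: U_def)
   from eq[OF lp[OF this]] show "T (lg q) = F q" unfolding lge[OF q] .
  qed
  then show "has_mderiv F (SOME D. has_mderiv F D q0) q0" by (rule someI)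
 qed (auto intro!: open_Diff)
qed

text \<open>At a singular point of the first kind, a single-valued solution is meromorphic, and its order is read off the residues.\<close>

lemma indicial:
 fixes l n T :: "complex \<Rightarrow> complex^2^2"
 assumes l: "mat_holo l (ball 0 1)" and n: "mat_holo n (ball 0 1)"
  and T: "\<And>v. v \<in> left_plane \<Longrightarrow> has_mderiv T (l (exp v) ** T v - T v ** n (exp v)) v"
  and per: "\<And>v. v \<in> left_plane \<Longrightarrow> T (v + period) = T v"
  and nz: "v0 \<in> left_plane" "\<And>v. v \<in> left_plane \<Longrightarrow> T v \<noteq> 0"
 obtains m :: int and r :: real and H :: "complex \<Rightarrow> complex^2^2" where "0 < r" "r \<le> 1" "mat_holo H (ball 0 r)" "H 0 \<noteq> 0"
  "\<And>v. Re v < ln r \<Longrightarrow> T v = scale_mat (exp (of_int m * v)) (H (exp v))"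
  "scale_mat (of_int m) (H 0) = l 0 ** H 0 - H 0 ** n 0"
proof -
 have Th: "mat_holo T left_plane" by (rule mat_holo_if_mderiv[OF T left_plane(1)])
 obtain F where F: "mat_holo F (ball 0 1 - {0})" "\<And>v. v \<in> left_plane \<Longrightarrow> F (exp v) = T v"
  using descend[OF Th per] by blast
 define e where "e = exp (- 1 :: real)"
 have e: "0 < e" "e < 1" "ln e = - 1" by (simp_all add: e_def)
 have sub: "cball 0 e \<subseteq> ball (0::complex) 1" using e by auto
 obtain cl where cl: "cl > 0" "\<And>q. q \<in> cball 0 e \<Longrightarrow> norm (l q) \<le> cl" using mat_holo_bounded[OF l compact_cball sub] by blast
 obtain cn where cn: "cn > 0" "\<And>q. q \<in> cball 0 e \<Longrightarrow> norm (n q) \<le> cn" using mat_holo_bounded[OF n compact_cball sub] by blast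
 define k where "k = 8 * cl + 8 * cn"
 have k: "k > 0" using cl(1) cn(1) by (simp add: k_def)
 have bd: "norm (l (exp v) ** T v - T v ** n (exp v)) \<le> k * norm (T v) + 0" if "Re v \<le> - 1" for v
 proof -
  have ev: "exp v \<in> cball 0 e" using that by (simp add: e_def)
  have "norm (l (exp v) ** T v - T v ** n (exp v)) \<le> norm (l (exp v) ** T v) + norm (T v ** n (exp v))" by (rule norm_triangle_ineq4)
  also have "\<dots> \<le> 8 * norm (l (exp v)) * norm (T v) + 8 * norm (T v) * norm (n (exp v))"
   by (intro add_mono norm_mat_mult_le)
  also have "\<dots> \<le> 8 * cl * norm (T v) + 8 * norm (T v) * cn"
   using cl cn ev by (intro add_mono mult_mono) (auto intro: less_imp_le)
  finally show ?thesis by (simp add: k_def algebra_simps)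
 qed
 \<comment> \<open>Starting points of the horizontal segments on which Gronwall's inequality is
   used, one for each value of the principal argument; compactness bounds \<open>T\<close> on
   them.\<close>
 define K where "K = closed_segment (Complex (- 1) (- pi)) (Complex (- 1) pi)"
 have memK: "Complex (- 1) w \<in> K" if "\<bar>w\<bar> \<le> pi" for w
  unfolding K_def using that by (auto simp: closed_segment_same_Re closed_segment_eq_real_ivl)
 have "K \<subseteq> left_plane" by (auto simp: K_def closed_segment_same_Re left_plane_def)
 then obtain c where c: "c > 0" "\<And>v. v \<in> K \<Longrightarrow> norm (T v) \<le> c" using mat_holo_bounded[OF Th, of K] by (auto simp: K_def)
 \<comment> \<open>Gronwall's inequality allows growth of order \<open>|q|\<close> to the power
   \<open>- k\<close>; any integer exponent \<open>N \<ge> k\<close> compensates for it.\<close>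
 define N where "N = nat \<lceil>k\<rceil>"
 have N: "k \<le> real N" unfolding N_def by linarith
 have growth: "cmod (q ^ N * F q $ i $ j) \<le> c" if q: "q \<in> ball 0 e - {0}" for q i j
 proof -
  define v where "v = Ln q"
  have ev: "exp v = q" using q by (simp add: v_def)
  have qn: "0 < cmod q" "cmod q < e" using q by auto
  have Re: "Re v = ln (cmod q)" using q by (simp add: v_def Re_Ln)
  then have Re1: "Re v < - 1" using qn ln_less_cancel_iff[of "cmod q" e] e by simp
  have Im: "\<bar>Im v\<bar> \<le> pi" using q mpi_less_Im_Ln[of q] Im_Ln_le_pi[of q] by (auto simp: v_def)
  define a where "a = Complex (- 1) (Im v)"
  have seg: "Re w \<le> - 1" if "w \<in> closed_segment a v" for w
  proof -
   have "a = Complex (- 1) (Im v)" "v = Complex (Re v) (Im v)" by (simp_all add: a_def)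
   then have "w \<in> closed_segment (Complex (- 1) (Im v)) (Complex (Re v) (Im v))" using that by simp
   then show ?thesis using Re1 by (auto simp: closed_segment_same_Im closed_segment_eq_real_ivl)
  qed
  have "norm (T v) \<le> (norm (T a) + 0 * dist a v) * exp (k * dist a v)"
  proof (rule mat_gronwall)
   fix w assume w: "w \<in> closed_segment a v"
   then have "w \<in> left_plane" using seg[OF w] by (simp add: left_plane_def)
   then show "has_mderiv T (l (exp w) ** T w - T w ** n (exp w)) w" by (rule T)
   show "norm (l (exp w) ** T w - T w ** n (exp w)) \<le> k * norm (T w) + 0" by (rule bd[OF seg[OF w]])
  qed (use k in simp_all)
  moreover have "dist a v = - 1 - Re v" using Re1 by (simp add: a_def dist_complex_def cmod_def)
  moreover have "norm (T a) \<le> c" using c(2)[OF memK[OF Im]] by (simp add: a_def)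
  ultimately have "norm (T v) \<le> norm (T a) * exp (k * (- 1 - Re v))" by simp
  also have "\<dots> \<le> c * exp (- k * Re v)"
   using \<open>norm (T a) \<le> c\<close> k c(1) by (intro mult_mono) (auto simp: algebra_simps)
  finally have "cmod (F q $ i $ j) \<le> c * exp (- k * Re v)"
   using norm_entry_le[of "T v" i j] F(2)[of v] Re1 by (simp add: ev left_plane_def)
  then have "cmod (q ^ N) * cmod (F q $ i $ j) \<le> cmod (q ^ N) * (c * exp (- k * Re v))" by (intro mult_left_mono) auto
  moreover have qN: "cmod (q ^ N) = exp (real N * Re v)" using qn by (simp add: norm_power Re exp_of_nat_mult)
  moreover have "exp (real N * Re v) * (c * exp (- k * Re v)) = c * exp ((real N - k) * Re v)"
   by (simp add: exp_add[symmetric] algebra_simps)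
  moreover have "c * exp ((real N - k) * Re v) \<le> c * 1" using N Re1 c(1) by (intro mult_left_mono) (auto simp: mult_nonneg_nonpos)
  ultimately show ?thesis by (simp only: norm_mult)
 qed
 have Fe: "mat_holo F (ball 0 e - {0})" using e by (intro mat_holo_subset[OF F(1)]) auto
 have em: "exp (- 2) \<in> ball (0::complex) e - {0}" by (simp add: e_def)
 have "F (exp (- 2)) \<noteq> 0" using nz(2)[of "- 2"] F(2)[of "- 2"] by (simp add: left_plane_def)
 then obtain m r H where mrH: "0 < r" "r \<le> e" "mat_holo H (ball 0 r)" "H 0 \<noteq> 0"
  "\<And>q. q \<in> ball 0 r - {0} \<Longrightarrow> F q = scale_mat (q powi m) (H q)"
  using matrix_pole[OF e(1) Fe growth em] by metis
 have lpr: "v \<in> left_plane" "exp v \<in> ball 0 r - {0}" if "Re v < ln r" for v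
 proof -
  have "exp (Re v) < exp (ln r)" using that by simp
  then have "exp (Re v) < r" using mrH(1) by simp
  then show "exp v \<in> ball 0 r - {0}" by simp
  have "ln r < 0" using mrH(1,2) e by simp
  then show "v \<in> left_plane" using that by (simp add: left_plane_def)
 qed
 have TH: "T v = scale_mat (exp (of_int m * v)) (H (exp v))" if "Re v < ln r" for v
  using mrH(5)[OF lpr(2)[OF that]] F(2)[OF lpr(1)[OF that]] by (simp add: exp_power_int)
 have or: "open {v. Re v < ln r}" by (rule open_halfspace_Re_lt)
 have ent: "of_int m * H 0 $ i $ j = (l 0 ** H 0 - H 0 ** n 0) $ i $ j" for i j
 proof -
  define h where "h = (\<lambda>q. H q $ i $ j)"
  have h: "h holomorphic_on ball 0 r" using mrH(3) by (simp add: h_def mat_holo_def)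
  have rhs: "(\<lambda>q. (l q ** H q - H q ** n q) $ i $ j) holomorphic_on ball 0 r"
  proof -
   have "mat_holo l (ball 0 r)" "mat_holo n (ball 0 r)" using l n mrH(2) e by (auto intro: mat_holo_subset)
   then have "mat_holo (\<lambda>q. l q ** H q) (ball 0 r)" "mat_holo (\<lambda>q. H q ** n q) (ball 0 r)" using mrH(3) by (auto intro: mat_holo_mult)
   then show ?thesis by (auto simp: mat_holo_def intro!: holomorphic_on_diff)
  qed
  \<comment> \<open>For \<open>q \<noteq> 0\<close> the equation of \<open>T\<close> becomes
    \<open>m H + q H' = l H - H n\<close>; the claim is its limit at \<open>q = 0\<close>.\<close>
  have "of_int m * h 0 + 0 * deriv h 0 = (l 0 ** H 0 - H 0 ** n 0) $ i $ j"
  proof (rule isCont_eq_if_eventually_eq[where f = "\<lambda>q. of_int m * h q + q * deriv h q" and g = "\<lambda>q. (l q ** H q - H q ** n q) $ i $ j" and s = 0])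
   have "(\<lambda>q. of_int m * h q + q * deriv h q) holomorphic_on ball 0 r"
    using h by (auto intro!: holomorphic_intros)
   then show "isCont (\<lambda>q. of_int m * h q + q * deriv h q) 0"
    using mrH(1) by (auto dest!: holomorphic_on_imp_continuous_on simp: continuous_on_eq_continuous_at)
   show "isCont (\<lambda>q. (l q ** H q - H q ** n q) $ i $ j) 0"
    using holomorphic_on_imp_continuous_on[OF rhs] mrH(1) by (simp add: continuous_on_eq_continuous_at)
   have "of_int m * h q + q * deriv h q = (l q ** H q - H q ** n q) $ i $ j" if q: "q \<noteq> 0" "dist q 0 < r" for q
   proof -
    define v where "v = Ln q"
    have ev: "exp v = q" using q by (simp add: v_def)
    have vr: "Re v < ln r" using q mrH(1) by (simp add: v_def Re_Ln)
    have hd: "(h has_field_derivative deriv h q) (at q)" using h q by (intro holomorphic_derivI[OF h]) auto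
    have "((\<lambda>v. exp (of_int m * v) * h (exp v)) has_field_derivative
      exp (of_int m * v) * (of_int m * h q + q * deriv h q)) (at v)"
     by (rule derivative_eq_intros DERIV_chain2[where f = h and g = exp] | use hd ev in \<open>simp add: algebra_simps\<close>)+
    then have "((\<lambda>v. T v $ i $ j) has_field_derivative exp (of_int m * v) * (of_int m * h q + q * deriv h q)) (at v)"
     by (rule has_field_derivative_transform_within_open[OF _ or]) (use vr in \<open>auto simp: TH h_def\<close>)
    moreover have "((\<lambda>v. T v $ i $ j) has_field_derivative (l (exp v) ** T v - T v ** n (exp v)) $ i $ j) (at v)"
     by (rule has_mderivD[OF T[OF lpr(1)[OF vr]]])
    ultimately have "exp (of_int m * v) * (of_int m * h q + q * deriv h q) = (l q ** T v - T v ** n q) $ i $ j"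
     unfolding ev by (rule DERIV_unique)
    also have "\<dots> = exp (of_int m * v) * (l q ** H q - H q ** n q) $ i $ j"
     by (simp add: TH[OF vr] ev mat_mult_entry algebra_simps)
    finally show ?thesis by simp
   qed
   then show "\<forall>\<^sub>F q in at 0. of_int m * h q + q * deriv h q = (l q ** H q - H q ** n q) $ i $ j"
    unfolding eventually_at using mrH(1) by blast
  qed
  then show ?thesis by (simp add: h_def)
 qed
 show ?thesis
 proof (rule that[OF mrH(1) _ mrH(3,4) TH])
  show "r \<le> 1" using mrH(2) e by simp
  show "scale_mat (of_int m) (H 0) = l 0 ** H 0 - H 0 ** n 0" using ent by (simp add: mat_eq_iff)
 qed
qed

text \<open>The Cayley-Hamilton theorem for trace zero: the square of \<open>A\<close> is the scalar
  \<open>- det A\<close>.\<close>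

lemma trace_free_square:
 assumes "A $ 2 $ 2 = - A $ 1 $ 1"
 shows "A ** (A ** X) = scale_mat (- det A) X" "(X ** A) ** A = scale_mat (- det A) X"
 using assms by (simp_all add: mat_eq_iff mat_mult_entry det_2 algebra_simps)

lemma scale_mat_simps:
 "scale_mat a (scale_mat b A) = scale_mat (a * b) A" "scale_mat 1 A = A" "scale_mat 0 A = 0" "scale_mat c 0 = 0"
 "scale_mat c (A + B) = scale_mat c A + scale_mat c B" "scale_mat c (A - B) = scale_mat c A - scale_mat c B"
 "scale_mat (a + b) A = scale_mat a A + scale_mat b A"
 by (simp_all add: mat_eq_iff algebra_simps)

lemma scale_mat_eq_0_iff: "scale_mat c A = 0 \<longleftrightarrow> c = 0 \<or> A = 0"
 by (auto simp: mat_eq_iff)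

lemma det_scale_mat: "det (scale_mat c A) = c\<^sup>2 * det A"
 by (simp add: det_2 power2_eq_square algebra_simps)

lemma mat_mult_distrib:
 fixes A B C :: "complex^2^2"
 shows "A ** (B + C) = A ** B + A ** C" "(A + B) ** C = A ** C + B ** C"
  "A ** (B - C) = A ** B - A ** C" "(A - B) ** C = A ** C - B ** C" "A ** 0 = 0" "0 ** A = 0" "A ** (- B) = - (A ** B)" "(- A) ** B = - (A ** B)"
 by (simp_all add: mat_eq_iff mat_mult_entry algebra_simps)

lemma mat_holo_limit:
 assumes "mat_holo F (ball 0 r)" "mat_holo G (ball 0 r)" "0 < r" "\<And>q. q \<in> ball 0 r - {0} \<Longrightarrow> F q = G q"
 shows "F 0 = (G 0 :: complex^2^2)"
proof -
 have "F 0 $ i $ j = G 0 $ i $ j" for i j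
 proof (rule isCont_eq_if_eventually_eq[where f = "\<lambda>q. F q $ i $ j" and g = "\<lambda>q. G q $ i $ j"])
  have "(\<lambda>q. F q $ i $ j) holomorphic_on ball 0 r" "(\<lambda>q. G q $ i $ j) holomorphic_on ball 0 r"
   using assms(1,2) by (auto simp: mat_holo_def)
  then show "isCont (\<lambda>q. F q $ i $ j) 0" "isCont (\<lambda>q. G q $ i $ j) 0"
   using assms(3) by (auto dest!: holomorphic_on_imp_continuous_on simp: continuous_on_eq_continuous_at)
  show "\<forall>\<^sub>F q in at 0. F q $ i $ j = G q $ i $ j"
   unfolding eventually_at using assms(3,4) by (intro exI[of _ r]) auto
 qed
 then show ?thesis by (simp add: mat_eq_iff)
qed

lemma mat_holo_scale:
 assumes "f holomorphic_on S" "mat_holo F S"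
 shows "mat_holo (\<lambda>q. scale_mat (f q) (F q)) S"
 using assms unfolding mat_holo_def by (auto intro!: holomorphic_intros)

lemma mat_holo_add: "mat_holo F S \<Longrightarrow> mat_holo G S \<Longrightarrow> mat_holo (\<lambda>q. F q + G q) S"
 unfolding mat_holo_def by (auto intro!: holomorphic_intros)

text \<open>A resonant point whose monodromy \<open>\<epsilon> M = 1 + N\<close>, \<open>\<epsilon> = (-1)\<^sup>n\<close>, is not scalar.  Removing the logarithm from \<open>Z\<close> gives a single-valued
 matrix to which \<open>indicial\<close> applies; it shows that the columns of \<open>Z N\<close> have the larger exponent \<open>n / 2\<close>.\<close>

lemma resonant_exponent:
 fixes l Z :: "complex \<Rightarrow> complex^2^2" and n :: nat
 assumes l: "mat_holo l (ball 0 1)" "l 0 $ 2 $ 2 = - l 0 $ 1 $ 1" "det (l 0) = - (of_nat n)\<^sup>2 / 4" and n: "n > 0"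
  and Z: "mat_ode (\<lambda>v. l (exp v)) Z left_plane" "\<And>v. v \<in> left_plane \<Longrightarrow> det (Z v) = 1"
  and per: "\<And>v. v \<in> left_plane \<Longrightarrow> Z (v + period) = Z v ** M"
  and N: "scale_mat ((- 1) ^ n) M = mat 1 + N" "N ** N = 0" "N \<noteq> 0"
 obtains r :: real and h :: "complex \<Rightarrow> complex^2^2" where "0 < r" "r \<le> 1" "mat_holo h (ball 0 r)" "h 0 \<noteq> 0" "l 0 ** h 0 = scale_mat (of_nat n / 2) (h 0)"
  "\<And>v. Re v < ln r \<Longrightarrow> Z v ** N = scale_mat (exp (of_nat n * v / 2)) (h (exp v))"
proof -
 \<comment> \<open>Multiplication of \<open>Z\<close> by \<open>exp (of_nat n * v / 2)\<close> moves
   the exponents \<open>- n / 2\<close> and \<open>n / 2\<close> to 0 and \<open>n\<close>, and the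
   residue becomes \<open>A\<close>, whose square is \<open>n\<close> times
   \<open>A\<close>.\<close>
 define A where "A = l 0 + scale_mat (of_nat n / 2) (mat 1)"
 define l' where "l' q = l q + scale_mat (of_nat n / 2) (mat 1)" for q
 \<comment> \<open>As \<open>L\<close> has square zero, \<open>mat 1 - scale_mat v L\<close> is the
   exponential of \<open>- v L\<close>. One period changes it by the subtraction of
   \<open>N\<close>, which compensates the factor \<open>mat 1 + N\<close> of the monodromy.\<close>
 define L where "L = scale_mat (1 / (period)) N"
 define k where "k v = scale_mat (exp (of_nat n * v / 2)) (Z v ** (mat 1 - scale_mat v L))" for v
 have LN: "L ** N = 0" "N ** L = 0" "L ** L = 0" using N(2) by (simp_all add: L_def scaleC_mat_mult scale_mat_simps)
 have A2: "A ** (A ** X) = scale_mat (of_nat n) (A ** X)" for X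
 proof -
  have "A ** (A ** X) = l 0 ** (l 0 ** X) + scale_mat (of_nat n) (l 0 ** X) + scale_mat ((of_nat n)\<^sup>2 / 4) X"
   by (simp add: A_def mat_mult_distrib scaleC_mat_mult scale_mat_simps mat_eq_iff power2_eq_square)
  then show ?thesis unfolding trace_free_square[OF l(2)] l(3)
   by (simp add: A_def mat_mult_distrib scaleC_mat_mult mat_eq_iff field_simps power2_eq_square)
 qed
 have l': "mat_holo l' (ball 0 1)" unfolding l'_def by (intro mat_holo_add l(1) mat_holo_const)
 have kN: "k v ** N = scale_mat (exp (of_nat n * v / 2)) (Z v ** N)" for v
  by (simp add: k_def scaleC_mat_mult mat_mult_distrib matrix_mul_assoc[symmetric] LN scale_mat_simps)
 have kL: "k v ** L = scale_mat (exp (of_nat n * v / 2)) (Z v ** L)" for v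
  by (simp add: k_def scaleC_mat_mult mat_mult_distrib matrix_mul_assoc[symmetric] LN scale_mat_simps)
 have dk: "has_mderiv k (l' (exp v) ** k v - k v ** L) v" if v: "v \<in> left_plane" for v
 proof -
  have 1: "((\<lambda>v. exp (of_nat n * v / 2)) has_field_derivative (of_nat n / 2 * exp (of_nat n * v / 2))) (at v)"
   by (auto intro!: derivative_eq_intros)
  have "has_mderiv (\<lambda>v. mat 1 - scale_mat v L) (0 - (scale_mat 1 L + scale_mat v 0)) v"
   by (intro has_mderiv_diff has_mderiv_const has_mderiv_scale) auto
  then have "has_mderiv k (scale_mat (of_nat n / 2 * exp (of_nat n * v / 2)) (Z v ** (mat 1 - scale_mat v L)) +
    scale_mat (exp (of_nat n * v / 2)) ((l (exp v) ** Z v) ** (mat 1 - scale_mat v L) + Z v ** (0 - (scale_mat 1 L + scale_mat v 0)))) v"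
   (is "has_mderiv k ?D v")
   unfolding k_def by (intro has_mderiv_scale[OF 1] has_mderiv_mult mat_odeD[OF Z(1) v])
  moreover have "?D = l' (exp v) ** k v - k v ** L"
   unfolding kL by (simp add: k_def l'_def mat_mult_distrib scaleC_mat_mult scale_mat_simps matrix_mul_assoc[symmetric])
    (simp add: mat_eq_iff field_simps)
  ultimately show ?thesis by simp
 qed
 have kper: "k (v + period) = k v" if v: "v \<in> left_plane" for v
 proof -
  have "exp (of_nat n * (v + period) / 2) = exp (of_nat n * v / 2) * exp (of_nat n * (of_real pi * \<i>))"
   by (simp add: exp_add[symmetric] field_simps)
  also have "exp (of_nat n * (of_real pi * \<i>)) = (- 1) ^ n" by (simp add: exp_of_nat_mult)
  finally have e: "exp (of_nat n * (v + period) / 2) = exp (of_nat n * v / 2) * (- 1) ^ n" .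
  have s: "scale_mat (v + period) L = scale_mat v L + N"
   by (simp add: L_def mat_eq_iff field_simps)
  have "k (v + period) = scale_mat (exp (of_nat n * v / 2)) (Z v ** (scale_mat ((- 1) ^ n) M ** (mat 1 - (scale_mat v L + N))))"
   unfolding k_def e s per[OF v] by (simp add: scaleC_mat_mult scale_mat_simps matrix_mul_assoc)
  also have "scale_mat ((- 1) ^ n) M ** (mat 1 - (scale_mat v L + N)) = mat 1 - scale_mat v L"
   unfolding N(1) by (simp add: mat_mult_distrib scaleC_mat_mult LN N(2) scale_mat_simps)
  finally show ?thesis by (simp add: k_def)
 qed
 have ZN: "Z v ** N \<noteq> 0" if v: "v \<in> left_plane" for v
 proof
  assume "Z v ** N = 0"
  then have "N = adj2 (Z v) ** 0" using adj2_cancel(2)[OF Z(2)[OF v], of N] by simp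
  then show False using N(3) by (simp add: mat_mult_distrib)
 qed
 have knz: "k v ** N \<noteq> 0" if v: "v \<in> left_plane" for v
  unfolding kN using ZN[OF v] by (simp add: scale_mat_eq_0_iff)
 have lp: "- 1 \<in> left_plane" by (simp add: left_plane_def)
 have "k v \<noteq> 0" if "v \<in> left_plane" for v using knz[OF that] by (auto simp: mat_mult_distrib)
 then obtain m r H where H: "0 < r" "r \<le> 1" "mat_holo H (ball 0 r)" "H 0 \<noteq> 0"
  "\<And>v. Re v < ln r \<Longrightarrow> k v = scale_mat (exp (of_int m * v)) (H (exp v))"
  "scale_mat (of_int m) (H 0) = l' 0 ** H 0 - H 0 ** L"
  using indicial[OF l' mat_holo_const dk kper lp] by metis
 have lA: "l' 0 = A" by (simp add: l'_def A_def)
 have lnq: "Re (Ln q) < ln s" "exp (Ln q) = q" if "q \<in> ball 0 s - {0}" for q s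
 proof -
  have q: "0 < cmod q" "cmod q < s" using that by auto
  then have "ln (cmod q) < ln s" using less_trans[OF q] by (subst ln_less_cancel_iff) auto
  then show "Re (Ln q) < ln s" using that by (simp add: Re_Ln)
  show "exp (Ln q) = q" using that by simp
 qed
 \<comment> \<open>If \<open>m = n\<close>, then \<open>det (k v)\<close> would be
   \<open>q ^ (2 * n)\<close> times a holomorphic function. But the factor that removes the
   logarithm has determinant 1, so this determinant is exactly \<open>q ^ n\<close>.\<close>
 have mn: "m \<noteq> int n"
 proof
  assume mn: "m = int n"
  have tr: "N $ 1 $ 1 + N $ 2 $ 2 = 0" "det N = 0"
  proof -
   have e: "N $ 1 $ 1 * N $ 1 $ 1 + N $ 1 $ 2 * N $ 2 $ 1 = 0" "N $ 1 $ 1 * N $ 1 $ 2 + N $ 1 $ 2 * N $ 2 $ 2 = 0"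
    "N $ 2 $ 1 * N $ 1 $ 1 + N $ 2 $ 2 * N $ 2 $ 1 = 0" "N $ 2 $ 1 * N $ 1 $ 2 + N $ 2 $ 2 * N $ 2 $ 2 = 0"
    using N(2) by (auto simp: mat_eq_iff mat_mult_entry)
   have "N $ 1 $ 2 * (N $ 1 $ 1 + N $ 2 $ 2) = 0" "N $ 2 $ 1 * (N $ 1 $ 1 + N $ 2 $ 2) = 0"
    using e(2,3) by algebra+
   then show t: "N $ 1 $ 1 + N $ 2 $ 2 = 0" using e by auto
   have "N $ 2 $ 2 = - N $ 1 $ 1" using t by algebra
   then show "det N = 0" using e(1) by (simp add: det_2) algebra
  qed
  have detk: "det (k v) = exp (of_nat n * v)" if v: "v \<in> left_plane" for v
  proof -
   have "det (mat 1 - scale_mat c N) = 1 - c * (N $ 1 $ 1 + N $ 2 $ 2) + c\<^sup>2 * det N" for c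
    by (simp add: det_2 algebra_simps power2_eq_square)
   then have "det (mat 1 - scale_mat c N) = 1" for c by (simp add: tr)
   then have "det (mat 1 - scale_mat v L) = 1" by (simp add: L_def scale_mat_simps)
   then have "det (k v) = exp (of_nat n * v / 2) * exp (of_nat n * v / 2)"
    using Z(2)[OF v] by (simp add: k_def det_scale_mat det_mul power2_eq_square)
   then show ?thesis by (simp add: exp_add[symmetric] mult.commute)
  qed
  have "q ^ n * det (H q) = 1" if q: "q \<in> ball 0 r - {0}" for q
  proof -
   have "Ln q \<in> left_plane" using order.strict_trans2[OF lnq(1)[OF q], of 0] H(1,2) by (simp add: left_plane_def)
   from detk[OF this] have "exp (of_nat n * Ln q) * (exp (of_nat n * Ln q) * det (H q)) = exp (of_nat n * Ln q)"
    unfolding H(5)[OF lnq(1)[OF q]] lnq(2)[OF q] mn by (simp add: det_2 algebra_simps)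
   then show ?thesis using q by (simp add: exp_of_nat_mult)
  qed
  moreover have "isCont (\<lambda>q. q ^ n * det (H q)) 0"
  proof -
   have "(\<lambda>q. q ^ n * det (H q)) holomorphic_on ball 0 r"
    using H(3) unfolding det_2 mat_holo_def by (auto intro!: holomorphic_intros)
   then show ?thesis using H(1) by (auto dest!: holomorphic_on_imp_continuous_on simp: continuous_on_eq_continuous_at)
  qed
  ultimately have "0 ^ n * det (H 0) = 1"
   using H(1) by (intro isCont_eq_if_eventually_eq[where f = "\<lambda>q. q ^ n * det (H q)" and g = "\<lambda>_. 1" and s = 0])
    (auto simp: eventually_at intro!: exI[of _ r])
  then show False unfolding zero_power[OF n] by simp
 qed
 \<comment> \<open>The indicial equation \<open>m H = A H - H L\<close> together with
   \<open>A A = n A\<close> and \<open>L L = 0\<close> gives \<open>(n - m)^2 A H = 0\<close>. Hence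
   \<open>A H = 0\<close>, then \<open>m = 0\<close>, and finally \<open>H L = 0\<close>.\<close>
 have HN: "m = 0" "H 0 ** N = 0"
 proof -
  define X where "X = A ** H 0"
  have B: "H 0 ** L = X - scale_mat (of_int m) (H 0)" using H(6) by (simp add: lA X_def)
  have "(H 0 ** L) ** L = 0" by (simp add: matrix_mul_assoc[symmetric] LN mat_mult_distrib)
  then have "(X - scale_mat (of_int m) (H 0)) ** L = 0" unfolding B .
  then have "X ** L - scale_mat (of_int m) (H 0 ** L) = 0" by (simp add: mat_mult_distrib scaleC_mat_mult)
  moreover have "X ** L = A ** X - scale_mat (of_int m) X"
   unfolding X_def using B by (simp add: matrix_mul_assoc[symmetric] X_def mat_mult_distrib scaleC_mat_mult)
  moreover have AX: "A ** X = scale_mat (of_nat n) X" unfolding X_def by (rule A2)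
  ultimately have e: "scale_mat (of_nat n - 2 * of_int m) X = scale_mat (- (of_int m)\<^sup>2) (H 0)"
   unfolding B by (simp add: mat_eq_iff algebra_simps power2_eq_square)
  then have "A ** scale_mat (of_nat n - 2 * of_int m) X = A ** scale_mat (- (of_int m)\<^sup>2) (H 0)" by simp
  then have "scale_mat ((of_nat n - of_int m)\<^sup>2) X = 0"
   unfolding scaleC_mat_mult AX X_def[symmetric] by (simp add: mat_eq_iff algebra_simps power2_eq_square)
  moreover have "of_nat n - of_int m \<noteq> (0 :: complex)" using mn by (metis eq_iff_diff_eq_0 of_int_eq_iff of_int_of_nat_eq)
  ultimately have X0: "X = 0" by (simp add: scale_mat_eq_0_iff)
  then show m0: "m = 0" using e H(4) by (simp add: scale_mat_simps scale_mat_eq_0_iff)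
  have "H 0 ** L = 0" unfolding B X0 m0 by (simp add: scale_mat_simps)
  then show "H 0 ** N = 0" by (simp add: L_def scaleC_mat_mult scale_mat_eq_0_iff)
 qed
 have dg: "has_mderiv (\<lambda>v. k v ** N) (l' (exp v) ** (k v ** N) - (k v ** N) ** 0) v" if v: "v \<in> left_plane" for v
  using has_mderiv_mult_const(1)[OF dk[OF v], of N]
  by (simp add: mat_mult_distrib matrix_mul_assoc[symmetric] LN)
 have gper: "k (v + period) ** N = k v ** N" if "v \<in> left_plane" for v using kper[OF that] by simp
 obtain p \<rho> h where h: "0 < \<rho>" "\<rho> \<le> 1" "mat_holo h (ball 0 \<rho>)" "h 0 \<noteq> 0"
  "\<And>v. Re v < ln \<rho> \<Longrightarrow> k v ** N = scale_mat (exp (of_int p * v)) (h (exp v))"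
  "scale_mat (of_int p) (h 0) = l' 0 ** h 0 - h 0 ** 0"
  using indicial[where T = "\<lambda>v. k v ** N", OF l' mat_holo_const dg gper lp knz] by metis
 have Ah: "A ** h 0 = scale_mat (of_int p) (h 0)" using h(6) by (simp add: lA mat_mult_distrib)
 have "scale_mat (of_int p * of_int p) (h 0) = scale_mat (of_nat n * of_int p) (h 0)"
  using A2[of "h 0"] unfolding Ah scaleC_mat_mult scale_mat_simps .
 then have "scale_mat (of_int p * (of_int p - of_nat n)) (h 0) = 0" by (simp add: mat_eq_iff algebra_simps)
 then have "of_int p * (of_int p - of_nat n) = (0 :: complex)" using h(4) by (simp add: scale_mat_eq_0_iff)
 then have pn: "p = 0 \<or> p = int n" by (metis eq_iff_diff_eq_0 mult_eq_0_iff of_int_0_eq_iff of_int_eq_iff of_int_of_nat_eq)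
 \<comment> \<open>Order 0 would give \<open>h 0 = H 0 ** N\<close>, but \<open>H 0 ** N\<close> has
   just been seen to vanish.\<close>
 have "p \<noteq> 0"
 proof
  assume p0: "p = 0"
  define s where "s = min r \<rho>"
  have s: "s > 0" "s \<le> r" "s \<le> \<rho>" using H(1) h(1) by (auto simp: s_def)
  have "h 0 = H 0 ** N"
  proof (rule mat_holo_limit[where r = s])
   show "mat_holo h (ball 0 s)" "mat_holo (\<lambda>q. H q ** N) (ball 0 s)"
    using h(3) H(3) s by (auto intro!: mat_holo_mult mat_holo_const intro: mat_holo_subset)
   fix q assume q: "q \<in> ball 0 s - {0 :: complex}"
   then have qq: "q \<in> ball 0 r - {0}" "q \<in> ball 0 \<rho> - {0}" using s by auto
   show "h q = H q ** N"
    using h(5)[OF lnq(1)[OF qq(2)]] H(5)[OF lnq(1)[OF qq(1)]] unfolding lnq(2)[OF q] p0 HN(1)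
    by (simp add: scale_mat_simps)
  qed (use s in auto)
  then show False using h(4) HN(2) by simp
 qed
 then have pn: "p = int n" using pn by simp
 show ?thesis
 proof (rule that[OF h(1-4)])
  show "l 0 ** h 0 = scale_mat (of_nat n / 2) (h 0)"
   using Ah by (simp add: A_def pn mat_mult_distrib scaleC_mat_mult mat_eq_iff field_simps)
  fix v assume v: "Re v < ln \<rho>"
  have "scale_mat (exp (- (of_nat n * v / 2))) (scale_mat (exp (of_nat n * v / 2)) (Z v ** N)) =
    scale_mat (exp (- (of_nat n * v / 2))) (scale_mat (exp (of_nat n * v)) (h (exp v)))"
   using h(5)[OF v] unfolding kN pn by simp
  then show "Z v ** N = scale_mat (exp (of_nat n * v / 2)) (h (exp v))"
   by (simp add: scale_mat_simps exp_add[symmetric] mult.commute)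
 qed
qed

section \<open>Boundedness of intertwiners at a singular point\<close>

text \<open>The image of the matrix is annihilated by \<open>(r1, r2)\<close>, so it lies on the
  line of \<open>(x1, x2)\<close>, which the matrix sends to zero. It is therefore
  nilpotent.\<close>

lemma trace_zero_if_kernel_eq_image:
 fixes c11 c12 c21 c22 :: complex
 assumes "r1 \<noteq> 0 \<or> r2 \<noteq> 0" "x1 \<noteq> 0 \<or> x2 \<noteq> 0" "r1 * x1 + r2 * x2 = 0" "r1 * c11 + r2 * c21 = 0" "r1 * c12 + r2 * c22 = 0"
  "c11 * x1 + c12 * x2 = 0" "c21 * x1 + c22 * x2 = 0"
 shows "c11 + c22 = 0"
proof -
 have "x1 * (r1 * (c11 + c22)) = 0" "x2 * (r2 * (c11 + c22)) = 0" "x1 * (r2 * (c11 + c22)) = 0" "x2 * (r1 * (c11 + c22)) = 0"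
  using assms(3-7) by algebra+
 then show ?thesis using assms(1,2) by auto
qed

text \<open>Equal monodromy makes the quotient single-valued, hence of an integral order
  \<open>m\<close>, and the claim is \<open>m \<ge> 0\<close>. A negative order forces resonance.
  There the nonscalar monodromy singles out, through \<open>resonant_exponent\<close>, the solutions
  with the larger exponent on both sides; the quotient must match them, and this is incompatible
  with a pole.\<close>

lemma intertwiner_bounded:
 fixes la lb Za Zb :: "complex \<Rightarrow> complex^2^2"
 assumes la: "mat_holo la (ball 0 1)" "trace_free la (ball 0 1)" "det (la 0) = - b\<^sup>2 / 4"
  and lb: "mat_holo lb (ball 0 1)" "trace_free lb (ball 0 1)" "det (lb 0) = - b\<^sup>2 / 4"
  and Za: "mat_ode (\<lambda>v. la (exp v)) Za left_plane" "\<And>v. v \<in> left_plane \<Longrightarrow> det (Za v) = 1"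
   "\<And>v. v \<in> left_plane \<Longrightarrow> Za (v + period) = Za v ** M"
  and Zb: "mat_ode (\<lambda>v. lb (exp v)) Zb left_plane" "\<And>v. v \<in> left_plane \<Longrightarrow> det (Zb v) = 1"
   "\<And>v. v \<in> left_plane \<Longrightarrow> Zb (v + period) = Zb v ** M"
  and M: "det M = 1" "trace M = 2 * cos (of_real pi * b)" "M \<notin> {mat 1, - mat 1}"
 obtains r C where "0 < r" "r \<le> 1" "\<And>v. Re v < ln r \<Longrightarrow> norm (Za v ** adj2 (Zb v)) \<le> C"
proof -
 define T where "T v = Za v ** adj2 (Zb v)" for v
 have dT: "has_mderiv T (la (exp v) ** T v - T v ** lb (exp v)) v" if v: "v \<in> left_plane" for v
 proof -
  have tf: "trace_free (\<lambda>v. lb (exp v)) left_plane" using lb(2) left_plane(4) by (auto simp: trace_free_def)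
  have "has_mderiv T ((la (exp v) ** Za v) ** adj2 (Zb v) + Za v ** scale_mat (- 1) (adj2 (Zb v) ** lb (exp v))) v"
   unfolding T_def by (intro has_mderiv_mult mat_odeD[OF Za(1) v] mat_ode_adj2[OF Zb(1) tf v])
  moreover have "(la (exp v) ** Za v) ** adj2 (Zb v) + Za v ** scale_mat (- 1) (adj2 (Zb v) ** lb (exp v)) = la (exp v) ** T v - T v ** lb (exp v)"
   by (simp add: T_def scaleC_mat_mult matrix_mul_assoc mat_eq_iff)
  ultimately show ?thesis by simp
 qed
 have per: "T (v + period) = T v" if "v \<in> left_plane" for v
  unfolding T_def Za(3)[OF that] Zb(3)[OF that] adj2_mult
  by (simp add: matrix_mul_assoc[symmetric] adj2_cancel[OF M(1)])
 have lp: "- 1 \<in> left_plane" by (simp add: left_plane_def)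
 have "det (T v) = 1" if "v \<in> left_plane" for v using Za(2)[OF that] Zb(2)[OF that] by (simp add: T_def det_mul)
 then have nz: "T v \<noteq> 0" if "v \<in> left_plane" for v using that by (force simp: det_2)
 obtain m r H where H: "0 < r" "r \<le> 1" "mat_holo H (ball 0 r)" "H 0 \<noteq> 0"
  "\<And>v. Re v < ln r \<Longrightarrow> T v = scale_mat (exp (of_int m * v)) (H (exp v))"
  "scale_mat (of_int m) (H 0) = la 0 ** H 0 - H 0 ** lb 0"
  using indicial[OF la(1) lb(1) dT per lp nz] by metis
 have tra: "la 0 $ 2 $ 2 = - la 0 $ 1 $ 1" and trb: "lb 0 $ 2 $ 2 = - lb 0 $ 1 $ 1"
  using la(2) lb(2) by (simp_all add: trace_free_def)
 have "m \<ge> 0"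
 proof (rule ccontr)
  assume "\<not> m \<ge> 0"
  define p where "p = nat (- m)"
  have p: "p > 0" "m = - int p" using \<open>\<not> m \<ge> 0\<close> by (auto simp: p_def)
  define A where "A = la 0"
  define B where "B = lb 0"
  define R where "R = H 0"
  define c where "c = b\<^sup>2 / 4"
  have AA: "A ** (A ** X) = scale_mat c X" and BB: "(X ** B) ** B = scale_mat c X" for X
   using trace_free_square(1)[OF tra] trace_free_square(2)[OF trb] la(3) lb(3) by (simp_all add: A_def B_def c_def)
  \<comment> \<open>Order \<open>- p\<close> means \<open>R B = A R + p R\<close>. As
    \<open>A\<close> and \<open>B\<close> have the same scalar square \<open>c\<close>, this gives
    \<open>A R = - (p / 2) R\<close> and \<open>R B = (p / 2) R\<close>, hence \<open>b = p\<close>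
    or \<open>b = - p\<close>: the difference of the exponents is integral.\<close>
  have RB: "R ** B = A ** R + scale_mat (of_nat p) R"
   using H(6) by (simp add: A_def B_def R_def p(2) mat_eq_iff algebra_simps)
  have "(R ** B) ** B = A ** (R ** B) + scale_mat (of_nat p) (R ** B)"
   by (subst RB) (simp add: mat_mult_distrib scaleC_mat_mult matrix_mul_assoc)
  then have "scale_mat c R = A ** (A ** R) + scale_mat (2 * of_nat p) (A ** R) + scale_mat ((of_nat p)\<^sup>2) R"
   unfolding BB unfolding RB by (simp add: mat_mult_distrib scaleC_mat_mult mat_eq_iff algebra_simps power2_eq_square)
  then have "scale_mat (of_nat p) (scale_mat 2 (A ** R) + scale_mat (of_nat p) R) = 0"
   unfolding AA by (simp add: mat_eq_iff algebra_simps power2_eq_square)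
  then have "scale_mat 2 (A ** R) + scale_mat (of_nat p) R = 0" using p(1) by (simp add: scale_mat_eq_0_iff)
  then have AR: "A ** R = scale_mat (- of_nat p / 2) R" by (simp add: mat_eq_iff field_simps add_eq_0_iff)
  have RB2: "R ** B = scale_mat (of_nat p / 2) R" unfolding RB AR by (simp add: mat_eq_iff field_simps)
  have "scale_mat c R = scale_mat ((of_nat p)\<^sup>2 / 4) R"
   using AA[of R] unfolding AR scaleC_mat_mult scale_mat_simps by (simp add: power2_eq_square)
  then have "scale_mat (c - (of_nat p)\<^sup>2 / 4) R = 0" by (simp add: mat_eq_iff algebra_simps)
  then have th: "b\<^sup>2 = (of_nat p)\<^sup>2" using H(4) by (simp add: scale_mat_eq_0_iff R_def c_def)
  then have "b = of_nat p \<or> b = - of_nat p" by (simp add: power2_eq_iff)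
  then have "cos (of_real pi * b) = cos (of_real (pi * real p))" by auto
  also have "\<dots> = of_real (cos (pi * real p))" by (rule cos_of_real)
  also have "\<dots> = (- 1) ^ p" by (simp add: cos_npi2)
  finally have tr: "M $ 1 $ 1 + M $ 2 $ 2 = 2 * (- 1) ^ p" using M(2) by (simp add: trace_def sum_2)
  define e where "e = (- 1 :: complex) ^ p"
  have e: "e * e = 1" by (simp add: e_def power_mult_distrib[symmetric])
  \<comment> \<open>At resonance the trace of \<open>M\<close> is \<open>2 * e\<close>, so
    \<open>scale_mat e M\<close> has the double eigenvalue 1. Thus \<open>n\<close> is nilpotent,
    and it is nonzero because \<open>M\<close> is not scalar.\<close>
  define n where "n = scale_mat e M - mat 1"
  have n: "scale_mat ((- 1) ^ p) M = mat 1 + n" by (simp add: n_def e_def)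
  have n2: "n ** n = 0"
  proof -
   have t: "M $ 2 $ 2 = 2 * e - M $ 1 $ 1" using tr by (simp add: e_def algebra_simps)
   have d: "M $ 1 $ 1 * (2 * e - M $ 1 $ 1) - M $ 1 $ 2 * M $ 2 $ 1 = 1" using M(1) by (simp add: det_2 t)
   show ?thesis
    unfolding mat_eq_iff mat_mult_entry n_def
    by (simp add: t) (use d e in algebra)
  qed
  have n0: "n \<noteq> 0"
  proof
   assume "n = 0"
   then have "scale_mat e (scale_mat e M) = scale_mat e (mat 1)" by (simp add: n_def)
   then have "M = scale_mat e (mat 1)" by (simp add: scale_mat_simps e)
   moreover have "e = 1 \<or> e = - 1" using e by (simp add: square_eq_1_iff)
   ultimately show False using M(3) by (auto simp: scale_mat_simps mat_eq_iff)
  qed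
  have dA: "det (la 0) = - (of_nat p)\<^sup>2 / 4" and dB: "det (lb 0) = - (of_nat p)\<^sup>2 / 4" using la(3) lb(3) th by simp_all
  obtain ra ha where ha: "0 < ra" "ra \<le> 1" "mat_holo ha (ball 0 ra)" "ha 0 \<noteq> 0" "la 0 ** ha 0 = scale_mat (of_nat p / 2) (ha 0)"
   "\<And>v. Re v < ln ra \<Longrightarrow> Za v ** n = scale_mat (exp (of_nat p * v / 2)) (ha (exp v))"
   using resonant_exponent[OF la(1) tra dA p(1) Za n n2 n0] by metis
  obtain rb hb where hb: "0 < rb" "rb \<le> 1" "mat_holo hb (ball 0 rb)" "hb 0 \<noteq> 0" "lb 0 ** hb 0 = scale_mat (of_nat p / 2) (hb 0)"
   "\<And>v. Re v < ln rb \<Longrightarrow> Zb v ** n = scale_mat (exp (of_nat p * v / 2)) (hb (exp v))"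
   using resonant_exponent[OF lb(1) trb dB p(1) Zb n n2 n0] by metis
  define s where "s = min r (min ra rb)"
  have s: "s > 0" "s \<le> r" "s \<le> ra" "s \<le> rb" using H(1) ha(1) hb(1) by (auto simp: s_def)
  \<comment> \<open>\<open>T\<close> maps \<open>Zb ** n\<close> to \<open>Za ** n\<close>, and both
    have the exponent \<open>p / 2\<close>. Since \<open>T\<close> has order \<open>- p\<close>,
    this leaves \<open>H hb = q^p ha\<close>, which vanishes at 0.\<close>
  have "H 0 ** hb 0 = scale_mat (0 ^ p) (ha 0)"
  proof (rule mat_holo_limit[where r = s])
   show "mat_holo (\<lambda>q. H q ** hb q) (ball 0 s)"
    using H(3) hb(3) s by (auto intro!: mat_holo_mult intro: mat_holo_subset)
   show "mat_holo (\<lambda>q. scale_mat (q ^ p) (ha q)) (ball 0 s)"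
    using ha(3) s by (auto intro!: mat_holo_scale holomorphic_intros intro: mat_holo_subset)
   fix q assume q: "q \<in> ball 0 s - {0 :: complex}"
   define v where "v = Ln q"
   have ev: "exp v = q" using q by (simp add: v_def)
   have "0 < cmod q" "cmod q < s" using q by auto
   then have "ln (cmod q) < ln s" using s(1) by (subst ln_less_cancel_iff) auto
   then have "Re v < ln s" using q by (simp add: v_def Re_Ln)
   moreover have "ln s \<le> ln r" "ln s \<le> ln ra" "ln s \<le> ln rb" using s by auto
   ultimately have vr: "Re v < ln r" "Re v < ln ra" "Re v < ln rb" by auto
   have "ln r \<le> 0" using H(1,2) by simp
   then have vl: "v \<in> left_plane" using vr by (simp add: left_plane_def)
   have "T v ** (Zb v ** n) = Za v ** n"
    unfolding T_def by (simp add: matrix_mul_assoc[symmetric] adj2_cancel[OF Zb(2)[OF vl]])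
   then have "scale_mat (exp (- (of_nat p * v))) (scale_mat (exp (of_nat p * v / 2)) (H q ** hb q)) = scale_mat (exp (of_nat p * v / 2)) (ha q)"
    unfolding H(5)[OF vr(1)] ha(6)[OF vr(2)] hb(6)[OF vr(3)] ev p(2) by (simp add: scaleC_mat_mult scale_mat_simps mult_ac)
   then have "scale_mat (exp (of_nat p * v / 2)) (scale_mat (exp (- (of_nat p * v / 2))) (scale_mat (exp (of_nat p * v)) (scale_mat (exp (- (of_nat p * v))) (H q ** hb q)))) =
     scale_mat (exp (of_nat p * v / 2)) (scale_mat (exp (- (of_nat p * v / 2))) (scale_mat (exp (of_nat p * v)) (ha q)))"
    by (simp add: mat_eq_iff)
   then show "H q ** hb q = scale_mat (q ^ p) (ha q)"
    by (simp add: scale_mat_simps exp_add[symmetric] ev[symmetric] exp_of_nat_mult[symmetric] mult.commute)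
  qed (use s in auto)
  then have Rh: "R ** hb 0 = 0" using p(1) by (simp add: R_def scale_mat_eq_0_iff)
  define C where "C = B - scale_mat (of_nat p / 2) (mat 1)"
  have RC: "R ** C = 0" unfolding C_def using RB2 by (simp add: mat_mult_distrib scaleC_mat_mult)
  have Ch: "C ** hb 0 = 0" unfolding C_def using hb(5) by (simp add: B_def mat_mult_distrib scaleC_mat_mult)
  obtain i k where "R $ i $ k \<noteq> 0" using H(4) by (auto simp: R_def vec_eq_iff)
  then have Ri: "R $ i $ 1 \<noteq> 0 \<or> R $ i $ 2 \<noteq> 0" using exhaust_2[of k] by auto
  obtain i' j where "hb 0 $ i' $ j \<noteq> 0" using hb(4) by (auto simp: vec_eq_iff)
  then have hj: "hb 0 $ 1 $ j \<noteq> 0 \<or> hb 0 $ 2 $ j \<noteq> 0" using exhaust_2[of i'] by auto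
  \<comment> \<open>A nonzero row of \<open>R\<close> and a nonzero column of \<open>hb 0\<close>
    annihilate \<open>C\<close> from the two sides and also each other. So the trace of
    \<open>C\<close> vanishes, although by construction it is \<open>- p\<close>.\<close>
  have "C $ 1 $ 1 + C $ 2 $ 2 = 0"
  proof (rule trace_zero_if_kernel_eq_image[OF Ri hj])
   have "(R ** hb 0) $ i $ j = 0" "(R ** C) $ i $ 1 = 0" "(R ** C) $ i $ 2 = 0" "(C ** hb 0) $ 1 $ j = 0" "(C ** hb 0) $ 2 $ j = 0"
    unfolding Rh RC Ch by simp_all
   then show "R $ i $ 1 * hb 0 $ 1 $ j + R $ i $ 2 * hb 0 $ 2 $ j = 0"
    "R $ i $ 1 * C $ 1 $ 1 + R $ i $ 2 * C $ 2 $ 1 = 0" "R $ i $ 1 * C $ 1 $ 2 + R $ i $ 2 * C $ 2 $ 2 = 0"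
    "C $ 1 $ 1 * hb 0 $ 1 $ j + C $ 1 $ 2 * hb 0 $ 2 $ j = 0" "C $ 2 $ 1 * hb 0 $ 1 $ j + C $ 2 $ 2 * hb 0 $ 2 $ j = 0"
    unfolding mat_mult_entry by simp_all
  qed
  then show False using p(1) trb by (simp add: C_def B_def)
 qed
 define s where "s = r / 2"
 have s: "0 < s" "s \<le> 1" "cball 0 s \<subseteq> ball (0::complex) r" using H(1,2) by (auto simp: s_def)
 obtain C where C: "C > 0" "\<And>q. q \<in> cball 0 s \<Longrightarrow> norm (H q) \<le> C" using mat_holo_bounded[OF H(3) compact_cball s(3)] by blast
 show ?thesis
 proof (rule that[OF s(1,2)])
  fix v assume v: "Re v < ln s"
  then have "exp (Re v) < exp (ln s)" by simp
  then have ev: "exp v \<in> cball 0 s" using s(1) by simp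
  have "ln s \<le> ln r" "ln s \<le> 0" using s H(1) by (auto simp: s_def)
  then have vr: "Re v < ln r" "Re v \<le> 0" using v by auto
  have "norm (T v) = exp (of_int m * Re v) * norm (H (exp v))" unfolding H(5)[OF vr(1)] norm_scale_mat by simp
  also have "\<dots> \<le> 1 * C" using vr(2) \<open>m \<ge> 0\<close> C(2)[OF ev] by (intro mult_mono) (auto simp: mult_nonneg_nonpos)
  finally show "norm (Za v ** adj2 (Zb v)) \<le> C" by (simp add: T_def)
 qed
qed

section \<open>Uniqueness\<close>

text \<open>The two-pole coefficient near the pole \<open>- c\<close>, written in
  \<open>q = w + c\<close> and multiplied by \<open>q\<close>. It is regular in the unit disc, as
  the other pole has distance 2, and its value at 0 is the residue.\<close>

definition pole_coeff :: "complex \<Rightarrow> complex \<Rightarrow> complex^2^2 \<Rightarrow> complex^2^2 \<Rightarrow> complex \<Rightarrow> complex^2^2" where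
 "pole_coeff x c Pa Pb q = scale_mat (q * x / 4) sigma3 + Pa + scale_mat (q / (q - 2 * c)) Pb"

lemma pole_coeff_two_pole: "q \<noteq> 0 \<Longrightarrow> scale_mat q (two_pole x c Pa Pb (q - c)) = pole_coeff x c Pa Pb q"
 by (simp add: mat_eq_iff pole_coeff_def two_pole_entry algebra_simps)

lemma pole_coeff_0 [simp]: "pole_coeff x c Pa Pb 0 = Pa"
 by (simp add: pole_coeff_def scale_mat_simps)

lemma pole_coeff_trace_free:
 assumes "Pa $ 2 $ 2 = - Pa $ 1 $ 1" "Pb $ 2 $ 2 = - Pb $ 1 $ 1"
 shows "trace_free (pole_coeff x c Pa Pb) S"
 using assms by (simp add: trace_free_def pole_coeff_def)

lemma pole_coeff_holo:
 assumes "c = 1 \<or> c = - 1"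
 shows "mat_holo (pole_coeff x c Pa Pb) (ball 0 1)"
proof -
 have "q - 2 * c \<noteq> 0" if "q \<in> ball 0 1" for q using that assms by auto
 then show ?thesis
  unfolding mat_holo_def pole_coeff_def by (auto intro!: holomorphic_intros)
qed

lemma mat_ode_pole:
 assumes "mat_ode (two_pole x c Pa Pb) X U" "\<And>v. v \<in> V \<Longrightarrow> exp v - c \<in> U"
 shows "mat_ode (\<lambda>v. pole_coeff x c Pa Pb (exp v)) (\<lambda>v. X (exp v - c)) V"
 unfolding mat_ode_def
proof
 fix v assume "v \<in> V"
 then have X: "has_mderiv X (two_pole x c Pa Pb (exp v - c) ** X (exp v - c)) (exp v - c)" by (intro mat_odeD[OF assms(1)] assms(2))
 have e: "((\<lambda>v. exp v - c) has_field_derivative exp v) (at v)" by (auto intro!: derivative_eq_intros)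
 have "has_mderiv (\<lambda>v. X (exp v - c)) (scale_mat (exp v) (two_pole x c Pa Pb (exp v - c) ** X (exp v - c))) v"
  by (rule has_mderiv_chain[where f = "\<lambda>v. exp v - c", OF X e])
 then show "has_mderiv (\<lambda>v. X (exp v - c)) (pole_coeff x c Pa Pb (exp v) ** X (exp v - c)) v"
  by (simp add: pole_coeff_two_pole[symmetric] scaleC_mat_mult)
qed

lemma left_strip:
 fixes a :: real
 defines "S \<equiv> {v. Re v < 0 \<and> a < Im v \<and> Im v < a + 2 * pi}"
 shows "open S" "connected S" "S \<subseteq> left_plane"
proof -
 have e: "S = {v. Re v < 0} \<inter> {v. a < Im v} \<inter> {v. Im v < a + 2 * pi}" by (auto simp: S_def)
 show "open S" unfolding e by (intro open_Int open_halfspace_Re_lt open_halfspace_Im_gt open_halfspace_Im_lt)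
 show "connected S" unfolding e
  by (intro convex_connected convex_Int convex_halfspace_Re_lt convex_halfspace_Im_gt convex_halfspace_Im_lt)
 show "S \<subseteq> left_plane" by (auto simp: S_def left_plane_def)
qed

text \<open>\<open>Z\<close> is the solution \<open>X\<close> of a two-pole system near the pole \<open>- c\<close> in the coordinate \<open>ln (w + c)\<close>; \<open>M\<close> is its local monodromy.\<close>

definition local_branch :: "complex \<Rightarrow> complex \<Rightarrow> complex^2^2 \<Rightarrow> complex^2^2 \<Rightarrow> (complex \<Rightarrow> complex^2^2) \<Rightarrow> complex^2^2 \<Rightarrow> (complex \<Rightarrow> complex^2^2) \<Rightarrow> bool" where
 "local_branch x c Pa Pb X M Z \<longleftrightarrow> mat_ode (\<lambda>v. pole_coeff x c Pa Pb (exp v)) Z left_plane \<and>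
   (\<forall>v\<in>left_plane. det (Z v) = 1 \<and> Z (v + period) = Z v ** M \<and> (0 < Im v \<longrightarrow> Im v < pi \<longrightarrow> Z v = X (exp v - c)))"

lemma local_branchD:
 assumes "local_branch x c Pa Pb X M Z"
 shows "mat_ode (\<lambda>v. pole_coeff x c Pa Pb (exp v)) Z left_plane" "v \<in> left_plane \<Longrightarrow> det (Z v) = 1"
  "v \<in> left_plane \<Longrightarrow> Z (v + period) = Z v ** M" "v \<in> left_plane \<Longrightarrow> 0 < Im v \<Longrightarrow> Im v < pi \<Longrightarrow> Z v = X (exp v - c)"
 using assms by (auto simp: local_branch_def)

text \<open>Two strips of width \<open>2 * pi\<close> are glued. Arguments between
  \<open>- pi\<close> and \<open>pi\<close> stay off the cut to the left of the pole, where
  \<open>X1\<close> is available; arguments between 0 and \<open>2 * pi\<close> stay off the cut to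
  the right, where \<open>X2\<close> is. They agree over the upper half plane, and one turn starting
  over the lower half plane compares \<open>X1\<close> with \<open>X2\<close>, which yields
  \<open>M\<close>.\<close>

lemma local_lift:
 assumes c: "c = 1 \<or> c = - 1" and tr: "Pa $ 2 $ 2 = - Pa $ 1 $ 1" "Pb $ 2 $ 2 = - Pb $ 1 $ 1"
  and X1: "mat_ode (two_pole x c Pa Pb) X1 U1" "\<And>z. z \<in> U1 \<Longrightarrow> det (X1 z) = 1"
  and X2: "mat_ode (two_pole x c Pa Pb) X2 U2"
  and U1: "\<And>v. Re v < 0 \<Longrightarrow> - pi < Im v \<Longrightarrow> Im v < pi \<Longrightarrow> exp v - c \<in> U1"
  and U2: "\<And>v. Re v < 0 \<Longrightarrow> 0 < Im v \<Longrightarrow> Im v < 2 * pi \<Longrightarrow> exp v - c \<in> U2"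
  and up: "\<And>z. z \<in> upper \<Longrightarrow> X2 z = X z \<and> X1 z = X z" and low: "\<And>z. z \<in> lower \<Longrightarrow> X2 z = X1 z ** M"
 obtains Z where "local_branch x c Pa Pb X M Z"
proof -
 let ?L = "\<lambda>v. pole_coeff x c Pa Pb (exp v)"
 have imc: "Im c = 0" using c by auto
 have tf: "trace_free ?L V" for V using pole_coeff_trace_free[OF tr, of x c UNIV] by (simp add: trace_free_def)
 have hol: "mat_holo ?L left_plane"
  by (rule mat_holo_compose[OF pole_coeff_holo[OF c] holomorphic_on_exp left_plane(4)])
 obtain W where W: "mat_ode ?L W left_plane" "\<And>v. v \<in> left_plane \<Longrightarrow> det (W v) = 1"
  using mat_ode_fundamental[OF left_plane(1,3) hol tf] by blast
 define S where "S a = {v. Re v < 0 \<and> a < Im v \<and> Im v < a + 2 * pi}" for a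
 note S = left_strip[folded S_def]
 have e1: "exp v - c \<in> U1" if "v \<in> S (- pi)" for v using that by (intro U1) (auto simp: S_def)
 have e2: "exp v - c \<in> U2" if "v \<in> S 0" for v using that by (intro U2) (auto simp: S_def)
 define p1 where "p1 = Complex (- 1) (pi / 2)"
 have p1: "p1 \<in> S 0" "p1 \<in> S (- pi)" "p1 \<in> left_plane" by (simp_all add: p1_def S_def left_plane_def)
 have p1u: "exp p1 - c \<in> upper" using imc by (simp add: p1_def upper_def Im_exp)
 define K where "K = adj2 (W p1) ** X1 (exp p1 - c)"
 define Z where "Z v = W v ** K" for v
 have Z: "mat_ode ?L Z left_plane" unfolding Z_def by (rule mat_ode_mult_const[OF W(1)])
 have dZ: "det (Z v) = 1" if "v \<in> left_plane" for v
  using W(2)[OF that] W(2)[OF p1(3)] X1(2)[OF e1[OF p1(2)]] by (simp add: Z_def K_def det_mul)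
 have Zp1: "Z p1 = X1 (exp p1 - c)" unfolding Z_def K_def by (rule adj2_cancel(1)[OF W(2)[OF p1(3)]])
 have Z1: "Z v = X1 (exp v - c)" if "v \<in> S (- pi)" for v
  by (rule mat_ode_unique_eq[OF mat_ode_subset[OF Z S(3)] mat_ode_pole[OF X1(1) e1] tf S(1,2) p1(2) dZ[OF p1(3)] that Zp1])
 have Zp1': "Z p1 = X2 (exp p1 - c)" using Zp1 up[OF p1u] by simp
 have Z2: "Z v = X2 (exp v - c)" if "v \<in> S 0" for v
  by (rule mat_ode_unique_eq[OF mat_ode_subset[OF Z S(3)] mat_ode_pole[OF X2 e2] tf S(1,2) p1(1) dZ[OF p1(3)] that Zp1'])
 have per: "exp (v + period) = exp v" for v by (simp add: exp_add)
 have ode2: "mat_ode ?L (\<lambda>v. Z (v + period)) left_plane"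
  by (rule mat_ode_translate[OF Z]) (simp add: left_plane(5) per)
 define p2 where "p2 = Complex (- 1) (- (pi / 2))"
 have p2: "p2 \<in> S (- pi)" "p2 + period \<in> S 0" "p2 \<in> left_plane"
  using pi_gt_zero by (auto simp: p2_def S_def left_plane_def simp del: pi_gt_zero)
 have p2l: "exp p2 - c \<in> lower" using imc by (simp add: p2_def lower_def Im_exp)
 have Zp2: "Z (p2 + period) = Z p2 ** M"
  unfolding Z2[OF p2(2)] Z1[OF p2(1)] per by (rule low[OF p2l])
 have "Z (v + period) = Z v ** M" if v: "v \<in> left_plane" for v
  using mat_ode_unique[OF Z ode2 tf left_plane(1,2) p2(3) dZ[OF p2(3)] v] unfolding Zp2 adj2_cancel(2)[OF dZ[OF p2(3)]] .
 moreover have "Z v = X (exp v - c)" if "v \<in> left_plane" "0 < Im v" "Im v < pi" for v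
 proof -
  have "exp v - c \<in> upper" using Im_exp_pos[OF that(2,3)] imc by (simp add: upper_def)
  then show ?thesis using Z1[of v] up that by (simp add: S_def left_plane_def)
 qed
 ultimately have "local_branch x c Pa Pb X M Z" using Z dZ by (simp add: local_branch_def)
 then show ?thesis by (rule that)
qed

text \<open>Without a residue the point is regular and all solutions near it are single-valued. The
  contrapositive ensures that nonscalar monodromy comes with nonzero residues, from which
  \<open>y\<close> can be recovered.\<close>

lemma monodromy_trivial_if_residue_0:
 assumes c: "c = 1 \<or> c = - 1" and tr: "Pb $ 2 $ 2 = - Pb $ 1 $ 1"
  and branch: "local_branch x c 0 Pb X M Z"
 shows "M = mat 1"
proof -
 note Z = local_branchD[OF branch]
 let ?A = "two_pole x c 0 Pb"
 define B where "B = ball (- c) 1"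
 have "c \<notin> B" using c by (auto simp: B_def dist_norm)
 then have nz: "l - c \<noteq> 0" if "l \<in> B" for l using that by auto
 have "mat_holo ?A B" unfolding mat_holo_def two_pole_entry using nz by (auto intro!: holomorphic_intros)
 moreover have "trace_free ?A B" by (rule two_pole_trace_free) (simp_all add: tr)
 moreover have "open B" "starlike B" unfolding B_def by (auto intro!: convex_imp_starlike)
 ultimately obtain W where W: "mat_ode ?A W B" "\<And>z. z \<in> B \<Longrightarrow> det (W z) = 1" using mat_ode_fundamental by metis
 have e: "exp v - c \<in> B" if "v \<in> left_plane" for v
  using left_plane(4)[OF that] by (simp add: B_def dist_norm norm_minus_commute)
 have tf: "trace_free (\<lambda>v. pole_coeff x c 0 Pb (exp v)) left_plane"
  using pole_coeff_trace_free[OF _ tr, of 0 x c UNIV] by (simp add: trace_free_def)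
 define p where "p = (- 1 :: complex)"
 have p: "p \<in> left_plane" by (simp add: p_def left_plane_def)
 have per: "exp (v + period) = exp v" for v by (simp add: exp_add)
 have eq: "Z v = W (exp v - c) ** (adj2 (W (exp p - c)) ** Z p)" if "v \<in> left_plane" for v
  by (rule mat_ode_unique[OF mat_ode_pole[OF W(1) e] Z(1) tf left_plane(1,2) p W(2)[OF e[OF p]] that])
 have "Z (p + period) = Z p" unfolding eq[OF left_plane(5)[OF p]] per using eq[OF p] by simp
 then have "Z p ** M = Z p" using Z(3)[OF p] by simp
 then have "adj2 (Z p) ** (Z p ** M) = adj2 (Z p) ** Z p" by simp
 then show ?thesis unfolding adj2_cancel(2)[OF Z(2)[OF p]] adj2_inverse(2)[OF Z(2)[OF p]] .
qed

lemma two_pole_swap: "two_pole x (- c) P1 P0 = two_pole x c P0 P1"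
 by (rule ext) (simp add: two_pole_def algebra_simps)

lemma slit_neighbourhoods:
 assumes v: "Re v < 0"
 shows "- pi < Im v \<Longrightarrow> Im v < pi \<Longrightarrow> exp v - 1 \<in> slitM" "0 < Im v \<Longrightarrow> Im v < 2 * pi \<Longrightarrow> exp v - 1 \<in> slitL"
  "- pi < Im v \<Longrightarrow> Im v < pi \<Longrightarrow> exp v - - 1 \<in> slitR" "0 < Im v \<Longrightarrow> Im v < 2 * pi \<Longrightarrow> exp v - - 1 \<in> slitM"
proof -
 have e: "exp (Re v) < 1" "0 < exp (Re v)" using v by simp_all
 have A: "Re (exp v) > 0 \<and> Re (exp v) < 1" if "- pi < Im v" "Im v < pi" "Im (exp v) = 0"
 proof -
  have "sin (Im v) = 0" using that(3) by (simp add: Im_exp)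
  then have "Im v = 0" using that sin_gt_zero[of "Im v"] sin_gt_zero[of "- Im v"] by (cases "Im v" "0 :: real" rule: linorder_cases) auto
  then show ?thesis using e by (simp add: Re_exp)
 qed
 have B: "Re (exp v) < 0 \<and> Re (exp v) > - 1" if "0 < Im v" "Im v < 2 * pi" "Im (exp v) = 0"
 proof -
  have "sin (Im v - pi) = 0" using that(3) by (simp add: Im_exp)
  then have "Im v - pi = 0" using that sin_gt_zero[of "Im v - pi"] sin_gt_zero[of "pi - Im v"] by (cases "Im v - pi" "0 :: real" rule: linorder_cases) auto
  then have "Im v = pi" by simp
  then show ?thesis using e by (simp add: Re_exp)
 qed
 show "- pi < Im v \<Longrightarrow> Im v < pi \<Longrightarrow> exp v - 1 \<in> slitM" "- pi < Im v \<Longrightarrow> Im v < pi \<Longrightarrow> exp v - - 1 \<in> slitR"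
  using A by (auto simp: slit_def)
 show "0 < Im v \<Longrightarrow> Im v < 2 * pi \<Longrightarrow> exp v - 1 \<in> slitL" "0 < Im v \<Longrightarrow> Im v < 2 * pi \<Longrightarrow> exp v - - 1 \<in> slitM"
  using B by (auto simp: slit_def)
qed

lemma sheets_lift:
 assumes tr: "P0 $ 2 $ 2 = - P0 $ 1 $ 1" "P1 $ 2 $ 2 = - P1 $ 1 $ 1"
  and sh: "sheets (two_pole x 1 P0 P1) X XL XM XR" and j: "jumps XL XM XR M0 M1"
 obtains Z0 Z1 where "local_branch x 1 P0 P1 X M0 Z0" "local_branch x (- 1) P1 P0 X M1 Z1"
proof -
 note sh' = sh[unfolded sheets_def] and j' = j[unfolded jumps_def]
 have L: "mat_ode (two_pole x 1 P0 P1) XL slitL" and Md: "mat_ode (two_pole x 1 P0 P1) XM slitM" "\<And>z. z \<in> slitM \<Longrightarrow> det (XM z) = 1"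
  and R: "mat_ode (two_pole x 1 P0 P1) XR slitR" "\<And>z. z \<in> slitR \<Longrightarrow> det (XR z) = 1"
  and u: "\<And>z. z \<in> upper \<Longrightarrow> XL z = X z \<and> XM z = X z" "\<And>z. z \<in> upper \<Longrightarrow> XM z = X z \<and> XR z = X z"
  using sh' by auto
 have jl: "\<And>z. z \<in> lower \<Longrightarrow> XL z = XM z ** M0" "\<And>z. z \<in> lower \<Longrightarrow> XM z = XR z ** M1" using j' by auto
 have c: "(1::complex) = 1 \<or> (1::complex) = - 1" "(- 1::complex) = 1 \<or> (- 1::complex) = - 1" by simp_all
 obtain Z0 where "local_branch x 1 P0 P1 X M0 Z0"
  using local_lift[OF c(1) tr Md L slit_neighbourhoods(1,2) u(1) jl(1)] by blast
 moreover obtain Z1 where "local_branch x (- 1) P1 P0 X M1 Z1"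
  using local_lift[OF c(2) tr(2,1) R[folded two_pole_swap[of x 1]] Md(1)[folded two_pole_swap[of x 1]] slit_neighbourhoods(3,4) u(2) jl(2)] by blast
 ultimately show ?thesis by (rule that)
qed

text \<open>Two solutions with the same jumps: their quotient is single-valued.\<close>

lemma glue_quotient:
 assumes a: "sheets A X XL XM XR" "jumps XL XM XR M0 M1" and b: "sheets B X' YL YM YR" "jumps YL YM YR M0 M1"
  and M: "det M0 = 1" "det M1 = 1" and B: "trace_free B UNIV"
 obtains R where "\<And>z. z \<noteq> 1 \<Longrightarrow> z \<noteq> - 1 \<Longrightarrow> has_mderiv R (A z ** R z - R z ** B z) z"
  "\<And>z. z \<in> upper \<Longrightarrow> R z = X z ** adj2 (X' z)"
proof -
 note sa = a(1)[unfolded sheets_def] and ja = a(2)[unfolded jumps_def] and sb = b(1)[unfolded sheets_def] and jb = b(2)[unfolded jumps_def]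
 define QL where "QL z = XL z ** adj2 (YL z)" for z
 define QM where "QM z = XM z ** adj2 (YM z)" for z
 define QR where "QR z = XR z ** adj2 (YR z)" for z
 have up: "QL z = QM z" "QR z = QM z" "QM z = X z ** adj2 (X' z)" if "z \<in> upper" for z
  using sa sb that by (simp_all add: QL_def QM_def QR_def)
 have low: "QL z = QM z" "QR z = QM z" if "z \<in> lower" for z
  using ja jb that by (simp_all add: QL_def QM_def QR_def adj2_mult matrix_mul_assoc[symmetric] adj2_cancel[OF M(1)] adj2_cancel[OF M(2)])
 \<comment> \<open>Off the real axis the three quotients coincide; on each open interval the one
   that is continued across it is chosen.\<close>
 define R where "R z = (if Im z = 0 \<and> Re z < - 1 then QL z else if Im z = 0 \<and> Re z > 1 then QR z else QM z)" for z
 have off: "QL z = QM z" "QR z = QM z" if "Im z \<noteq> 0" for z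
  using up low that by (auto simp: upper_def lower_def linorder_neq_iff)
 have RL: "QL z = R z" if "z \<in> slitL" for z using that off[of z] by (auto simp: R_def slit_def)
 have RM: "QM z = R z" if "z \<in> slitM" for z using that off[of z] by (auto simp: R_def slit_def)
 have RR: "QR z = R z" if "z \<in> slitR" for z using that off[of z] by (auto simp: R_def slit_def)
 have tf: "trace_free B S" for S using B by (simp add: trace_free_def)
 have quot: "has_mderiv (\<lambda>z. V z ** adj2 (W z)) (A z ** (V z ** adj2 (W z)) - (V z ** adj2 (W z)) ** B z) z"
  if "mat_ode A V S" "mat_ode B W S" "z \<in> S" for V W S z
 proof -
  have "has_mderiv (\<lambda>z. V z ** adj2 (W z)) ((A z ** V z) ** adj2 (W z) + V z ** scale_mat (- 1) (adj2 (W z) ** B z)) z"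
   by (intro has_mderiv_mult mat_odeD[OF that(1,3)] mat_ode_adj2[OF that(2) tf that(3)])
  moreover have "(A z ** V z) ** adj2 (W z) + V z ** scale_mat (- 1) (adj2 (W z) ** B z) = A z ** (V z ** adj2 (W z)) - (V z ** adj2 (W z)) ** B z"
   by (simp add: scaleC_mat_mult matrix_mul_assoc mat_eq_iff)
  ultimately show ?thesis by simp
 qed
 have cover: "z \<in> slitL \<or> z \<in> slitM \<or> z \<in> slitR" if "z \<noteq> 1" "z \<noteq> - 1" for z
  using that by (auto simp: slit_def complex_eq_iff)
 show ?thesis
 proof
  fix z :: complex assume z: "z \<noteq> 1" "z \<noteq> - 1"
  from cover[OF this] consider "z \<in> slitL" | "z \<in> slitM" | "z \<in> slitR" by blast
  then show "has_mderiv R (A z ** R z - R z ** B z) z"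
  proof cases
   case 1
   have "has_mderiv QL (A z ** QL z - QL z ** B z) z" unfolding QL_def using sa sb 1 by (intro quot[of _ slitL]) auto
   then show ?thesis unfolding RL[OF 1] by (rule has_mderiv_transform[OF _ slits(1) 1 RL])
  next
   case 2
   have "has_mderiv QM (A z ** QM z - QM z ** B z) z" unfolding QM_def using sa sb 2 by (intro quot[of _ slitM]) auto
   then show ?thesis unfolding RM[OF 2] by (rule has_mderiv_transform[OF _ slits(2) 2 RM])
  next
   case 3
   have "has_mderiv QR (A z ** QR z - QR z ** B z) z" unfolding QR_def using sa sb 3 by (intro quot[of _ slitR]) auto
   then show ?thesis unfolding RR[OF 3] by (rule has_mderiv_transform[OF _ slits(3) 3 RR])
  qed
 next
  fix z :: complex assume z: "z \<in> upper"
  show "R z = X z ** adj2 (X' z)" using up(3)[OF z] RM[OF subsetD[OF slits(13) z]] by simp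
 qed
qed

text \<open>In the logarithmic coordinate at the pole, \<open>R\<close> is the quotient of the two
  local branches: this holds over the upper half plane and extends by the identity theorem. Then
  \<open>intertwiner_bounded\<close> applies.\<close>

lemma quotient_bounded_near_pole:
 assumes c: "c = 1 \<or> c = - 1"
  and tr: "Pa $ 2 $ 2 = - Pa $ 1 $ 1" "Pb $ 2 $ 2 = - Pb $ 1 $ 1" "Qa $ 2 $ 2 = - Qa $ 1 $ 1" "Qb $ 2 $ 2 = - Qb $ 1 $ 1"
  and d: "det Pa = - k\<^sup>2 / 4" "det Qa = - k\<^sup>2 / 4"
  and branch: "local_branch x c Pa Pb X M Z" "local_branch x c Qa Qb X' M Z'"
  and M: "det M = 1" "trace M = 2 * cos (of_real pi * k)" "M \<notin> {mat 1, - mat 1}"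
  and R: "mat_holo R (- {1, - 1})" "\<And>w. w \<in> upper \<Longrightarrow> R w = X w ** adj2 (X' w)"
 shows "\<exists>C. \<forall>\<^sub>F w in at (- c). norm (R w) \<le> C"
proof -
 note Z = local_branchD[OF branch(1)] and Z' = local_branchD[OF branch(2)]
 have dd: "det (pole_coeff x c Pa Pb 0) = - k\<^sup>2 / 4" "det (pole_coeff x c Qa Qb 0) = - k\<^sup>2 / 4" using d by simp_all
 obtain r C where r: "0 < r" "r \<le> 1" "\<And>v. Re v < ln r \<Longrightarrow> norm (Z v ** adj2 (Z' v)) \<le> C"
  using intertwiner_bounded[OF pole_coeff_holo[OF c] pole_coeff_trace_free[OF tr(1,2)] dd(1)
    pole_coeff_holo[OF c] pole_coeff_trace_free[OF tr(3,4)] dd(2) Z(1-3) Z'(1-3) M] by metis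
 have avoid: "exp v - c \<in> - {1, - 1}" if "v \<in> left_plane" for v
 proof -
  have q: "q - c \<in> - {1, - 1}" if "q \<in> ball 0 1" "q \<noteq> 0" for q
   using that c by (auto simp: algebra_simps add_eq_0_iff2)
  show ?thesis by (rule q[OF left_plane(4)[OF that]]) simp
 qed
 have eq: "R (exp v - c) = Z v ** adj2 (Z' v)" if v: "v \<in> left_plane" for v
 proof -
  define p where "p = Complex (- 1) (pi / 2)"
  have p: "p \<in> left_plane" by (simp add: p_def left_plane_def)
  show ?thesis
  proof (rule mat_holo_identity[OF _ _ left_plane(1,2) p _ v])
   show "mat_holo (\<lambda>v. R (exp v - c)) left_plane"
    by (rule mat_holo_compose[OF R(1) _ avoid]) (auto intro!: holomorphic_intros)
   show "mat_holo (\<lambda>v. Z v ** adj2 (Z' v)) left_plane"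
    by (intro mat_holo_mult mat_holo_adj2 mat_ode_holo[OF Z(1) left_plane(1)] mat_ode_holo[OF Z'(1) left_plane(1)])
   have "open {v. Re v < 0 \<and> 0 < Im v \<and> Im v < pi}"
    by (intro open_Collect_conj open_halfspace_Re_lt open_halfspace_Im_gt open_halfspace_Im_lt)
   then have "\<forall>\<^sub>F v in nhds p. v \<in> {v. Re v < 0 \<and> 0 < Im v \<and> Im v < pi}"
    by (rule eventually_nhds_in_open) (simp add: p_def)
   then show "\<forall>\<^sub>F v in nhds p. R (exp v - c) = Z v ** adj2 (Z' v)"
   proof eventually_elim
    case (elim v)
    then have "exp v - c \<in> upper" using Im_exp_pos[of v] c by (auto simp: upper_def)
    from R(2)[OF this] show ?case using Z(4)[of v] Z'(4)[of v] elim by (simp add: left_plane_def)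
   qed
  qed
 qed
 have "norm (R w) \<le> C" if z: "w \<noteq> - c" "dist w (- c) < r" for w
 proof -
  define v where "v = Ln (w + c)"
  have nz: "w + c \<noteq> 0" using z(1) by (auto simp: add_eq_0_iff2)
  have "cmod (w + c) < r" using z(2) by (simp add: dist_norm)
  then have "ln (cmod (w + c)) < ln r" using nz r(1) by (subst ln_less_cancel_iff) auto
  then have vr: "Re v < ln r" using nz by (simp add: v_def Re_Ln)
  have "ln r \<le> 0" using r by simp
  then have "v \<in> left_plane" using vr by (simp add: left_plane_def)
  from eq[OF this] have "R w = Z v ** adj2 (Z' v)" using nz by (simp add: v_def)
  then show ?thesis using r(3)[OF vr] by simp
 qed
 then show ?thesis unfolding eventually_at using r(1) by blast
qed

section \<open>Boundedness at infinity and constancy of the quotient\<close>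

text \<open>Riemann's theorem on removable singularities, used once for each pole.\<close>

lemma bounded_extends_entire:
 fixes f :: "complex \<Rightarrow> complex"
 assumes "f holomorphic_on - {1, - 1}" "\<forall>\<^sub>F z in at 1. cmod (f z) \<le> C1" "\<forall>\<^sub>F z in at (- 1). cmod (f z) \<le> C2"
 obtains g where "g holomorphic_on UNIV" "\<And>z. z \<noteq> 1 \<Longrightarrow> z \<noteq> - 1 \<Longrightarrow> g z = f z"
proof -
 have "f holomorphic_on - {1} - {- 1}" using assms(1) by (rule holomorphic_on_subset) auto
 moreover have i: "- 1 \<in> interior (- {1 :: complex})" by (subst interior_open) auto
 ultimately obtain g1 where g1: "g1 holomorphic_on - {1}" "\<And>z. z \<in> - {1} - {- 1} \<Longrightarrow> g1 z = f z"
  using holomorphic_on_extend_bounded[of f "- {1}" "- 1"] assms(3) by auto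
 have "g1 holomorphic_on UNIV - {1}" using g1(1) by (simp add: Compl_eq_Diff_UNIV)
 moreover have "\<forall>\<^sub>F z in at 1. cmod (g1 z) \<le> C1"
 proof -
  have "\<forall>\<^sub>F z in at 1. z \<in> - {- 1 :: complex}" by (rule eventually_at_in_open') auto
  moreover have "\<forall>\<^sub>F z in at 1. z \<noteq> (1 :: complex)" by (rule eventually_neq_at_within)
  ultimately show ?thesis using assms(2) by eventually_elim (use g1(2) in auto)
 qed
 ultimately obtain g where g: "g holomorphic_on UNIV" "\<And>z. z \<in> UNIV - {1} \<Longrightarrow> g z = g1 z"
  using holomorphic_on_extend_bounded[of g1 UNIV 1] by auto
 show ?thesis by (rule that[OF g(1)]) (use g(2) g1(2) in auto)
qed

text \<open>Phragmen-Lindelof in a sector of half-angle \<open>\<pi> / 8\<close>, in the coordinate \<open>v = ln l\<close>.\<close>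

lemma phragmen_lindelof_strip:
 fixes h :: "complex \<Rightarrow> complex"
 assumes hol: "h holomorphic_on log_plane" and R0: "R0 > 0" and B: "B > 0" and K: "K \<ge> 0" and C: "C \<ge> 0"
  and growth: "\<And>v. R0 \<le> Re v \<Longrightarrow> \<bar>Im v - b\<bar> \<le> pi / 8 \<Longrightarrow> cmod (h v) \<le> C * exp (K * exp (Re v))"
  and bdry: "\<And>v. R0 \<le> Re v \<Longrightarrow> \<bar>Im v - b\<bar> \<le> pi / 8 \<Longrightarrow> Re v = R0 \<or> \<bar>Im v - b\<bar> = pi / 8 \<Longrightarrow> cmod (h v) \<le> B"
  and v0: "R0 \<le> Re v0" "\<bar>Im v0 - b\<bar> \<le> pi / 8"
 shows "cmod (h v0) \<le> B"
proof -
 have main: "cmod (h v0) \<le> B * exp (e * exp (2 * Re v0))" if e: "e > 0" for e :: real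
 proof -
  \<comment> \<open>The multiplier is \<open>exp (- e l^2)\<close> in the variable rotated to the
    axis of the sector. There the doubled angle is at most \<open>pi / 4\<close>, so its cosine
    exceeds 1/2 and the quadratic decay beats the growth \<open>exp (K |l|)\<close>.\<close>
  define m where "m w = exp (- of_real e * exp (2 * (w - \<i> * of_real b)))" for w
  define g where "g w = h w * m w" for w
  have nm: "cmod (m w) = exp (- (e * exp (2 * Re w) * cos (2 * (Im w - b))))" for w
   by (simp add: m_def Re_exp)
  have cosb: "cos (2 * (Im w - b)) \<ge> 1 / 2" if "\<bar>Im w - b\<bar> \<le> pi / 8" for w
  proof -
   have "2 * a \<le> pi / 3" if "a \<le> pi / 8" "0 \<le> a" for a using that by linarith
   from this[OF that abs_ge_zero] have "\<bar>2 * (Im w - b)\<bar> \<le> pi / 3" unfolding abs_mult abs_numeral .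
   then have "cos (pi / 3) \<le> cos \<bar>2 * (Im w - b)\<bar>" by (intro cos_monotone_0_pi_le) auto
   then show ?thesis by (simp add: cos_60)
  qed
  have m1: "cmod (m w) \<le> exp (- (e / 2 * exp (2 * Re w)))" if "\<bar>Im w - b\<bar> \<le> pi / 8" for w
  proof -
   have "e * exp (2 * Re w) * (1 / 2) \<le> e * exp (2 * Re w) * cos (2 * (Im w - b))" using cosb[OF that] e by (intro mult_left_mono) auto
   then show ?thesis unfolding nm by simp
  qed
  have "m1'": "cmod (m w) \<le> 1" if "\<bar>Im w - b\<bar> \<le> pi / 8" for w
   by (rule order_trans[OF m1[OF that]]) (use e in simp)
  \<comment> \<open>For \<open>X = exp R1 \<ge> E\<close> one has
    \<open>K X - (e / 2) X^2 \<le> - X\<close>, hence the product is at most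
    \<open>C exp (- X) \<le> C / X \<le> B\<close> on the outer edge of the rectangle.\<close>
  define E where "E = max 1 (max (2 * (K + 1) / e) (C / B))"
  define R1 where "R1 = max (Re v0 + 1) (ln E)"
  have E0: "E > 0" by (simp add: E_def less_max_iff_disj)
  have R1: "Re v0 < R1" "R0 < R1" "E \<le> exp R1"
   using v0(1) E0 exp_ln[OF E0] exp_le_cancel_iff[of "ln E" R1] by (auto simp: R1_def)
  have far: "C * exp (K * exp R1) * exp (- (e / 2 * exp (2 * R1))) \<le> B"
  proof -
   define X where "X = exp R1"
   have X: "X > 0" "X \<ge> 2 * (K + 1) / e" "X \<ge> C / B" using R1(3) by (auto simp: X_def E_def)
   have "e / 2 * X \<ge> K + 1" using X(2) e by (simp add: field_simps)
   then have "(K + 1) * X \<le> e / 2 * X * X" using X(1) by (intro mult_right_mono) auto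
   then have "K * X - e / 2 * (X * X) \<le> - X" by (simp add: algebra_simps)
   then have "exp (K * X - e / 2 * (X * X)) \<le> exp (- X)" by simp
   also have "\<dots> \<le> 1 / X"
   proof -
    have "X \<le> exp X" using exp_ge_add_one_self[of X] by linarith
    then show ?thesis using X(1) by (simp add: exp_minus field_simps)
   qed
   finally have "C * exp (K * X - e / 2 * (X * X)) \<le> C * (1 / X)" using C by (intro mult_left_mono)
   also have "\<dots> \<le> B" using X(1,3) B by (simp add: field_simps)
   finally have "C * exp (K * X - e / 2 * (X * X)) \<le> B" .
   moreover have "exp (2 * R1) = X * X" unfolding X_def mult_2 exp_add ..
   moreover have "exp (K * X) * exp (- (e / 2 * (X * X))) = exp (K * X - e / 2 * (X * X))"
    by (subst exp_add[symmetric]) simp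
   ultimately show ?thesis unfolding X_def[symmetric] by (simp only: mult.assoc)
  qed
  define S where "S = cbox (Complex R0 (b - pi / 8)) (Complex R1 (b + pi / 8))"
  have S: "w \<in> S \<longleftrightarrow> R0 \<le> Re w \<and> Re w \<le> R1 \<and> \<bar>Im w - b\<bar> \<le> pi / 8" for w
   unfolding S_def in_cbox_complex_iff abs_le_iff complex.sel atLeastAtMost_iff by linarith
  have Slp: "S \<subseteq> log_plane" using R0 by (auto simp: S log_plane_def)
  have gh: "g holomorphic_on S" unfolding g_def m_def by (intro holomorphic_intros holomorphic_on_subset[OF hol Slp])
  have "cmod (g v0) \<le> B"
  proof (rule maximum_modulus_frontier[of g S])
   show "g holomorphic_on interior S" by (rule holomorphic_on_subset[OF gh interior_subset])
   show "continuous_on (closure S) g" using holomorphic_on_imp_continuous_on[OF gh] by (simp add: S_def)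
   show "bounded S" by (simp add: S_def)
   show "v0 \<in> S" using v0 R1 by (simp add: S)
   fix w assume "w \<in> frontier S"
   then have w: "w \<in> S" "w \<notin> box (Complex R0 (b - pi / 8)) (Complex R1 (b + pi / 8))"
    by (auto simp: frontier_def S_def)
   then have cases: "Re w = R1 \<or> Re w = R0 \<or> \<bar>Im w - b\<bar> = pi / 8"
    unfolding S in_box_complex_iff by (auto simp: abs_if split: if_splits)
   have wi: "R0 \<le> Re w" "\<bar>Im w - b\<bar> \<le> pi / 8" using w(1) by (auto simp: S)
   show "cmod (g w) \<le> B"
   proof (cases "Re w = R1")
    case True
    have "cmod (g w) \<le> (C * exp (K * exp R1)) * exp (- (e / 2 * exp (2 * R1)))"
     unfolding g_def norm_mult using growth[OF wi] m1[OF wi(2)] C True by (intro mult_mono) auto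
    then show ?thesis using far by linarith
   next
    case False
    then have "cmod (h w) \<le> B" using cases by (intro bdry wi) auto
    then have "cmod (g w) \<le> B * 1" unfolding g_def norm_mult using "m1'"[OF wi(2)] B by (intro mult_mono) auto
    then show ?thesis by simp
   qed
  qed
  moreover have "cmod (m v0) \<ge> exp (- (e * exp (2 * Re v0)))"
  proof -
   have "e * exp (2 * Re v0) * cos (2 * (Im v0 - b)) \<le> e * exp (2 * Re v0) * 1" using e by (intro mult_left_mono) auto
   then show ?thesis unfolding nm by simp
  qed
  ultimately have "cmod (h v0) * exp (- (e * exp (2 * Re v0))) \<le> B"
   unfolding g_def norm_mult by (meson mult_left_mono norm_ge_zero order_trans)
  then show ?thesis by (simp add: exp_minus field_simps)
 qed
 have "((\<lambda>e. B * exp (e * exp (2 * Re v0))) \<longlongrightarrow> B * exp (0 * exp (2 * Re v0))) (at_right 0)"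
  by (intro tendsto_intros)
 moreover have "\<forall>\<^sub>F e in at_right 0. cmod (h v0) \<le> B * exp (e * exp (2 * Re v0))"
  using eventually_at_right_less[of 0] by eventually_elim (rule main)
 ultimately have "cmod (h v0) \<le> B * exp (0 * exp (2 * Re v0))" by (rule tendsto_lowerbound) simp
 then show ?thesis by simp
qed

lemma norm_mat_mult_leI: "norm A \<le> a \<Longrightarrow> norm B \<le> b \<Longrightarrow> norm (A ** B) \<le> 8 * a * b" for A B :: "complex^2^2"
 using order_trans[OF norm_mat_mult_le mult_mono[OF mult_left_mono]] norm_ge_zero[of A] by fastforce

text \<open>Outside the disc of radius 2 both coefficients are bounded, so Gronwall's inequality
  along radii gives growth of order at most one. A sector of half-angle \<open>pi / 8\<close> is
  narrow enough for such growth.\<close>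

lemma quotient_growth:
 assumes R: "\<And>q. q \<noteq> 1 \<Longrightarrow> q \<noteq> - 1 \<Longrightarrow> has_mderiv R (two_pole x 1 P0 P1 q ** R q - R q ** two_pole x 1 Q0 Q1 q) q"
 obtains C K where "C \<ge> 0" "K \<ge> 0" "\<And>q. cmod q \<ge> 2 \<Longrightarrow> norm (R q) \<le> C * exp (K * cmod q)"
proof -
 define a where "a = cmod x + norm P0 + norm P1 + norm Q0 + norm Q1"
 have a: "a \<ge> 0" by (simp add: a_def)
 have bd: "norm (two_pole x 1 A0 A1 q) \<le> 4 * (cmod x + norm A0 + norm A1)" if z: "cmod q \<ge> 2" for A0 A1 q
 proof (rule norm_mat_leI)
  fix i j :: 2
  have "cmod (q + 1) \<ge> 1" "cmod (q - 1) \<ge> 1"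
   using z norm_triangle_ineq2[of q "- 1"] norm_triangle_ineq2[of q 1] by auto
  then have "cmod (A0 $ i $ j / (q + 1)) \<le> cmod (A0 $ i $ j)" "cmod (A1 $ i $ j / (q - 1)) \<le> cmod (A1 $ i $ j)"
   by (auto simp: norm_divide intro!: mult_imp_div_pos_le mult_right_le_one_le simp: mult_le_cancel_left1)
  moreover have "cmod (x / 4 * sigma3 $ i $ j) \<le> cmod x"
   using exhaust_2[of i] exhaust_2[of j] by (auto simp: norm_mult norm_divide)
  ultimately show "cmod (two_pole x 1 A0 A1 q $ i $ j) \<le> cmod x + norm A0 + norm A1"
   unfolding two_pole_entry using norm_entry_le[of A0 i j] norm_entry_le[of A1 i j]
   by (smt (verit) norm_triangle_ineq)
 qed
 define K where "K = 64 * a"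
 have K: "K \<ge> 0" using a by (simp add: K_def)
 have "norm (two_pole x 1 P0 P1 y) \<le> 4 * a" "norm (two_pole x 1 Q0 Q1 y) \<le> 4 * a" if "cmod y \<ge> 2" for y
  using order_trans[OF bd[OF that, of P0 P1]] order_trans[OF bd[OF that, of Q0 Q1]] by (auto simp: a_def)
 then have db: "norm (two_pole x 1 P0 P1 y ** R y - R y ** two_pole x 1 Q0 Q1 y) \<le> K * norm (R y) + 0" if "cmod y \<ge> 2" for y
  using norm_mat_mult_leI[of "two_pole x 1 P0 P1 y" "4 * a" "R y", OF _ order_refl]
   norm_mat_mult_leI[of "R y" _ "two_pole x 1 Q0 Q1 y" "4 * a", OF order_refl]
   norm_triangle_ineq4[of "two_pole x 1 P0 P1 y ** R y" "R y ** two_pole x 1 Q0 Q1 y"] that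
  by (simp add: K_def algebra_simps)
 have Rh: "mat_holo R (- {1, - 1})" by (rule mat_holo_if_mderiv[OF R]) (auto intro!: open_Compl)
 have "sphere 0 2 \<subseteq> - {1, - 1 :: complex}" by auto
 then obtain c where c: "c > 0" "\<And>q. q \<in> sphere 0 2 \<Longrightarrow> norm (R q) \<le> c" using mat_holo_bounded[OF Rh compact_sphere] by blast
 show ?thesis
 proof (rule that[OF less_imp_le[OF c(1)] K])
  fix q :: complex assume z: "cmod q \<ge> 2"
  \<comment> \<open>The point on the circle of radius 2 in the same direction as \<open>q\<close>,
    from which the radial estimate starts.\<close>
  define p where "p = of_real (2 / cmod q) * q"
  have zn: "cmod q > 0" using z by linarith
  have p: "cmod p = 2" using zn by (simp add: p_def norm_mult norm_divide)
  have dp: "dist p q = cmod q - 2"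
  proof -
   have "q - p = of_real (1 - 2 / cmod q) * q" by (simp add: p_def algebra_simps)
   then have "cmod (q - p) = \<bar>1 - 2 / cmod q\<bar> * cmod q" by (simp only: norm_mult norm_of_real)
   also have "\<bar>1 - 2 / cmod q\<bar> = 1 - 2 / cmod q" using z zn by simp
   finally show ?thesis using zn by (simp add: dist_norm norm_minus_commute field_simps)
  qed
  have seg: "cmod w \<ge> 2" if "w \<in> closed_segment p q" for w
  proof -
   obtain r :: real where r: "0 \<le> r" "r \<le> 1" "w = p + of_real r * (q - p)"
    using \<open>w \<in> closed_segment p q\<close> unfolding closed_segment_iff_affine by blast
   have "w = of_real (2 / cmod q + r * (1 - 2 / cmod q)) * q" by (simp add: r(3) p_def algebra_simps)
   then have "cmod w = \<bar>2 / cmod q + r * (1 - 2 / cmod q)\<bar> * cmod q" by (simp only: norm_mult norm_of_real)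
   moreover have "0 \<le> r * (1 - 2 / cmod q)" using r(1) z zn by simp
   then have "2 / cmod q \<le> \<bar>2 / cmod q + r * (1 - 2 / cmod q)\<bar>" by (intro order_trans[OF _ abs_ge_self]) simp
   then have "2 / cmod q * cmod q \<le> \<bar>2 / cmod q + r * (1 - 2 / cmod q)\<bar> * cmod q" using zn by (intro mult_right_mono) auto
   ultimately show ?thesis using zn by simp
  qed
  have "norm (R q) \<le> (norm (R p) + 0 * dist p q) * exp (K * dist p q)"
  proof (rule mat_gronwall)
   fix w assume "w \<in> closed_segment p q"
   from seg[OF this] have w: "cmod w \<ge> 2" .
   then show "has_mderiv R (two_pole x 1 P0 P1 w ** R w - R w ** two_pole x 1 Q0 Q1 w) w" by (intro R) auto
   show "norm (two_pole x 1 P0 P1 w ** R w - R w ** two_pole x 1 Q0 Q1 w) \<le> K * norm (R w) + 0" by (rule db[OF w])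
  qed (use K in auto)
  also have "\<dots> \<le> c * exp (K * cmod q)"
   using c(1) c(2)[of p] p K zn unfolding dp by (intro mult_mono) (auto intro!: mult_left_mono)
  finally show "norm (R q) \<le> c * exp (K * cmod q)" .
 qed
qed

lemma diag_conj_exp_sigma3:
 assumes "C $ 1 $ 2 = 0" "C $ 2 $ 1 = 0"
 shows "exp_sigma3 w ** C ** exp_sigma3 (- w) = C"
 using assms by (simp add: mat_eq_iff mat_mult_entry exp_minus)

lemma adj2_exp_sigma3: "adj2 (exp_sigma3 w) = exp_sigma3 (- w)"
 by (simp add: mat_eq_iff)

lemma norm_adj2_leI: "norm A \<le> a \<Longrightarrow> norm (adj2 A) \<le> 4 * a"
proof (rule norm_mat_leI)
 fix i j assume "norm A \<le> a"
 then show "cmod (adj2 A $ i $ j) \<le> a"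
  using exhaust_2[of i] exhaust_2[of j] order_trans[OF norm_entry_le[of A]] by auto
qed

lemma canonical_asymp_bounded:
 assumes "canonical_asymp t k F d"
 obtains R C where "R > 0" "\<And>v. R \<le> Re v \<Longrightarrow> \<bar>Im v - pi / 2\<bar> \<le> pi - d \<Longrightarrow>
  norm (F v ** exp_sigma3 (- ((of_real t * exp v - 2 * k * v) / 4))) \<le> C"
proof -
 obtain K R where K: "K > 0" "R > 0" "\<And>v i j. R \<le> Re v \<Longrightarrow> \<bar>Im v - pi / 2\<bar> \<le> pi - d \<Longrightarrow>
   cmod ((F v ** exp_sigma3 (- ((of_real t * exp v - 2 * k * v) / 4)) - mat 1) $ i $ j) \<le> K * exp (- Re v)"
  by (rule canonical_asympE[OF assms]) blast
 show ?thesis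
 proof (rule that[OF K(2)])
  fix v assume v: "R \<le> Re v" "\<bar>Im v - pi / 2\<bar> \<le> pi - d"
  define P where "P = F v ** exp_sigma3 (- ((of_real t * exp v - 2 * k * v) / 4))"
  have "K * exp (- Re v) \<le> K * 1" using K(1,2) v(1) by (intro mult_left_mono) auto
  then have "norm (P - mat 1) \<le> 4 * K" unfolding P_def using order_trans[OF K(3)[OF v]] by (intro norm_mat_leI) simp
  then show "norm P \<le> 4 * K + norm (mat 1 :: complex^2^2)" using norm_triangle_ineq[of "P - mat 1" "mat 1"] by simp
 qed
qed

text \<open>The quotient is bounded in closed subsectors because the exponential factors cancel; the growth bound fills in
 the remaining narrow sector.\<close>

lemma quotient_constant:
 assumes a: "\<bar>a\<bar> < pi / 2"
  and R: "\<And>y. y \<noteq> 1 \<Longrightarrow> y \<noteq> - 1 \<Longrightarrow> has_mderiv R (two_pole x 1 P0 P1 y ** R y - R y ** two_pole x 1 Q0 Q1 y) y"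
  and b: "\<forall>\<^sub>F z in at 1. norm (R z) \<le> C1" "\<forall>\<^sub>F z in at (- 1). norm (R z) \<le> C2"
  and as: "\<And>\<delta>. \<delta> > 0 \<Longrightarrow> canonical_asymp t k Fa \<delta>" "\<And>\<delta>. \<delta> > 0 \<Longrightarrow> canonical_asymp t k Fb \<delta>"
  and C: "C $ 1 $ 2 = 0" "C $ 2 $ 1 = 0"
  and RF: "\<And>v. 0 < Re v \<Longrightarrow> \<bar>Im v - pi / 2\<bar> < pi \<Longrightarrow>
    R (exp (v - \<i> * of_real a)) = exp_sigma3 w ** (Fa v ** C ** adj2 (Fb v)) ** exp_sigma3 (- w)"
  and y: "y \<noteq> 1" "y \<noteq> - 1"
 shows "R y = C"
proof -
 have Rh: "mat_holo R (- {1, - 1})" by (rule mat_holo_if_mderiv[OF R]) (auto intro!: open_Compl)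
 define q where "q v = (of_real t * exp v - 2 * k * v) / 4" for v
 define Pa where "Pa v = Fa v ** exp_sigma3 (- q v)" for v
 define Pb where "Pb v = Fb v ** exp_sigma3 (- q v)" for v
 have RP: "R (exp (v - \<i> * of_real a)) = exp_sigma3 w ** (Pa v ** C ** adj2 (Pb v)) ** exp_sigma3 (- w)"
  if "0 < Re v" "\<bar>Im v - pi / 2\<bar> < pi" for v
 proof -
  \<comment> \<open>A diagonal \<open>C\<close> commutes with the exponential factors, so these
    cancel between the two solutions and only the bounded normalised parts remain.\<close>
  have "Pa v ** C ** adj2 (Pb v) = Fa v ** (exp_sigma3 (- q v) ** C ** exp_sigma3 (- (- q v))) ** adj2 (Fb v)"
   by (simp add: Pa_def Pb_def adj2_mult adj2_exp_sigma3 matrix_mul_assoc)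
  also have "\<dots> = Fa v ** C ** adj2 (Fb v)" unfolding diag_conj_exp_sigma3[OF C] ..
  finally show ?thesis unfolding RF[OF that] by simp
 qed
 have pi8: "pi / 8 > 0" by simp
 obtain Ra Ka where Ka: "Ra > 0" "\<And>v. Ra \<le> Re v \<Longrightarrow> \<bar>Im v - pi / 2\<bar> \<le> pi - pi / 8 \<Longrightarrow> norm (Pa v) \<le> Ka"
  unfolding Pa_def q_def by (rule canonical_asymp_bounded[OF as(1)[OF pi8]]) blast
 obtain Rb Kb where Kb: "Rb > 0" "\<And>v. Rb \<le> Re v \<Longrightarrow> \<bar>Im v - pi / 2\<bar> \<le> pi - pi / 8 \<Longrightarrow> norm (Pb v) \<le> Kb"
  unfolding Pb_def q_def by (rule canonical_asymp_bounded[OF as(2)[OF pi8]]) blast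
 obtain Cg K where g: "Cg \<ge> 0" "K \<ge> 0" "\<And>y. cmod y \<ge> 2 \<Longrightarrow> norm (R y) \<le> Cg * exp (K * cmod y)"
  using quotient_growth[OF R] by metis
 define R0 where "R0 = max (ln 2) (max Ra Rb)"
 have R0: "R0 > 0" "Ra \<le> R0" "Rb \<le> R0" "ln 2 \<le> R0" using Ka(1) by (auto simp: R0_def)
 define Bs where "Bs = 8 * (8 * norm (exp_sigma3 w) * (8 * (8 * Ka * norm C) * (4 * Kb))) * norm (exp_sigma3 (- w))"
 have sector: "norm (R (exp (v - \<i> * of_real a))) \<le> Bs" if e: "R0 \<le> Re v" "\<bar>Im v - pi / 2\<bar> \<le> pi - pi / 8" for v
 proof -
  have e': "0 < Re v" "\<bar>Im v - pi / 2\<bar> < pi" "Ra \<le> Re v" "Rb \<le> Re v" using e R0 pi_gt_zero by linarith+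
  show ?thesis
   unfolding RP[OF e'(1,2)] Bs_def
   by (intro norm_mat_mult_leI norm_adj2_leI Ka(2) Kb(2) e e' order_refl)
 qed
 have per: "exp (v + period - \<i> * of_real a) = exp (v - \<i> * of_real a)" for v
  by (simp add: exp_add exp_diff)
 \<comment> \<open>\<open>R\<close> depends on \<open>v\<close> through the exponential only, so one
   period carries the bound over to arguments from \<open>- pi\<close> to
   \<open>- 5 * pi / 8\<close>.\<close>
 have sector': "norm (R (exp (v - \<i> * of_real a))) \<le> Bs" if e: "R0 \<le> Re v" "- pi \<le> Im v" "Im v \<le> - 5 * pi / 8" for v
  using sector[of "v + period"] e pi_gt_zero unfolding per by (simp add: abs_le_iff)
 have ce: "cmod (exp (v - \<i> * of_real a)) = exp (Re v)" for v by simp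
 obtain Bc where Bc: "Bc > 0" "\<And>y. y \<in> sphere 0 (exp R0) \<Longrightarrow> norm (R y) \<le> Bc"
 proof -
  have "exp R0 > 1" using R0(1) by simp
  then have "sphere 0 (exp R0) \<subseteq> - {1, - 1 :: complex}" by auto
  then show ?thesis using mat_holo_bounded[OF Rh compact_sphere] that by blast
 qed
 define B where "B = \<bar>Bs\<bar> + Bc"
 have B: "B > 0" "Bs \<le> B" "Bc \<le> B" using Bc(1) by (auto simp: B_def)
 \<comment> \<open>Modulo \<open>2 * pi\<close>, only arguments between \<open>- 5 * pi / 8\<close>
   and \<open>- 3 * pi / 8\<close> are not yet covered: a sector of half-angle \<open>pi / 8\<close>
   about the direction \<open>- pi / 2\<close>, on whose edges the bound is already known.\<close>
 have narrow: "cmod (R (exp (v0 - \<i> * of_real a)) $ i $ j) \<le> B" if e: "R0 \<le> Re v0" "\<bar>Im v0 - (- pi / 2)\<bar> \<le> pi / 8" for v0 i j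
 proof (rule phragmen_lindelof_strip[OF _ R0(1) B(1) g(2,1) _ _ e, where h = "\<lambda>v. R (exp (v - \<i> * of_real a)) $ i $ j"])
  have "mat_holo (\<lambda>v. R (exp (v - \<i> * of_real a))) log_plane"
   by (rule mat_holo_compose[OF Rh _ exp_log_plane_avoids]) (auto intro!: holomorphic_intros simp: log_plane_def)
  then show "(\<lambda>v. R (exp (v - \<i> * of_real a)) $ i $ j) holomorphic_on log_plane" by (simp add: mat_holo_def)
  fix v assume h: "R0 \<le> Re v" "\<bar>Im v - (- pi / 2)\<bar> \<le> pi / 8"
  have "exp (ln 2) \<le> exp (Re v)" using h(1) R0(4) by (intro exp_le_cancel_iff[THEN iffD2]) linarith
  then have "cmod (exp (v - \<i> * of_real a)) \<ge> 2" unfolding ce by simp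
  from g(3)[OF this] show "cmod (R (exp (v - \<i> * of_real a)) $ i $ j) \<le> Cg * exp (K * exp (Re v))"
   unfolding ce using norm_entry_le order_trans by blast
  assume bd: "Re v = R0 \<or> \<bar>Im v - (- pi / 2)\<bar> = pi / 8"
  have "norm (R (exp (v - \<i> * of_real a))) \<le> B"
  proof (cases "Re v = R0")
   case True
   then have "exp (v - \<i> * of_real a) \<in> sphere 0 (exp R0)" by simp
   from Bc(2)[OF this] show ?thesis using B(3) by linarith
  next
   case False
   then consider "Im v = - pi / 2 + pi / 8" | "Im v = - pi / 2 - pi / 8" using bd by (auto simp: abs_if split: if_splits)
   then show ?thesis
   proof cases
    case 1
    then have "\<bar>Im v - pi / 2\<bar> \<le> pi - pi / 8" using pi_gt_zero by (simp add: abs_if)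
    from sector[OF h(1) this] show ?thesis using B(2) by linarith
   next
    case 2
    then have "- pi \<le> Im v" "Im v \<le> - 5 * pi / 8" using pi_gt_zero by simp_all
    from sector'[OF h(1) this] show ?thesis using B(2) by linarith
   qed
  qed
  then show "cmod (R (exp (v - \<i> * of_real a)) $ i $ j) \<le> B" using norm_entry_le order_trans by blast
 qed
 have far: "cmod (R z $ i $ j) \<le> B" if z: "cmod z \<ge> exp R0" for z i j
 proof -
  define v where "v = Ln (z * exp (\<i> * of_real a))"
  have z0: "cmod z > 0" using z exp_gt_zero[of R0] by linarith
  then have nz: "z * exp (\<i> * of_real a) \<noteq> 0" by auto
  have ez: "exp (v - \<i> * of_real a) = z" using nz by (simp add: v_def exp_diff)
  have "Re v = ln (cmod z)" using nz by (simp add: v_def Re_Ln norm_mult)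
  moreover have "ln (exp R0) \<le> ln (cmod z)" using z z0 by (intro ln_le_cancel_iff[THEN iffD2]) auto
  ultimately have Re: "R0 \<le> Re v" by simp
  have Im: "- pi \<le> Im v" "Im v \<le> pi" using mpi_less_Im_Ln[OF nz] Im_Ln_le_pi[OF nz] by (auto simp: v_def)
  consider "Im v \<le> - 5 * pi / 8" | "- 5 * pi / 8 \<le> Im v" "Im v \<le> - 3 * pi / 8" | "- 3 * pi / 8 \<le> Im v" by linarith
  then show ?thesis
  proof cases
   case 1
   from sector'[OF Re Im(1) this] show ?thesis unfolding ez using norm_entry_le[of "R z" i j] B(2) by linarith
  next
   case 2
   then have "\<bar>Im v - (- pi / 2)\<bar> \<le> pi / 8" unfolding abs_le_iff by linarith
   from narrow[OF Re this] show ?thesis unfolding ez .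
  next
   case 3
   then have "\<bar>Im v - pi / 2\<bar> \<le> pi - pi / 8" using Im(2) pi_gt_zero unfolding abs_le_iff by linarith
   from sector[OF Re this] show ?thesis unfolding ez using norm_entry_le[of "R z" i j] B(2) by linarith
  qed
 qed
 have const: "\<exists>d. \<forall>z. z \<noteq> 1 \<and> z \<noteq> - 1 \<longrightarrow> R z $ i $ j = d" for i j
 proof -
  have e: "\<forall>\<^sub>F z in at 1. cmod (R z $ i $ j) \<le> C1" "\<forall>\<^sub>F z in at (- 1). cmod (R z $ i $ j) \<le> C2"
   using b by (auto elim!: eventually_mono intro: order_trans[OF norm_entry_le])
  obtain f where f: "f holomorphic_on UNIV" "\<And>z. z \<noteq> 1 \<Longrightarrow> z \<noteq> - 1 \<Longrightarrow> f z = R z $ i $ j"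
   using bounded_extends_entire[OF _ e] Rh unfolding mat_holo_def by metis
  have "compact (f ` cball 0 (exp R0))"
   by (intro compact_continuous_image holomorphic_on_imp_continuous_on holomorphic_on_subset[OF f(1)]) auto
  then have "bounded (f ` cball 0 (exp R0))" by (rule compact_imp_bounded)
  then obtain Bf where Bf: "\<And>z. z \<in> cball 0 (exp R0) \<Longrightarrow> cmod (f z) \<le> Bf"
   unfolding bounded_iff by blast
  have R01: "exp R0 > 1" using R0(1) by simp
  have "cmod (f z) \<le> max Bf B" for z
  proof (cases "cmod z \<le> exp R0")
   case True then show ?thesis using Bf[of z] by simp
  next
   case False
   then have "z \<noteq> 1" "z \<noteq> - 1" using R01 by auto
   then show ?thesis using far[of z i j] f(2)[of z] False by simp
  qed
  then have "bounded (range f)" unfolding bounded_iff by blast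
  then have "f constant_on UNIV" by (rule Liouville_theorem[OF f(1)])
  then obtain d where d: "\<And>z. f z = d" unfolding constant_on_def by blast
  show ?thesis
  proof (intro exI[of _ d] allI impI)
   fix z :: complex assume "z \<noteq> 1 \<and> z \<noteq> - 1"
   then show "R z $ i $ j = d" using f(2)[of z] d[of z] by simp
  qed
 qed
 have cst: "R z = R y" if "z \<noteq> 1" "z \<noteq> - 1" for z
 proof -
  have "R z $ i $ j = R y $ i $ j" for i j using const[of i j] that y by metis
  then show ?thesis by (simp add: mat_eq_iff)
 qed
 define D where "D = exp_sigma3 (- w) ** R y ** exp_sigma3 w"
 \<comment> \<open>On the middle ray both normalised solutions tend to the identity, so the constant
   value must be \<open>C\<close>.\<close>
 define line where "line r = Complex r (pi / 2)" for r
 have DP: "D = Pa (line r) ** C ** adj2 (Pb (line r))" if r: "r > 0" for r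
 proof -
  define X where "X = Pa (line r) ** C ** adj2 (Pb (line r))"
  have "line r - \<i> * of_real a \<in> log_plane" using r by (simp add: log_plane_def line_def)
  then have "R (exp (line r - \<i> * of_real a)) = R y" using exp_log_plane_avoids by (intro cst) blast+
  moreover have "R (exp (line r - \<i> * of_real a)) = exp_sigma3 w ** X ** exp_sigma3 (- w)"
   unfolding X_def using r by (intro RP) (auto simp: line_def)
  ultimately have "D = exp_sigma3 (- w) ** (exp_sigma3 w ** X ** exp_sigma3 (- w)) ** exp_sigma3 w" by (simp add: D_def)
  also have "\<dots> = (exp_sigma3 (- w) ** exp_sigma3 w) ** X ** (exp_sigma3 (- w) ** exp_sigma3 w)" by (simp only: matrix_mul_assoc)
  also have "\<dots> = X" by (simp add: exp_sigma3_add)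
  finally show ?thesis by (simp add: X_def)
 qed
 have la: "((\<lambda>r. Pa (line r) $ i $ j) \<longlongrightarrow> mat 1 $ i $ j) at_top" for i j
  unfolding Pa_def q_def line_def by (rule canonical_asymp_tendsto[OF as(1)[OF pi_gt_zero]]) simp
 have lb: "((\<lambda>r. Pb (line r) $ i $ j) \<longlongrightarrow> mat 1 $ i $ j) at_top" for i j
  unfolding Pb_def q_def line_def by (rule canonical_asymp_tendsto[OF as(2)[OF pi_gt_zero]]) simp
 have lb': "((\<lambda>r. adj2 (Pb (line r)) $ i $ j) \<longlongrightarrow> mat 1 $ i $ j) at_top" for i j
  using lb[of 1 1] lb[of 2 2] tendsto_minus[OF lb[of 1 2]] tendsto_minus[OF lb[of 2 1]] exhaust_2[of i] exhaust_2[of j] by auto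
 have "D $ i $ j = C $ i $ j" for i j
 proof (rule tendsto_unique[of at_top "\<lambda>r. (Pa (line r) ** C ** adj2 (Pb (line r))) $ i $ j"])
  have "\<forall>\<^sub>F r in at_top. (Pa (line r) ** C ** adj2 (Pb (line r))) $ i $ j = D $ i $ j"
   using eventually_gt_at_top[of 0] by eventually_elim (simp add: DP)
  then show "((\<lambda>r. (Pa (line r) ** C ** adj2 (Pb (line r))) $ i $ j) \<longlongrightarrow> D $ i $ j) at_top" by (rule tendsto_eventually)
  have "((\<lambda>r. (Pa (line r) ** C ** adj2 (Pb (line r))) $ i $ j) \<longlongrightarrow> (mat 1 ** C ** mat 1) $ i $ j) at_top"
   unfolding mat_mult_entry by (intro tendsto_intros la lb')
  then show "((\<lambda>r. (Pa (line r) ** C ** adj2 (Pb (line r))) $ i $ j) \<longlongrightarrow> C $ i $ j) at_top" by simp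
 qed simp
 then have DC: "D = C" by (simp add: mat_eq_iff)
 have "exp_sigma3 w ** D ** exp_sigma3 (- w) = (exp_sigma3 w ** exp_sigma3 (- w)) ** R y ** (exp_sigma3 w ** exp_sigma3 (- w))"
  unfolding D_def by (simp only: matrix_mul_assoc)
 then have "R y = exp_sigma3 w ** C ** exp_sigma3 (- w)" unfolding DC by (simp add: exp_sigma3_add)
 then show ?thesis unfolding diag_conj_exp_sigma3[OF C] .
qed

section \<open>Recovering the Painleve function from the monodromy\<close>

lemma sheets_mult_const:
 assumes sh: "sheets A X XL XM XR" and j: "jumps XL XM XR M0 M1" and C: "det C = 1"
 shows "sheets A (\<lambda>z. X z ** C) (\<lambda>z. XL z ** C) (\<lambda>z. XM z ** C) (\<lambda>z. XR z ** C)"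
  "jumps (\<lambda>z. XL z ** C) (\<lambda>z. XM z ** C) (\<lambda>z. XR z ** C) (adj2 C ** M0 ** C) (adj2 C ** M1 ** C)"
proof -
 show "sheets A (\<lambda>z. X z ** C) (\<lambda>z. XL z ** C) (\<lambda>z. XM z ** C) (\<lambda>z. XR z ** C)"
  using sh C unfolding sheets_def by (auto simp: det_mul intro: mat_ode_mult_const)
 have e: "X ** C ** (adj2 C ** M ** C) = X ** M ** C" for X M :: "complex^2^2"
  by (simp add: matrix_mul_assoc adj2_cancel[OF C])
 show "jumps (\<lambda>z. XL z ** C) (\<lambda>z. XM z ** C) (\<lambda>z. XR z ** C) (adj2 C ** M0 ** C) (adj2 C ** M1 ** C)"
  unfolding jumps_def e using j unfolding jumps_def by simp
qed

text \<open>With trace zero this says that the local exponents at the two poles are plus and minus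
  \<open>k0 / 2\<close>, respectively \<open>k1 / 2\<close>. They do not depend on \<open>y\<close>,
  \<open>z\<close>, \<open>u\<close>, which is why two solutions can be compared locally.\<close>

lemma A0_A1_det:
 assumes "u \<noteq> 0" "y \<noteq> 0"
 shows "det (A0_mat k0 z u) = - k0\<^sup>2 / 4" "det (A1_mat k0 k1 kinf y z u) = - k1\<^sup>2 / 4"
proof -
 have i: "u * inverse u = 1" "(u * y) * inverse (u * y) = 1" using assms by (simp_all add: field_simps)
 have "det (A0_mat k0 z u) = - (z + k0 / 2)\<^sup>2 + (u * inverse u) * (z * (z + k0))" by (simp add: det_2 power2_eq_square algebra_simps)
 then show "det (A0_mat k0 z u) = - k0\<^sup>2 / 4" unfolding i by (simp add: power2_eq_square field_simps)
 have "det (A1_mat k0 k1 kinf y z u) = - (z + (k0 + kinf) / 2)\<^sup>2 +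
   ((u * y) * inverse (u * y)) * ((z + (k0 - k1 + kinf) / 2) * (z + (k0 + k1 + kinf) / 2))"
 proof -
  have "(- z - h) * (z + h) - (p * a) * (- w * b) = - (z + h)\<^sup>2 + (p * w) * (a * b)" for h p w a b :: complex
   by (simp add: power2_eq_square algebra_simps)
  then show ?thesis unfolding det_2 A0_A1_entries .
 qed
 then show "det (A1_mat k0 k1 kinf y z u) = - k1\<^sup>2 / 4" unfolding i by (simp add: power2_eq_square field_simps)
qed

lemma two_pole_intertwine:
 assumes C: "C $ 1 $ 2 = 0" "C $ 2 $ 1 = 0"
  and e: "\<And>q. q \<noteq> 1 \<Longrightarrow> q \<noteq> - 1 \<Longrightarrow> two_pole x 1 P0 P1 q ** C = C ** two_pole x 1 Q0 Q1 q"
 shows "P0 ** C = C ** Q0" "P1 ** C = C ** Q1"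
proof -
 have s: "sigma3 ** C = C ** sigma3" using C by (simp add: mat_eq_iff mat_mult_entry)
 define A where "A = P0 ** C - C ** Q0"
 define B where "B = P1 ** C - C ** Q1"
 have "scale_mat (1 / (q + 1)) A + scale_mat (1 / (q - 1)) B = two_pole x 1 P0 P1 q ** C - C ** two_pole x 1 Q0 Q1 q" for q
  by (simp add: A_def B_def two_pole_def mat_mult_distrib scaleC_mat_mult scale_mat_simps s algebra_simps)
 then have z: "scale_mat (1 / (q + 1)) A + scale_mat (1 / (q - 1)) B = 0" if "q \<noteq> 1" "q \<noteq> - 1" for q using e[OF that] by simp
 have "A $ i $ j = 0 \<and> B $ i $ j = 0" for i j
 proof -
  \<comment> \<open>Two test points suffice: \<open>q = 0\<close> gives \<open>A = B\<close>, and
    \<open>q = 3\<close> gives \<open>A / 4 + B / 2 = 0\<close>.\<close>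
  have "(scale_mat (1 / (0 + 1)) A + scale_mat (1 / (0 - 1)) B) $ i $ j = 0" "(scale_mat (1 / (3 + 1)) A + scale_mat (1 / (3 - 1)) B) $ i $ j = 0"
   by (subst z; simp)+
  then show ?thesis by simp
 qed
 then have "A = 0" "B = 0" by (simp_all add: mat_eq_iff)
 then show "P0 ** C = C ** Q0" "P1 ** C = C ** Q1" by (simp_all add: A_def B_def)
qed

text \<open>Diagonal conjugation fixes \<open>z\<close> and only rescales \<open>u\<close>. The
  diagonal entries of a residue are determined by the factors in its off-diagonal entries, so a
  nonzero residue has a nonzero off-diagonal entry: the one of \<open>A0_mat\<close> yields the
  ratio of \<open>u\<close> and \<open>u'\<close>, and the one of \<open>A1_mat\<close> then yields
  \<open>y\<close>.\<close>

lemma A0_A1_intertwine: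
 assumes C: "C $ 1 $ 2 = 0" "C $ 2 $ 1 = 0" "det C = 1"
  and nz: "y \<noteq> 0" "u \<noteq> 0" "y' \<noteq> 0" "u' \<noteq> 0"
  and A0: "A0_mat k0 z u ** C = C ** A0_mat k0 z' u'" "A0_mat k0 z u \<noteq> 0"
  and A1: "A1_mat k0 k1 kinf y z u ** C = C ** A1_mat k0 k1 kinf y' z' u'" "A1_mat k0 k1 kinf y z u \<noteq> 0"
 shows "y = y'"
proof -
 define d where "d = C $ 1 $ 1"
 define e where "e = C $ 2 $ 2"
 have de: "d \<noteq> 0" "e \<noteq> 0" using C by (auto simp: det_2 d_def e_def)
 have "(A0_mat k0 z u ** C) $ i $ j = (C ** A0_mat k0 z' u') $ i $ j" for i j using A0(1) by simp
 from this[of 1 1] this[of 1 2] this[of 2 1]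
 have 0: "(z + k0 / 2) * d = d * (z' + k0 / 2)" "- u * (z + k0) * e = d * (- u' * (z' + k0))" "inverse u * z * d = e * (inverse u' * z')"
  unfolding mat_mult_entry C(1,2) d_def[symmetric] e_def[symmetric] by simp_all
 have zz: "z' = z" using 0(1) de by simp
 have "z \<noteq> 0 \<or> z + k0 \<noteq> 0" using A0(2) by (auto simp: mat_eq_iff)
 then have ue: "u * e = d * u'"
 proof
  assume "z \<noteq> 0"
  then have "inverse u * d = e * inverse u'" using 0(3) unfolding zz by simp
  then show ?thesis using nz by (simp add: field_simps)
 next
  assume "z + k0 \<noteq> 0"
  then show ?thesis using 0(2) unfolding zz by simp
 qed
 define a where "a = z + (k0 - k1 + kinf) / 2"
 define b where "b = z + (k0 + k1 + kinf) / 2"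
 have "(A1_mat k0 k1 kinf y z u ** C) $ i $ j = (C ** A1_mat k0 k1 kinf y' z' u') $ i $ j" for i j using A1(1) by simp
 from this[of 1 2] this[of 2 1]
 have 1: "u * y * a * e = d * (u' * y' * a)" "- inverse (u * y) * b * d = e * (- inverse (u' * y') * b)"
  unfolding mat_mult_entry C(1,2) d_def[symmetric] e_def[symmetric] zz by (simp_all add: a_def b_def)
 have "a \<noteq> 0 \<or> b \<noteq> 0"
 proof (rule ccontr)
  assume "\<not> (a \<noteq> 0 \<or> b \<noteq> 0)"
  then have ab: "a = 0" "b = 0" by auto
  have "A1_mat k0 k1 kinf y z u $ 1 $ 1 = - (a + b) / 2" "A1_mat k0 k1 kinf y z u $ 2 $ 2 = (a + b) / 2"
   by (simp_all add: a_def b_def field_simps)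
  then show False using A1(2) ab by (simp add: mat_eq_iff a_def[symmetric] b_def[symmetric])
 qed
 then show ?thesis
 proof
  assume "a \<noteq> 0"
  have "(u * e) * y * a = (d * u') * y' * a" using 1(1) by (simp add: mult_ac)
  then show ?thesis unfolding ue using \<open>a \<noteq> 0\<close> de nz by simp
 next
  assume "b \<noteq> 0"
  then have "inverse (u * y) * d = e * inverse (u' * y')" using 1(2) by (simp add: mult_ac)
  then have "d * u' * y' = u * e * y" using nz by (simp add: field_simps)
  then show ?thesis unfolding ue using de nz by simp
 qed
qed

text \<open>The gauge factor \<open>G\<close> between the two data is first multiplied into the
  second solution, so that both have equal jumps. The quotient then equals \<open>adj2 G\<close>,
  which is diagonal; a constant quotient has derivative zero and hence intertwines the two
  coefficients, so \<open>A0_A1_intertwine\<close> identifies the values of the two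
  solutions.\<close>

lemma PV_unique_at:
 fixes s :: complex
 assumes f: "\<bar>Im s\<bar> < pi / 2" and nz: "y \<noteq> 0" "u \<noteq> 0" "y' \<noteq> 0" "u' \<noteq> 0"
  and data: "monodromy_data k0 k1 kinf (Im s) (exp (Re s)) y z u N" "monodromy_data k0 k1 kinf (Im s) (exp (Re s)) y' z' u' N'"
  and N: "(N, N') \<in> gauge_rel" "N \<in> monodromy_pairs k0 k1 kinf" "fst N \<notin> {mat 1, - mat 1}" "snd N \<notin> {mat 1, - mat 1}"
 shows "y = y'"
proof -
 define f where "f = Im s"
 define t where "t = exp (Re s)"
 have t: "t > 0" by (simp add: t_def)
 have ph: "\<bar>f\<bar> < pi / 2" using f by (simp add: f_def)
 have es: "exp s = of_real t * exp (\<i> * of_real f)" unfolding t_def f_def using exp_eq_polar[of s] by (simp add: cis_conv_exp)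
 define P0 where "P0 = A0_mat k0 z u"
 define P1 where "P1 = A1_mat k0 k1 kinf y z u"
 define Q0 where "Q0 = A0_mat k0 z' u'"
 define Q1 where "Q1 = A1_mat k0 k1 kinf y' z' u'"
 have trP: "P0 $ 2 $ 2 = - P0 $ 1 $ 1" "P1 $ 2 $ 2 = - P1 $ 1 $ 1" "P0 $ 1 $ 1 + P1 $ 1 $ 1 = - kinf / 2" unfolding P0_def P1_def by (rule A0_A1_trace)+
 have trQ: "Q0 $ 2 $ 2 = - Q0 $ 1 $ 1" "Q1 $ 2 $ 2 = - Q1 $ 1 $ 1" "Q0 $ 1 $ 1 + Q1 $ 1 $ 1 = - kinf / 2" unfolding Q0_def Q1_def by (rule A0_A1_trace)+
 have det: "det (fst N) = 1" "det (snd N) = 1" "trace (fst N) = 2 * cos (of_real pi * k0)" "trace (snd N) = 2 * cos (of_real pi * k1)"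
  using N(2) by (auto simp: monodromy_pairs_iff)
 obtain g where g: "g \<noteq> 0" "fst N' = pow_sigma3 g ** fst N ** adj2 (pow_sigma3 g)" "snd N' = pow_sigma3 g ** snd N ** adj2 (pow_sigma3 g)"
  by (rule gauge_relE[OF N(1)])
 define G where "G = pow_sigma3 g"
 have G: "det G = 1" using pow_sigma3_facts(1)[OF g(1)] by (simp add: G_def)
 have N': "adj2 G ** fst N' ** G = fst N" "adj2 G ** snd N' ** G = snd N"
  unfolding g(2,3) G_def[symmetric] by (simp_all add: matrix_mul_assoc[symmetric] adj2_cancel[OF G] adj2_inverse[OF G])
 define c where "c = exp (\<i> * of_real f)"
 define w where "w = varpi kinf f t"
 obtain Ya where Ya: "canonical_solution2 (Y_coeff k0 k1 kinf f t y z u) kinf t Ya"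
  and conta: "analytic_continuation_along (lasso 101 (1/2) (- c)) Ya (\<lambda>l. Ya l ** fst N)"
   "analytic_continuation_along (lasso 101 (1/2) c) Ya (\<lambda>l. Ya l ** snd N)"
  using data(1) unfolding monodromy_data_def f_def[symmetric] t_def[symmetric] c_def by fastforce
 obtain Yb where Yb: "canonical_solution2 (Y_coeff k0 k1 kinf f t y' z' u') kinf t Yb"
  and contb: "analytic_continuation_along (lasso 101 (1/2) (- c)) Yb (\<lambda>l. Yb l ** fst N')"
   "analytic_continuation_along (lasso 101 (1/2) c) Yb (\<lambda>l. Yb l ** snd N')"
  using data(2) unfolding monodromy_data_def f_def[symmetric] t_def[symmetric] c_def by fastforce
 obtain Fa where pa: "mat_ode (log_system (two_pole (exp s) 1 P0 P1)) Fa log_plane" "\<And>h. h \<in> log_plane \<Longrightarrow> det (Fa h) = 1" "canonical_at f Fa"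
  unfolding f_def using canonical_at_exists[OF trP] by metis
 obtain Fb where pb: "mat_ode (log_system (two_pole (exp s) 1 Q0 Q1)) Fb log_plane" "\<And>h. h \<in> log_plane \<Longrightarrow> det (Fb h) = 1" "canonical_at f Fb"
  unfolding f_def using canonical_at_exists[OF trQ] by metis
 obtain Da where Da: "det Da = 1" "\<And>h. h \<in> wide_strip f \<Longrightarrow> exp_sigma3 w ** Ya (exp (h + \<i> * of_real f)) = Fa h ** Da"
  using canonical_solution2_fundamental[OF Ya t es pa[unfolded P0_def P1_def]] unfolding w_def by metis
 obtain Db where Db: "det Db = 1" "\<And>h. h \<in> wide_strip f \<Longrightarrow> exp_sigma3 w ** Yb (exp (h + \<i> * of_real f)) = Fb h ** Db"
  using canonical_solution2_fundamental[OF Yb t es pb[unfolded Q0_def Q1_def]] unfolding w_def by metis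
 obtain X XL XM XR where sa: "sheets (two_pole (exp s) 1 P0 P1) X XL XM XR" "jumps XL XM XR (fst N) (snd N)"
  "\<And>h. h \<in> log_plane \<Longrightarrow> 0 < Im h \<Longrightarrow> Im h < pi \<Longrightarrow> X (exp h) = Fa h ** Da"
  using data_sheets[OF Ya t ph conta[unfolded c_def] es pa(1,2)[unfolded P0_def P1_def] Da[unfolded w_def]]
  unfolding P0_def P1_def by metis
 obtain V VL VM VR where sb: "sheets (two_pole (exp s) 1 Q0 Q1) V VL VM VR" "jumps VL VM VR (fst N') (snd N')"
  "\<And>h. h \<in> log_plane \<Longrightarrow> 0 < Im h \<Longrightarrow> Im h < pi \<Longrightarrow> V (exp h) = Fb h ** Db"
  using data_sheets[OF Yb t ph contb[unfolded c_def] es pb(1,2)[unfolded Q0_def Q1_def] Db[unfolded w_def]]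
  unfolding Q0_def Q1_def by metis
 note sb' = sheets_mult_const[OF sb(1,2) G, unfolded N']
 obtain R where R: "\<And>x. x \<noteq> 1 \<Longrightarrow> x \<noteq> - 1 \<Longrightarrow> has_mderiv R (two_pole (exp s) 1 P0 P1 x ** R x - R x ** two_pole (exp s) 1 Q0 Q1 x) x"
  "\<And>x. x \<in> upper \<Longrightarrow> R x = X x ** adj2 (V x ** G)"
  using glue_quotient[OF sa(1,2) sb' det(1,2) two_pole_trace_free[OF trQ(1,2)]] by metis
 have Rh: "mat_holo R (- {1, - 1})" by (rule mat_holo_if_mderiv[OF R(1)]) (auto intro!: open_Compl)
 obtain Z0 Z1 where Z: "local_branch (exp s) 1 P0 P1 X (fst N) Z0" "local_branch (exp s) (- 1) P1 P0 X (snd N) Z1"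
  using sheets_lift[OF trP(1,2) sa(1,2)] by blast
 obtain Z0' Z1' where Z': "local_branch (exp s) 1 Q0 Q1 (\<lambda>z. V z ** G) (fst N) Z0'" "local_branch (exp s) (- 1) Q1 Q0 (\<lambda>z. V z ** G) (snd N) Z1'"
  using sheets_lift[OF trQ(1,2) sb'] by blast
 have dP: "det P0 = - k0\<^sup>2 / 4" "det P1 = - k1\<^sup>2 / 4" "det Q0 = - k0\<^sup>2 / 4" "det Q1 = - k1\<^sup>2 / 4"
  unfolding P0_def P1_def Q0_def Q1_def using nz by (simp_all only: A0_A1_det simp_thms)
 have P0nz: "P0 \<noteq> 0" using monodromy_trivial_if_residue_0[of 1 P1 "exp s"] trP(2) Z(1) N(3) by auto
 have P1nz: "P1 \<noteq> 0" using monodromy_trivial_if_residue_0[of "- 1" P0 "exp s"] trP(1) Z(2) N(4) by auto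
 obtain C0 where C0: "\<forall>\<^sub>F z in at (- 1). norm (R z) \<le> C0"
  using quotient_bounded_near_pole[OF _ trP(1,2) trQ(1,2) dP(1,3) Z(1) Z'(1) det(1,3) N(3) Rh R(2)] by auto
 obtain C1 where C1: "\<forall>\<^sub>F z in at 1. norm (R z) \<le> C1"
  using quotient_bounded_near_pole[OF _ trP(2,1) trQ(2,1) dP(2,4) Z(2) Z'(2) det(2,4) N(4) Rh R(2)] by auto
 have RF: "R (exp h) = Fa h ** Da ** adj2 (Fb h ** Db ** G)" if h: "h \<in> log_plane" for h
 proof -
  define p where "p = Complex 1 (pi / 2)"
  have p: "p \<in> log_plane" by (simp add: p_def log_plane_def)
  show ?thesis
  proof (rule mat_holo_identity[OF _ _ log_plane(1,3) p _ h])
   show "mat_holo (\<lambda>h. R (exp h)) log_plane" by (rule mat_holo_compose[OF Rh holomorphic_on_exp exp_log_plane_avoids])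
   show "mat_holo (\<lambda>h. Fa h ** Da ** adj2 (Fb h ** Db ** G)) log_plane"
    by (intro mat_holo_mult mat_holo_adj2 mat_holo_const mat_ode_holo[OF pa(1) log_plane(1)] mat_ode_holo[OF pb(1) log_plane(1)])
   have "open {v. 0 < Re v \<and> 0 < Im v \<and> Im v < pi}"
    by (intro open_Collect_conj open_halfspace_Re_gt open_halfspace_Im_gt open_halfspace_Im_lt)
   then have "\<forall>\<^sub>F v in nhds p. v \<in> {v. 0 < Re v \<and> 0 < Im v \<and> Im v < pi}"
    by (rule eventually_nhds_in_open) (simp add: p_def)
   then show "\<forall>\<^sub>F v in nhds p. R (exp v) = Fa v ** Da ** adj2 (Fb v ** Db ** G)"
   proof eventually_elim
    case (elim v)
    then have v: "v \<in> log_plane" "0 < Im v" "Im v < pi" by (auto simp: log_plane_def)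
    show ?case unfolding R(2)[OF Im_exp_pos[OF v(2,3)]] sa(3)[OF v] sb(3)[OF v] ..
   qed
  qed
 qed
 define C where "C = adj2 G"
 have C: "C $ 1 $ 2 = 0" "C $ 2 $ 1 = 0" "det C = 1" using G by (simp_all add: C_def G_def pow_sigma3_def)
 have RC: "R x = C" if z: "x \<noteq> 1" "x \<noteq> - 1" for x
 proof (rule quotient_constant[OF ph R(1) C1 C0 _ _ C(1,2) _ z])
  show "canonical_asymp t kinf (\<lambda>h. Ya (exp h)) d" "canonical_asymp t kinf (\<lambda>h. Yb (exp h)) d" if "d > 0" for d
   using canonical_solution2D(2)[OF Ya that] canonical_solution2D(2)[OF Yb that] by auto
  fix h assume "0 < Re h" "\<bar>Im h - pi / 2\<bar> < pi"
  then have ws: "h - \<i> * of_real f \<in> wide_strip f" by (simp add: wide_strip_def)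
  then have lp: "h - \<i> * of_real f \<in> log_plane" using wide_strip(3) by blast
  have e: "h - \<i> * of_real f + \<i> * of_real f = h" by simp
  show "R (exp (h - \<i> * of_real f)) = exp_sigma3 w ** (Ya (exp h) ** C ** adj2 (Yb (exp h))) ** exp_sigma3 (- w)"
   unfolding RF[OF lp] Da(2)[OF ws, unfolded e, symmetric] Db(2)[OF ws, unfolded e, symmetric]
   by (simp add: adj2_mult adj2_exp_sigma3 C_def matrix_mul_assoc)
 qed auto
 have inter: "two_pole (exp s) 1 P0 P1 x ** C = C ** two_pole (exp s) 1 Q0 Q1 x" if z: "x \<noteq> 1" "x \<noteq> - 1" for x
 proof -
  have o: "open (- {1, - 1 :: complex})" by (intro open_Compl) auto
  have "has_mderiv (\<lambda>_. C) (two_pole (exp s) 1 P0 P1 x ** C - C ** two_pole (exp s) 1 Q0 Q1 x) x"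
   using has_mderiv_transform[OF R(1)[OF z] o, of "\<lambda>_. C"] RC z by simp
  then have "two_pole (exp s) 1 P0 P1 x ** C - C ** two_pole (exp s) 1 Q0 Q1 x = 0"
   by (rule has_mderiv_unique[OF _ has_mderiv_const])
  then show ?thesis by simp
 qed
 note PQ = two_pole_intertwine[OF C(1,2) inter]
 show ?thesis
  by (rule A0_A1_intertwine[OF C nz PQ(1)[unfolded P0_def Q0_def] P0nz[unfolded P0_def] PQ(2)[unfolded P1_def Q1_def] P1nz[unfolded P1_def]])
qed

lemma conj_scalar_iff:
 assumes "det P = 1"
 shows "P ** A ** adj2 P \<in> {mat 1, - mat 1} \<longleftrightarrow> A \<in> {mat 1, - mat 1}"
proof -
 have "P ** A ** adj2 P = B \<longleftrightarrow> A = adj2 P ** B ** P" for B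
 proof
  assume "P ** A ** adj2 P = B"
  then show "A = adj2 P ** B ** P" by (auto simp: matrix_mul_assoc[symmetric] adj2_cancel[OF assms] adj2_inverse[OF assms])
 next
  assume "A = adj2 P ** B ** P"
  then show "P ** A ** adj2 P = B" by (simp add: matrix_mul_assoc[symmetric] adj2_cancel[OF assms] adj2_inverse[OF assms])
 qed
 then show ?thesis by (auto simp: mat_mult_distrib adj2_inverse[OF assms])
qed

text \<open>The difference vanishes on a punctured neighbourhood of \<open>p\<close>, hence off a
  discrete set. At every point the limits then agree, and the value of a nicely meromorphic function
  is its limit, or 0 at a pole.\<close>

lemma nicely_meromorphic_eqI:
 fixes f g :: "complex \<Rightarrow> complex"
 assumes "f nicely_meromorphic_on UNIV" "g nicely_meromorphic_on UNIV" "open U" "p \<in> U" "\<forall>\<^sub>F s in at p. f s = g s"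
 shows "f = g"
proof
 fix s
 have "(\<lambda>s. f s - g s) meromorphic_on UNIV"
  using assms(1,2) unfolding nicely_meromorphic_on_def by (intro meromorphic_intros) auto
 then have "(\<forall>\<^sub>\<approx>s. f s - g s = 0) \<or> (\<forall>\<^sub>\<approx>s. f s - g s \<noteq> 0)" by (rule meromorphic_imp_constant_or_avoid) auto
 moreover have "\<not> (\<forall>\<^sub>\<approx>s. f s - g s \<noteq> 0)"
 proof
  assume "\<forall>\<^sub>\<approx>s. f s - g s \<noteq> 0"
  then have "\<forall>\<^sub>F s in at p. f s - g s \<noteq> 0" by (rule eventually_cosparse_imp_eventually_at) simp
  with assms(5) have "\<forall>\<^sub>F s in at p. False" by eventually_elim simp
  then show False by simp
 qed
 ultimately have "\<forall>\<^sub>\<approx>s. f s - g s = 0" by blast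
 then have "\<forall>\<^sub>F x in at s. f x - g x = 0" by (rule eventually_cosparse_imp_eventually_at) simp
 then have ev: "\<forall>\<^sub>F x in at s. f x = g x" by eventually_elim simp
 have lim: "filterlim f F (at s) \<longleftrightarrow> filterlim g F (at s)" for F by (rule filterlim_cong[OF refl refl ev])
 have "(is_pole f s \<and> f s = 0) \<or> f \<midarrow>s\<rightarrow> f s" "(is_pole g s \<and> g s = 0) \<or> g \<midarrow>s\<rightarrow> g s"
  using assms(1,2) unfolding nicely_meromorphic_on_def by auto
 then show "f s = g s"
 proof (elim disjE conjE)
  assume "is_pole f s" "g \<midarrow>s\<rightarrow> g s"
  then have "filterlim g at_infinity (at s)" by (simp add: is_pole_def lim)
  then show ?thesis using \<open>g \<midarrow>s\<rightarrow> g s\<close> not_tendsto_and_filterlim_at_infinity at_neq_bot by blast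
 next
  assume "is_pole g s" "f \<midarrow>s\<rightarrow> f s"
  then have "filterlim f at_infinity (at s)" by (simp add: is_pole_def lim)
  then show ?thesis using \<open>f \<midarrow>s\<rightarrow> f s\<close> not_tendsto_and_filterlim_at_infinity at_neq_bot by blast
 next
  assume "f \<midarrow>s\<rightarrow> f s" "g \<midarrow>s\<rightarrow> g s"
  then show ?thesis unfolding lim by (intro tendsto_unique[of "at s" g]) auto
 qed simp
qed

text \<open>The two systems come with different auxiliary functions and different exceptional
  points. All of these avoid a punctured neighbourhood of 0, a point of the strip in which the data
  are given; pointwise equality there determines the functions.\<close>

lemma PV_labelled_unique:
 assumes M: "M \<in> monodromy_pairs k0 k1 kinf" "fst M \<notin> {mat 1, - mat 1}" "snd M \<notin> {mat 1, - mat 1}"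
  and lab: "PV_labelled k0 k1 kinf (gauge_class M) y" "PV_labelled k0 k1 kinf (gauge_class M) y'"
 shows "y = y'"
proof -
 obtain z u where PV: "PV_system k0 k1 kinf y z u"
  and dat: "\<And>s. \<bar>Im s\<bar> < pi / 2 \<Longrightarrow> s \<in> good_set y z u \<Longrightarrow>
   \<exists>N. monodromy_data k0 k1 kinf (Im s) (exp (Re s)) (y s) (z s) (u s) N \<and> gauge_class N = gauge_class M"
  using lab(1) unfolding PV_labelled_def good_set_def by blast
 obtain z' u' where PV': "PV_system k0 k1 kinf y' z' u'"
  and dat': "\<And>s. \<bar>Im s\<bar> < pi / 2 \<Longrightarrow> s \<in> good_set y' z' u' \<Longrightarrow>
   \<exists>N. monodromy_data k0 k1 kinf (Im s) (exp (Re s)) (y' s) (z' s) (u' s) N \<and> gauge_class N = gauge_class M"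
  using lab(2) unfolding PV_labelled_def good_set_def by blast
 have eq: "y s = y' s" if s: "\<bar>Im s\<bar> < pi / 2" "s \<in> good_set y z u" "s \<in> good_set y' z' u'" for s
 proof -
  obtain N where N: "monodromy_data k0 k1 kinf (Im s) (exp (Re s)) (y s) (z s) (u s) N" "gauge_class N = gauge_class M" using dat[OF s(1,2)] by blast
  obtain N' where N': "monodromy_data k0 k1 kinf (Im s) (exp (Re s)) (y' s) (z' s) (u' s) N'" "gauge_class N' = gauge_class M" using dat'[OF s(1,3)] by blast
  have "gauge_class N = gauge_class N'" "gauge_class M = gauge_class N" using N(2) N'(2) by simp_all
  then have r: "(N, N') \<in> gauge_rel" "(M, N) \<in> gauge_rel" by (simp_all only: gauge_class_eq_iff)
  have Np: "N \<in> monodromy_pairs k0 k1 kinf" by (rule monodromy_pairs_gauge[OF r(2) M(1)])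
  obtain c where c: "c \<noteq> 0" "fst N = pow_sigma3 c ** fst M ** adj2 (pow_sigma3 c)" "snd N = pow_sigma3 c ** snd M ** adj2 (pow_sigma3 c)"
   by (rule gauge_relE[OF r(2)])
  have "fst N \<notin> {mat 1, - mat 1}" "snd N \<notin> {mat 1, - mat 1}"
   unfolding c(2,3) conj_scalar_iff[OF pow_sigma3_facts(1)[OF c(1)]] by (rule M(2,3))+
  then show ?thesis
   using PV_unique_at[OF s(1) _ _ _ _ N(1) N'(1) r(1) Np] s(2,3) by (simp add: good_set_def)
 qed
 have "\<forall>\<^sub>F s in at 0. s \<in> good_set y z u" "\<forall>\<^sub>F s in at 0. s \<in> good_set y' z' u'"
  using good_set_cosparse[OF PV] good_set_cosparse[OF PV'] by (auto intro: eventually_cosparse_imp_eventually_at)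
 moreover have "\<forall>\<^sub>F s in at 0. \<bar>Im s\<bar> < pi / 2"
 proof -
  have "\<bar>Im s\<bar> < pi / 2" if "dist s 0 < pi / 2" for s using abs_Im_le_cmod[of s] that by simp
  then show ?thesis unfolding eventually_at by (intro exI[of _ "pi / 2"]) simp
 qed
 ultimately have "\<forall>\<^sub>F s in at 0. y s = y' s" by eventually_elim (rule eq)
 then show ?thesis
  using lab unfolding PV_labelled_def PV_solution_def by (intro nicely_meromorphic_eqI[OF _ _ open_UNIV UNIV_I]) auto
qed

text \<open>The identity of functions takes this form because a label can belong to several
  solutions when one of the matrices is plus or minus the identity. The translate always carries the
  shifted label, and conjugation preserves being nonscalar, so otherwise uniqueness turns this into
  an equality.\<close>

theorem theorem2p14:
 fixes \<theta>0 \<theta>1 \<theta>inf :: complex and M0 M1 :: "complex^2^2"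
  and y :: "complex \<Rightarrow> complex" and p :: int
 assumes "gauge_class (M0, M1) \<in> monodromy_manifold \<theta>0 \<theta>1 \<theta>inf"
  and "PV_labelled \<theta>0 \<theta>1 \<theta>inf (gauge_class (M0, M1)) y"
 shows "gauge_class (shifted_pair p (M0, M1)) \<in> monodromy_manifold \<theta>0 \<theta>1 \<theta>inf \<and>
     PV_labelled \<theta>0 \<theta>1 \<theta>inf (gauge_class (shifted_pair p (M0, M1)))
      (\<lambda>s. y (s + 2 * of_real pi * \<i> * of_int p)) \<and>
     (M0 \<notin> {mat 1, - mat 1} \<and> M1 \<notin> {mat 1, - mat 1} \<longrightarrow>
      (\<forall>w. PV_labelled \<theta>0 \<theta>1 \<theta>inf (gauge_class (shifted_pair p (M0, M1))) w \<longrightarrow>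
       (\<forall>s. y (s + 2 * of_real pi * \<i> * of_int p) = w s)))"
proof (intro conjI impI allI)
 have M: "(M0, M1) \<in> monodromy_pairs \<theta>0 \<theta>1 \<theta>inf" using assms(1) by (simp add: gauge_class_in_manifold)
 have S: "shifted_pair p (M0, M1) \<in> monodromy_pairs \<theta>0 \<theta>1 \<theta>inf" by (rule shifted_pair_monodromy_pairs[OF M])
 show "gauge_class (shifted_pair p (M0, M1)) \<in> monodromy_manifold \<theta>0 \<theta>1 \<theta>inf" using S by (simp add: gauge_class_in_manifold)
 show L: "PV_labelled \<theta>0 \<theta>1 \<theta>inf (gauge_class (shifted_pair p (M0, M1))) (\<lambda>s. y (s + period * of_int p))"
  by (rule PV_labelled_shift[OF M assms(2)])
 fix w s
 assume nt: "M0 \<notin> {mat 1, - mat 1} \<and> M1 \<notin> {mat 1, - mat 1}"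
  and w: "PV_labelled \<theta>0 \<theta>1 \<theta>inf (gauge_class (shifted_pair p (M0, M1))) w"
 have d: "det (M1 ** M0) = 1" using M by (simp add: monodromy_pairs_iff det_mul)
 have "fst (shifted_pair p (M0, M1)) \<notin> {mat 1, - mat 1}" "snd (shifted_pair p (M0, M1)) \<notin> {mat 1, - mat 1}"
  using nt shifted_pair_eq[of "(M0, M1)" p] conj_scalar_iff[OF det_mat_powi[OF d]] d by simp_all
 from PV_labelled_unique[OF S this L w] show "y (s + period * of_int p) = w s" by (rule fun_cong)
qed

end
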